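(* There exist a number $k\in\mathbb{Z}_+$, an operator $V_0\in\mathfrak{S}_2(\mathcal{H},\mathcal{P})$ and a continuously invertible operator $U\in B(\mathcal{H})$ of the form $U=I+W$ with $W\in\mathfrak{S}_2(\mathcal{H},\mathcal{P})$, such that $L=L_0-V$ is similar to $L_0-V_0$ with similarity transform $U$, i.e. $UD(L_0)=D(L)$ and $$LU=U(L_0-V_0),$$ and the subspaces $\mathcal{H}_{(k)}=\mathrm{Im}\,P_{(k)}$ and $\mathcal{H}_\ell=\mathrm{Im}\,P_\ell$, $|\ell|>k$, are invariant for $V_0$. Moreover, denoting by $V_{0(k)}$ and $V_{0,\ell}$ the restrictions of $V_0$ to $\mathcal{H}_{(k)}$ and $\mathcal{H}_\ell$, $|\ell|>k$, the operator $L$ is the $U$-orthogonal direct sum $$L=U\Big(L_0-\Big(V_{0(k)}\oplus\Big(\bigoplus_{|\ell|>k}V_{0,\ell}\Big)\Big)\Big)U^{-1}$$ with respect to the $U$-orthogonal decomposition $\mathcal{H}=U\mathcal{H}_{(k)}\oplus\big(\bigoplus_{|\ell|>k}U\mathcal{H}_\ell\big)$.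
   Context: Setting. Let $\omega>0$, let $H$ be a complex Hilbert space, and let $\mathcal{H}=L^2=L^2([0,\omega],H)$ with inner product $\langle x,y\rangle=\frac1\omega\int_0^\omega\langle x(s),y(s)\rangle_H\,ds$. $W_2^1$ is the Sobolev space of continuous functions in $L^2$ with derivative in $L^2$. Let $\mathcal{V}:[0,\omega]\to B(H)$ be strongly measurable with $s\mapsto\mathcal{V}(s)x$ in $L^2$ for every $x\in H$, and let $\widehat{\mathcal{V}}(n)x=\frac1\omega\int_0^\omega\mathcal{V}(s)x\,e^{-i2\pi ns/\omega}ds$, $n\in\mathbb{Z}$. Assume $\sum_{n\in\mathbb{Z}}\|\widehat{\mathcal{V}}(n)\|^2<\infty$ and $\sum_{j,\ell\in\mathbb{Z}}\big\|\sum_{n\neq\ell}\frac{\widehat{\mathcal{V}}(j+n)\widehat{\mathcal{V}}(\ell+n)}{\ell-n}\big\|^2<\infty$. Let $L_0=\frac{d}{ds}$ with domain $D(L_0)=\{y\in W_2^1: y(0)=y(\omega)\}$, $(Vy)(s)=\mathcal{V}(s)y(\omega-s)$ for $y\in D(L_0)$, and $L=L_0-V$ with $D(L)=D(L_0)$. Projections. For $\ell\in\mathbb{Z}$ let $(P_\ell x)(s)=\widehat{x}(\ell)e^{i2\pi\ell s/\omega}$, $\widehat{x}(\ell)=\frac1\omega\int_0^\omega x(\tau)e^{-i2\pi\ell\tau/\omega}d\tau$ (the spectral projections of $L_0$ for the eigenvalues $i2\pi\ell/\omega$), $\mathcal{P}=\{P_\ell:\ell\in\mathbb{Z}\}$,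 and $P_{(m)}=\sum_{|\ell|\le m}P_\ell$ for $m\in\mathbb{Z}_+=\mathbb{N}\cup\{0\}$. $\mathfrak{S}_2(\mathcal{H},\mathcal{P})$ is the set of $X\in B(\mathcal{H})$ with $\|X\|_{2,\mathcal{P}}^2=\sum_{j,\ell\in\mathbb{Z}}\|P_jXP_\ell\|^2<\infty$ (operator norms inside the sum). Direct sums. Given an orthogonal decomposition of $\mathcal{H}$ into closed subspaces $\mathcal{G}_i$ with orthogonal projections $Q_i$, a closed operator $A$ is the orthogonal direct sum $\bigoplus_iA_i$ of bounded operators $A_i\in B(\mathcal{G}_i)$ if $D(A)=\{x:\sum_i\|A_iQ_ix\|^2<\infty\}$, each $\mathcal{G}_i\subset D(A)$ is invariant under $A$ with $A|_{\mathcal{G}_i}=A_i$, and $Ax=\sum_iA_iQ_ix$ (unconditionally convergent) for $x\in D(A)$. For a continuously invertible $U\in B(\mathcal{H})$, the corresponding $U$-orthogonal decomposition of $\mathcal{H}$ is the direct sum of the subspaces $U\mathcal{G}_i$, and a closed operator $A$ is a $U$-orthogonal direct sum with respect to it if $U^{-1}AU$ is an orthogonal direct sum $\bigoplus_iA_i$ with respect to the $\mathcal{G}_i$; its parts are then $UA_iU^{-1}$. *)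

theory Defs
  imports "HOL-Analysis.Analysis"
begin

section \<open>Complex Hilbert spaces\<close>

text \<open>The inner product is linear in the first argument. The real structure underlying
  a complex Hilbert space is the one given by \<^class>\<open>real_inner\<close> and \<^class>\<open>banach\<close>;
  no separability is assumed.\<close>

class complex_hilbert = real_inner + banach +
  fixes scaleC :: "complex \<Rightarrow> 'a \<Rightarrow> 'a" (infixr "*\<^sub>C" 75)
    and cinner :: "'a \<Rightarrow> 'a \<Rightarrow> complex"
  assumes scaleC_add_right: "a *\<^sub>C (x + y) = a *\<^sub>C x + a *\<^sub>C y"
    and scaleC_add_left: "(a + b) *\<^sub>C x = a *\<^sub>C x + b *\<^sub>C x"
    and scaleC_scaleC: "a *\<^sub>C b *\<^sub>C x = (a * b) *\<^sub>C x"
    and scaleC_of_real: "complex_of_real r *\<^sub>C x = r *\<^sub>R x"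
    and cinner_commute: "cinner x y = cnj (cinner y x)"
    and cinner_add_left: "cinner (x + y) z = cinner x z + cinner y z"
    and cinner_scaleC_left: "cinner (a *\<^sub>C x) y = a * cinner x y"
    and inner_eq_Re_cinner: "inner x y = Re (cinner x y)"

instantiation complex :: complex_hilbert
begin

definition scaleC_complex :: "complex \<Rightarrow> complex \<Rightarrow> complex"
  where "scaleC_complex a x = a * x"

definition cinner_complex :: "complex \<Rightarrow> complex \<Rightarrow> complex"
  where "cinner_complex x y = x * cnj y"

instance
  by standard
    (auto simp: scaleC_complex_def cinner_complex_def algebra_simps scaleR_conv_of_real
      inner_complex_def)

end


section \<open>The space \<open>L\<^sup>2([0,\<omega>],H)\<close>\<close>

text \<open>Elements of \<open>L\<^sup>2([0,\<omega>],H)\<close> are represented by functions \<^typ>\<open>real \<Rightarrow> 'h\<close>, of which only the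
  values on \<open>[0,\<omega>]\<close> matter; equality in \<open>L\<^sup>2\<close> is the relation \<open>L2_eq\<close> (equality almost
  everywhere). Subspaces and domains of operators are sets of representatives closed under
  \<open>L2_eq\<close>, and operators map representatives to representatives.

  The Bochner integral of the library requires a second countable range, which would force \<open>H\<close>
  to be separable. All integrals here are therefore the (Henstock-Kurzweil) \<^const>\<open>integral\<close>,
  which coincides with the Bochner integral on strongly measurable functions with integrable
  norm.\<close>

definition strongly_measurable_on :: "real set \<Rightarrow> (real \<Rightarrow> 'a::metric_space) \<Rightarrow> bool" where
  "strongly_measurable_on S x \<longleftrightarrow>
    (\<exists>f :: nat \<Rightarrow> real \<Rightarrow> 'a. (\<forall>i. simple_function (lebesgue_on S) (f i)) \<and>
      (AE s in lebesgue_on S. (\<lambda>i. f i s) \<longlonglongrightarrow> x s))"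

definition L2_space :: "real \<Rightarrow> (real \<Rightarrow> 'h::complex_hilbert) set" where
  "L2_space \<omega> = {x. strongly_measurable_on {0..\<omega>} x \<and> (\<lambda>s. (norm (x s))\<^sup>2) integrable_on {0..\<omega>}}"

definition L2_eq :: "real \<Rightarrow> (real \<Rightarrow> 'h::complex_hilbert) \<Rightarrow> (real \<Rightarrow> 'h) \<Rightarrow> bool" where
  "L2_eq \<omega> x y \<longleftrightarrow> (AE s in lebesgue_on {0..\<omega>}. x s = y s)"

definition L2_inner :: "real \<Rightarrow> (real \<Rightarrow> 'h::complex_hilbert) \<Rightarrow> (real \<Rightarrow> 'h) \<Rightarrow> complex" where
  "L2_inner \<omega> x y = (1 / complex_of_real \<omega>) * integral {0..\<omega>} (\<lambda>s. cinner (x s) (y s))"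

definition L2_norm :: "real \<Rightarrow> (real \<Rightarrow> 'h::complex_hilbert) \<Rightarrow> real" where
  "L2_norm \<omega> x = sqrt ((1 / \<omega>) * integral {0..\<omega>} (\<lambda>s. (norm (x s))\<^sup>2))"

text \<open>Unconditional convergence of \<open>\<Sum>i\<in>I. f i\<close> to \<open>x\<close>, cf. \<^const>\<open>has_sum\<close>.\<close>

definition L2_has_sum ::
    "real \<Rightarrow> ('i \<Rightarrow> real \<Rightarrow> 'h::complex_hilbert) \<Rightarrow> 'i set \<Rightarrow> (real \<Rightarrow> 'h) \<Rightarrow> bool" where
  "L2_has_sum \<omega> f I x \<longleftrightarrow>
    ((\<lambda>F. L2_norm \<omega> (\<lambda>s. (\<Sum>i\<in>F. f i s) - x s)) \<longlongrightarrow> 0) (finite_subsets_at_top I)"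


section \<open>Operators\<close>

type_synonym 'h operator = "(real \<Rightarrow> 'h) \<Rightarrow> (real \<Rightarrow> 'h)"

definition L2_subspace :: "real \<Rightarrow> (real \<Rightarrow> 'h::complex_hilbert) set \<Rightarrow> bool" where
  "L2_subspace \<omega> G \<longleftrightarrow> G \<subseteq> L2_space \<omega> \<and> (\<lambda>s. 0) \<in> G \<and>
    (\<forall>x\<in>G. \<forall>y\<in>G. (\<lambda>s. x s + y s) \<in> G) \<and>
    (\<forall>c. \<forall>x\<in>G. (\<lambda>s. c *\<^sub>C x s) \<in> G) \<and>
    (\<forall>x\<in>G. \<forall>y\<in>L2_space \<omega>. L2_eq \<omega> x y \<longrightarrow> y \<in> G)"

definition linear_operator ::
    "real \<Rightarrow> (real \<Rightarrow> 'h::complex_hilbert) set \<Rightarrow> (real \<Rightarrow> 'h) set \<Rightarrow> 'h operator \<Rightarrow> bool" where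
  "linear_operator \<omega> D R A \<longleftrightarrow> L2_subspace \<omega> D \<and> L2_subspace \<omega> R \<and>
    (\<forall>x\<in>D. A x \<in> R) \<and>
    (\<forall>x\<in>D. \<forall>y\<in>D. L2_eq \<omega> x y \<longrightarrow> L2_eq \<omega> (A x) (A y)) \<and>
    (\<forall>x\<in>D. \<forall>y\<in>D. L2_eq \<omega> (A (\<lambda>s. x s + y s)) (\<lambda>s. A x s + A y s)) \<and>
    (\<forall>c. \<forall>x\<in>D. L2_eq \<omega> (A (\<lambda>s. c *\<^sub>C x s)) (\<lambda>s. c *\<^sub>C A x s))"

definition closed_operator ::
    "real \<Rightarrow> (real \<Rightarrow> 'h::complex_hilbert) set \<Rightarrow> 'h operator \<Rightarrow> bool" where
  "closed_operator \<omega> D A \<longleftrightarrow> linear_operator \<omega> D (L2_space \<omega>) A \<and>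
    (\<forall>X x y. (\<forall>n::nat. X n \<in> D) \<and> x \<in> L2_space \<omega> \<and> y \<in> L2_space \<omega> \<and>
      (\<lambda>n. L2_norm \<omega> (\<lambda>s. X n s - x s)) \<longlonglongrightarrow> 0 \<and>
      (\<lambda>n. L2_norm \<omega> (\<lambda>s. A (X n) s - y s)) \<longlonglongrightarrow> 0
      \<longrightarrow> x \<in> D \<and> L2_eq \<omega> (A x) y)"

text \<open>\<open>A \<in> B(G)\<close> for a subspace \<open>G\<close>.\<close>

definition bounded_operator_on ::
    "real \<Rightarrow> (real \<Rightarrow> 'h::complex_hilbert) set \<Rightarrow> 'h operator \<Rightarrow> bool" where
  "bounded_operator_on \<omega> G A \<longleftrightarrow> linear_operator \<omega> G G A \<and>
    (\<exists>C. \<forall>x\<in>G. L2_norm \<omega> (A x) \<le> C * L2_norm \<omega> x)"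

definition operator_norm :: "real \<Rightarrow> 'h::complex_hilbert operator \<Rightarrow> real" where
  "operator_norm \<omega> X = (SUP x\<in>{x \<in> L2_space \<omega>. L2_norm \<omega> x \<le> 1}. L2_norm \<omega> (X x))"

definition L2_image ::
    "real \<Rightarrow> 'h::complex_hilbert operator \<Rightarrow> (real \<Rightarrow> 'h) set \<Rightarrow> (real \<Rightarrow> 'h) set" where
  "L2_image \<omega> X D = {y \<in> L2_space \<omega>. \<exists>x\<in>D. L2_eq \<omega> y (X x)}"

definition operator_Im :: "real \<Rightarrow> 'h::complex_hilbert operator \<Rightarrow> (real \<Rightarrow> 'h) set" where
  "operator_Im \<omega> X = L2_image \<omega> X (L2_space \<omega>)"

definition invariant_subspace ::
    "real \<Rightarrow> 'h::complex_hilbert operator \<Rightarrow> (real \<Rightarrow> 'h) set \<Rightarrow> bool" where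
  "invariant_subspace \<omega> X G \<longleftrightarrow> L2_subspace \<omega> G \<and> (\<forall>x\<in>G. X x \<in> G)"

definition inverse_operators ::
    "real \<Rightarrow> 'h::complex_hilbert operator \<Rightarrow> 'h operator \<Rightarrow> bool" where
  "inverse_operators \<omega> U Ui \<longleftrightarrow>
    bounded_operator_on \<omega> (L2_space \<omega>) U \<and> bounded_operator_on \<omega> (L2_space \<omega>) Ui \<and>
    (\<forall>x\<in>L2_space \<omega>. L2_eq \<omega> (U (Ui x)) x \<and> L2_eq \<omega> (Ui (U x)) x)"


section \<open>Orthogonal and \<open>U\<close>-orthogonal direct sums\<close>

definition orthogonal_projection :: "real \<Rightarrow> 'h::complex_hilbert operator \<Rightarrow> bool" where
  "orthogonal_projection \<omega> Q \<longleftrightarrow> bounded_operator_on \<omega> (L2_space \<omega>) Q \<and>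
    (\<forall>x\<in>L2_space \<omega>. L2_eq \<omega> (Q (Q x)) (Q x)) \<and>
    (\<forall>x\<in>L2_space \<omega>. \<forall>y\<in>L2_space \<omega>. L2_inner \<omega> (Q x) y = L2_inner \<omega> x (Q y))"

text \<open>The decomposition into the subspaces \<open>operator_Im \<omega> (Q i)\<close>, \<open>i \<in> I\<close>.\<close>

definition orthogonal_decomposition ::
    "real \<Rightarrow> 'i set \<Rightarrow> ('i \<Rightarrow> 'h::complex_hilbert operator) \<Rightarrow> bool" where
  "orthogonal_decomposition \<omega> I Q \<longleftrightarrow>
    (\<forall>i\<in>I. orthogonal_projection \<omega> (Q i)) \<and>
    (\<forall>i\<in>I. \<forall>j\<in>I. i \<noteq> j \<longrightarrow>
      (\<forall>x\<in>operator_Im \<omega> (Q i). \<forall>y\<in>operator_Im \<omega> (Q j). L2_inner \<omega> x y = 0)) \<and>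
    (\<forall>x\<in>L2_space \<omega>. L2_has_sum \<omega> (\<lambda>i. Q i x) I x)"

text \<open>The operator \<open>A\<close> with domain \<open>D\<close> is the orthogonal direct sum of the parts
  \<open>B i \<in> B(operator_Im \<omega> (Q i))\<close>; the values of \<open>B i\<close> elsewhere are irrelevant.\<close>

definition orthogonal_direct_sum ::
    "real \<Rightarrow> 'i set \<Rightarrow> ('i \<Rightarrow> 'h::complex_hilbert operator) \<Rightarrow>
     (real \<Rightarrow> 'h) set \<Rightarrow> 'h operator \<Rightarrow> ('i \<Rightarrow> 'h operator) \<Rightarrow> bool" where
  "orthogonal_direct_sum \<omega> I Q D A B \<longleftrightarrow>
    orthogonal_decomposition \<omega> I Q \<and>
    closed_operator \<omega> D A \<and>
    (\<forall>i\<in>I. bounded_operator_on \<omega> (operator_Im \<omega> (Q i)) (B i)) \<and>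
    D = {x \<in> L2_space \<omega>. (\<lambda>i. (L2_norm \<omega> (B i (Q i x)))\<^sup>2) summable_on I} \<and>
    (\<forall>i\<in>I. operator_Im \<omega> (Q i) \<subseteq> D \<and> invariant_subspace \<omega> A (operator_Im \<omega> (Q i)) \<and>
      (\<forall>x\<in>operator_Im \<omega> (Q i). L2_eq \<omega> (A x) (B i x))) \<and>
    (\<forall>x\<in>D. L2_has_sum \<omega> (\<lambda>i. B i (Q i x)) I (A x))"

text \<open>\<open>A\<close> with domain \<open>D\<close> is the \<open>U\<close>-orthogonal direct sum, with respect to the subspaces
  \<open>U (operator_Im \<omega> (Q i))\<close>, of the parts \<open>U \<circ> B i \<circ> Ui\<close>, where \<open>Ui\<close> is the inverse of \<open>U\<close>.
  The domain of \<open>Ui A U\<close> is the preimage of \<open>D\<close> under \<open>U\<close>.\<close>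

definition U_orthogonal_direct_sum ::
    "real \<Rightarrow> 'h::complex_hilbert operator \<Rightarrow> 'h operator \<Rightarrow> 'i set \<Rightarrow> ('i \<Rightarrow> 'h operator) \<Rightarrow>
     (real \<Rightarrow> 'h) set \<Rightarrow> 'h operator \<Rightarrow> ('i \<Rightarrow> 'h operator) \<Rightarrow> bool" where
  "U_orthogonal_direct_sum \<omega> U Ui I Q D A B \<longleftrightarrow>
    inverse_operators \<omega> U Ui \<and> closed_operator \<omega> D A \<and>
    orthogonal_direct_sum \<omega> I Q {x \<in> L2_space \<omega>. U x \<in> D} (\<lambda>x. Ui (A (U x))) B"


section \<open>The projections \<open>P\<^sub>\<ell>\<close> and the class \<open>\<SS>\<^sub>2\<close>\<close>

definition fourier_coeff :: "real \<Rightarrow> (real \<Rightarrow> 'h::complex_hilbert) \<Rightarrow> int \<Rightarrow> 'h" where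
  "fourier_coeff \<omega> x l =
    (1 / \<omega>) *\<^sub>R integral {0..\<omega>} (\<lambda>s. cis (- 2 * pi * of_int l * s / \<omega>) *\<^sub>C x s)"

definition P_single :: "real \<Rightarrow> int \<Rightarrow> 'h::complex_hilbert operator" where
  "P_single \<omega> l x = (\<lambda>s. cis (2 * pi * of_int l * s / \<omega>) *\<^sub>C fourier_coeff \<omega> x l)"

definition P_upto :: "real \<Rightarrow> nat \<Rightarrow> 'h::complex_hilbert operator" where
  "P_upto \<omega> m x = (\<lambda>s. \<Sum>l | \<bar>l\<bar> \<le> int m. P_single \<omega> l x s)"

definition S2 :: "real \<Rightarrow> 'h::complex_hilbert operator set" where
  "S2 \<omega> = {X. bounded_operator_on \<omega> (L2_space \<omega>) X \<and>
    (\<lambda>(j, l). (operator_norm \<omega> (P_single \<omega> j \<circ> X \<circ> P_single \<omega> l))\<^sup>2) summable_on (UNIV :: (int \<times> int) set)}"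

text \<open>The decomposition into \<open>Im P\<^sub>(\<^sub>k\<^sub>)\<close> (index \<^const>\<open>None\<close>) and \<open>Im P\<^sub>\<ell>\<close>, \<open>\<bar>\<ell>\<bar> > k\<close>
  (index \<open>Some \<ell>\<close>).\<close>

definition block_index :: "nat \<Rightarrow> int option set" where
  "block_index k = insert None (Some ` {l. \<bar>l\<bar> > int k})"

definition block_proj :: "real \<Rightarrow> nat \<Rightarrow> int option \<Rightarrow> 'h::complex_hilbert operator" where
  "block_proj \<omega> k i = (case i of None \<Rightarrow> P_upto \<omega> k | Some l \<Rightarrow> P_single \<omega> l)"


section \<open>The operators \<open>L\<^sub>0\<close>, \<open>V\<close> and \<open>L\<close>\<close>

definition is_L2_derivative ::
    "real \<Rightarrow> (real \<Rightarrow> 'h::complex_hilbert) \<Rightarrow> (real \<Rightarrow> 'h) \<Rightarrow> bool" where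
  "is_L2_derivative \<omega> y z \<longleftrightarrow> z \<in> L2_space \<omega> \<and> (\<forall>t\<in>{0..\<omega>}. y t = y 0 + integral {0..t} z)"

definition W21 :: "real \<Rightarrow> (real \<Rightarrow> 'h::complex_hilbert) set" where
  "W21 \<omega> = {y \<in> L2_space \<omega>. continuous_on {0..\<omega>} y \<and> (\<exists>z. is_L2_derivative \<omega> y z)}"

text \<open>As subsets of \<open>L\<^sup>2\<close> are closed under \<open>L2_eq\<close>, the domain consists of all functions that agree
  almost everywhere with a function \<open>y \<in> W\<^sub>2\<^sup>1\<close> such that \<open>y(0) = y(\<omega>)\<close>.\<close>

definition dom_L0 :: "real \<Rightarrow> (real \<Rightarrow> 'h::complex_hilbert) set" where
  "dom_L0 \<omega> = {x \<in> L2_space \<omega>. \<exists>y\<in>W21 \<omega>. y 0 = y \<omega> \<and> L2_eq \<omega> x y}"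

text \<open>The derivative is determined up to \<open>L2_eq\<close>.\<close>

definition L0 :: "real \<Rightarrow> 'h::complex_hilbert operator" where
  "L0 \<omega> x = (SOME z. \<exists>y\<in>W21 \<omega>. L2_eq \<omega> x y \<and> is_L2_derivative \<omega> y z)"

definition V_op :: "real \<Rightarrow> (real \<Rightarrow> 'h::complex_hilbert \<Rightarrow>\<^sub>L 'h) \<Rightarrow> 'h operator" where
  "V_op \<omega> \<V> y = (\<lambda>s. blinfun_apply (\<V> s) (y (\<omega> - s)))"

definition L_op :: "real \<Rightarrow> (real \<Rightarrow> 'h::complex_hilbert \<Rightarrow>\<^sub>L 'h) \<Rightarrow> 'h operator" where
  "L_op \<omega> \<V> y = (\<lambda>s. L0 \<omega> y s - V_op \<omega> \<V> y s)"

text \<open>If \<open>s \<mapsto> \<V>(s)x\<close> is in \<open>L\<^sup>2\<close> for every \<open>x\<close>, the function passed to \<^const>\<open>Blinfun\<close> is bounded and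
  linear by the closed graph theorem.\<close>

definition V_hat :: "real \<Rightarrow> (real \<Rightarrow> 'h::complex_hilbert \<Rightarrow>\<^sub>L 'h) \<Rightarrow> int \<Rightarrow> 'h \<Rightarrow>\<^sub>L 'h" where
  "V_hat \<omega> \<V> n = Blinfun (\<lambda>x. fourier_coeff \<omega> (\<lambda>s. blinfun_apply (\<V> s) x) n)"

end

theory Submission
  imports Defs
begin

text \<open>In the basis of exponentials, \<open>L\<^sub>0\<close> is \<open>2 \<pi> i / \<omega>\<close> times multiplication \<open>N\<close> by the index \<open>n\<close>. The
  reflection in \<open>V\<close> exchanges the exponentials with indices \<open>n\<close> and \<open>-n\<close>, so \<open>V\<close> is \<open>2 \<pi> i / \<omega>\<close> times
  the Hankel matrix \<open>v(j + n)\<close>, where \<open>v\<close> is the sequence of Fourier coefficients of \<open>\<V>\<close> divided by the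
  same number. The theorem is thus about a diagonal operator perturbed by a Hankel matrix whose rows are
  square-summable, but which in general is not square-summable itself.

  A square-summable perturbation \<open>B\<close> of \<open>N\<close> can be made block diagonal directly
  (\<open>block_diagonalization\<close>). The equation \<open>(N - B) (I + W) = (I + W) (N - V\<^sub>0)\<close> prescribes the commutator
  of \<open>N\<close> with \<open>W\<close>, that is, the numbers \<open>(j - l) W(j, l)\<close>. On the blocks it determines \<open>V\<^sub>0\<close>, off the
  blocks one divides by \<open>j - l\<close>. If the central block is large, all denominators that matter are large,
  and \<open>W\<close> is the fixed point of a contraction.

  The Hankel matrix is reduced to this case by a first similarity (\<open>first_transformation\<close>). Here \<open>W\<close>
  has the entries \<open>v(j + l) / (j - l)\<close> off the blocks and is square-summable, since \<open>v\<close> is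
  square-summable in \<open>j + l\<close> and \<open>1 / (j - l)\<close> in \<open>j - l\<close>. What remains of the perturbation is the block
  part of \<open>v\<close>, which is square-summable, and \<open>v W\<close>, which is so by the assumption on the double sums. The
  composition of both similarities has the form \<open>I + W\<close> (\<open>sequence_similarity\<close>). It maps the domain of
  \<open>N\<close> onto itself: into, by the conjugation identities, and onto, by comparing resolvents far out on the
  imaginary axis (\<open>domain_onto\<close>), where \<open>N - v\<close> minus the spectral parameter is injective because a
  sequence in the domain of \<open>N\<close> is absolutely summable.

  The transfer to functions rests on the Riesz-Fischer theorem, the uniqueness of Fourier coefficients
  and Parseval's identity, proved here for the gauge integral of strongly measurable functions.
  Strongly measurable functions are essentially separably valued and hence limits of dominated simple
  functions, which gives their integrability (\<open>strongly_measurable_integrable\<close>). The domain of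
  \<open>L\<^sub>0\<close> corresponds to the domain of \<open>N\<close> (\<open>dom_L0_of_fourier\<close>, \<open>dom_L0_times_index\<close>), and on it \<open>V\<close> is the
  Hankel operator (\<open>V_op_fourier\<close>). A block involves finitely many indices only, so the parts of
  \<open>L\<^sub>0 - V\<^sub>0\<close> are bounded, and the statements about direct sums reduce to splitting square-summable
  sequences into blocks (\<open>orthogonal_direct_sum_blocks\<close>).\<close>


section \<open>Square-summable families\<close>

text \<open>Bounds on finite partial sums bring the inequalities for finite \<open>L2_set\<close> norms to bear.\<close>

lemma square_summable_iff:
  fixes f :: "'i \<Rightarrow> 'e::real_normed_vector"
  shows "(\<lambda>i. (norm (f i))\<^sup>2) summable_on UNIV \<longleftrightarrow>
    (\<exists>C. \<forall>F. finite F \<longrightarrow> L2_set (\<lambda>i. norm (f i)) F \<le> C)"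
proof
  assume s: "(\<lambda>i. (norm (f i))\<^sup>2) summable_on UNIV"
  have "L2_set (\<lambda>i. norm (f i)) F \<le> sqrt (\<Sum>\<^sub>\<infinity>i. (norm (f i))\<^sup>2)" if "finite F" for F
    unfolding L2_set_def using finite_sum_le_infsum[OF s that] by simp
  then show "\<exists>C. \<forall>F. finite F \<longrightarrow> L2_set (\<lambda>i. norm (f i)) F \<le> C" by blast
next
  assume "\<exists>C. \<forall>F. finite F \<longrightarrow> L2_set (\<lambda>i. norm (f i)) F \<le> C"
  then obtain C where C: "\<And>F. finite F \<Longrightarrow> L2_set (\<lambda>i. norm (f i)) F \<le> C" by blast
  have "(\<Sum>i\<in>F. (norm (f i))\<^sup>2) \<le> C\<^sup>2" if "finite F" for F
  proof -
    have "(\<Sum>i\<in>F. (norm (f i))\<^sup>2) = (L2_set (\<lambda>i. norm (f i)) F)\<^sup>2"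
      unfolding L2_set_def by (simp add: sum_nonneg)
    also have "\<dots> \<le> C\<^sup>2" using C[OF that] by (intro power_mono) auto
    finally show ?thesis .
  qed
  then show "(\<lambda>i. (norm (f i))\<^sup>2) summable_on UNIV"
    by (intro nonneg_bdd_above_summable_on bdd_aboveI[where M="C\<^sup>2"]) auto
qed

typedef (overloaded) ('i, 'e) ell2 =
    "{f :: 'i \<Rightarrow> 'e::real_normed_vector. (\<lambda>i. (norm (f i))\<^sup>2) summable_on UNIV}"
  morphisms entry Ell2
  by (rule exI[of _ "\<lambda>_. 0"]) simp

lemma ell2_eqI: "(\<And>i. entry x i = entry y i) \<Longrightarrow> x = y"
  by (metis entry_inject ext)

lemma summable_entry: "(\<lambda>i. (norm (entry x i))\<^sup>2) summable_on UNIV"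
  using entry[of x] by simp

lemma entry_Ell2: "(\<lambda>i. (norm (f i))\<^sup>2) summable_on UNIV \<Longrightarrow> entry (Ell2 f) i = f i"
  by (simp add: Ell2_inverse)

lemma square_summable_add:
  fixes f g :: "'i \<Rightarrow> 'e::real_normed_vector"
  assumes "(\<lambda>i. (norm (f i))\<^sup>2) summable_on UNIV" "(\<lambda>i. (norm (g i))\<^sup>2) summable_on UNIV"
  shows "(\<lambda>i. (norm (f i + g i))\<^sup>2) summable_on UNIV"
proof -
  obtain C D where C: "\<And>F. finite F \<Longrightarrow> L2_set (\<lambda>i. norm (f i)) F \<le> C"
    and D: "\<And>F. finite F \<Longrightarrow> L2_set (\<lambda>i. norm (g i)) F \<le> D"
    using assms unfolding square_summable_iff by blast
  have "L2_set (\<lambda>i. norm (f i + g i)) F \<le> C + D" if "finite F" for F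
  proof -
    have "L2_set (\<lambda>i. norm (f i + g i)) F \<le> L2_set (\<lambda>i. norm (f i) + norm (g i)) F"
      by (intro L2_set_mono) (auto intro: norm_triangle_ineq)
    also have "\<dots> \<le> L2_set (\<lambda>i. norm (f i)) F + L2_set (\<lambda>i. norm (g i)) F"
      by (rule L2_set_triangle_ineq)
    finally show ?thesis using C[OF that] D[OF that] by linarith
  qed
  then show ?thesis unfolding square_summable_iff by blast
qed

lemma square_summable_scaleR:
  fixes f :: "'i \<Rightarrow> 'e::real_normed_vector"
  assumes "(\<lambda>i. (norm (f i))\<^sup>2) summable_on UNIV"
  shows "(\<lambda>i. (norm (c *\<^sub>R f i))\<^sup>2) summable_on UNIV"
  using summable_on_cmult_right[OF assms, of "c\<^sup>2"] by (simp add: power_mult_distrib)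

instantiation ell2 :: (type, real_normed_vector) real_normed_vector
begin

definition zero_ell2 :: "('a, 'b) ell2" where "0 = Ell2 (\<lambda>_. 0)"
definition plus_ell2 :: "('a, 'b) ell2 \<Rightarrow> ('a, 'b) ell2 \<Rightarrow> ('a, 'b) ell2"
  where "x + y = Ell2 (\<lambda>i. entry x i + entry y i)"
definition scaleR_ell2 :: "real \<Rightarrow> ('a, 'b) ell2 \<Rightarrow> ('a, 'b) ell2"
  where "c *\<^sub>R x = Ell2 (\<lambda>i. c *\<^sub>R entry x i)"
definition uminus_ell2 :: "('a, 'b) ell2 \<Rightarrow> ('a, 'b) ell2" where "uminus_ell2 x = Ell2 (\<lambda>i. - entry x i)"
definition minus_ell2 :: "('a, 'b) ell2 \<Rightarrow> ('a, 'b) ell2 \<Rightarrow> ('a, 'b) ell2" where "minus_ell2 x y = x + - y"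
definition norm_ell2 :: "('a, 'b) ell2 \<Rightarrow> real"
  where "norm x = sqrt (\<Sum>\<^sub>\<infinity>i. (norm (entry x i))\<^sup>2)"
definition sgn_ell2 :: "('a, 'b) ell2 \<Rightarrow> ('a, 'b) ell2" where "sgn_ell2 x = scaleR (inverse (norm x)) x"
definition dist_ell2 :: "('a, 'b) ell2 \<Rightarrow> ('a, 'b) ell2 \<Rightarrow> real" where "dist_ell2 x y = norm (x - y)"
definition uniformity_ell2 :: "(('a, 'b) ell2 \<times> ('a, 'b) ell2) filter"
  where "uniformity_ell2 = (INF e\<in>{0 <..}. principal {(x, y). dist x y < e})"
definition open_ell2 :: "('a, 'b) ell2 set \<Rightarrow> bool"
  where "open_ell2 U = (\<forall>x\<in>U. eventually (\<lambda>(x', y). x' = x \<longrightarrow> y \<in> U) uniformity)"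

lemma entry_zero: "entry (0::('a, 'b) ell2) i = 0"
  by (simp add: zero_ell2_def entry_Ell2)

lemma entry_plus: "entry (x + y :: ('a, 'b) ell2) i = entry x i + entry y i"
  unfolding plus_ell2_def by (rule entry_Ell2[OF square_summable_add[OF summable_entry summable_entry]])

lemma entry_scaleR: "entry (c *\<^sub>R x :: ('a, 'b) ell2) i = c *\<^sub>R entry x i"
  unfolding scaleR_ell2_def by (rule entry_Ell2[OF square_summable_scaleR[OF summable_entry]])

lemma entry_uminus: "entry (- x :: ('a, 'b) ell2) i = - entry x i"
  unfolding uminus_ell2_def using square_summable_scaleR[OF summable_entry[of x], of "-1"]
  by (intro entry_Ell2) simp

lemma L2_set_entry_le_norm:
  fixes x :: "('a, 'b) ell2"
  assumes "finite F" shows "L2_set (\<lambda>i. norm (entry x i)) F \<le> norm x"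
  unfolding L2_set_def norm_ell2_def using finite_sum_le_infsum[OF summable_entry assms] by simp

lemma norm_ell2_le:
  fixes x :: "('a, 'b) ell2"
  assumes "\<And>F. finite F \<Longrightarrow> L2_set (\<lambda>i. norm (entry x i)) F \<le> C"
  shows "norm x \<le> C"
proof -
  have C: "0 \<le> C" using assms[of "{}"] by simp
  have "(\<Sum>\<^sub>\<infinity>i. (norm (entry x i))\<^sup>2) \<le> C\<^sup>2"
  proof (rule infsum_le_finite_sums[OF summable_entry])
    fix F :: "'a set" assume "finite F"
    then have "(L2_set (\<lambda>i. norm (entry x i)) F)\<^sup>2 \<le> C\<^sup>2"
      using assms by (intro power_mono) auto
    then show "(\<Sum>i\<in>F. (norm (entry x i))\<^sup>2) \<le> C\<^sup>2"
      unfolding L2_set_def by (simp add: sum_nonneg)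
  qed
  then show ?thesis using C unfolding norm_ell2_def by (simp add: real_le_lsqrt infsum_nonneg)
qed

instance
proof
  fix x y z :: "('a, 'b) ell2" and a b :: real
  show "x + y + z = x + (y + z)" by (rule ell2_eqI) (simp add: entry_plus)
  show "x + y = y + x" by (rule ell2_eqI) (simp add: entry_plus)
  show "0 + x = x" by (rule ell2_eqI) (simp add: entry_plus entry_zero)
  show "- x + x = 0" by (rule ell2_eqI) (simp add: entry_plus entry_zero entry_uminus)
  show "x - y = x + - y" by (rule minus_ell2_def)
  show "a *\<^sub>R (x + y) = a *\<^sub>R x + a *\<^sub>R y"
    by (rule ell2_eqI) (simp add: entry_plus entry_scaleR scaleR_add_right)
  show "(a + b) *\<^sub>R x = a *\<^sub>R x + b *\<^sub>R x"
    by (rule ell2_eqI) (simp add: entry_plus entry_scaleR scaleR_add_left)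
  show "a *\<^sub>R b *\<^sub>R x = (a * b) *\<^sub>R x" by (rule ell2_eqI) (simp add: entry_scaleR)
  show "1 *\<^sub>R x = x" by (rule ell2_eqI) (simp add: entry_scaleR)
  show "sgn x = inverse (norm x) *\<^sub>R x" by (rule sgn_ell2_def)
  show "dist x y = norm (x - y)" by (rule dist_ell2_def)
  show "(uniformity :: (('a, 'b) ell2 \<times> ('a, 'b) ell2) filter) = (INF e\<in>{0 <..}. principal {(x, y). dist x y < e})"
    by (rule uniformity_ell2_def)
  show "open U = (\<forall>x\<in>U. \<forall>\<^sub>F (x', y) in uniformity. x' = x \<longrightarrow> y \<in> U)" for U :: "('a, 'b) ell2 set"
    by (rule open_ell2_def)
  show "(norm x = 0) = (x = 0)"
  proof
    assume n0: "norm x = 0"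
    show "x = 0"
    proof (rule ell2_eqI)
      fix i
      have "norm (entry x i) \<le> 0" using L2_set_entry_le_norm[of "{i}" x] n0 by simp
      then show "entry x i = entry 0 i" by (simp add: entry_zero)
    qed
  qed (simp add: norm_ell2_def entry_zero)
  show "norm (x + y) \<le> norm x + norm y"
  proof (rule norm_ell2_le)
    fix F :: "'a set" assume F: "finite F"
    have "L2_set (\<lambda>i. norm (entry (x + y) i)) F \<le> L2_set (\<lambda>i. norm (entry x i) + norm (entry y i)) F"
      by (intro L2_set_mono) (auto simp: entry_plus intro: norm_triangle_ineq)
    also have "\<dots> \<le> L2_set (\<lambda>i. norm (entry x i)) F + L2_set (\<lambda>i. norm (entry y i)) F"
      by (rule L2_set_triangle_ineq)
    also have "\<dots> \<le> norm x + norm y" by (intro add_mono L2_set_entry_le_norm F)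
    finally show "L2_set (\<lambda>i. norm (entry (x + y) i)) F \<le> norm x + norm y" .
  qed
  show "norm (a *\<^sub>R x) = \<bar>a\<bar> * norm x"
    by (simp add: norm_ell2_def entry_scaleR power_mult_distrib infsum_cmult_right' real_sqrt_mult)
qed

end

lemma norm_entry_le: "norm (entry x i) \<le> norm x"
  using L2_set_entry_le_norm[of "{i}" x] by simp

lemma entry_minus: "entry (x - y) i = entry x i - entry y i"
  by (metis add_uminus_conv_diff entry_plus entry_uminus)

lemmas entry_simps = entry_zero entry_plus entry_scaleR entry_uminus entry_minus

lemma norm_ell2_squared: "(norm x)\<^sup>2 = (\<Sum>\<^sub>\<infinity>i. (norm (entry x i))\<^sup>2)"
  by (simp add: norm_ell2_def infsum_nonneg)

lemma bounded_linear_entry: "bounded_linear (\<lambda>x. entry x i)"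
  by (rule bounded_linear_intro[of _ 1]) (auto simp: entry_simps norm_entry_le)

lemma Ell2_bounded:
  fixes f :: "'i \<Rightarrow> 'e::real_normed_vector"
  assumes "\<And>F. finite F \<Longrightarrow> L2_set (\<lambda>i. norm (f i)) F \<le> C"
  shows "entry (Ell2 f) i = f i" "norm (Ell2 f) \<le> C"
proof -
  have s: "(\<lambda>i. (norm (f i))\<^sup>2) summable_on UNIV" unfolding square_summable_iff using assms by blast
  show "entry (Ell2 f) i = f i" by (rule entry_Ell2[OF s])
  show "norm (Ell2 f) \<le> C" using assms by (intro norm_ell2_le) (simp add: entry_Ell2[OF s])
qed

text \<open>A Cauchy sequence converges entrywise; the Cauchy bounds, being bounds on finite partial
  sums, pass to the entrywise limit.\<close>

instance ell2 :: (type, banach) banach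
proof
  fix X :: "nat \<Rightarrow> ('a, 'b) ell2" assume X: "Cauchy X"
  have "Cauchy (\<lambda>n. entry (X n) i)" for i
    using bounded_linear.Cauchy[OF bounded_linear_entry X] .
  then have "\<exists>l. (\<lambda>n. entry (X n) i) \<longlonglongrightarrow> l" for i
    using Cauchy_convergent convergent_def by blast
  then obtain f where f: "\<And>i. (\<lambda>n. entry (X n) i) \<longlonglongrightarrow> f i" by metis
  have bd: "L2_set (\<lambda>i. norm (entry (X m) i - f i)) F \<le> e"
    if "finite F" "\<And>n. n \<ge> M \<Longrightarrow> norm (X m - X n) \<le> e" for F e m M
  proof (rule tendsto_le[OF sequentially_bot tendsto_const])
    show "(\<lambda>n. L2_set (\<lambda>i. norm (entry (X m) i - entry (X n) i)) F) \<longlonglongrightarrow> L2_set (\<lambda>i. norm (entry (X m) i - f i)) F"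
      unfolding L2_set_def by (intro tendsto_intros f)
    have "L2_set (\<lambda>i. norm (entry (X m) i - entry (X n) i)) F \<le> e" if "n \<ge> M" for n
      using L2_set_entry_le_norm[OF \<open>finite F\<close>, of "X m - X n"] \<open>\<And>n. n \<ge> M \<Longrightarrow> norm (X m - X n) \<le> e\<close>[OF that]
      by (simp add: entry_simps)
    then show "\<forall>\<^sub>F n in sequentially. L2_set (\<lambda>i. norm (entry (X m) i - entry (X n) i)) F \<le> e"
      unfolding eventually_sequentially by blast
  qed
  have ex: "\<exists>M. \<forall>m\<ge>M. \<forall>n\<ge>M. norm (X m - X n) \<le> e" if "e > 0" for e
    using X that unfolding Cauchy_def dist_norm by (meson less_imp_le)
  obtain M1 where M1: "\<forall>m\<ge>M1. \<forall>n\<ge>M1. norm (X m - X n) \<le> 1" using ex[of 1] by auto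
  have s1: "(\<lambda>i. (norm (entry (X M1) i - f i))\<^sup>2) summable_on UNIV"
    unfolding square_summable_iff using bd[of _ M1 M1 1] M1 by blast
  have sf: "(\<lambda>i. (norm (f i))\<^sup>2) summable_on UNIV"
    using square_summable_add[OF summable_entry[of "X M1"] square_summable_scaleR[OF s1, of "-1"]]
    by simp
  have "X \<longlonglongrightarrow> Ell2 f"
  proof (rule LIMSEQ_I)
    fix r :: real assume "r > 0"
    obtain M where M: "\<forall>m\<ge>M. \<forall>n\<ge>M. norm (X m - X n) \<le> r/2" using ex[of "r/2"] \<open>r > 0\<close> by auto
    have "norm (X m - Ell2 f) \<le> r/2" if "m \<ge> M" for m
    proof (rule norm_ell2_le)
      fix F :: "'a set" assume "finite F"
      then show "L2_set (\<lambda>i. norm (entry (X m - Ell2 f) i)) F \<le> r/2"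
        using bd[of F M m "r/2"] M that by (simp add: entry_simps entry_Ell2[OF sf])
    qed
    then show "\<exists>no. \<forall>n\<ge>no. norm (X n - Ell2 f) < r" using \<open>r > 0\<close> by (intro exI[of _ M]) fastforce
  qed
  then show "convergent X" by (auto simp: convergent_def)
qed

text \<open>Comparison with the sum of the squares.\<close>

lemma summable_on_product:
  fixes f :: "'i \<Rightarrow> 'e::real_normed_vector" and g :: "'i \<Rightarrow> 'f::real_normed_vector"
  assumes "(\<lambda>i. (norm (f i))\<^sup>2) summable_on UNIV" "(\<lambda>i. (norm (g i))\<^sup>2) summable_on UNIV"
  shows "(\<lambda>i. norm (f i) * norm (g i)) summable_on UNIV"
proof (rule summable_on_comparison_test[OF summable_on_add[OF assms]])
  fix i
  have "0 \<le> (norm (f i) - norm (g i))\<^sup>2 + (norm (f i))\<^sup>2 + (norm (g i))\<^sup>2" by simp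
  then show "norm (f i) * norm (g i) \<le> (norm (f i))\<^sup>2 + (norm (g i))\<^sup>2"
    by (simp add: power2_diff)
qed auto

lemma infsum_product_le:
  fixes x :: "('i, 'e::real_normed_vector) ell2" and y :: "('i, 'f::real_normed_vector) ell2"
  shows "(\<Sum>\<^sub>\<infinity>i. norm (entry x i) * norm (entry y i)) \<le> norm x * norm y"
proof (rule infsum_le_finite_sums[OF summable_on_product[OF summable_entry summable_entry]])
  fix F :: "'i set" assume F: "finite F"
  have "(\<Sum>i\<in>F. norm (entry x i) * norm (entry y i)) \<le> L2_set (\<lambda>i. norm (entry x i)) F * L2_set (\<lambda>i. norm (entry y i)) F"
    using L2_set_mult_ineq[of "\<lambda>i. norm (entry x i)" "\<lambda>i. norm (entry y i)" F] by simp
  also have "\<dots> \<le> norm x * norm y" by (intro mult_mono L2_set_entry_le_norm F) auto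
  finally show "(\<Sum>i\<in>F. norm (entry x i) * norm (entry y i)) \<le> norm x * norm y" .
qed


section \<open>Complex-linear operators\<close>

lemma norm_scaleC: "norm (c *\<^sub>C x) = cmod c * norm (x::'h::complex_hilbert)"
proof -
  have r: "cinner x (c *\<^sub>C x) = cnj c * cinner x x" for x :: 'h
    by (metis cinner_commute cinner_scaleC_left complex_cnj_mult complex_cnj_cnj)
  have "(norm (c *\<^sub>C x))\<^sup>2 = Re (cinner (c *\<^sub>C x) (c *\<^sub>C x))"
    by (simp add: power2_norm_eq_inner inner_eq_Re_cinner)
  also have "\<dots> = Re ((c * cnj c) * cinner x x)" by (simp only: cinner_scaleC_left r mult.assoc)
  also have "\<dots> = Re (complex_of_real ((cmod c)\<^sup>2) * cinner x x)" by (simp only: complex_norm_square)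
  also have "\<dots> = (cmod c)\<^sup>2 * Re (cinner x x)" by simp
  also have "\<dots> = (cmod c)\<^sup>2 * (norm x)\<^sup>2"
    by (simp add: power2_norm_eq_inner inner_eq_Re_cinner)
  finally show ?thesis
    by (metis mult_nonneg_nonneg norm_ge_zero power2_eq_imp_eq power_mult_distrib)
qed

lemma scaleC_scaleR: "c *\<^sub>C (r *\<^sub>R x) = r *\<^sub>R (c *\<^sub>C (x::'h::complex_hilbert))"
  by (simp flip: scaleC_of_real add: scaleC_scaleC mult.commute)

lemma bounded_linear_scaleC: "bounded_linear (\<lambda>x::'h::complex_hilbert. c *\<^sub>C x)"
  by (rule bounded_linear_intro[of _ "cmod c"])
     (auto simp: scaleC_add_right scaleC_scaleR norm_scaleC mult.commute)

lemma scaleC_zero_right [simp]: "c *\<^sub>C (0::'h::complex_hilbert) = 0"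
  using linear_simps(3)[OF bounded_linear_scaleC] .

lemma scaleC_zero_left [simp]: "0 *\<^sub>C (x::'h::complex_hilbert) = 0"
  using scaleC_of_real[of 0 x] by simp

lemma scaleC_one [simp]: "1 *\<^sub>C (x::'h::complex_hilbert) = x"
  using scaleC_of_real[of 1 x] by simp

lemma scaleC_minus_right: "c *\<^sub>C (x - y) = c *\<^sub>C x - c *\<^sub>C (y::'h::complex_hilbert)"
  using linear_simps(2)[OF bounded_linear_scaleC] .

lemma scaleC_minus_left: "(a - b) *\<^sub>C x = a *\<^sub>C x - b *\<^sub>C (x::'h::complex_hilbert)"
  by (metis add_diff_cancel_right' diff_add_cancel scaleC_add_left)

definition clinear :: "('h::complex_hilbert \<Rightarrow>\<^sub>L 'h) \<Rightarrow> bool" where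
  "clinear A \<longleftrightarrow> (\<forall>c x. blinfun_apply A (c *\<^sub>C x) = c *\<^sub>C blinfun_apply A x)"

lemma clinear_zero: "clinear 0"
  and clinear_add: "clinear A \<Longrightarrow> clinear B \<Longrightarrow> clinear (A + B)"
  and clinear_minus: "clinear A \<Longrightarrow> clinear B \<Longrightarrow> clinear (A - B)"
  and clinear_scaleR: "clinear A \<Longrightarrow> clinear (r *\<^sub>R A)"
  and clinear_compose: "clinear A \<Longrightarrow> clinear B \<Longrightarrow> clinear (A o\<^sub>L B)"
  by (auto simp: clinear_def blinfun.add_left blinfun.diff_left blinfun.scaleR_left blinfun.zero_left
      scaleC_add_right scaleC_minus_right scaleC_scaleR)

lemma closed_clinear: "closed {A :: 'h::complex_hilbert \<Rightarrow>\<^sub>L 'h. clinear A}"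
proof -
  have "{A :: 'h \<Rightarrow>\<^sub>L 'h. clinear A} = (\<Inter>c. \<Inter>x. {A. blinfun_apply A (c *\<^sub>C x) = c *\<^sub>C blinfun_apply A x})"
    by (auto simp: clinear_def)
  moreover have "closed {A. blinfun_apply A (c *\<^sub>C x) = c *\<^sub>C blinfun_apply A (x::'h)}" for c x
    by (intro closed_Collect_eq continuous_intros
        bounded_linear.continuous_on[OF bounded_linear_scaleC])
  ultimately show ?thesis by (simp only:) (intro closed_INT ballI)
qed

lemma clinear_infsum:
  assumes "\<And>i. i \<in> I \<Longrightarrow> clinear (f i)"
  shows "clinear (infsum f I)"
proof (cases "f summable_on I")
  case True
  have "infsum f I \<in> {A. clinear A}"
  proof (rule Lim_in_closed_set[OF closed_clinear _ _ infsum_tendsto[OF True]])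
    have "clinear (sum f F)" if "finite F" "F \<subseteq> I" for F
      using that assms by (induction rule: finite_induct) (auto simp: clinear_zero clinear_add)
    then show "\<forall>\<^sub>F F in finite_subsets_at_top I. sum f F \<in> {A. clinear A}"
      by (intro eventually_finite_subsets_at_top_weakI) auto
  qed auto
  then show ?thesis by simp
qed (simp add: infsum_not_exists clinear_zero)

lemma infsum_linear:
  assumes "bounded_linear h" "f summable_on A"
  shows "(\<Sum>\<^sub>\<infinity>i\<in>A. h (f i)) = h (infsum f A)"
  using has_sum_bounded_linear[OF assms(1) has_sum_infsum[OF assms(2)]] by (intro infsumI) (simp add: o_def)


section \<open>Operator matrices\<close>

text \<open>One definition serves for rows of operators applied to vectors of \<open>H\<close> and for rows of operators
  composed with columns of operators.\<close>

definition pairing :: "('a \<Rightarrow> 'b \<Rightarrow> 'c) \<Rightarrow> ('i, 'a::real_normed_vector) ell2 \<Rightarrow>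
    ('i, 'b::real_normed_vector) ell2 \<Rightarrow> 'c::banach" where
  "pairing f x y = (\<Sum>\<^sub>\<infinity>i. f (entry x i) (entry y i))"

locale contractive_bilinear = bounded_bilinear f
  for f :: "'a::real_normed_vector \<Rightarrow> 'b::real_normed_vector \<Rightarrow> 'c::banach" +
  assumes contractive: "norm (f a b) \<le> norm a * norm b"
begin

lemma abs_summable:
  fixes x :: "('i, 'a) ell2" and y :: "('i, 'b) ell2"
  shows "(\<lambda>i. norm (f (entry x i) (entry y i))) summable_on UNIV"
  by (rule summable_on_comparison_test[OF summable_on_product[OF summable_entry[of x] summable_entry[of y]]])
     (auto simp: contractive)

lemma summable:
  fixes x :: "('i, 'a) ell2" and y :: "('i, 'b) ell2"
  shows "(\<lambda>i. f (entry x i) (entry y i)) summable_on UNIV"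
  by (rule abs_summable_summable[OF abs_summable])

lemma norm_pairing_le:
  fixes x :: "('i, 'a) ell2" and y :: "('i, 'b) ell2"
  shows "norm (pairing f x y) \<le> norm x * norm y"
proof -
  have "norm (pairing f x y) \<le> (\<Sum>\<^sub>\<infinity>i. norm (f (entry x i) (entry y i)))"
    unfolding pairing_def by (rule norm_infsum_bound[OF abs_summable])
  also have "\<dots> \<le> (\<Sum>\<^sub>\<infinity>i. norm (entry x i) * norm (entry y i))"
    by (intro infsum_mono abs_summable summable_on_product summable_entry contractive)
  also have "\<dots> \<le> norm x * norm y" by (rule infsum_product_le)
  finally show ?thesis .
qed

lemma bounded_bilinear_pairing:
  "bounded_bilinear (pairing f :: ('i, 'a) ell2 \<Rightarrow> ('i, 'b) ell2 \<Rightarrow> 'c)"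
proof
  fix x x' :: "('i, 'a) ell2" and y y' :: "('i, 'b) ell2" and r :: real
  show "pairing f (x + x') y = pairing f x y + pairing f x' y"
    by (simp add: pairing_def entry_simps add_left infsum_add summable)
  show "pairing f x (y + y') = pairing f x y + pairing f x y'"
    by (simp add: pairing_def entry_simps add_right infsum_add summable)
  show "pairing f (r *\<^sub>R x) y = r *\<^sub>R pairing f x y"
    by (simp add: pairing_def entry_simps scaleR_left infsum_scaleR_right)
  show "pairing f x (r *\<^sub>R y) = r *\<^sub>R pairing f x y"
    by (simp add: pairing_def entry_simps scaleR_right infsum_scaleR_right)
  show "\<exists>K. \<forall>a b. norm (pairing f (a :: ('i, 'a) ell2) b) \<le> norm a * norm b * K"
    by (intro exI[of _ 1]) (simp add: norm_pairing_le)
qed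

end

interpretation app: contractive_bilinear "blinfun_apply :: ('a::real_normed_vector \<Rightarrow>\<^sub>L 'b::banach) \<Rightarrow> 'a \<Rightarrow> 'b"
  by unfold_locales (rule norm_blinfun)

interpretation comp: contractive_bilinear "(o\<^sub>L) :: ('b::real_normed_vector \<Rightarrow>\<^sub>L 'c::banach) \<Rightarrow> ('a::real_normed_vector \<Rightarrow>\<^sub>L 'b) \<Rightarrow> 'a \<Rightarrow>\<^sub>L 'c"
  by (intro contractive_bilinear.intro bounded_bilinear_blinfun_compose contractive_bilinear_axioms.intro
      norm_blinfun_compose)

interpretation app_pairing: bounded_bilinear "pairing blinfun_apply :: ('i, 'a::real_normed_vector \<Rightarrow>\<^sub>L 'b::banach) ell2 \<Rightarrow> ('i, 'a) ell2 \<Rightarrow> 'b"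
  by (rule app.bounded_bilinear_pairing)

interpretation comp_pairing: bounded_bilinear "pairing (o\<^sub>L) :: ('i, 'b::real_normed_vector \<Rightarrow>\<^sub>L 'c::banach) ell2 \<Rightarrow> ('i, 'a::real_normed_vector \<Rightarrow>\<^sub>L 'b) ell2 \<Rightarrow> 'a \<Rightarrow>\<^sub>L 'c"
  by (rule comp.bounded_bilinear_pairing)

type_synonym 'h vec2 = "(int, 'h) ell2"
type_synonym 'h row = "(int, 'h \<Rightarrow>\<^sub>L 'h) ell2"
type_synonym 'h mat = "(int \<times> int, 'h \<Rightarrow>\<^sub>L 'h) ell2"

lemma L2_set_squared: "(L2_set f F)\<^sup>2 = (\<Sum>i\<in>F. (f i)\<^sup>2)"
  unfolding L2_set_def by (simp add: sum_nonneg)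

text \<open>Every finite set of index pairs lies in a finite rectangle, over which the sum can be iterated.\<close>

lemma Ell2_rectangle:
  fixes M :: "'i \<Rightarrow> 'j \<Rightarrow> 'e::real_normed_vector"
  assumes C: "0 \<le> C"
    and bd: "\<And>F G. finite F \<Longrightarrow> finite G \<Longrightarrow> (\<Sum>j\<in>F. \<Sum>l\<in>G. (norm (M j l))\<^sup>2) \<le> C\<^sup>2"
  shows "entry (Ell2 (\<lambda>(j, l). M j l)) (j, l) = M j l" "norm (Ell2 (\<lambda>(j, l). M j l)) \<le> C"
proof -
  have *: "L2_set (\<lambda>i. norm (case i of (j, l) \<Rightarrow> M j l)) F \<le> C" if F: "finite F" for F
  proof -
    have "(L2_set (\<lambda>i. norm (case i of (j, l) \<Rightarrow> M j l)) F)\<^sup>2 \<le> (\<Sum>(j, l)\<in>fst ` F \<times> snd ` F. (norm (M j l))\<^sup>2)"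
      unfolding L2_set_squared using F
      by (simp add: split_def) (rule sum_mono2, auto simp: subset_fst_snd)
    also have "\<dots> \<le> C\<^sup>2"
      unfolding sum.cartesian_product[symmetric] using F by (intro bd) auto
    finally show ?thesis by (rule power2_le_imp_le[OF _ C])
  qed
  show "entry (Ell2 (\<lambda>(j, l). M j l)) (j, l) = M j l"
    using Ell2_bounded(1)[of "\<lambda>(j, l). M j l" C "(j, l)"] * by simp
  show "norm (Ell2 (\<lambda>(j, l). M j l)) \<le> C" by (rule Ell2_bounded(2)[OF *])
qed

definition mrow :: "('i \<times> 'j, 'e::real_normed_vector) ell2 \<Rightarrow> 'i \<Rightarrow> ('j, 'e) ell2" where
  "mrow A j = Ell2 (\<lambda>l. entry A (j, l))"
definition mcol :: "('i \<times> 'j, 'e::real_normed_vector) ell2 \<Rightarrow> 'j \<Rightarrow> ('i, 'e) ell2" where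
  "mcol A l = Ell2 (\<lambda>j. entry A (j, l))"

text \<open>Rows, columns and shifts of a square-summable family are sections of it along injective maps.\<close>

lemma L2_set_section_le:
  assumes "inj h" "finite F"
  shows "L2_set (\<lambda>l. norm (entry A (h l))) F \<le> norm A"
proof -
  have "L2_set (\<lambda>l. norm (entry A (h l))) F = L2_set (\<lambda>i. norm (entry A i)) (h ` F)"
    unfolding L2_set_def using assms by (subst sum.reindex) (auto simp: inj_on_def)
  also have "\<dots> \<le> norm A" using assms by (intro L2_set_entry_le_norm) auto
  finally show ?thesis .
qed

lemma entry_mrow: "entry (mrow A j) l = entry A (j, l)"
  unfolding mrow_def by (rule Ell2_bounded[OF L2_set_section_le]) (auto simp: inj_on_def)
lemma entry_mcol: "entry (mcol A l) j = entry A (j, l)"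
  unfolding mcol_def by (rule Ell2_bounded[OF L2_set_section_le]) (auto simp: inj_on_def)

lemmas mat_entry = entry_mrow entry_mcol

lemma bounded_linear_section:
  assumes inj: "inj h" and e: "\<And>A i. entry (f A) i = entry A (h i)"
  shows "bounded_linear f"
proof (rule bounded_linear_intro[of _ 1])
  show "f (x + y) = f x + f y" for x y by (rule ell2_eqI) (simp add: e entry_simps)
  show "f (r *\<^sub>R x) = r *\<^sub>R f x" for r x by (rule ell2_eqI) (simp add: e entry_simps)
  show "norm (f x) \<le> norm x * 1" for x
    by (auto intro!: norm_ell2_le L2_set_section_le[OF inj] simp: e)
qed

lemma bounded_linear_mrow: "bounded_linear (\<lambda>A. mrow A j)"
  by (rule bounded_linear_section[of "\<lambda>l. (j, l)"]) (auto simp: entry_mrow inj_on_def)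
lemma bounded_linear_mcol: "bounded_linear (\<lambda>A. mcol A l)"
  by (rule bounded_linear_section[of "\<lambda>j. (j, l)"]) (auto simp: entry_mcol inj_on_def)

lemma has_sum_mrow: "((\<lambda>j. (norm (mrow A j))\<^sup>2) has_sum (norm A)\<^sup>2) UNIV"
proof -
  have "((\<lambda>p. (norm (entry A p))\<^sup>2) has_sum (norm A)\<^sup>2) (SIGMA j:UNIV. UNIV)"
    using summable_entry[of A] by (simp add: norm_ell2_squared)
  then show ?thesis
    by (rule has_sum_SigmaD) (use summable_entry[of "mrow A _"] in \<open>simp add: norm_ell2_squared entry_mrow\<close>)
qed

lemma has_sum_mcol: "((\<lambda>l. (norm (mcol A l))\<^sup>2) has_sum (norm A)\<^sup>2) UNIV"
proof -
  have "((\<lambda>p. (norm (entry A p))\<^sup>2) has_sum (norm A)\<^sup>2) (UNIV \<times> UNIV)"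
    using summable_entry[of A] by (simp add: norm_ell2_squared)
  then have "((\<lambda>(l, j). (norm (entry A (j, l)))\<^sup>2) has_sum (norm A)\<^sup>2) (UNIV \<times> UNIV)"
    by (subst (asm) has_sum_swap) (simp add: case_prod_unfold)
  then show ?thesis
    by (rule has_sum_SigmaD) (use summable_entry[of "mcol A _"] in \<open>simp add: norm_ell2_squared entry_mcol\<close>)
qed

lemma sum_mrow_le: "finite F \<Longrightarrow> (\<Sum>j\<in>F. (norm (mrow A j))\<^sup>2) \<le> (norm A)\<^sup>2"
  using finite_sum_le_has_sum[OF has_sum_mrow] by auto
lemma sum_mcol_le: "finite F \<Longrightarrow> (\<Sum>j\<in>F. (norm (mcol A j))\<^sup>2) \<le> (norm A)\<^sup>2"
  using finite_sum_le_has_sum[OF has_sum_mcol] by auto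

subsection \<open>Products\<close>

text \<open>Products of two matrices, of a matrix and a vector, and of a row and a matrix. By the
  Cauchy-Schwarz inequality the series in each entry converges absolutely.\<close>

definition mm :: "'h::banach mat \<Rightarrow> 'h mat \<Rightarrow> 'h mat" where
  "mm A B = Ell2 (\<lambda>(j, l). pairing (o\<^sub>L) (mrow A j) (mcol B l))"
definition mv :: "'h::banach mat \<Rightarrow> 'h vec2 \<Rightarrow> 'h vec2" where
  "mv A x = Ell2 (\<lambda>j. pairing blinfun_apply (mrow A j) x)"
definition rm :: "'h::banach row \<Rightarrow> 'h mat \<Rightarrow> 'h row" where
  "rm r B = Ell2 (\<lambda>l. pairing (o\<^sub>L) r (mcol B l))"

text \<open>The bound of entry \<open>(j, l)\<close> by row \<open>j\<close> of \<open>A\<close> and column \<open>l\<close> of \<open>B\<close> separates the variables, as for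
  Hilbert-Schmidt operators.\<close>

lemma norm_pairing_mm_le:
  fixes A B :: "'h::banach mat"
  assumes "finite F" "finite G"
  shows "(\<Sum>j\<in>F. \<Sum>l\<in>G. (norm (pairing (o\<^sub>L) (mrow A j) (mcol B l)))\<^sup>2) \<le> (norm A * norm B)\<^sup>2"
proof -
  have "(\<Sum>j\<in>F. \<Sum>l\<in>G. (norm (pairing (o\<^sub>L) (mrow A j) (mcol B l)))\<^sup>2)
      \<le> (\<Sum>j\<in>F. \<Sum>l\<in>G. (norm (mrow A j))\<^sup>2 * (norm (mcol B l))\<^sup>2)"
    by (intro sum_mono) (unfold power_mult_distrib[symmetric], intro power_mono comp.norm_pairing_le norm_ge_zero)
  also have "\<dots> = (\<Sum>j\<in>F. (norm (mrow A j))\<^sup>2) * (\<Sum>l\<in>G. (norm (mcol B l))\<^sup>2)"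
    by (simp add: sum_product)
  also have "\<dots> \<le> (norm A)\<^sup>2 * (norm B)\<^sup>2"
    using assms by (intro mult_mono sum_mrow_le sum_mcol_le sum_nonneg) auto
  finally show ?thesis by (simp add: power_mult_distrib)
qed

lemma entry_mm: "entry (mm A B) (j, l) = pairing (o\<^sub>L) (mrow A j) (mcol B l)"
  unfolding mm_def by (rule Ell2_rectangle[OF _ norm_pairing_mm_le]) auto

lemma norm_mm_le: "norm (mm A B) \<le> norm A * norm B"
  unfolding mm_def by (rule Ell2_rectangle[OF _ norm_pairing_mm_le]) auto

lemma L2_set_mv_le:
  fixes A :: "'h::banach mat"
  assumes "finite F"
  shows "L2_set (\<lambda>j. norm (pairing blinfun_apply (mrow A j) x)) F \<le> norm A * norm x"
proof (rule power2_le_imp_le)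
  have "(\<Sum>j\<in>F. (norm (pairing blinfun_apply (mrow A j) x))\<^sup>2) \<le> (\<Sum>j\<in>F. (norm (mrow A j))\<^sup>2 * (norm x)\<^sup>2)"
    by (intro sum_mono) (unfold power_mult_distrib[symmetric], intro power_mono app.norm_pairing_le norm_ge_zero)
  also have "\<dots> \<le> (norm A)\<^sup>2 * (norm x)\<^sup>2"
    using sum_mrow_le[OF assms, of A] by (simp flip: sum_distrib_right add: mult_right_mono)
  finally show "(L2_set (\<lambda>j. norm (pairing blinfun_apply (mrow A j) x)) F)\<^sup>2 \<le> (norm A * norm x)\<^sup>2"
    by (simp add: L2_set_squared power_mult_distrib)
qed simp

lemma entry_mv: "entry (mv A x) j = pairing blinfun_apply (mrow A j) x"
  unfolding mv_def by (rule Ell2_bounded[OF L2_set_mv_le])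
lemma norm_mv_le: "norm (mv A x) \<le> norm A * norm x"
  unfolding mv_def by (rule Ell2_bounded[OF L2_set_mv_le])

lemma L2_set_rm_le:
  fixes r :: "'h::banach row"
  assumes "finite F"
  shows "L2_set (\<lambda>l. norm (pairing (o\<^sub>L) r (mcol B l))) F \<le> norm r * norm B"
proof (rule power2_le_imp_le)
  have "(\<Sum>l\<in>F. (norm (pairing (o\<^sub>L) r (mcol B l)))\<^sup>2) \<le> (\<Sum>l\<in>F. (norm r)\<^sup>2 * (norm (mcol B l))\<^sup>2)"
    by (intro sum_mono) (unfold power_mult_distrib[symmetric], intro power_mono comp.norm_pairing_le norm_ge_zero)
  also have "\<dots> \<le> (norm r)\<^sup>2 * (norm B)\<^sup>2"
    using sum_mcol_le[OF assms, of B] by (simp flip: sum_distrib_left add: mult_left_mono)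
  finally show "(L2_set (\<lambda>l. norm (pairing (o\<^sub>L) r (mcol B l))) F)\<^sup>2 \<le> (norm r * norm B)\<^sup>2"
    by (simp add: L2_set_squared power_mult_distrib)
qed simp

lemma entry_rm: "entry (rm r B) l = pairing (o\<^sub>L) r (mcol B l)"
  unfolding rm_def by (rule Ell2_bounded[OF L2_set_rm_le])

lemma mrow_mm: "mrow (mm A B) j = rm (mrow A j) B"
  by (rule ell2_eqI) (simp add: entry_mrow entry_mm entry_rm)

interpretation mm: bounded_bilinear "mm :: 'h::banach mat \<Rightarrow> _"
proof
  fix A A' B B' :: "'h mat" and r :: real
  note lin = linear_simps[OF bounded_linear_mrow] linear_simps[OF bounded_linear_mcol]
  show "mm (A + A') B = mm A B + mm A' B"
    by (rule ell2_eqI) (auto simp: entry_mm entry_simps lin comp_pairing.add_left)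
  show "mm A (B + B') = mm A B + mm A B'"
    by (rule ell2_eqI) (auto simp: entry_mm entry_simps lin comp_pairing.add_right)
  show "mm (r *\<^sub>R A) B = r *\<^sub>R mm A B"
    by (rule ell2_eqI) (auto simp: entry_mm entry_simps lin comp_pairing.scaleR_left)
  show "mm A (r *\<^sub>R B) = r *\<^sub>R mm A B"
    by (rule ell2_eqI) (auto simp: entry_mm entry_simps lin comp_pairing.scaleR_right)
  show "\<exists>K. \<forall>a b. norm (mm (a :: 'h mat) b) \<le> norm a * norm b * K"
    by (intro exI[of _ 1]) (simp add: norm_mm_le)
qed

interpretation mv: bounded_bilinear "mv :: 'h::banach mat \<Rightarrow> _"
proof
  fix A A' :: "'h mat" and x y :: "'h vec2" and r :: real
  note lin = linear_simps[OF bounded_linear_mrow]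
  show "mv (A + A') x = mv A x + mv A' x"
    by (rule ell2_eqI) (auto simp: entry_mv entry_simps lin app_pairing.add_left)
  show "mv A (x + y) = mv A x + mv A y"
    by (rule ell2_eqI) (auto simp: entry_mv entry_simps lin app_pairing.add_right)
  show "mv (r *\<^sub>R A) x = r *\<^sub>R mv A x"
    by (rule ell2_eqI) (auto simp: entry_mv entry_simps lin app_pairing.scaleR_left)
  show "mv A (r *\<^sub>R x) = r *\<^sub>R mv A x"
    by (rule ell2_eqI) (auto simp: entry_mv entry_simps lin app_pairing.scaleR_right)
  show "\<exists>K. \<forall>a b. norm (mv (a :: 'h mat) b) \<le> norm a * norm b * K"
    by (intro exI[of _ 1]) (simp add: norm_mv_le)
qed

text \<open>The double series is absolutely convergent because the outer product of a square-summable
  row and a square-summable vector is square-summable over pairs of indices.\<close>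

lemma pairing_mv:
  fixes r :: "'h::banach row"
  shows "pairing blinfun_apply r (mv B x) = pairing blinfun_apply (rm r B) x"
proof -
  define X where "X = Ell2 (\<lambda>(n::int, l::int). norm (entry r n) * norm (entry x l))"
  have X: "entry X (n, l) = norm (entry r n) * norm (entry x l)" for n l
    unfolding X_def
  proof (rule Ell2_rectangle[where C = "norm r * norm x"])
    fix F G :: "int set" assume FG: "finite F" "finite G"
    have "(\<Sum>j\<in>F. \<Sum>l\<in>G. (norm (norm (entry r j) * norm (entry x l)))\<^sup>2)
        = (L2_set (\<lambda>j. norm (entry r j)) F)\<^sup>2 * (L2_set (\<lambda>l. norm (entry x l)) G)\<^sup>2"
      by (simp add: L2_set_squared sum_product power_mult_distrib)
    also have "\<dots> \<le> (norm r)\<^sup>2 * (norm x)\<^sup>2"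
      using FG by (intro mult_mono power_mono L2_set_entry_le_norm) auto
    finally show "(\<Sum>j\<in>F. \<Sum>l\<in>G. (norm (norm (entry r j) * norm (entry x l)))\<^sup>2) \<le> (norm r * norm x)\<^sup>2"
      by (simp add: power_mult_distrib)
  qed simp
  let ?g = "\<lambda>n l. blinfun_apply (entry r n) (blinfun_apply (entry B (n, l)) (entry x l))"
  have bd: "norm (?g n l) \<le> norm (entry B (n, l)) * norm (entry X (n, l))" for n l
  proof -
    have "norm (?g n l) \<le> norm (entry r n) * (norm (entry B (n, l)) * norm (entry x l))"
      by (intro order_trans[OF norm_blinfun] mult_left_mono norm_blinfun) auto
    then show ?thesis by (simp add: X mult_ac)
  qed
  have "(\<lambda>p. norm ((\<lambda>(n, l). ?g n l) p)) summable_on UNIV"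
    by (rule summable_on_comparison_test[OF summable_on_product[OF summable_entry[of B] summable_entry[of X]]])
       (use bd in auto)
  then have "(\<lambda>p. norm ((\<lambda>(n, l). ?g n l) p)) summable_on UNIV \<times> UNIV" by simp
  then have s: "(\<lambda>(n, l). ?g n l) summable_on UNIV \<times> UNIV" by (rule abs_summable_summable)
  have "pairing blinfun_apply r (mv B x) = (\<Sum>\<^sub>\<infinity>n. \<Sum>\<^sub>\<infinity>l. ?g n l)"
    unfolding pairing_def entry_mv entry_mrow
    using app.summable[of "mrow B _" x]
    by (intro infsum_cong infsum_linear[symmetric] blinfun.bounded_linear_right)
       (simp add: entry_mrow)
  also have "\<dots> = (\<Sum>\<^sub>\<infinity>l. \<Sum>\<^sub>\<infinity>n. ?g n l)" by (rule infsum_swap_banach[OF s])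
  also have "\<dots> = (\<Sum>\<^sub>\<infinity>l. blinfun_apply (\<Sum>\<^sub>\<infinity>n. entry r n o\<^sub>L entry B (n, l)) (entry x l))"
  proof (rule infsum_cong)
    fix l
    have "(\<Sum>\<^sub>\<infinity>n. blinfun_apply (entry r n o\<^sub>L entry B (n, l)) (entry x l))
       = blinfun_apply (\<Sum>\<^sub>\<infinity>n. entry r n o\<^sub>L entry B (n, l)) (entry x l)"
      using comp.summable[of r "mcol B l"]
      by (intro infsum_linear blinfun.bounded_linear_left) (simp add: entry_mcol)
    then show "(\<Sum>\<^sub>\<infinity>n. ?g n l) = blinfun_apply (\<Sum>\<^sub>\<infinity>n. entry r n o\<^sub>L entry B (n, l)) (entry x l)"
      by simp
  qed
  also have "\<dots> = pairing blinfun_apply (rm r B) x"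
    unfolding pairing_def entry_rm entry_mcol ..
  finally show ?thesis .
qed

lemma mv_mm: "mv (mm A B) x = mv A (mv B x)"
  by (rule ell2_eqI) (simp add: entry_mv mrow_mm pairing_mv)

definition mclinear :: "('i, 'h::complex_hilbert \<Rightarrow>\<^sub>L 'h) ell2 \<Rightarrow> bool" where
  "mclinear A \<longleftrightarrow> (\<forall>p. clinear (entry A p))"

lemma mclinear_add: "mclinear A \<Longrightarrow> mclinear B \<Longrightarrow> mclinear (A + B)"
  and mclinear_minus: "mclinear A \<Longrightarrow> mclinear B \<Longrightarrow> mclinear (A - B)"
  by (auto simp: mclinear_def entry_simps clinear_add clinear_minus)

lemma mclinear_mm: "mclinear A \<Longrightarrow> mclinear B \<Longrightarrow> mclinear (mm A B)"
  unfolding mclinear_def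
  by (auto simp: entry_mm pairing_def mat_entry intro!: clinear_infsum clinear_compose)

text \<open>Fixed point equations are solved among the matrices of complex-linear operators; completeness of
  that set is what the contraction principle needs.\<close>

lemma closed_mclinear: "closed {A :: ('i, 'h::complex_hilbert \<Rightarrow>\<^sub>L 'h) ell2. mclinear A}"
proof -
  have "{A :: ('i, 'h \<Rightarrow>\<^sub>L 'h) ell2. mclinear A} = (\<Inter>p. {A. entry A p \<in> {B. clinear B}})"
    by (auto simp: mclinear_def)
  moreover have "closed {A :: ('i, 'h \<Rightarrow>\<^sub>L 'h) ell2. entry A p \<in> {B. clinear B}}" for p
  proof -
    have "isCont (\<lambda>A :: ('i, 'h \<Rightarrow>\<^sub>L 'h) ell2. entry A p) x" for x
      by (rule bounded_linear.isCont[OF bounded_linear_entry continuous_ident])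
    from continuous_closed_vimage[OF closed_clinear this] show ?thesis by (simp add: vimage_def)
  qed
  ultimately show ?thesis by (simp only:) (intro closed_INT ballI)
qed


section \<open>Square-summable perturbations of diag(n)\<close>

subsection \<open>Entrywise multipliers\<close>

text \<open>The entrywise (Hadamard) multiplier with symbol \<open>c\<close>. It is only applied to symbols bounded by 1.\<close>

definition hadamard :: "('i \<Rightarrow> 'j \<Rightarrow> real) \<Rightarrow> ('i \<times> 'j, 'e::real_normed_vector) ell2 \<Rightarrow> ('i \<times> 'j, 'e) ell2" where
  "hadamard c A = Ell2 (\<lambda>(j, l). c j l *\<^sub>R entry A (j, l))"

lemma norm_ell2_mono:
  assumes "\<And>i. norm (entry x i) \<le> norm (entry y i)"
  shows "norm x \<le> norm y"
proof (rule norm_ell2_le)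
  fix F :: "'a set" assume "finite F"
  have "L2_set (\<lambda>i. norm (entry x i)) F \<le> L2_set (\<lambda>i. norm (entry y i)) F"
    by (intro L2_set_mono assms) auto
  also have "\<dots> \<le> norm y" using \<open>finite F\<close> by (rule L2_set_entry_le_norm)
  finally show "L2_set (\<lambda>i. norm (entry x i)) F \<le> norm y" .
qed

lemma entry_hadamard:
  assumes "\<And>j l. \<bar>c j l\<bar> \<le> 1"
  shows "entry (hadamard c A) (j, l) = c j l *\<^sub>R entry A (j, l)"
proof -
  have "L2_set (\<lambda>p. norm (case p of (j, l) \<Rightarrow> c j l *\<^sub>R entry A (j, l))) F \<le> norm A"
    if "finite F" for F
  proof -
    have "L2_set (\<lambda>p. norm (case p of (j, l) \<Rightarrow> c j l *\<^sub>R entry A (j, l))) F \<le> L2_set (\<lambda>p. norm (entry A p)) F"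
      using assms by (intro L2_set_mono) (auto simp: mult_left_le_one_le)
    also have "\<dots> \<le> norm A" using that by (rule L2_set_entry_le_norm)
    finally show ?thesis .
  qed
  then show ?thesis unfolding hadamard_def by (subst Ell2_bounded(1)) auto
qed

lemma norm_hadamard_le:
  assumes "\<And>j l. \<bar>c j l\<bar> \<le> 1"
  shows "norm (hadamard c A) \<le> norm A"
  using assms by (intro norm_ell2_mono) (auto simp: entry_hadamard mult_left_le_one_le)

lemma bounded_linear_hadamard:
  assumes "\<And>j l. \<bar>c j l\<bar> \<le> 1"
  shows "bounded_linear (hadamard c)"
  using assms
  by (intro bounded_linear_intro[of _ 1] ell2_eqI)
     (auto simp: entry_hadamard entry_simps norm_hadamard_le scaleR_add_right)

lemma mclinear_hadamard:
  assumes "\<And>j l. \<bar>c j l\<bar> \<le> 1" "mclinear A"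
  shows "mclinear (hadamard c A)"
  using assms unfolding mclinear_def by (auto simp: entry_hadamard intro: clinear_scaleR)

lemma norm_entry_mm_le: "norm (entry (mm A B) (j, l)) \<le> norm (mrow A j) * norm (mcol B l)"
  by (simp add: entry_mm comp.norm_pairing_le)

text \<open>Since entry \<open>(j, l)\<close> of the product is bounded by row \<open>j\<close> of \<open>B\<close> and column \<open>l\<close> of \<open>W\<close>, the multiplier
  can be charged to the rows of \<open>B\<close>: if it is small against these, it makes the product small in
  proportion to \<open>W\<close>.\<close>

lemma norm_hadamard_mm_rows:
  fixes B W :: "'h::banach mat"
  assumes c: "\<And>j l. \<bar>c j l\<bar> \<le> 1"
    and e: "\<And>l F. finite F \<Longrightarrow> (\<Sum>j\<in>F. (c j l)\<^sup>2 * (norm (mrow B j))\<^sup>2) \<le> e\<^sup>2" and "e \<ge> 0"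
  shows "norm (hadamard c (mm B W)) \<le> e * norm W"
  unfolding hadamard_def
proof (rule Ell2_rectangle)
  fix F G :: "int set" assume FG: "finite F" "finite G"
  have "(\<Sum>j\<in>F. \<Sum>l\<in>G. (norm (c j l *\<^sub>R entry (mm B W) (j, l)))\<^sup>2)
      \<le> (\<Sum>j\<in>F. \<Sum>l\<in>G. (norm (mcol W l))\<^sup>2 * ((c j l)\<^sup>2 * (norm (mrow B j))\<^sup>2))"
  proof (intro sum_mono)
    fix j l
    have "(norm (c j l *\<^sub>R entry (mm B W) (j, l)))\<^sup>2 \<le> (\<bar>c j l\<bar> * (norm (mrow B j) * norm (mcol W l)))\<^sup>2"
      by (intro power_mono) (auto intro: mult_left_mono norm_entry_mm_le)
    then show "(norm (c j l *\<^sub>R entry (mm B W) (j, l)))\<^sup>2 \<le> (norm (mcol W l))\<^sup>2 * ((c j l)\<^sup>2 * (norm (mrow B j))\<^sup>2)"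
      by (simp add: power_mult_distrib mult_ac)
  qed
  also have "\<dots> = (\<Sum>l\<in>G. (norm (mcol W l))\<^sup>2 * (\<Sum>j\<in>F. (c j l)\<^sup>2 * (norm (mrow B j))\<^sup>2))"
    by (subst sum.swap) (simp add: sum_distrib_left)
  also have "\<dots> \<le> (\<Sum>l\<in>G. (norm (mcol W l))\<^sup>2 * e\<^sup>2)"
    using FG by (intro sum_mono mult_left_mono e) auto
  also have "\<dots> \<le> (norm W)\<^sup>2 * e\<^sup>2"
    using sum_mcol_le[OF FG(2), of W] by (simp flip: sum_distrib_right add: mult_right_mono)
  finally show "(\<Sum>j\<in>F. \<Sum>l\<in>G. (norm (c j l *\<^sub>R entry (mm B W) (j, l)))\<^sup>2) \<le> (e * norm W)\<^sup>2"
    by (simp add: power_mult_distrib mult.commute)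
qed (use \<open>e \<ge> 0\<close> in auto)

lemma norm_hadamard_mm_cols:
  fixes C W :: "'h::banach mat"
  assumes c: "\<And>j l. \<bar>c j l\<bar> \<le> 1"
    and e: "\<And>j F. finite F \<Longrightarrow> (\<Sum>l\<in>F. (c j l)\<^sup>2 * (norm (mcol C l))\<^sup>2) \<le> e\<^sup>2" and "e \<ge> 0"
  shows "norm (hadamard c (mm W C)) \<le> e * norm W"
  unfolding hadamard_def
proof (rule Ell2_rectangle)
  fix F G :: "int set" assume FG: "finite F" "finite G"
  have "(\<Sum>j\<in>F. \<Sum>l\<in>G. (norm (c j l *\<^sub>R entry (mm W C) (j, l)))\<^sup>2)
      \<le> (\<Sum>j\<in>F. \<Sum>l\<in>G. (norm (mrow W j))\<^sup>2 * ((c j l)\<^sup>2 * (norm (mcol C l))\<^sup>2))"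
  proof (intro sum_mono)
    fix j l
    have "(norm (c j l *\<^sub>R entry (mm W C) (j, l)))\<^sup>2 \<le> (\<bar>c j l\<bar> * (norm (mrow W j) * norm (mcol C l)))\<^sup>2"
      by (intro power_mono) (auto intro: mult_left_mono norm_entry_mm_le)
    then show "(norm (c j l *\<^sub>R entry (mm W C) (j, l)))\<^sup>2 \<le> (norm (mrow W j))\<^sup>2 * ((c j l)\<^sup>2 * (norm (mcol C l))\<^sup>2)"
      by (simp add: power_mult_distrib mult_ac)
  qed
  also have "\<dots> = (\<Sum>j\<in>F. (norm (mrow W j))\<^sup>2 * (\<Sum>l\<in>G. (c j l)\<^sup>2 * (norm (mcol C l))\<^sup>2))"
    by (simp add: sum_distrib_left)
  also have "\<dots> \<le> (\<Sum>j\<in>F. (norm (mrow W j))\<^sup>2 * e\<^sup>2)"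
    using FG by (intro sum_mono mult_left_mono e) auto
  also have "\<dots> \<le> (norm W)\<^sup>2 * e\<^sup>2"
    using sum_mrow_le[OF FG(1), of W] by (simp flip: sum_distrib_right add: mult_right_mono)
  finally show "(\<Sum>j\<in>F. \<Sum>l\<in>G. (norm (c j l *\<^sub>R entry (mm W C) (j, l)))\<^sup>2) \<le> (e * norm W)\<^sup>2"
    by (simp add: power_mult_distrib mult.commute)
qed (use \<open>e \<ge> 0\<close> in auto)

subsection \<open>Blocks\<close>

definition same_block :: "nat \<Rightarrow> int \<Rightarrow> int \<Rightarrow> bool" where
  "same_block k j l \<longleftrightarrow> j = l \<or> (\<bar>j\<bar> \<le> int k \<and> \<bar>l\<bar> \<le> int k)"

text \<open>The commutator of diag(n) with a matrix multiplies entry \<open>(j, l)\<close> by \<open>j - l\<close>. This multiplier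
  inverts it on the matrices that vanish on the blocks.\<close>

definition inv_comm :: "nat \<Rightarrow> int \<Rightarrow> int \<Rightarrow> real" where
  "inv_comm k j l = (if same_block k j l then 0 else 1 / real_of_int (j - l))"

definition block_entry :: "nat \<Rightarrow> int \<Rightarrow> int \<Rightarrow> real" where
  "block_entry k j l = (if same_block k j l then 1 else 0)"

lemma abs_inv_comm_le: "\<bar>inv_comm k j l\<bar> \<le> 1"
  and abs_block_entry_le: "\<bar>block_entry k j l\<bar> \<le> 1"
proof -
  have "1 / \<bar>real_of_int (j - l)\<bar> \<le> 1" if "j \<noteq> l"
  proof -
    have "1 \<le> \<bar>j - l\<bar>" using that by linarith
    then have "1 \<le> \<bar>real_of_int (j - l)\<bar>" by linarith
    then show ?thesis by simp
  qed
  then show "\<bar>inv_comm k j l\<bar> \<le> 1" by (auto simp: inv_comm_def same_block_def)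
qed (simp add: block_entry_def)

lemma inv_comm_sym: "(inv_comm k j l)\<^sup>2 = (inv_comm k l j)\<^sup>2"
  by (auto simp: inv_comm_def same_block_def power_divide power2_commute)

lemma summable_tail:
  fixes s :: "'i \<Rightarrow> real"
  assumes s: "s summable_on UNIV" "\<And>i. s i \<ge> 0" and "e > 0"
  obtains F0 where "finite F0" "\<And>F. finite F \<Longrightarrow> F \<inter> F0 = {} \<Longrightarrow> sum s F \<le> e"
proof -
  obtain F0 where F0: "finite F0" "dist (sum s F0) (infsum s UNIV) \<le> e"
    using infsum_finite_approximation[OF s(1) \<open>e > 0\<close>] by auto
  have "sum s F \<le> e" if "finite F" "F \<inter> F0 = {}" for F
  proof -
    have "sum s F + sum s F0 = sum s (F \<union> F0)" using that F0(1) by (simp add: sum.union_disjoint)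
    also have "\<dots> \<le> infsum s UNIV" using that F0(1) s by (intro finite_sum_le_infsum) auto
    finally show ?thesis using F0(2) by (simp add: dist_real_def)
  qed
  with F0(1) that show ?thesis by blast
qed

text \<open>Either the index \<open>q\<close> is large, and then the tail of \<open>s\<close> is small, or \<open>q\<close> is bounded;
  then \<open>p\<close>, lying in a different block, exceeds \<open>k\<close> and the distance \<open>p - q\<close> is large.\<close>

lemma inv_comm_sum_small:
  fixes s :: "int \<Rightarrow> real"
  assumes s: "s summable_on UNIV" "\<And>i. s i \<ge> 0" and "e > 0"
  shows "\<exists>k0. \<forall>k\<ge>k0. \<forall>p F. finite F \<longrightarrow> (\<Sum>q\<in>F. (inv_comm k p q)\<^sup>2 * s q) \<le> e"
proof -
  obtain F0 where F0: "finite F0" "\<And>F. finite F \<Longrightarrow> F \<inter> F0 = {} \<Longrightarrow> sum s F \<le> e/2"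
    using summable_tail[OF s, of "e/2"] \<open>e > 0\<close> by auto
  obtain K where K: "\<And>q. q \<in> F0 \<Longrightarrow> \<bar>q\<bar> \<le> int K"
  proof -
    obtain M where "\<forall>q\<in>F0. \<bar>q\<bar> \<le> M" using finite_set_of_finite_maps F0(1)
      by (metis Max_ge finite_imageI image_eqI)
    then have "\<And>q. q \<in> F0 \<Longrightarrow> \<bar>q\<bar> \<le> int (nat M)" by fastforce
    then show ?thesis by (rule that)
  qed
  define S where "S = infsum s UNIV"
  have S: "S \<ge> 0" "\<And>F. finite F \<Longrightarrow> sum s F \<le> S"
    unfolding S_def using s by (auto intro: infsum_nonneg finite_sum_le_infsum)
  obtain N :: nat where N: "2 * S / e < real N" "N > 0"
    using reals_Archimedean2[of "max 1 (2 * S / e)"] by (metis max.strict_boundedE of_nat_0_less_iff zero_less_one less_trans)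
  have "(\<Sum>q\<in>F. (inv_comm k p q)\<^sup>2 * s q) \<le> e" if k: "k \<ge> K + N" and F: "finite F" for k p F
  proof -
    have 1: "(\<Sum>q\<in>F - F0. (inv_comm k p q)\<^sup>2 * s q) \<le> e/2"
    proof -
      have "(\<Sum>q\<in>F - F0. (inv_comm k p q)\<^sup>2 * s q) \<le> sum s (F - F0)"
        using s(2) abs_inv_comm_le[of k p] by (intro sum_mono mult_left_le_one_le) (auto simp: abs_square_le_1)
      also have "\<dots> \<le> e/2" using F by (intro F0) auto
      finally show ?thesis .
    qed
    have g: "(inv_comm k p q)\<^sup>2 \<le> 1 / real N" if "q \<in> F0" for q
    proof (cases "same_block k p q")
      case False
      have "int N \<le> \<bar>p - q\<bar>" using False K[OF that] k by (auto simp: same_block_def)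
      then have n: "real N \<le> \<bar>real_of_int (p - q)\<bar>" by linarith
      have "real N \<le> (real N)\<^sup>2" using N(2) by (simp add: power2_eq_square)
      also have "\<dots> \<le> (real_of_int (p - q))\<^sup>2" using n by (metis abs_le_square_iff abs_of_nat)
      finally have "1 / (real_of_int (p - q))\<^sup>2 \<le> 1 / real N"
        using N(2) by (intro divide_left_mono mult_pos_pos) auto
      then show ?thesis using False by (simp add: inv_comm_def power_divide)
    qed (simp add: inv_comm_def)
    have "(\<Sum>q\<in>F \<inter> F0. (inv_comm k p q)\<^sup>2 * s q) \<le> (\<Sum>q\<in>F \<inter> F0. 1 / real N * s q)"
      using s(2) g by (intro sum_mono mult_right_mono) auto
    also have "\<dots> \<le> 1 / real N * S"
      unfolding sum_distrib_left[symmetric] using F by (intro mult_left_mono S) auto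
    also have "\<dots> \<le> e/2" using N \<open>e > 0\<close> by (simp add: field_simps)
    finally have "(\<Sum>q\<in>F \<inter> F0. (inv_comm k p q)\<^sup>2 * s q) \<le> e/2" .
    moreover have "(\<Sum>q\<in>F. (inv_comm k p q)\<^sup>2 * s q)
        = (\<Sum>q\<in>F - F0. (inv_comm k p q)\<^sup>2 * s q) + (\<Sum>q\<in>F \<inter> F0. (inv_comm k p q)\<^sup>2 * s q)"
      using F by (subst sum.union_disjoint[symmetric]) (auto intro: sum.cong)
    ultimately show ?thesis using 1 by linarith
  qed
  then show ?thesis by blast
qed

text \<open>The multiplier kills the square \<open>[-k, k] \<times> [-k, k]\<close>, outside of which a square-summable matrix
  has small norm when \<open>k\<close> is large.\<close>

lemma hadamard_tail_small:
  fixes A :: "(int \<times> int, 'e::real_normed_vector) ell2"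
  assumes c: "\<And>k j l. \<bar>c k j l\<bar> \<le> (if same_block k j l then 0 else 1)" and "e > 0"
  shows "\<exists>k0. \<forall>k\<ge>k0. norm (hadamard (c k) A) \<le> e"
proof -
  have c1: "\<bar>c k j l\<bar> \<le> 1" for k j l using c[of k j l] by (simp split: if_splits)
  obtain F0 where F0: "finite F0" "\<And>F. finite F \<Longrightarrow> F \<inter> F0 = {} \<Longrightarrow> (\<Sum>p\<in>F. (norm (entry A p))\<^sup>2) \<le> e\<^sup>2"
    using summable_tail[OF summable_entry[of A], of "e\<^sup>2"] \<open>e > 0\<close> by auto
  obtain M where M: "\<forall>p\<in>F0. \<bar>fst p\<bar> \<le> M \<and> \<bar>snd p\<bar> \<le> M"
  proof -
    have "\<exists>M. \<forall>q\<in>F0. \<bar>f q\<bar> \<le> (M::int)" for f :: "int \<times> int \<Rightarrow> int"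
      using F0(1) by (metis Max_ge finite_imageI image_eqI)
    then obtain M1 M2 where "\<forall>p\<in>F0. \<bar>fst p\<bar> \<le> M1" "\<forall>p\<in>F0. \<bar>snd p\<bar> \<le> M2" by metis
    then show ?thesis by (intro that[of "max M1 M2"]) fastforce
  qed
  have "norm (hadamard (c k) A) \<le> e" if k: "k \<ge> nat M" for k
  proof (rule norm_ell2_le)
    fix F :: "(int \<times> int) set" assume F: "finite F"
    have z: "entry (hadamard (c k) A) p = 0" if "p \<in> F0" for p
    proof -
      obtain j l where p: "p = (j, l)" by (cases p)
      have "same_block k j l" using M that k unfolding p same_block_def by force
      then show ?thesis using c[of k j l] unfolding p by (simp add: entry_hadamard[of "c k", OF c1])
    qed
    have "(L2_set (\<lambda>p. norm (entry (hadamard (c k) A) p)) F)\<^sup>2 = (\<Sum>p\<in>F - F0. (norm (entry (hadamard (c k) A) p))\<^sup>2)"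
      unfolding L2_set_squared using F z by (intro sum.mono_neutral_right) auto
    also have "\<dots> \<le> (\<Sum>p\<in>F - F0. (norm (entry A p))\<^sup>2)"
      using c1 by (intro sum_mono power_mono) (auto simp: entry_hadamard[of "c k", OF c1] mult_left_le_one_le)
    also have "\<dots> \<le> e\<^sup>2" using F by (intro F0) auto
    finally show "L2_set (\<lambda>p. norm (entry (hadamard (c k) A) p)) F \<le> e"
      by (rule power2_le_imp_le) (use \<open>e > 0\<close> in simp)
  qed
  then show ?thesis by blast
qed

subsection \<open>Block diagonalisation of square-summable perturbations\<close>

text \<open>With \<open>N = diag(n)\<close>, the similarity \<open>(N - B) (I + W) = (I + W) (N - V0)\<close> amounts to
  \<open>N W - W N = B + B W - W V0 - V0\<close>, whose left side has the entries \<open>(j - l) W(j, l)\<close>. For \<open>W\<close>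
  vanishing on the blocks, the block part of the equation is solved by letting \<open>V0\<close> be the block part
  of \<open>B + B W\<close>, and division by \<open>j - l\<close> turns the rest into a fixed point equation that is quadratic
  in \<open>W\<close>. It is a contraction on a small ball once \<open>k\<close> is large, because then \<open>1 / (j - l)\<close> across
  different blocks is small against the rows and columns of \<open>B\<close>.\<close>

lemma block_diagonalization:
  fixes B :: "'h::complex_hilbert mat"
  assumes Bl: "mclinear B"
  shows "\<exists>k W V0. norm W < 1 \<and> mclinear W \<and> mclinear V0 \<and>
    (\<forall>j l. \<not> same_block k j l \<longrightarrow> entry V0 (j, l) = 0) \<and>
    (\<forall>j l. real_of_int (j - l) *\<^sub>R entry W (j, l) = entry (B + mm B W - mm W V0 - V0) (j, l))"
proof -
  \<comment> \<open>makes the quadratic term at most an eighth of \<open>norm W\<close> on the ball of radius \<open>r\<close>\<close>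
  define r where "r = 1 / (8 * (norm B + 1))"
  have r: "0 < r" "r < 1" "r * norm B \<le> 1/8"
    unfolding r_def by (auto simp: field_simps add_pos_nonneg)
  obtain k1 where k1: "\<forall>k\<ge>k1. \<forall>p F. finite F \<longrightarrow> (\<Sum>q\<in>F. (inv_comm k p q)\<^sup>2 * (norm (mrow B q))\<^sup>2) \<le> (1/8)\<^sup>2"
    using inv_comm_sum_small[of "\<lambda>q. (norm (mrow B q))\<^sup>2" "(1/8)\<^sup>2"] has_sum_mrow[of B]
    by (auto simp: has_sum_imp_summable)
  obtain k2 where k2: "\<forall>k\<ge>k2. \<forall>p F. finite F \<longrightarrow> (\<Sum>q\<in>F. (inv_comm k p q)\<^sup>2 * (norm (mcol B q))\<^sup>2) \<le> (1/8)\<^sup>2"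
    using inv_comm_sum_small[of "\<lambda>q. (norm (mcol B q))\<^sup>2" "(1/8)\<^sup>2"] has_sum_mcol[of B]
    by (auto simp: has_sum_imp_summable)
  have "\<bar>inv_comm k j l\<bar> \<le> (if same_block k j l then 0 else 1)" for k j l
    using abs_inv_comm_le[of k j l] by (cases "same_block k j l") (simp_all add: inv_comm_def)
  then obtain k3 where k3: "\<forall>k\<ge>k3. norm (hadamard (inv_comm k) B) \<le> r/4"
    using hadamard_tail_small[of inv_comm "r/4" B] r(1) by auto
  define k where "k = max k1 (max k2 k3)"
  define g where "g = (hadamard (inv_comm k) :: 'h mat \<Rightarrow> 'h mat)"
  define d where "d = (hadamard (block_entry k) :: 'h mat \<Rightarrow> 'h mat)"
  have eg: "entry (g X) (j, l) = inv_comm k j l *\<^sub>R entry X (j, l)" for X j l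
    unfolding g_def by (rule entry_hadamard[OF abs_inv_comm_le])
  have ed: "entry (d X) (j, l) = block_entry k j l *\<^sub>R entry X (j, l)" for X j l
    unfolding d_def by (rule entry_hadamard[OF abs_block_entry_le])
  have ng: "norm (g X) \<le> norm X" and nd: "norm (d X) \<le> norm X" for X
    unfolding g_def d_def by (rule norm_hadamard_le, rule abs_inv_comm_le abs_block_entry_le)+
  interpret g: bounded_linear g unfolding g_def by (rule bounded_linear_hadamard[OF abs_inv_comm_le])
  interpret d: bounded_linear d unfolding d_def by (rule bounded_linear_hadamard[OF abs_block_entry_le])
  have gB: "norm (g B) \<le> r/4" using k3 by (simp add: g_def k_def)
  have gBW: "norm (g (mm B W)) \<le> 1/8 * norm W" for W
    unfolding g_def
  proof (rule norm_hadamard_mm_rows[OF abs_inv_comm_le])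
    fix l :: int and F :: "int set" assume "finite F"
    then have "(\<Sum>j\<in>F. (inv_comm k l j)\<^sup>2 * (norm (mrow B j))\<^sup>2) \<le> (1/8)\<^sup>2" using k1 by (simp add: k_def)
    then show "(\<Sum>j\<in>F. (inv_comm k j l)\<^sup>2 * (norm (mrow B j))\<^sup>2) \<le> (1/8)\<^sup>2"
      by (subst inv_comm_sym)
  qed simp
  have colB: "norm (mcol (d B) l) \<le> norm (mcol B l)" for l
    by (rule norm_ell2_mono) (auto simp: entry_mcol ed block_entry_def)
  have gWB: "norm (g (mm W (d B))) \<le> 1/8 * norm W" for W
    unfolding g_def
  proof (rule norm_hadamard_mm_cols[OF abs_inv_comm_le])
    fix j :: int and F :: "int set" assume "finite F"
    have "(\<Sum>l\<in>F. (inv_comm k j l)\<^sup>2 * (norm (mcol (d B) l))\<^sup>2) \<le> (\<Sum>l\<in>F. (inv_comm k j l)\<^sup>2 * (norm (mcol B l))\<^sup>2)"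
      by (intro sum_mono mult_left_mono power_mono colB) auto
    also have "\<dots> \<le> (1/8)\<^sup>2" using k2 \<open>finite F\<close> by (simp add: k_def)
    finally show "(\<Sum>l\<in>F. (inv_comm k j l)\<^sup>2 * (norm (mcol (d B) l))\<^sup>2) \<le> (1/8)\<^sup>2" .
  qed simp
  have gq: "norm (g (mm W (d (mm B W')))) \<le> norm B * (norm W * norm W')" for W W'
  proof -
    have "norm (g (mm W (d (mm B W')))) \<le> norm W * norm (d (mm B W'))"
      by (rule order_trans[OF ng norm_mm_le])
    also have "\<dots> \<le> norm W * (norm B * norm W')"
      by (intro mult_left_mono order_trans[OF nd norm_mm_le]) auto
    finally show ?thesis by (simp add: mult_ac)
  qed
  \<comment> \<open>\<open>d (B + B W)\<close> stands for \<open>V0\<close>; \<open>g\<close> divides by \<open>j - l\<close> off the blocks\<close>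
  define Phi where "Phi W = g B + g (mm B W) - g (mm W (d B)) - g (mm W (d (mm B W)))" for W
  define S where "S = {W :: 'h mat. norm W \<le> r \<and> mclinear W}"
  have mcg: "mclinear (g X)" and mcd: "mclinear (d X)" if "mclinear X" for X
    unfolding g_def d_def using that by (auto intro: mclinear_hadamard abs_inv_comm_le abs_block_entry_le)
  have ql: "norm B * (norm W * norm W') \<le> 1/8 * norm W'" if "norm W \<le> r" for W W' :: "'h mat"
  proof -
    have "norm B * norm W \<le> norm B * r" using that by (intro mult_left_mono) auto
    then have "norm B * norm W \<le> 1/8" using r(3) by (simp add: mult.commute)
    then have "(norm B * norm W) * norm W' \<le> 1/8 * norm W'" by (intro mult_right_mono) auto
    then show ?thesis by (simp add: mult.assoc)
  qed
  have "\<exists>!W. W \<in> S \<and> Phi W = W"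
  proof (rule Banach_fix[where c = "1/2"])
    have "closed S"
    proof -
      have "S = cball 0 r \<inter> {W. mclinear W}" by (auto simp: S_def)
      then show ?thesis by (simp add: closed_Int closed_mclinear)
    qed
    then show "complete S" by (simp add: complete_eq_closed)
    have "0 \<in> S" using r by (auto simp: S_def mclinear_def entry_simps clinear_zero)
    then show "S \<noteq> {}" by blast
    show "Phi ` S \<subseteq> S"
    proof safe
      fix W assume W: "W \<in> S"
      then have nW: "norm W \<le> r" by (simp add: S_def)
      have "norm (Phi W) \<le> norm (g B) + norm (g (mm B W)) + norm (g (mm W (d B))) + norm (g (mm W (d (mm B W))))"
        unfolding Phi_def by (smt (verit) norm_triangle_ineq norm_triangle_ineq4)
      also have "\<dots> \<le> r/4 + 1/8 * norm W + 1/8 * norm W + 1/8 * norm W"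
        by (intro add_mono gB gBW gWB order_trans[OF gq ql[OF nW]])
      also have "\<dots> \<le> r" using nW r(1) by linarith
      finally have "norm (Phi W) \<le> r" .
      moreover have "mclinear (Phi W)"
        unfolding Phi_def using W Bl
        by (auto simp: S_def intro!: mclinear_add mclinear_minus mcg mcd mclinear_mm)
      ultimately show "Phi W \<in> S" by (simp add: S_def)
    qed
    show "dist (Phi W) (Phi W') \<le> 1/2 * dist W W'" if W: "W \<in> S" "W' \<in> S" for W W'
    proof -
      have "Phi W - Phi W' = g (mm B (W - W')) - g (mm (W - W') (d B)) -
          (g (mm (W - W') (d (mm B W))) + g (mm W' (d (mm B (W - W')))))"
        by (simp add: Phi_def mm.diff_left mm.diff_right g.diff d.diff)
      then have "norm (Phi W - Phi W') \<le> norm (g (mm B (W - W'))) + norm (g (mm (W - W') (d B))) +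
          (norm (g (mm (W - W') (d (mm B W)))) + norm (g (mm W' (d (mm B (W - W'))))))"
        by (smt (verit) norm_triangle_ineq norm_triangle_ineq4)
      also have "\<dots> \<le> 1/8 * norm (W - W') + 1/8 * norm (W - W') + (1/8 * norm (W - W') + 1/8 * norm (W - W'))"
      proof (intro add_mono gBW gWB)
        show "norm (g (mm (W - W') (d (mm B W)))) \<le> 1/8 * norm (W - W')"
          using gq[of "W - W'" W] ql[of W "W - W'"] W by (simp add: S_def mult.commute)
        show "norm (g (mm W' (d (mm B (W - W'))))) \<le> 1/8 * norm (W - W')"
          using gq[of W' "W - W'"] ql[of W' "W - W'"] W by (simp add: S_def)
      qed
      finally show ?thesis by (simp add: dist_norm)
    qed
  qed auto
  then obtain W where W: "W \<in> S" "Phi W = W" by blast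
  define V0 where "V0 = d (B + mm B W)"
  have Weq: "W = g (B + mm B W - mm W V0)"
    using W(2) by (simp add: Phi_def V0_def g.add g.diff d.add mm.add_right algebra_simps)
  have V0z: "entry V0 (j, l) = 0" if "\<not> same_block k j l" for j l
    using that by (simp add: V0_def ed block_entry_def)
  have Wz: "entry W (j, l) = 0" if "same_block k j l" for j l
    using that by (subst Weq) (simp add: eg inv_comm_def)
  have "real_of_int (j - l) *\<^sub>R entry W (j, l) = entry (B + mm B W - mm W V0 - V0) (j, l)" for j l
  proof (cases "same_block k j l")
    case True
    have "entry W (j, n) o\<^sub>L entry V0 (n, l) = 0" for n
    proof (cases "same_block k n l")
      case True
      then have "same_block k j n" using \<open>same_block k j l\<close> by (auto simp: same_block_def)
      then show ?thesis by (simp add: Wz)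
    qed (simp add: V0z)
    then have "entry (mm W V0) (j, l) = 0"
      by (simp add: entry_mm pairing_def mat_entry)
    moreover have "entry V0 (j, l) = entry (B + mm B W) (j, l)"
      using True by (simp add: V0_def ed block_entry_def)
    ultimately show ?thesis using Wz[OF True] by (simp add: entry_simps)
  next
    case False
    have "entry W (j, l) = inv_comm k j l *\<^sub>R entry (B + mm B W - mm W V0) (j, l)"
      by (subst Weq) (rule eg)
    moreover have "j \<noteq> l" using False by (auto simp: same_block_def)
    ultimately show ?thesis using False V0z[OF False] by (simp add: inv_comm_def entry_simps)
  qed
  moreover have "mclinear V0" unfolding V0_def using W(1) Bl
    by (auto simp: S_def intro!: mcd mclinear_add mclinear_mm)
  ultimately show ?thesis using W(1) r V0z unfolding S_def by (intro exI[of _ k] exI[of _ W] exI[of _ V0]) auto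
qed


section \<open>Multiplication by the index and Hankel operators\<close>

text \<open>Multiplication by the index is unbounded on square-summable sequences. As a relation it records both
  that \<open>x\<close> lies in its domain and that \<open>z\<close> is the image.\<close>

definition times_index :: "'h::complex_hilbert vec2 \<Rightarrow> 'h vec2 \<Rightarrow> bool" where
  "times_index x z \<longleftrightarrow> (\<forall>n. entry z n = real_of_int n *\<^sub>R entry x n)"

lemma has_section:
  assumes "inj h"
  shows "\<exists>y. (\<forall>i. entry y i = entry x (h i)) \<and> norm y \<le> norm x"
proof -
  note * = Ell2_bounded[of "\<lambda>i. entry x (h i)", OF L2_set_section_le[OF assms]]
  show ?thesis by (rule exI[of _ "Ell2 (\<lambda>i. entry x (h i))"]) (simp add: *)
qed

definition shift_row :: "'h::banach row \<Rightarrow> int \<Rightarrow> 'h row" where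
  "shift_row v j = Ell2 (\<lambda>n. entry v (j + n))"

lemma entry_shift_row: "entry (shift_row v j) n = entry v (j + n)"
  unfolding shift_row_def by (rule Ell2_bounded[OF L2_set_section_le]) (auto simp: inj_on_def)

text \<open>The Hankel operator with symbol \<open>v\<close>. Its values on a square-summable sequence need not be
  square-summable and are therefore given entry by entry.\<close>

definition hankel :: "'h::banach row \<Rightarrow> 'h vec2 \<Rightarrow> int \<Rightarrow> 'h" where
  "hankel v x j = pairing blinfun_apply (shift_row v j) x"

lemma summable_inverse_squares_int: "(\<lambda>n::int. (1 / real_of_int n)\<^sup>2) summable_on UNIV"
proof -
  have "summable (\<lambda>n::nat. inverse ((real n)\<^sup>2))"
    using inverse_power_summable[of 2, where 'a = real] by simp
  then have "(\<lambda>n::nat. inverse ((real n)\<^sup>2)) summable_on UNIV"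
    by (intro summable_nonneg_imp_summable_on) auto
  then have n: "(\<lambda>n::nat. (1 / real n)\<^sup>2) summable_on UNIV" by (simp add: power_divide inverse_eq_divide)
  have "(\<lambda>n::int. (1 / real_of_int n)\<^sup>2) summable_on range int"
    using n by (subst summable_on_reindex) (auto simp: o_def)
  moreover have "(\<lambda>n::int. (1 / real_of_int n)\<^sup>2) summable_on range (\<lambda>n. - int n)"
    using n by (subst summable_on_reindex) (auto simp: o_def inj_on_def)
  ultimately have "(\<lambda>n::int. (1 / real_of_int n)\<^sup>2) summable_on (range int \<union> range (\<lambda>n. - int n))"
    by (rule summable_on_union)
  moreover have "range int \<union> range (\<lambda>n. - int n) = UNIV"
  proof -
    have "n \<in> range int \<union> range (\<lambda>n. - int n)" for n by (cases n rule: int_cases2) auto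
    then show ?thesis by auto
  qed
  ultimately show ?thesis by simp
qed

text \<open>The entry at index 0 is \<open>1 / 0 = 0\<close>.\<close>

definition inv_index :: "(int, real) ell2" where
  "inv_index = Ell2 (\<lambda>n. 1 / real_of_int n)"

lemma entry_inv_index: "entry inv_index n = 1 / real_of_int n"
  unfolding inv_index_def using summable_inverse_squares_int
  by (intro entry_Ell2) (simp only: real_norm_def power2_abs)

text \<open>The Cauchy-Schwarz inequality applied to \<open>n x(n)\<close> and \<open>1 / n\<close>, with the index 0 treated separately.\<close>

lemma dom_index_abs_summable:
  assumes "times_index x z"
  shows "(\<lambda>n. norm (entry x n)) summable_on UNIV"
proof -
  have "(\<lambda>n. (if n \<in> {0} then norm (entry x n) else 0)) summable_on UNIV"
    by (rule finite_nonzero_values_imp_summable_on) (auto intro: finite_subset[of _ "{0}"])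
  then have s: "(\<lambda>n. norm (entry inv_index n) * norm (entry z n) + (if n \<in> {0} then norm (entry x n) else 0)) summable_on UNIV"
    by (intro summable_on_add summable_on_product summable_entry)
  have "norm (entry x n) \<le> norm (entry inv_index n) * norm (entry z n) + (if n \<in> {0} then norm (entry x n) else 0)" for n
    using assms by (simp add: times_index_def entry_inv_index)
  then show ?thesis by (intro summable_on_comparison_test[OF s]) auto
qed

text \<open>The image is the sum over \<open>n\<close> of the shifted families \<open>j \<mapsto> v(j + n) x(n)\<close>, whose norms are at most
  \<open>norm v * norm (x n)\<close>.\<close>

lemma hankel_in_ell2:
  fixes v :: "'h::complex_hilbert row"
  assumes "(\<lambda>n. norm (entry x n)) summable_on UNIV"
  shows "\<exists>y. (\<forall>j. entry y j = hankel v x j) \<and> norm y \<le> norm v * (\<Sum>\<^sub>\<infinity>n. norm (entry x n))"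
proof -
  have "\<exists>e. (\<forall>j. entry e j = blinfun_apply (entry v (j + n)) (entry x n)) \<and> norm e \<le> norm v * norm (entry x n)" for n
  proof -
    have "L2_set (\<lambda>j. norm (blinfun_apply (entry v (j + n)) (entry x n))) F \<le> norm v * norm (entry x n)"
      if F: "finite F" for F
    proof -
      have "L2_set (\<lambda>j. norm (blinfun_apply (entry v (j + n)) (entry x n))) F
          \<le> L2_set (\<lambda>j. norm (entry x n) * norm (entry v (j + n))) F"
        by (intro L2_set_mono) (metis mult.commute norm_blinfun, simp)
      also have "\<dots> = norm (entry x n) * L2_set (\<lambda>j. norm (entry v (j + n))) F"
        by (simp add: L2_set_right_distrib)
      also have "\<dots> \<le> norm (entry x n) * norm v"
        using F by (intro mult_left_mono L2_set_section_le[of "\<lambda>j. j + n"]) (auto simp: inj_on_def)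
      finally show ?thesis by (simp add: mult.commute)
    qed
    note * = Ell2_bounded[of "\<lambda>j. blinfun_apply (entry v (j + n)) (entry x n)", OF this]
    show ?thesis by (rule exI[of _ "Ell2 (\<lambda>j. blinfun_apply (entry v (j + n)) (entry x n))"]) (simp add: *)
  qed
  then obtain e where e: "\<And>n j. entry (e n) j = blinfun_apply (entry v (j + n)) (entry x n)"
    "\<And>n. norm (e n) \<le> norm v * norm (entry x n)" by metis
  have s: "(\<lambda>n. norm (e n)) summable_on UNIV"
    using e(2) by (intro summable_on_comparison_test[OF summable_on_cmult_right[OF assms, of "norm v"]]) auto
  have "entry (\<Sum>\<^sub>\<infinity>n. e n) j = hankel v x j" for j
    using infsum_linear[OF bounded_linear_entry abs_summable_summable[OF s], of j]
    by (simp add: hankel_def pairing_def e entry_shift_row)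
  moreover have "norm (\<Sum>\<^sub>\<infinity>n. e n) \<le> norm v * (\<Sum>\<^sub>\<infinity>n. norm (entry x n))"
  proof -
    have "norm (\<Sum>\<^sub>\<infinity>n. e n) \<le> (\<Sum>\<^sub>\<infinity>n. norm (e n))" by (rule norm_infsum_bound[OF s])
    also have "\<dots> \<le> (\<Sum>\<^sub>\<infinity>n. norm v * norm (entry x n))"
      by (intro infsum_mono s summable_on_cmult_right assms e)
    also have "\<dots> = norm v * (\<Sum>\<^sub>\<infinity>n. norm (entry x n))" by (rule infsum_cmult_right')
    finally show ?thesis .
  qed
  ultimately show ?thesis by blast
qed

text \<open>The commutator of multiplication by the index with \<open>W\<close> has the rows \<open>R\<close>; this is the product rule
  for the index acting on \<open>W x\<close>.\<close>

lemma index_mult_mv: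
  fixes W :: "'h::complex_hilbert mat"
  assumes "times_index x z" and R: "\<And>l. entry R l = real_of_int (j - l) *\<^sub>R entry W (j, l)"
  shows "real_of_int j *\<^sub>R entry (mv W x) j = pairing blinfun_apply R x + entry (mv W z) j"
proof -
  have "pairing blinfun_apply R x + entry (mv W z) j =
      (\<Sum>\<^sub>\<infinity>l. blinfun_apply (entry R l) (entry x l) + blinfun_apply (entry (mrow W j) l) (entry z l))"
    by (simp add: pairing_def entry_mv infsum_add app.summable)
  also have "\<dots> = (\<Sum>\<^sub>\<infinity>l. real_of_int j *\<^sub>R blinfun_apply (entry (mrow W j) l) (entry x l))"
    using assms(1)
    by (intro infsum_cong)
       (simp add: R times_index_def mat_entry blinfun.scaleR_left blinfun.scaleR_right flip: scaleR_add_left)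
  also have "\<dots> = real_of_int j *\<^sub>R entry (mv W x) j"
    by (simp add: infsum_scaleR_right entry_mv pairing_def)
  finally show ?thesis by simp
qed

subsection \<open>Conjugating a Hankel perturbation into a square-summable one\<close>

lemma summable_on_finite_columns:
  fixes M :: "int \<Rightarrow> int \<Rightarrow> 'e::real_normed_vector"
  assumes "finite L" "\<And>j l. l \<notin> L \<Longrightarrow> M j l = 0" "\<And>l. l \<in> L \<Longrightarrow> (\<lambda>j. (norm (M j l))\<^sup>2) summable_on UNIV"
  shows "(\<lambda>(j, l). (norm (M j l))\<^sup>2) summable_on UNIV"
proof -
  have "(\<lambda>(l, j). (norm (M j l))\<^sup>2) summable_on (SIGMA l:L. UNIV)"
    using assms by (intro summable_on_SigmaI[where g = "\<lambda>l. \<Sum>\<^sub>\<infinity>j. (norm (M j l))\<^sup>2"]) auto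
  then have "(\<lambda>(l, j). (norm (M j l))\<^sup>2) summable_on (UNIV \<times> UNIV)"
    by (rule summable_on_cong_neutral[THEN iffD1, rotated -1]) (use assms(2) in \<open>auto simp del: norm_eq_zero, force\<close>)
  then show ?thesis by (subst (asm) summable_on_swap) simp
qed

lemma summable_on_diagonal:
  fixes d :: "int \<Rightarrow> 'e::real_normed_vector"
  assumes "(\<lambda>j. (norm (d j))\<^sup>2) summable_on UNIV"
  shows "(\<lambda>(j, l). (norm (if j = l then d j else 0))\<^sup>2) summable_on (UNIV :: (int \<times> int) set)"
proof -
  have "(\<lambda>(j, l). (norm (if j = l then d j else 0))\<^sup>2) summable_on range (\<lambda>j. (j, j))"
    using assms by (subst summable_on_reindex) (auto simp: inj_on_def o_def)
  then show ?thesis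
    by (subst summable_on_cong_neutral[where T = "range (\<lambda>j. (j, j))"]) auto
qed

lemma one_plus_contraction:
  fixes T :: "'a::banach \<Rightarrow> 'a"
  assumes T: "bounded_linear T" and q: "\<And>x. norm (T x) \<le> q * norm x" "q < 1"
  shows "bij (\<lambda>x. x + T x)" "norm x \<le> norm (x + T x) / (1 - q)"
proof -
  interpret bounded_linear T by fact
  have "\<exists>!x. y - T x = x" for y
  proof (rule banach_fix_type)
    show "0 \<le> max q 0" "max q 0 < 1" using q(2) by auto
    have "dist (y - T x) (y - T x') \<le> max q 0 * dist x x'" for x x'
    proof -
      have "dist (y - T x) (y - T x') = norm (T (x - x'))"
        by (simp add: dist_norm diff norm_minus_commute)
      also have "\<dots> \<le> q * norm (x - x')" by (rule q)
      also have "\<dots> \<le> max q 0 * norm (x - x')" by (intro mult_right_mono) auto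
      finally show ?thesis by (simp add: dist_norm)
    qed
    then show "\<forall>x x'. dist (y - T x) (y - T x') \<le> max q 0 * dist x x'" by blast
  qed
  then have "\<exists>!x. y = x + T x" for y by (simp add: diff_eq_eq)
  then show "bij (\<lambda>x. x + T x)" unfolding bij_iff by metis
  have "norm x \<le> norm (x + T x) + norm (T x)" by (metis add_diff_cancel_right' norm_triangle_ineq4)
  then have "(1 - q) * norm x \<le> norm (x + T x)" using q(1)[of x] by (simp add: algebra_simps)
  then show "norm x \<le> norm (x + T x) / (1 - q)" using q(2) by (simp add: field_simps)
qed

text \<open>The matrix \<open>v(j + l)\<close> need not be square-summable, but \<open>v(j + l) / (j - l)\<close> is, being the product of a
  function of \<open>j + l\<close> and one of \<open>j - l\<close>. Let \<open>W\<close> be its part off the blocks. Then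
  \<open>N W - W N = v - J\<close> with \<open>J\<close> the block part of \<open>v\<close>, so that \<open>(N - v) (I + W) = (I + W) N - (J + v W)\<close>
  and the new perturbation \<open>B\<close> solves \<open>(I + W) B = J + v W\<close>. Up to finitely many terms in finitely many
  columns, the entries of \<open>v W\<close> are the sums assumed to be square-summable.\<close>

lemma first_transformation:
  fixes v :: "'h::complex_hilbert row"
  assumes vl: "mclinear v"
    and hyp: "(\<lambda>(j, l). (norm (\<Sum>\<^sub>\<infinity>n\<in>UNIV - {l}.
          (1 / real_of_int (l - n)) *\<^sub>R (entry v (j + n) o\<^sub>L entry v (l + n))))\<^sup>2)
        summable_on (UNIV :: (int \<times> int) set)"
  shows "\<exists>W B. norm W < 1 \<and> mclinear W \<and> mclinear B \<and>
    (\<forall>x z. times_index x z \<longrightarrow> (\<exists>z'. times_index (x + mv W x) z' \<and>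
      (\<forall>j. entry z' j - hankel v (x + mv W x) j = entry (z - mv B x + mv W (z - mv B x)) j)))"
proof -
  define X where "X = Ell2 (\<lambda>(m, d). entry inv_index d *\<^sub>R entry v m)"
  have X: "entry X (m, d) = entry inv_index d *\<^sub>R entry v m" for m d
    unfolding X_def
  proof (rule Ell2_rectangle[where C = "norm v * norm inv_index"])
    fix F G :: "int set" assume FG: "finite F" "finite G"
    have "(\<Sum>m\<in>F. \<Sum>d\<in>G. (norm (entry inv_index d *\<^sub>R entry v m))\<^sup>2)
        = (L2_set (\<lambda>m. norm (entry v m)) F)\<^sup>2 * (L2_set (\<lambda>d. norm (entry inv_index d)) G)\<^sup>2"
      by (simp add: L2_set_squared sum_product power_mult_distrib, simp add: mult.commute)
    also have "\<dots> \<le> (norm v)\<^sup>2 * (norm inv_index)\<^sup>2"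
      using FG by (intro mult_mono power_mono L2_set_entry_le_norm) auto
    finally show "(\<Sum>m\<in>F. \<Sum>d\<in>G. (norm (entry inv_index d *\<^sub>R entry v m))\<^sup>2) \<le> (norm v * norm inv_index)\<^sup>2"
      by (simp add: power_mult_distrib)
  qed simp
  obtain A where A: "\<And>j l. entry A (j, l) = (1 / real_of_int (j - l)) *\<^sub>R entry v (j + l)"
  proof -
    have "inj (\<lambda>(j::int, l). (j + l, j - l))" by (auto simp: inj_on_def)
    from has_section[OF this, of X] obtain A
      where "\<forall>i. entry A i = entry X (case i of (j, l) \<Rightarrow> (j + l, j - l))" by blast
    then show ?thesis by (intro that[of A]) (simp add: X entry_inv_index)
  qed
  define off where "off = (\<lambda>k j l. if same_block k j l then 0 else 1 :: real)"
  have abs_off: "\<bar>off k j l\<bar> \<le> 1" for k j l by (simp add: off_def)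
  obtain k where k: "norm (hadamard (off k) A) \<le> 1/2"
    using hadamard_tail_small[of off "1/2" A] by (auto simp: off_def)
  define W where "W = hadamard (off k) A"
  have W: "entry W (j, l) = inv_comm k j l *\<^sub>R entry v (j + l)" for j l
    unfolding W_def by (simp add: entry_hadamard[OF abs_off] A) (simp add: off_def inv_comm_def)
  have nW: "norm W \<le> 1/2" using k by (simp add: W_def)
  have Wl: "mclinear W" using vl by (auto simp: mclinear_def W intro: clinear_scaleR)
  let ?K = "{- int k..int k}"
  \<comment> \<open>the block diagonal part of the Hankel matrix: its diagonal is a section of \<open>v\<close>, the rest lies in a finite square\<close>
  define J where "J = Ell2 (\<lambda>(j, l). block_entry k j l *\<^sub>R entry v (j + l))"
  have J: "entry J (j, l) = block_entry k j l *\<^sub>R entry v (j + l)" for j l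
  proof -
    have "inj (\<lambda>j::int. j + j)" by (auto simp: inj_on_def)
    from has_section[OF this, of v] obtain d where d: "\<And>j. entry d j = entry v (j + j)" by auto
    have 1: "(\<lambda>(j, l). (norm (if j = l then entry d j else 0))\<^sup>2) summable_on (UNIV :: (int \<times> int) set)"
      by (rule summable_on_diagonal[OF summable_entry])
    have 2: "(\<lambda>(j, l). (norm (if j \<noteq> l \<and> \<bar>j\<bar> \<le> int k \<and> \<bar>l\<bar> \<le> int k then entry v (j + l) else 0))\<^sup>2)
        summable_on (UNIV :: (int \<times> int) set)"
      by (rule finite_nonzero_values_imp_summable_on, rule finite_subset[of _ "?K \<times> ?K"]) (auto split: if_splits)
    have "(\<lambda>(j, l). (norm ((if j = l then entry d j else 0) +
        (if j \<noteq> l \<and> \<bar>j\<bar> \<le> int k \<and> \<bar>l\<bar> \<le> int k then entry v (j + l) else 0)))\<^sup>2) summable_on (UNIV :: (int \<times> int) set)"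
      using square_summable_add[of "\<lambda>p. if fst p = snd p then entry d (fst p) else 0"
          "\<lambda>p. if fst p \<noteq> snd p \<and> \<bar>fst p\<bar> \<le> int k \<and> \<bar>snd p\<bar> \<le> int k then entry v (fst p + snd p) else 0"] 1 2
      by (simp add: case_prod_unfold)
    also have "(\<lambda>(j, l). (norm ((if j = l then entry d j else 0) +
        (if j \<noteq> l \<and> \<bar>j\<bar> \<le> int k \<and> \<bar>l\<bar> \<le> int k then entry v (j + l) else 0)))\<^sup>2) =
        (\<lambda>p. (norm (case p of (j, l) \<Rightarrow> block_entry k j l *\<^sub>R entry v (j + l)))\<^sup>2)"
      by (auto simp: block_entry_def same_block_def d)
    finally show ?thesis unfolding J_def by (subst entry_Ell2) auto
  qed
  have Jl: "mclinear J" using vl by (auto simp: mclinear_def J intro: clinear_scaleR)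
  \<comment> \<open>the product of the Hankel matrix and \<open>W\<close>\<close>
  define Y where "Y = Ell2 (\<lambda>(j, l). entry (rm (shift_row v j) W) l)"
  have Y: "entry Y (j, l) = entry (rm (shift_row v j) W) l" for j l
  proof -
    \<comment> \<open>\<open>h\<close> is the double sum of the hypothesis; in the columns \<open>\<bar>l\<bar> \<le> k\<close> it also contains the terms from the block, which \<open>c\<close> takes away\<close>
    define h where "h j l = (\<Sum>\<^sub>\<infinity>n\<in>UNIV - {l}. (1 / real_of_int (l - n)) *\<^sub>R (entry v (j + n) o\<^sub>L entry v (l + n)))" for j l
    define c where "c j l = (if l \<in> ?K then \<Sum>n\<in>?K - {l}. (1 / real_of_int (l - n)) *\<^sub>R (entry v (j + n) o\<^sub>L entry v (l + n)) else 0)" for j l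
    have sc: "(\<lambda>(j, l). (norm (c j l))\<^sup>2) summable_on UNIV"
    proof (rule summable_on_finite_columns[of ?K])
      fix l assume "l \<in> ?K"
      have "(\<lambda>j. (norm (\<Sum>n\<in>N. (1 / real_of_int (l - n)) *\<^sub>R (entry v (j + n) o\<^sub>L entry v (l + n))))\<^sup>2) summable_on UNIV"
        if "finite N" for N
        using that
      proof (induction rule: finite_induct)
        case (insert n N)
        have "(\<lambda>j. (norm (entry v (j + n) o\<^sub>L entry v (l + n)))\<^sup>2) summable_on UNIV"
        proof -
          have "inj (\<lambda>j. j + n)" by (auto simp: inj_on_def)
          from has_section[OF this, of v] obtain w where w: "\<And>j. entry w j = entry v (j + n)" by auto
          have "(\<lambda>j. (norm (entry v (l + n)))\<^sup>2 * (norm (entry w j))\<^sup>2) summable_on UNIV"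
            by (rule summable_on_cmult_right[OF summable_entry])
          then show ?thesis
          proof (rule summable_on_comparison_test)
            fix j
            have "(norm (entry v (j + n) o\<^sub>L entry v (l + n)))\<^sup>2 \<le> (norm (entry w j) * norm (entry v (l + n)))\<^sup>2"
              unfolding w by (intro power_mono norm_blinfun_compose) auto
            then show "(norm (entry v (j + n) o\<^sub>L entry v (l + n)))\<^sup>2 \<le> (norm (entry v (l + n)))\<^sup>2 * (norm (entry w j))\<^sup>2"
              by (simp add: power_mult_distrib mult.commute)
          qed auto
        qed
        from square_summable_add[OF square_summable_scaleR[OF this, of "1 / real_of_int (l - n)"] insert.IH]
        show ?case using insert.hyps by simp
      qed simp
      from this[of "?K - {l}"] show "(\<lambda>j. (norm (c j l))\<^sup>2) summable_on UNIV"
        using \<open>l \<in> ?K\<close> by (simp add: c_def)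
    qed (auto simp: c_def)
    have key: "entry (rm (shift_row v j) W) l = c j l - h j l" for j l
    proof -
      let ?t = "\<lambda>n. (1 / real_of_int (l - n)) *\<^sub>R (entry v (j + n) o\<^sub>L entry v (l + n))"
      have sW: "(\<lambda>n. entry v (j + n) o\<^sub>L entry W (n, l)) summable_on UNIV"
        using comp.summable[of "shift_row v j" "mcol W l"] by (simp add: entry_shift_row mat_entry)
      have rmW: "entry (rm (shift_row v j) W) l = (\<Sum>\<^sub>\<infinity>n. entry v (j + n) o\<^sub>L entry W (n, l))"
        by (simp add: entry_rm pairing_def entry_shift_row mat_entry)
      define N where "N = (if l \<in> ?K then ?K - {l} else {})"
      have N: "finite N" "N \<subseteq> UNIV - {l}" by (auto simp: N_def)
      have Wt: "entry v (j + n) o\<^sub>L entry W (n, l) = (if n = l \<or> n \<in> N then 0 else - ?t n)" for n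
      proof -
        have sb: "same_block k n l \<longleftrightarrow> n = l \<or> n \<in> N" by (auto simp: same_block_def N_def)
        have "1 / real_of_int (n - l) = - (1 / real_of_int (l - n))"
          by (metis minus_diff_eq minus_divide_right of_int_minus)
        then show ?thesis
          unfolding W inv_comm_def sb by (auto simp: add.commute[of n l] comp.scaleR_right simp flip: scaleR_minus_left)
      qed
      have "entry (rm (shift_row v j) W) l = (\<Sum>\<^sub>\<infinity>n\<in>UNIV - {l} - N. - ?t n)"
        unfolding rmW Wt by (rule infsum_cong_neutral) (auto split: if_splits)
      also have "\<dots> = - (\<Sum>\<^sub>\<infinity>n\<in>UNIV - {l} - N. ?t n)" by (rule infsum_uminus)
      finally have e1: "entry (rm (shift_row v j) W) l = - (\<Sum>\<^sub>\<infinity>n\<in>UNIV - {l} - N. ?t n)" .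
      have "(\<lambda>n. - (entry v (j + n) o\<^sub>L entry W (n, l))) summable_on UNIV - {l} - N"
        using summable_on_subset_banach[OF sW, of "UNIV - {l} - N"] by (simp add: summable_on_uminus)
      then have s1: "?t summable_on UNIV - {l} - N"
        by (rule summable_on_cong[THEN iffD1, rotated]) (auto simp: Wt)
      have "h j l = infsum ?t (N \<union> (UNIV - {l} - N))"
        unfolding h_def using N by (intro infsum_cong_neutral) auto
      also have "\<dots> = infsum ?t N + infsum ?t (UNIV - {l} - N)"
        using N s1 by (intro infsum_Un_disjoint) auto
      also have "infsum ?t N = c j l" using N by (auto simp: c_def N_def)
      finally show ?thesis using e1 by simp
    qed
    have "(\<lambda>p. (norm ((case p of (j, l) \<Rightarrow> c j l) + (-1) *\<^sub>R (case p of (j, l) \<Rightarrow> h j l)))\<^sup>2) summable_on UNIV"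
      using sc hyp unfolding h_def[symmetric]
      by (intro square_summable_add square_summable_scaleR) (simp_all add: case_prod_unfold)
    then have "(\<lambda>p. (norm (case p of (j, l) \<Rightarrow> entry (rm (shift_row v j) W) l))\<^sup>2) summable_on UNIV"
      by (simp add: key case_prod_unfold)
    then show ?thesis unfolding Y_def by (subst entry_Ell2) auto
  qed
  have Yl: "mclinear Y"
    using vl Wl unfolding mclinear_def
    by (auto simp: Y entry_rm pairing_def mat_entry entry_shift_row intro!: clinear_infsum clinear_compose)
  \<comment> \<open>the new perturbation \<open>B\<close> is \<open>(I + W)\<close> inverted on \<open>E\<close>, the fixed point of a contraction\<close>
  define E where "E = J + Y"
  have "\<exists>!B. B \<in> {B. mclinear B} \<and> E - mm W B = B"
  proof (rule Banach_fix[where c = "1/2"])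
    show "complete {B :: 'h mat. mclinear B}" by (simp add: complete_eq_closed closed_mclinear)
    show "{B :: 'h mat. mclinear B} \<noteq> {}"
      by (auto simp: mclinear_def entry_simps clinear_zero intro!: exI[of _ 0])
    show "(\<lambda>B. E - mm W B) ` {B. mclinear B} \<subseteq> {B. mclinear B}"
      using Jl Yl Wl by (auto simp: E_def intro!: mclinear_minus mclinear_add mclinear_mm)
    fix B B' :: "'h mat"
    have "dist (E - mm W B) (E - mm W B') = norm (mm W (B - B'))"
      by (simp add: dist_norm mm.diff_right norm_minus_commute)
    also have "\<dots> \<le> norm W * norm (B - B')" by (rule norm_mm_le)
    also have "\<dots> \<le> 1/2 * norm (B - B')" using nW by (intro mult_right_mono) auto
    finally show "dist (E - mm W B) (E - mm W B') \<le> 1/2 * dist B B'" by (simp add: dist_norm)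
  qed auto
  then obtain B where B: "mclinear B" "E - mm W B = B" by blast
  have "\<exists>z'. times_index (x + mv W x) z' \<and>
      (\<forall>j. entry z' j - hankel v (x + mv W x) j = entry (z - mv B x + mv W (z - mv B x)) j)"
    if xz: "times_index x z" for x z
  proof -
    obtain y where y: "\<And>j. entry y j = hankel v x j"
      using hankel_in_ell2[OF dom_index_abs_summable[OF xz], of v] by blast
    define z' where "z' = z + (y - mv J x + mv W z)"
    have N: "real_of_int j *\<^sub>R entry (mv W x) j = entry (y - mv J x + mv W z) j" for j
    proof -
      have "entry (shift_row v j - mrow J j) l = real_of_int (j - l) *\<^sub>R entry W (j, l)" for l
        by (auto simp: entry_simps entry_shift_row mat_entry J W inv_comm_def block_entry_def same_block_def)
      from index_mult_mv[OF xz this] show ?thesis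
        by (simp add: entry_simps y hankel_def entry_mv app_pairing.diff_left)
    qed
    have "times_index (x + mv W x) z'"
      using xz unfolding times_index_def z'_def by (auto simp: entry_plus N scaleR_add_right simp del: of_int_diff)
    moreover have "entry z' j - hankel v (x + mv W x) j = entry (z - mv B x + mv W (z - mv B x)) j" for j
    proof -
      have "mrow Y j = rm (shift_row v j) W" by (rule ell2_eqI) (simp add: entry_mrow Y)
      then have "hankel v (mv W x) j = entry (mv Y x) j"
        by (simp add: hankel_def pairing_mv entry_mv)
      then have "hankel v (x + mv W x) j = entry (y + mv Y x) j"
        by (simp add: hankel_def app_pairing.add_right entry_simps) (simp add: y hankel_def)
      moreover have "z' - (y + mv Y x) = z - mv B x + mv W (z - mv B x)"
      proof -
        have "mv J x + mv Y x = mv B x + mv W (mv B x)"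
          using arg_cong[OF B(2), of "\<lambda>A. mv A x"]
          by (simp add: E_def mv.diff_left mv.add_left mv_mm algebra_simps)
        then show ?thesis by (simp add: z'_def mv.diff_right algebra_simps)
      qed
      ultimately show ?thesis by (metis entry_minus)
    qed
    ultimately show ?thesis by blast
  qed
  then show ?thesis using nW Wl B(1) by (intro exI[of _ W] exI[of _ B]) auto
qed

subsection \<open>Complex scalars acting on sequences\<close>

definition cmul :: "('i \<Rightarrow> complex) \<Rightarrow> ('i, 'h::complex_hilbert) ell2 \<Rightarrow> ('i, 'h) ell2" where
  "cmul c x = Ell2 (\<lambda>i. c i *\<^sub>C entry x i)"

lemma cmul_bounded:
  assumes "\<And>i. cmod (c i) \<le> K"
  shows "entry (cmul c x) i = c i *\<^sub>C entry x i" "norm (cmul c x) \<le> K * norm x"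
proof -
  have K: "K \<ge> 0" using assms[of undefined] norm_ge_zero[of "c undefined"] by linarith
  have "L2_set (\<lambda>i. norm (c i *\<^sub>C entry x i)) F \<le> K * norm x" if "finite F" for F
  proof -
    have "L2_set (\<lambda>i. norm (c i *\<^sub>C entry x i)) F \<le> L2_set (\<lambda>i. K * norm (entry x i)) F"
      using assms by (intro L2_set_mono) (auto simp: norm_scaleC intro: mult_right_mono)
    also have "\<dots> = K * L2_set (\<lambda>i. norm (entry x i)) F" using K by (simp add: L2_set_right_distrib)
    also have "\<dots> \<le> K * norm x" using K that by (intro mult_left_mono L2_set_entry_le_norm)
    finally show ?thesis .
  qed
  from Ell2_bounded[of "\<lambda>i. c i *\<^sub>C entry x i", OF this]
  show "entry (cmul c x) i = c i *\<^sub>C entry x i" "norm (cmul c x) \<le> K * norm x"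
    by (simp_all add: cmul_def)
qed

lemma bounded_linear_cmul:
  assumes "\<And>i. cmod (c i) \<le> K"
  shows "bounded_linear (cmul c :: ('i, 'h::complex_hilbert) ell2 \<Rightarrow> _)"
  by (rule bounded_linear_intro[of _ K], (rule ell2_eqI)?)
     (auto intro!: ell2_eqI simp: cmul_bounded[of c K, OF assms] entry_simps scaleC_add_right scaleC_scaleR mult.commute)

lemma entry_cmul_const: "entry (cmul (\<lambda>_. c) x) i = c *\<^sub>C entry x i"
  by (rule cmul_bounded(1)[of _ "cmod c"]) simp

lemma pairing_cmul:
  fixes r :: "'h::complex_hilbert row"
  assumes "mclinear r"
  shows "pairing blinfun_apply r (cmul (\<lambda>_. c) x) = c *\<^sub>C pairing blinfun_apply r x"
proof -
  have "pairing blinfun_apply r (cmul (\<lambda>_. c) x) = (\<Sum>\<^sub>\<infinity>i. c *\<^sub>C blinfun_apply (entry r i) (entry x i))"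
    unfolding pairing_def entry_cmul_const using assms by (simp add: mclinear_def clinear_def)
  also have "\<dots> = c *\<^sub>C pairing blinfun_apply r x"
    unfolding pairing_def by (rule infsum_linear[OF bounded_linear_scaleC app.summable])
  finally show ?thesis .
qed

lemma mclinear_mrow: "mclinear A \<Longrightarrow> mclinear (mrow A j)"
  by (simp add: mclinear_def entry_mrow)

lemma mv_cmul: "mclinear A \<Longrightarrow> mv A (cmul (\<lambda>_. c) x) = cmul (\<lambda>_. c) (mv A x)"
  by (rule ell2_eqI) (simp add: entry_mv entry_cmul_const pairing_cmul mclinear_mrow)

subsection \<open>Invariance of the domain\<close>

text \<open>The moduli of the eigenvalues of the resolvent of diag(n) at \<open>i t\<close>.\<close>

definition resolvent_weight :: "real \<Rightarrow> (int, real) ell2" where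
  "resolvent_weight t = Ell2 (\<lambda>n. 1 / cmod (of_int n - \<i> * of_real t))"

lemma cmod_shifted_squared: "(cmod (of_int n - \<i> * of_real t))\<^sup>2 = (real_of_int n)\<^sup>2 + t\<^sup>2"
  by (simp add: cmod_def)

text \<open>Dominated convergence for sums: each term tends to 0, and away from the index 0 the
  squares are dominated by \<open>1 / n\<^sup>2\<close>.\<close>

lemma resolvent_weight_small:
  assumes "e > 0"
  obtains t0 where "t0 > 0" "\<And>t. t \<ge> t0 \<Longrightarrow> norm (resolvent_weight t) \<le> e"
    "\<And>t n. t \<ge> t0 \<Longrightarrow> entry (resolvent_weight t) n = 1 / cmod (of_int n - \<i> * of_real t)"
proof -
  obtain F0 where F0: "finite F0" "\<And>F. finite F \<Longrightarrow> F \<inter> F0 = {} \<Longrightarrow> (\<Sum>n\<in>F. (1 / real_of_int n)\<^sup>2) \<le> e\<^sup>2 / 2"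
    using summable_tail[OF summable_inverse_squares_int, of "e\<^sup>2 / 2"] assms by auto
  define F1 where "F1 = insert 0 F0"
  define t0 where "t0 = sqrt (2 * real (card F1) / e\<^sup>2) + 1"
  have t0: "t0 > 0" unfolding t0_def by (intro add_nonneg_pos) auto
  have *: "L2_set (\<lambda>n. norm (1 / cmod (of_int n - \<i> * of_real t))) F \<le> e" if "t \<ge> t0" "finite F" for t F
  proof -
    have q: "(norm (1 / cmod (of_int n - \<i> * of_real t)))\<^sup>2 = 1 / ((real_of_int n)\<^sup>2 + t\<^sup>2)" for n
      using cmod_shifted_squared[of n t] by (simp add: power_divide)
    have t: "t > 0" using t0 that by linarith
    have "(\<Sum>n\<in>F - F1. 1 / ((real_of_int n)\<^sup>2 + t\<^sup>2)) \<le> (\<Sum>n\<in>F - F1. (1 / real_of_int n)\<^sup>2)"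
      by (intro sum_mono) (auto simp: F1_def power_divide intro!: divide_left_mono mult_pos_pos add_pos_nonneg)
    also have "\<dots> \<le> e\<^sup>2 / 2" using that by (intro F0) (auto simp: F1_def)
    finally have 1: "(\<Sum>n\<in>F - F1. 1 / ((real_of_int n)\<^sup>2 + t\<^sup>2)) \<le> e\<^sup>2 / 2" .
    have "(\<Sum>n\<in>F \<inter> F1. 1 / ((real_of_int n)\<^sup>2 + t\<^sup>2)) \<le> (\<Sum>n\<in>F \<inter> F1. 1 / t\<^sup>2)"
      using t by (intro sum_mono divide_left_mono) (auto intro!: mult_pos_pos add_nonneg_pos)
    also have "\<dots> \<le> real (card F1) / t\<^sup>2"
      using F0(1) by (simp add: F1_def divide_right_mono card_mono)
    also have "\<dots> \<le> e\<^sup>2 / 2"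
    proof -
      have "sqrt (2 * real (card F1) / e\<^sup>2) \<le> t" using that by (simp add: t0_def)
      then have "2 * real (card F1) / e\<^sup>2 \<le> t\<^sup>2" by (rule sqrt_le_D)
      then show ?thesis using t assms by (simp add: field_simps)
    qed
    finally have 2: "(\<Sum>n\<in>F \<inter> F1. 1 / ((real_of_int n)\<^sup>2 + t\<^sup>2)) \<le> e\<^sup>2 / 2" .
    have "(L2_set (\<lambda>n. norm (1 / cmod (of_int n - \<i> * of_real t))) F)\<^sup>2 =
        (\<Sum>n\<in>F - F1. 1 / ((real_of_int n)\<^sup>2 + t\<^sup>2)) + (\<Sum>n\<in>F \<inter> F1. 1 / ((real_of_int n)\<^sup>2 + t\<^sup>2))"
      unfolding L2_set_squared q using that(2) by (subst sum.union_disjoint[symmetric]) (auto intro: sum.cong)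
    also have "\<dots> \<le> e\<^sup>2" using 1 2 by linarith
    finally show ?thesis by (rule power2_le_imp_le) (use assms in simp)
  qed
  show ?thesis
  proof (rule that[OF t0])
    fix t assume "t \<ge> t0"
    note b = Ell2_bounded[of "\<lambda>n. 1 / cmod (of_int n - \<i> * of_real t)", OF *[OF this]]
    show "norm (resolvent_weight t) \<le> e" unfolding resolvent_weight_def by (rule b)
    show "entry (resolvent_weight t) n = 1 / cmod (of_int n - \<i> * of_real t)" for n
      unfolding resolvent_weight_def by (rule b)
  qed
qed

lemma scaleC_shifted: "(of_int n - \<mu>) *\<^sub>C x = real_of_int n *\<^sub>R x - \<mu> *\<^sub>C (x::'h::complex_hilbert)"
  using scaleC_of_real[of "real_of_int n" x] by (simp add: scaleC_minus_left)

text \<open>For \<open>e = (N - i t) d = v d\<close> the Cauchy-Schwarz inequality bounds the sum of the norms of the entries of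
  \<open>d\<close> by the norm of \<open>e\<close> times that of the resolvent weight, and the Hankel operator maps absolutely
  summable sequences boundedly to square-summable ones.\<close>

lemma shifted_injective:
  fixes v :: "'h::complex_hilbert row"
  assumes dz: "times_index d z"
    and w: "\<And>n. entry (resolvent_weight t) n = 1 / cmod (of_int n - \<i> * of_real t)"
    and small: "norm v * norm (resolvent_weight t) < 1" and t: "t > 0"
    and eq: "\<And>j. entry z j - hankel v d j = (\<i> * of_real t) *\<^sub>C entry d j"
  shows "d = 0"
proof -
  define e where "e = z - cmul (\<lambda>_. \<i> * of_real t) d"
  have e: "entry e n = (of_int n - \<i> * of_real t) *\<^sub>C entry d n" for n
    using dz by (simp add: e_def entry_simps entry_cmul_const times_index_def scaleC_shifted)
  have pos: "cmod (of_int n - \<i> * of_real t) > 0" for n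
  proof -
    have "(cmod (of_int n - \<i> * of_real t))\<^sup>2 > 0"
      unfolding cmod_shifted_squared using t by (intro add_nonneg_pos) auto
    then show ?thesis by simp
  qed
  have de: "norm (entry d n) = norm (entry (resolvent_weight t) n) * norm (entry e n)" for n
    using pos[of n] by (simp add: e w norm_scaleC)
  obtain y where y: "\<And>j. entry y j = hankel v d j" "norm y \<le> norm v * (\<Sum>\<^sub>\<infinity>n. norm (entry d n))"
    using hankel_in_ell2[OF dom_index_abs_summable[OF dz], of v] by blast
  have "y = e"
    using eq by (intro ell2_eqI) (simp add: y e_def entry_simps entry_cmul_const diff_eq_eq)
  have "(\<Sum>\<^sub>\<infinity>n. norm (entry d n)) \<le> norm (resolvent_weight t) * norm e"
    unfolding de by (rule infsum_product_le)
  then have "norm v * (\<Sum>\<^sub>\<infinity>n. norm (entry d n)) \<le> norm v * (norm (resolvent_weight t) * norm e)"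
    by (rule mult_left_mono) simp
  with y(2) have "norm e \<le> (norm v * norm (resolvent_weight t)) * norm e"
    unfolding \<open>y = e\<close> by (simp add: mult.assoc)
  then have "(1 - norm v * norm (resolvent_weight t)) * norm e \<le> 0" by (simp add: algebra_simps)
  then have "norm e = 0" using small by (simp add: mult_le_0_iff)
  then show "d = 0" by (intro ell2_eqI) (metis de entry_zero mult_zero_right norm_eq_zero)
qed

text \<open>The domain is preserved in both directions: for large imaginary \<open>\<mu>\<close> the resolvent equation
  of the diagonalised operator can be solved inside the domain, and the original operator minus
  \<open>\<mu>\<close> is injective there.\<close>

lemma domain_onto:
  fixes v :: "'h::complex_hilbert row" and W V0 :: "'h mat"
  assumes Wl: "mclinear W" and b: "bij (\<lambda>x. x + mv W x)"
    and tr: "\<And>x z. times_index x z \<Longrightarrow> \<exists>z'. times_index (x + mv W x) z' \<and>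
      (\<forall>j. entry z' j - hankel v (x + mv W x) j = entry (z - mv V0 x + mv W (z - mv V0 x)) j)"
    and y: "times_index y z'"
  shows "\<exists>x z. times_index x z \<and> y = x + mv W x"
proof -
  obtain t0 where t0: "t0 > 0" "\<And>t. t \<ge> t0 \<Longrightarrow> norm (resolvent_weight t) \<le> 1 / (2 * (norm v + 1))"
    "\<And>t n. t \<ge> t0 \<Longrightarrow> entry (resolvent_weight t) n = 1 / cmod (of_int n - \<i> * of_real t)"
    using resolvent_weight_small[of "1 / (2 * (norm v + 1))"] by (auto simp: add_nonneg_pos)
  \<comment> \<open>the resolvent of diag(n) at \<open>i t\<close> has norm at most \<open>1 / t\<close>, which makes \<open>R V0\<close> a contraction\<close>
  define t where "t = max t0 (2 * norm V0 + 1)"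
  have t: "t \<ge> t0" "t > 0" "t > 2 * norm V0" using t0(1) by (auto simp: t_def)
  have small: "norm v * norm (resolvent_weight t) < 1"
  proof -
    have "norm v * norm (resolvent_weight t) \<le> norm v * (1 / (2 * (norm v + 1)))"
      by (intro mult_left_mono t0 t) auto
    also have "\<dots> < 1"
    proof -
      have nv: "0 \<le> norm v" by simp
      have "norm v < 2 * (norm v + 1)" using nv by argo
      moreover have "0 < 2 * (norm v + 1)" using nv by argo
      ultimately
      show ?thesis by (simp only: times_divide_eq_right mult_1_right pos_divide_less_eq mult_1_left)
    qed
    finally show ?thesis .
  qed
  define \<mu> where "\<mu> = \<i> * complex_of_real t"
  have pos: "cmod (of_int n - \<mu>) \<ge> t" for n
    using t(2) cmod_shifted_squared[of n t] unfolding \<mu>_def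
    by (intro power2_le_imp_le[OF _ norm_ge_zero]) simp
  define R where "R = (cmul (\<lambda>n. 1 / (of_int n - \<mu>)) :: 'h vec2 \<Rightarrow> 'h vec2)"
  have Rb: "cmod (1 / (of_int n - \<mu>)) \<le> 1 / t" for n
    using pos[of n] t(2) by (simp add: norm_divide frac_le)
  have R: "entry (R x) n = (1 / (of_int n - \<mu>)) *\<^sub>C entry x n" "norm (R x) \<le> 1 / t * norm x" for x n
    unfolding R_def by (rule cmul_bounded[OF Rb])+
  interpret R: bounded_linear R unfolding R_def by (rule bounded_linear_cmul[OF Rb])
  obtain y1 where y1: "\<And>j. entry y1 j = hankel v y j"
    using hankel_in_ell2[OF dom_index_abs_summable[OF y], of v] by blast
  define f where "f = z' - y1 - cmul (\<lambda>_. \<mu>) y"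
  obtain g where g: "f = g + mv W g" using b unfolding bij_iff by metis
  have "bij (\<lambda>x. x + - R (mv V0 x))"
  proof (rule one_plus_contraction)
    show "bounded_linear (\<lambda>x. - R (mv V0 x))"
      by (intro bounded_linear_minus bounded_linear_compose[OF R.bounded_linear_axioms mv.bounded_linear_right])
    fix x
    have "norm (R (mv V0 x)) \<le> 1 / t * norm (mv V0 x)" by (rule R(2))
    also have "\<dots> \<le> 1 / t * (norm V0 * norm x)"
      using t(2) by (intro mult_left_mono norm_mv_le) auto
    finally show "norm (- R (mv V0 x)) \<le> (norm V0 / t) * norm x" by simp
    show "norm V0 / t < 1" 
    proof -
      have "0 \<le> norm V0" by simp
      then have "norm V0 < t" using t(3) by linarith
      then show ?thesis using t(2) by (simp add: divide_less_eq)
    qed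
  qed
  then obtain x where x: "x + - R (mv V0 x) = R g" unfolding bij_iff by metis
  have xR: "x = R (g + mv V0 x)" using x by (simp add: R.add diff_eq_eq)
  define z where "z = g + mv V0 x + cmul (\<lambda>_. \<mu>) x"
  have xz: "times_index x z"
    unfolding times_index_def
  proof
    fix n
    have nz: "of_int n - \<mu> \<noteq> 0" using pos[of n] t(2) by auto
    have "(of_int n - \<mu>) *\<^sub>C entry x n = entry (g + mv V0 x) n"
      using nz by (subst xR) (simp add: R(1) scaleC_scaleC)
    then show "entry z n = real_of_int n *\<^sub>R entry x n"
      by (simp add: z_def entry_simps entry_cmul_const scaleC_shifted diff_eq_eq)
  qed
  obtain z2 where z2: "times_index (x + mv W x) z2"
    "\<And>j. entry z2 j - hankel v (x + mv W x) j = entry (z - mv V0 x + mv W (z - mv V0 x)) j"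
    using tr[OF xz] by blast
  have "z - mv V0 x = g + cmul (\<lambda>_. \<mu>) x" by (simp add: z_def)
  then have "z - mv V0 x + mv W (z - mv V0 x) = f + (cmul (\<lambda>_. \<mu>) x + cmul (\<lambda>_. \<mu>) (mv W x))"
    by (simp add: g mv.add_right mv_cmul[OF Wl])
  then have e2: "entry z2 j - hankel v (x + mv W x) j = entry f j + \<mu> *\<^sub>C entry (x + mv W x) j" for j
    using z2(2) by (simp add: entry_simps entry_cmul_const scaleC_add_right)
  have "y - (x + mv W x) = 0"
  proof (rule shifted_injective[where t = t and v = v])
    show "times_index (y - (x + mv W x)) (z' - z2)"
      using y z2(1) unfolding times_index_def by (simp add: entry_simps scaleR_diff_right)
    show "entry (z' - z2) j - hankel v (y - (x + mv W x)) j = (\<i> * of_real t) *\<^sub>C entry (y - (x + mv W x)) j" for j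
    proof -
      have "entry f j = entry z' j - hankel v y j - \<mu> *\<^sub>C entry y j"
        by (simp add: f_def entry_simps y1 entry_cmul_const)
      then show ?thesis using e2[of j]
        unfolding \<mu>_def[symmetric] hankel_def app_pairing.diff_right entry_minus scaleC_minus_right
        by (simp add: algebra_simps)
    qed
  qed (use t small t0(3) in auto)
  then show ?thesis using xz by (intro exI[of _ x] exI[of _ z]) simp
qed

subsection \<open>The similarity transformation on sequences\<close>

text \<open>The first transformation replaces the Hankel operator by a square-summable matrix \<open>B\<close>, the second one
  makes \<open>B\<close> block diagonal. Both factors \<open>I + W1\<close> and \<open>I + W2\<close> are invertible because the norms of \<open>W1\<close>
  and \<open>W2\<close> are less than 1.\<close>

theorem sequence_similarity:
  fixes v :: "'h::complex_hilbert row"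
  assumes vl: "mclinear v"
    and hyp: "(\<lambda>(j, l). (norm (\<Sum>\<^sub>\<infinity>n\<in>UNIV - {l}.
          (1 / real_of_int (l - n)) *\<^sub>R (entry v (j + n) o\<^sub>L entry v (l + n))))\<^sup>2)
        summable_on (UNIV :: (int \<times> int) set)"
  obtains k W V0 K where "mclinear W" "mclinear V0" "bij (\<lambda>x. x + mv W x)"
    "\<And>j l. \<not> same_block k j l \<Longrightarrow> entry V0 (j, l) = 0"
    "\<And>x. norm x \<le> K * norm (x + mv W x)"
    "\<And>x z. times_index x z \<Longrightarrow> \<exists>z'. times_index (x + mv W x) z' \<and>
      (\<forall>j. entry z' j - hankel v (x + mv W x) j = entry (z - mv V0 x + mv W (z - mv V0 x)) j)"
    "\<And>y z'. times_index y z' \<Longrightarrow> \<exists>x z. times_index x z \<and> y = x + mv W x"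
proof -
  obtain W1 B where W1: "norm W1 < 1" "mclinear W1" and B: "mclinear B"
    and tr1: "\<And>x z. times_index x z \<Longrightarrow> (\<exists>z'. times_index (x + mv W1 x) z' \<and>
      (\<forall>j. entry z' j - hankel v (x + mv W1 x) j = entry (z - mv B x + mv W1 (z - mv B x)) j))"
    using first_transformation[OF assms] by blast
  obtain k W2 V0 where W2: "norm W2 < 1" "mclinear W2" and V0: "mclinear V0"
    "\<And>j l. \<not> same_block k j l \<Longrightarrow> entry V0 (j, l) = 0"
    and eq2: "\<And>j l. real_of_int (j - l) *\<^sub>R entry W2 (j, l) = entry (B + mm B W2 - mm W2 V0 - V0) (j, l)"
    using block_diagonalization[OF B] by metis
  have tr2: "\<exists>z'. times_index (x + mv W2 x) z' \<and> z' - mv B (x + mv W2 x) = z - mv V0 x + mv W2 (z - mv V0 x)"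
    if xz: "times_index x z" for x z
  proof -
    define X where "X = B + mm B W2 - mm W2 V0 - V0"
    have "real_of_int j *\<^sub>R entry (mv W2 x) j = entry (mv X x + mv W2 z) j" for j
    proof -
      have "entry (mrow X j) l = real_of_int (j - l) *\<^sub>R entry W2 (j, l)" for l
        by (simp only: eq2 X_def entry_mrow)
      from index_mult_mv[OF xz this] show ?thesis by (simp add: entry_simps entry_mv)
    qed
    then have "times_index (x + mv W2 x) (z + (mv X x + mv W2 z))"
      using xz unfolding times_index_def by (simp add: entry_plus scaleR_add_right)
    moreover have "z + (mv X x + mv W2 z) - mv B (x + mv W2 x) = z - mv V0 x + mv W2 (z - mv V0 x)"
      by (simp add: X_def mv.add_left mv.diff_left mv.add_right mv.diff_right mv_mm algebra_simps)
    ultimately show ?thesis by blast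
  qed
  define W where "W = W1 + W2 + mm W1 W2"
  have W: "x + mv W x = (x + mv W2 x) + mv W1 (x + mv W2 x)" for x
    by (simp add: W_def mv.add_left mv.add_right mv_mm)
  note c1 = one_plus_contraction[OF mv.bounded_linear_right norm_mv_le W1(1)]
  note c2 = one_plus_contraction[OF mv.bounded_linear_right norm_mv_le W2(1)]
  have bj: "bij (\<lambda>x. x + mv W x)"
    using bij_comp[OF c2(1) c1(1)] by (simp add: W o_def)
  have bd: "norm x \<le> (1 / ((1 - norm W1) * (1 - norm W2))) * norm (x + mv W x)" for x
  proof -
    have "norm x \<le> norm (x + mv W2 x) / (1 - norm W2)" by (rule c2(2))
    also have "\<dots> \<le> norm (x + mv W x) / (1 - norm W1) / (1 - norm W2)"
      unfolding W using W2(1) by (intro divide_right_mono c1(2)) auto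
    finally show ?thesis by simp
  qed
  have tr: "\<exists>z'. times_index (x + mv W x) z' \<and>
      (\<forall>j. entry z' j - hankel v (x + mv W x) j = entry (z - mv V0 x + mv W (z - mv V0 x)) j)"
    if xz: "times_index x z" for x z
  proof -
    obtain z2 where z2: "times_index (x + mv W2 x) z2"
      "z2 - mv B (x + mv W2 x) = z - mv V0 x + mv W2 (z - mv V0 x)" using tr2[OF xz] by blast
    show ?thesis using tr1[OF z2(1)] unfolding z2(2) W .
  qed
  have Wl: "mclinear W"
    unfolding W_def using W1 W2 by (intro mclinear_add mclinear_mm)
  show ?thesis
    by (rule that[OF Wl V0(1) bj V0(2) bd tr domain_onto[OF Wl bj tr]])
qed


section \<open>Integration of strongly measurable functions\<close>

lemma AE_interval_iff:
  "(AE s in lebesgue_on {a..b::real}. P s) \<longleftrightarrow> (\<exists>N. negligible N \<and> (\<forall>s\<in>{a..b} - N. P s))"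
  unfolding AE_restrict_space_iff[of "{a..b}" lebesgue, simplified] eventually_ae_filter_negligible
  by (intro iff_exI conj_cong) auto

lemma measurable_off_negligible:
  fixes f g :: "real \<Rightarrow> real"
  assumes f: "f \<in> borel_measurable (lebesgue_on {a..b})" and N: "negligible N"
    and eq: "\<And>s. s \<in> {a..b} - N \<Longrightarrow> f s = g s"
  shows "g \<in> borel_measurable (lebesgue_on {a..b})"
proof -
  have "(\<lambda>s. indicator {a..b} s *\<^sub>R f s) \<in> borel_measurable lebesgue"
    using f by (subst (asm) borel_measurable_restrict_space_iff) auto
  moreover have "AE s in lebesgue. indicator {a..b} s *\<^sub>R f s = indicator {a..b} s *\<^sub>R g s"
    unfolding eventually_ae_filter_negligible
    using N eq by (intro exI[of _ N]) (auto simp: indicator_def)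
  ultimately have "(\<lambda>s. indicator {a..b} s *\<^sub>R g s) \<in> borel_measurable lebesgue"
    by (rule borel_measurable_AE)
  then show ?thesis by (subst borel_measurable_restrict_space_iff) auto
qed

text \<open>Composition with simple functions is harmless for any \<open>g\<close>; continuity passes to the limit off a
  null set.\<close>

lemma strongly_measurable_comp_real:
  fixes g :: "'a::metric_space \<Rightarrow> real"
  assumes x: "strongly_measurable_on {a..b} x" and g: "continuous_on UNIV g"
  shows "(\<lambda>s. g (x s)) \<in> borel_measurable (lebesgue_on {a..b})"
proof -
  obtain f N where f: "\<And>i. simple_function (lebesgue_on {a..b}) (f i)"
    and N: "negligible N" "\<And>s. s \<in> {a..b} - N \<Longrightarrow> (\<lambda>i. f i s) \<longlonglongrightarrow> x s"
    using x unfolding strongly_measurable_on_def AE_interval_iff by blast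
  have Nm: "N \<inter> {a..b} \<in> sets (lebesgue_on {a..b})"
    using negligible_imp_sets[OF N(1)] by (auto simp: sets_restrict_space)
  have "(\<lambda>s. if s \<in> N then 0 else g (x s)) \<in> borel_measurable (lebesgue_on {a..b})"
  proof (rule borel_measurable_LIMSEQ_real)
    fix i
    have "(\<lambda>s. g (f i s)) \<in> borel_measurable (lebesgue_on {a..b})"
      using simple_function_compose[OF f[of i], of g] by (intro borel_measurable_simple_function) (simp add: o_def)
    then show "(\<lambda>s. if s \<in> N then 0 else g (f i s)) \<in> borel_measurable (lebesgue_on {a..b})"
      using Nm by (intro measurable_If) (auto simp: Int_def conj_commute)
  next
    fix s assume "s \<in> space (lebesgue_on {a..b})"
    then show "(\<lambda>i. if s \<in> N then 0 else g (f i s)) \<longlonglongrightarrow> (if s \<in> N then 0 else g (x s))"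
      using N(2)[of s] g by (auto intro!: continuous_on_tendsto_compose[OF g])
  qed
  then show ?thesis by (rule measurable_off_negligible[OF _ N(1)]) auto
qed

text \<open>All values of the approximating simple functions form a countable set.\<close>

lemma strongly_measurable_separable:
  fixes x :: "real \<Rightarrow> 'a::metric_space"
  assumes x: "strongly_measurable_on {a..b} x"
  obtains C where "countable C" "AE s in lebesgue_on {a..b}. x s \<in> closure C"
proof -
  obtain f where f: "\<And>i. simple_function (lebesgue_on {a..b}) (f i)"
    and lim: "AE s in lebesgue_on {a..b}. (\<lambda>i. f i s) \<longlonglongrightarrow> x s"
    using x unfolding strongly_measurable_on_def by blast
  define C where "C = (\<Union>i. f i ` {a..b})"
  have "finite (f i ` {a..b})" for i using f[of i] by (auto simp: simple_function_def)
  then have "countable C" unfolding C_def by (auto intro: countable_finite)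
  moreover have "AE s in lebesgue_on {a..b}. x s \<in> closure C"
    using lim
  proof (rule AE_mp, intro AE_I2 impI)
    fix s assume "s \<in> space (lebesgue_on {a..b})" "(\<lambda>i. f i s) \<longlonglongrightarrow> x s"
    moreover from this have "f i s \<in> C" for i unfolding C_def by (auto intro!: exI[of _ i])
    ultimately show "x s \<in> closure C"
      unfolding closure_sequential by (intro exI[of _ "\<lambda>i. f i s"]) auto
  qed
  ultimately show ?thesis by (rule that)
qed

text \<open>Nearest points among the first m members of a dense sequence; the first member \<open>d 0\<close> is
  always a competitor, which gives domination.\<close>

lemma simple_approximation:
  fixes x :: "real \<Rightarrow> 'a::metric_space" and d :: "nat \<Rightarrow> 'a"
  assumes m: "\<And>p. (\<lambda>s. dist (x s) (d p)) \<in> borel_measurable (lebesgue_on {a..b})"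
    and c: "AE s in lebesgue_on {a..b}. x s \<in> closure (range d)"
  shows "\<exists>g. (\<forall>m. simple_function (lebesgue_on {a..b}) (g m)) \<and>
    (\<forall>m s. dist (x s) (g m s) \<le> dist (x s) (d 0)) \<and>
    (AE s in lebesgue_on {a..b}. (\<lambda>m. g m s) \<longlonglongrightarrow> x s)"
proof -
  define near where "near m s p \<longleftrightarrow> p \<le> m \<and> (\<forall>q\<le>m. dist (x s) (d p) \<le> dist (x s) (d q))" for m :: nat and s p
  define idx where "idx m s = (LEAST p. near m s p)" for m s
  have ex: "\<exists>p. near m s p" for m s
  proof -
    let ?f = "\<lambda>p. dist (x s) (d p)"
    have "Min (?f ` {..m}) \<in> ?f ` {..m}" by (intro Min_in) auto
    then obtain p where p: "Min (?f ` {..m}) = ?f p" "p \<in> {..m}" by (rule imageE)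
    have "?f p \<le> ?f q" if "q \<le> m" for q unfolding p(1)[symmetric] using that by (intro Min_le) auto
    with p(2) show ?thesis by (auto simp: near_def)
  qed
  have idx: "near m s (idx m s)" for m s
    unfolding idx_def using ex[of m s] by (rule LeastI_ex)
  note [measurable] = m
  have im: "idx m \<in> measurable (lebesgue_on {a..b}) (count_space UNIV)" for m
    unfolding idx_def near_def by measurable
  have sf: "simple_function (lebesgue_on {a..b}) (idx m)" for m
    unfolding simple_function_def
  proof (intro conjI ballI)
    have "idx m ` space (lebesgue_on {a..b}) \<subseteq> {..m}" using idx[of m] by (auto simp: near_def)
    then show "finite (idx m ` space (lebesgue_on {a..b}))" by (rule finite_subset) simp
    show "idx m -` {v} \<inter> space (lebesgue_on {a..b}) \<in> sets (lebesgue_on {a..b})" for v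
      by (rule measurable_sets[OF im]) simp
  qed
  define g where "g m s = d (idx m s)" for m s
  show ?thesis
  proof (intro exI[of _ g] conjI allI)
    show "simple_function (lebesgue_on {a..b}) (g m)" for m
      using simple_function_compose[OF sf[of m], of d] by (simp add: g_def[abs_def] o_def)
    show "dist (x s) (g m s) \<le> dist (x s) (d 0)" for m s
      using idx[of m s] by (auto simp: near_def g_def)
    show "AE s in lebesgue_on {a..b}. (\<lambda>m. g m s) \<longlonglongrightarrow> x s"
      using c
    proof (rule AE_mp, intro AE_I2 impI)
      fix s assume s: "x s \<in> closure (range d)"
      show "(\<lambda>m. g m s) \<longlonglongrightarrow> x s"
      proof (rule metric_LIMSEQ_I)
        fix r :: real assume "r > 0"
        then obtain q where "dist (d q) (x s) < r" using s unfolding closure_approachable by auto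
        then have "dist (g m s) (x s) < r" if "m \<ge> q" for m
          using idx[of m s] that unfolding near_def g_def by (metis dist_commute le_less_trans)
        then show "\<exists>no. \<forall>n\<ge>no. dist (g n s) (x s) < r" by blast
      qed
    qed
  qed
qed

text \<open>Countably many essentially separable ranges have a common separable closure, which then contains
  almost all values of the limit.\<close>

lemma strongly_measurable_AE_limit:
  fixes x :: "real \<Rightarrow> 'a::metric_space"
  assumes X: "\<And>n::nat. strongly_measurable_on {a..b} (X n)"
    and lim: "AE s in lebesgue_on {a..b}. (\<lambda>n. X n s) \<longlonglongrightarrow> x s"
  shows "strongly_measurable_on {a..b} x"
proof -
  have "\<exists>C. countable C \<and> (AE s in lebesgue_on {a..b}. X n s \<in> closure C)" for n
    using strongly_measurable_separable[OF X[of n]] by blast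
  then obtain C where C: "\<And>n. countable (C n)" "\<And>n. AE s in lebesgue_on {a..b}. X n s \<in> closure (C n)"
    by metis
  define d where "d = from_nat_into (insert (x a) (\<Union>n. C n))"
  have d: "range d = insert (x a) (\<Union>n. C n)"
    unfolding d_def using C(1) by (intro range_from_nat_into countable_insert countable_UN) auto
  have "AE s in lebesgue_on {a..b}. \<forall>n. X n s \<in> closure (C n)"
    using C(2) by (subst AE_all_countable) auto
  then have cl: "AE s in lebesgue_on {a..b}. x s \<in> closure (range d)"
    using lim
  proof eventually_elim
    case (elim s)
    have "X n s \<in> closure (range d)" for n
      using elim(1) closure_mono[of "C n" "range d"] by (auto simp: d)
    then show ?case using elim(2) by (rule closed_sequentially[OF closed_closure])
  qed
  obtain N where N: "negligible N" "\<And>s. s \<in> {a..b} - N \<Longrightarrow> (\<lambda>n. X n s) \<longlonglongrightarrow> x s"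
    using lim unfolding AE_interval_iff by blast
  have Nm: "N \<inter> {a..b} \<in> sets (lebesgue_on {a..b})"
    using negligible_imp_sets[OF N(1)] by (auto simp: sets_restrict_space)
  have ms: "(\<lambda>s. dist (x s) (d p)) \<in> borel_measurable (lebesgue_on {a..b})" for p
  proof (rule measurable_off_negligible[OF _ N(1)])
    show "(\<lambda>s. if s \<in> N then 0 else dist (x s) (d p)) \<in> borel_measurable (lebesgue_on {a..b})"
    proof (rule borel_measurable_LIMSEQ_real)
      fix i
      have "(\<lambda>s. dist (X i s) (d p)) \<in> borel_measurable (lebesgue_on {a..b})"
        by (intro strongly_measurable_comp_real[OF X] continuous_intros)
      then show "(\<lambda>s. if s \<in> N then 0 else dist (X i s) (d p)) \<in> borel_measurable (lebesgue_on {a..b})"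
        using Nm by (intro measurable_If) (auto simp: Int_def conj_commute)
    next
      fix s assume "s \<in> space (lebesgue_on {a..b})"
      then show "(\<lambda>i. if s \<in> N then 0 else dist (X i s) (d p)) \<longlonglongrightarrow> (if s \<in> N then 0 else dist (x s) (d p))"
        using N(2)[of s] by (auto intro!: tendsto_intros)
    qed
  qed auto
  obtain g where "\<And>m. simple_function (lebesgue_on {a..b}) (g m)"
    "\<And>m s. dist (x s) (g m s) \<le> dist (x s) (d 0)"
    "AE s in lebesgue_on {a..b}. (\<lambda>m. g m s) \<longlonglongrightarrow> x s"
    using simple_approximation[OF ms cl] by auto
  then show ?thesis unfolding strongly_measurable_on_def by blast
qed

lemma strongly_measurable_comp2:
  fixes g :: "'a::metric_space \<Rightarrow> 'b::metric_space \<Rightarrow> 'c::metric_space"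
  assumes x: "strongly_measurable_on {a..b} x" and y: "strongly_measurable_on {a..b} y"
    and g: "continuous_on UNIV (\<lambda>(u, v). g u v)"
  shows "strongly_measurable_on {a..b} (\<lambda>s. g (x s) (y s))"
proof -
  obtain f f' where f: "\<And>i. simple_function (lebesgue_on {a..b}) (f i)"
    "AE s in lebesgue_on {a..b}. (\<lambda>i. f i s) \<longlonglongrightarrow> x s"
    and f': "\<And>i. simple_function (lebesgue_on {a..b}) (f' i)"
    "AE s in lebesgue_on {a..b}. (\<lambda>i. f' i s) \<longlonglongrightarrow> y s"
    using x y unfolding strongly_measurable_on_def by blast
  have "AE s in lebesgue_on {a..b}. (\<lambda>i. g (f i s) (f' i s)) \<longlonglongrightarrow> g (x s) (y s)"
    using f(2) f'(2)
  proof eventually_elim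
    case (elim s)
    from continuous_on_tendsto_compose[OF g tendsto_Pair[OF elim]] show ?case by simp
  qed
  moreover have "simple_function (lebesgue_on {a..b}) (\<lambda>s. g (f i s) (f' i s))" for i
    by (rule simple_function_compose2[OF f(1) f'(1)])
  ultimately show ?thesis unfolding strongly_measurable_on_def
    by (intro exI[of _ "\<lambda>i s. g (f i s) (f' i s)"] conjI allI)
qed

lemma strongly_measurable_const: "strongly_measurable_on {a..b} (\<lambda>s. c)"
  unfolding strongly_measurable_on_def by (intro exI[of _ "\<lambda>_ _. c"]) auto

lemma strongly_measurable_measurable:
  fixes f :: "real \<Rightarrow> 'a::{metric_space, second_countable_topology}"
  assumes "f \<in> borel_measurable (lebesgue_on {a..b})"
  shows "strongly_measurable_on {a..b} f"
proof -
  obtain F where "\<And>i. simple_function (lebesgue_on {a..b}) (F i)"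
    "\<And>x. x \<in> space (lebesgue_on {a..b}) \<Longrightarrow> (\<lambda>i. F i x) \<longlonglongrightarrow> f x"
    using borel_measurable_implies_sequence_metric[OF assms] by metis
  then show ?thesis unfolding strongly_measurable_on_def by (intro exI[of _ F]) auto
qed

lemma strongly_measurable_continuous:
  fixes f :: "real \<Rightarrow> 'a::{metric_space, second_countable_topology}"
  assumes "continuous_on UNIV f"
  shows "strongly_measurable_on {a..b} f"
  using borel_measurable_continuous_onI[OF assms]
  by (intro strongly_measurable_measurable measurable_restrict_space1 measurable_completion) simp

lemma strongly_measurable_plus:
  fixes x y :: "real \<Rightarrow> 'a::real_normed_vector"
  shows "strongly_measurable_on {a..b} x \<Longrightarrow> strongly_measurable_on {a..b} y \<Longrightarrow>
    strongly_measurable_on {a..b} (\<lambda>s. x s + y s)"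
  by (rule strongly_measurable_comp2) (auto intro!: continuous_intros simp: case_prod_unfold)

lemma continuous_on_scaleC_pair: "continuous_on UNIV (\<lambda>(c, x::'h::complex_hilbert). c *\<^sub>C x)"
proof -
  have "bounded_bilinear (\<lambda>c (x::'h). c *\<^sub>C x)"
  proof
    show "\<exists>K. \<forall>a b. norm (a *\<^sub>C (b::'h)) \<le> norm a * norm b * K"
      by (intro exI[of _ 1]) (simp add: norm_scaleC)
    show "(r *\<^sub>R a) *\<^sub>C b = r *\<^sub>R (a *\<^sub>C b)" for r a and b :: 'h
      by (metis scaleC_of_real scaleC_scaleC scaleR_conv_of_real)
  qed (auto simp: scaleC_add_left scaleC_add_right scaleC_scaleR)
  from bounded_bilinear.continuous_on[OF this continuous_on_fst[OF continuous_on_id] continuous_on_snd[OF continuous_on_id]]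
  have "continuous_on UNIV (\<lambda>p :: complex \<times> 'h. fst p *\<^sub>C snd p)" .
  then show ?thesis by (simp add: case_prod_unfold)
qed

lemmas strongly_measurable_scaleC = strongly_measurable_comp2[OF _ _ continuous_on_scaleC_pair]

subsection \<open>Existence of the integral\<close>

lemma simple_function_integrable_on:
  fixes g :: "real \<Rightarrow> 'a::banach"
  assumes g: "simple_function (lebesgue_on {a..b}) g"
  shows "g integrable_on {a..b}"
proof -
  have fin: "finite (g ` {a..b})" using g by (auto simp: simple_function_def)
  have "(\<lambda>s. \<Sum>v\<in>g ` {a..b}. indicator (g -` {v} \<inter> {a..b}) s *\<^sub>R v) integrable_on {a..b}"
  proof (rule integrable_sum[OF fin])
    fix v assume "v \<in> g ` {a..b}"
    then have "g -` {v} \<inter> {a..b} \<in> sets (lebesgue_on {a..b})" using g by (auto simp: simple_function_def)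
    then have "g -` {v} \<inter> {a..b} \<in> sets lebesgue" by (simp add: sets_restrict_space_iff)
    moreover have "bounded (g -` {v} \<inter> {a..b})"
      by (rule bounded_subset[OF bounded_closed_interval[of a b]]) auto
    ultimately have "g -` {v} \<inter> {a..b} \<in> lmeasurable"
      by (intro bounded_set_imp_lmeasurable)
    then have "g -` {v} \<inter> {a..b} \<inter> {a..b} \<in> lmeasurable" by (simp only: Int_assoc Int_absorb)
    then have "indicat_real (g -` {v} \<inter> {a..b}) integrable_on {a..b}"
      by (simp add: integrable_on_indicator)
    from integrable_linear[OF this bounded_linear_scaleR_left[of v]]
    show "(\<lambda>s. indicator (g -` {v} \<inter> {a..b}) s *\<^sub>R v) integrable_on {a..b}" by (simp add: o_def)
  qed
  then show ?thesis
  proof (rule integrable_eq)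
    fix s assume s: "s \<in> {a..b}"
    have "(\<Sum>v\<in>g ` {a..b}. indicator (g -` {v} \<inter> {a..b}) s *\<^sub>R v) = (\<Sum>v\<in>{g s}. indicator (g -` {v} \<inter> {a..b}) s *\<^sub>R v)"
      using fin s by (intro sum.mono_neutral_right) (auto simp: indicator_def)
    also have "\<dots> = g s" using s by (simp add: indicator_def)
    finally show "(\<Sum>v\<in>g ` {a..b}. indicator (g -` {v} \<inter> {a..b}) s *\<^sub>R v) = g s" .
  qed
qed

text \<open>A function that is close in mean to integrable functions is integrable: Riemann sums over a
  fine division differ from those of the approximant by at most a Riemann sum of the error bound.\<close>

lemma integrable_on_approximable:
  fixes x :: "real \<Rightarrow> 'a::banach"
  assumes "\<And>e. e > 0 \<Longrightarrow> \<exists>g h. g integrable_on {a..b} \<and> h integrable_on {a..b} \<and>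
    (\<forall>s\<in>{a..b}. norm (x s - g s) \<le> h s) \<and> integral {a..b} h \<le> e"
  shows "x integrable_on {a..b}"
proof -
  have "x integrable_on cbox a b"
    unfolding integrable_Cauchy
  proof (intro allI impI)
    fix e :: real assume "e > 0"
    then obtain g h where g: "g integrable_on cbox a b" and h: "h integrable_on cbox a b"
      and gh: "\<And>s. s \<in> {a..b} \<Longrightarrow> norm (x s - g s) \<le> h s" and ih: "integral (cbox a b) h \<le> e/8"
      using assms[of "e/8"] by (auto simp: cbox_interval)
    obtain \<gamma>1 where \<gamma>1: "gauge \<gamma>1" "\<And>D1 D2. D1 tagged_division_of (cbox a b) \<and> \<gamma>1 fine D1 \<and>
        D2 tagged_division_of (cbox a b) \<and> \<gamma>1 fine D2 \<Longrightarrow>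
        norm ((\<Sum>(x,K)\<in>D1. measure lborel K *\<^sub>R g x) - (\<Sum>(x,K)\<in>D2. measure lborel K *\<^sub>R g x)) < e/8"
      using g[unfolded integrable_Cauchy] \<open>e > 0\<close> by (metis divide_pos_pos zero_less_numeral)
    obtain \<gamma>2 where \<gamma>2: "gauge \<gamma>2" "\<And>D. D tagged_division_of (cbox a b) \<and> \<gamma>2 fine D \<Longrightarrow>
        norm ((\<Sum>(x,K)\<in>D. measure lborel K *\<^sub>R h x) - integral (cbox a b) h) < e/8"
      using integrable_integral[OF h, unfolded has_integral] \<open>e > 0\<close> by (metis divide_pos_pos zero_less_numeral)
    have close: "norm ((\<Sum>(s,K)\<in>D. measure lborel K *\<^sub>R x s) - (\<Sum>(s,K)\<in>D. measure lborel K *\<^sub>R g s)) \<le> e/4"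
      if D: "D tagged_division_of (cbox a b)" "\<gamma>2 fine D" for D
    proof -
      have "norm ((\<Sum>(s,K)\<in>D. measure lborel K *\<^sub>R x s) - (\<Sum>(s,K)\<in>D. measure lborel K *\<^sub>R g s))
          = norm (\<Sum>(s,K)\<in>D. measure lborel K *\<^sub>R (x s - g s))"
        by (simp add: sum_subtractf[symmetric] case_prod_unfold scaleR_diff_right)
      also have "\<dots> \<le> (\<Sum>(s,K)\<in>D. measure lborel K *\<^sub>R h s)"
      proof (rule sum_norm_le, clarify)
        fix s K assume "(s, K) \<in> D"
        then have "s \<in> {a..b}" using tag_in_interval[OF D(1)] by (simp add: cbox_interval)
        then show "norm (measure lborel K *\<^sub>R (x s - g s)) \<le> measure lborel K *\<^sub>R h s"
          using gh by (simp add: mult_left_mono)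
      qed
      also have "\<dots> \<le> e/4" using \<gamma>2(2)[OF conjI[OF D]] ih unfolding real_norm_def by linarith
      finally show ?thesis .
    qed
    show "\<exists>\<gamma>. gauge \<gamma> \<and> (\<forall>D1 D2. D1 tagged_division_of (cbox a b) \<and> \<gamma> fine D1 \<and>
        D2 tagged_division_of (cbox a b) \<and> \<gamma> fine D2 \<longrightarrow>
        norm ((\<Sum>(x',K)\<in>D1. measure lborel K *\<^sub>R x x') - (\<Sum>(x',K)\<in>D2. measure lborel K *\<^sub>R x x')) < e)"
    proof (intro exI[of _ "\<lambda>s. \<gamma>1 s \<inter> \<gamma>2 s"] conjI allI impI gauge_Int \<gamma>1(1) \<gamma>2(1))
      fix D1 D2
      assume D: "D1 tagged_division_of (cbox a b) \<and> (\<lambda>s. \<gamma>1 s \<inter> \<gamma>2 s) fine D1 \<and>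
        D2 tagged_division_of (cbox a b) \<and> (\<lambda>s. \<gamma>1 s \<inter> \<gamma>2 s) fine D2"
      then have g12: "norm ((\<Sum>(s,K)\<in>D1. measure lborel K *\<^sub>R g s) - (\<Sum>(s,K)\<in>D2. measure lborel K *\<^sub>R g s)) < e/8"
        by (intro \<gamma>1(2)) (auto simp: fine_Int)
      have "norm (u - w) < e" if "norm (u - u') \<le> e/4" "norm (w - w') \<le> e/4" "norm (u' - w') < e/8" for u w u' w' :: 'a
      proof -
        have "u - w = (u - u') - (w - w') + (u' - w')" by simp
        then have "norm (u - w) \<le> norm (u - u') + norm (w - w') + norm (u' - w')"
          by (metis (no_types, lifting) add_right_mono norm_triangle_ineq norm_triangle_ineq4 order_trans)
        then show ?thesis using that \<open>e > 0\<close> by linarith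
      qed
      from this[OF close[of D1] close[of D2] g12] D
      show "norm ((\<Sum>(x',K)\<in>D1. measure lborel K *\<^sub>R x x') - (\<Sum>(x',K)\<in>D2. measure lborel K *\<^sub>R x x')) < e"
        unfolding fine_Int by blast
    qed
  qed
  then show ?thesis by (simp add: cbox_interval)
qed

lemma dominated_convergence_AE:
  fixes f :: "nat \<Rightarrow> real \<Rightarrow> real"
  assumes f: "\<And>k. f k integrable_on {a..b}" and h: "h integrable_on {a..b}"
    and le: "\<And>k s. s \<in> {a..b} \<Longrightarrow> \<bar>f k s\<bar> \<le> h s"
    and conv: "AE s in lebesgue_on {a..b}. (\<lambda>k. f k s) \<longlonglongrightarrow> g s"
  shows "g integrable_on {a..b}" "(\<lambda>k. integral {a..b} (f k)) \<longlonglongrightarrow> integral {a..b} g"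
proof -
  obtain N where N: "negligible N" "\<And>s. s \<in> {a..b} - N \<Longrightarrow> (\<lambda>k. f k s) \<longlonglongrightarrow> g s"
    using conv unfolding AE_interval_iff by blast
  let ?f = "\<lambda>k s. if s \<in> N then 0 else f k s" and ?g = "\<lambda>s. if s \<in> N then 0 else g s"
  have f': "?f k integrable_on {a..b}" for k
    by (rule integrable_spike[OF f[of k] N(1)]) auto
  have h0: "\<bar>?f k s\<bar> \<le> h s" if "s \<in> {a..b}" for k s
    using le[OF that, of k] by auto
  note D = dominated_convergence[of ?f "{a..b}" h ?g, OF f' h]
  have gi: "?g integrable_on {a..b}" and lim: "(\<lambda>k. integral {a..b} (?f k)) \<longlonglongrightarrow> integral {a..b} ?g"
    using D h0 N(2) by auto
  show "g integrable_on {a..b}" by (rule integrable_spike[OF gi N(1)]) auto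
  have "integral {a..b} (?f k) = integral {a..b} (f k)" for k by (rule integral_spike[OF N(1)]) auto
  moreover have "integral {a..b} ?g = integral {a..b} g" by (rule integral_spike[OF N(1)]) auto
  ultimately show "(\<lambda>k. integral {a..b} (f k)) \<longlonglongrightarrow> integral {a..b} g" using lim by simp
qed

text \<open>Taking 0 as the first approximating value bounds the approximation errors by \<open>norm (x s)\<close>, and
  dominated convergence makes them small in mean.\<close>

lemma strongly_measurable_integrable:
  fixes x :: "real \<Rightarrow> 'a::banach"
  assumes x: "strongly_measurable_on {a..b} x" and h: "h integrable_on {a..b}"
    and le: "\<And>s. s \<in> {a..b} \<Longrightarrow> norm (x s) \<le> h s"
  shows "x integrable_on {a..b}" "(\<lambda>s. norm (x s)) integrable_on {a..b}"
proof -
  have S: "{a..b} \<in> sets lebesgue" by simp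
  have "(\<lambda>s. norm (x s)) \<in> borel_measurable (lebesgue_on {a..b})"
    by (intro strongly_measurable_comp_real[OF x] continuous_intros)
  then show nx: "(\<lambda>s. norm (x s)) integrable_on {a..b}"
    using le by (intro measurable_bounded_by_integrable_imp_integrable_real[OF _ h _ S]) auto
  obtain C where C: "countable C" "AE s in lebesgue_on {a..b}. x s \<in> closure C"
    using strongly_measurable_separable[OF x] .
  \<comment> \<open>the first value 0 bounds the error of the approximation by \<open>norm (x s)\<close>\<close>
  define d where "d = case_nat 0 (from_nat_into (insert 0 C))"
  have "C \<subseteq> range d"
  proof
    fix c assume "c \<in> C"
    then obtain n where "c = from_nat_into (insert 0 C) n"
      using C(1) by (metis countable_insert from_nat_into_surj insertI2)
    then have "c = d (Suc n)" by (simp add: d_def)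
    then show "c \<in> range d" by blast
  qed
  have cl: "AE s in lebesgue_on {a..b}. x s \<in> closure (range d)"
    using C(2) closure_mono[OF \<open>C \<subseteq> range d\<close>] by (auto elim: eventually_mono)
  have ms: "(\<lambda>s. dist (x s) (d p)) \<in> borel_measurable (lebesgue_on {a..b})" for p
    by (intro strongly_measurable_comp_real[OF x] continuous_intros)
  obtain g where g: "\<And>m. simple_function (lebesgue_on {a..b}) (g m)"
    "\<And>m s. dist (x s) (g m s) \<le> dist (x s) (d 0)"
    "AE s in lebesgue_on {a..b}. (\<lambda>m. g m s) \<longlonglongrightarrow> x s"
    using simple_approximation[OF ms cl] by auto
  have gm: "norm (x s - g m s) \<le> norm (x s)" for m s
    using g(2)[of s m] by (simp add: d_def dist_norm)
  have sg: "strongly_measurable_on {a..b} (g m)" for m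
    unfolding strongly_measurable_on_def by (intro exI[of _ "\<lambda>_. g m"]) (auto simp: g(1))
  have "strongly_measurable_on {a..b} (\<lambda>s. x s - g m s)" for m
    by (rule strongly_measurable_comp2[OF x sg]) (auto intro!: continuous_intros simp: case_prod_unfold)
  from strongly_measurable_comp_real[OF this, of norm]
  have di: "(\<lambda>s. norm (x s - g m s)) integrable_on {a..b}" for m
    using gm by (intro measurable_bounded_by_integrable_imp_integrable_real[OF _ nx _ S]) (auto intro: continuous_intros)
  have "(\<lambda>m. integral {a..b} (\<lambda>s. norm (x s - g m s))) \<longlonglongrightarrow> integral {a..b} (\<lambda>s. 0)"
  proof (rule dominated_convergence_AE[OF di nx])
    show "AE s in lebesgue_on {a..b}. (\<lambda>m. norm (x s - g m s)) \<longlonglongrightarrow> 0"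
      using g(3)
    proof eventually_elim
      case (elim s)
      then have "(\<lambda>m. norm (x s - g m s)) \<longlonglongrightarrow> norm (x s - x s)" by (intro tendsto_intros)
      then show ?case by simp
    qed
  qed (simp add: gm)
  then have lim: "(\<lambda>m. integral {a..b} (\<lambda>s. norm (x s - g m s))) \<longlonglongrightarrow> 0" by simp
  show "x integrable_on {a..b}"
  proof (rule integrable_on_approximable)
    fix e :: real assume "e > 0"
    with lim obtain m where "norm (integral {a..b} (\<lambda>s. norm (x s - g m s))) < e"
      using LIMSEQ_D[of _ 0 e] by (metis diff_zero order_refl)
    then show "\<exists>g h. g integrable_on {a..b} \<and> h integrable_on {a..b} \<and>
        (\<forall>s\<in>{a..b}. norm (x s - g s) \<le> h s) \<and> integral {a..b} h \<le> e"
      using di[of m] simple_function_integrable_on[OF g(1)[of m]]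
      by (intro exI[of _ "g m"] exI[of _ "\<lambda>s. norm (x s - g m s)"]) auto
  qed
qed


section \<open>The space of square-integrable functions\<close>

abbreviation sq :: "real \<Rightarrow> (real \<Rightarrow> 'h::complex_hilbert) \<Rightarrow> real" where
  "sq \<omega> x \<equiv> integral {0..\<omega>} (\<lambda>s. (norm (x s))\<^sup>2)"

lemma interval_lebesgue: "{a..b::real} \<in> sets lebesgue"
  by simp

lemma L2_space_dominated:
  assumes x: "strongly_measurable_on {0..\<omega>} x" and h: "h integrable_on {0..\<omega>}"
    and le: "\<And>s. s \<in> {0..\<omega>} \<Longrightarrow> (norm (x s))\<^sup>2 \<le> h s"
  shows "x \<in> L2_space \<omega>"
proof -
  have "(\<lambda>s. (norm (x s))\<^sup>2) \<in> borel_measurable (lebesgue_on {0..\<omega>})"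
    by (rule strongly_measurable_comp_real[OF x]) (intro continuous_intros)
  then have "(\<lambda>s. (norm (x s))\<^sup>2) integrable_on {0..\<omega>}"
    by (rule measurable_bounded_by_integrable_imp_integrable_real[OF _ h _ interval_lebesgue]) (use le in auto)
  with x show ?thesis by (simp add: L2_space_def)
qed

lemma L2_space_strongly_measurable: "x \<in> L2_space \<omega> \<Longrightarrow> strongly_measurable_on {0..\<omega>} x"
  and L2_space_sq_integrable: "x \<in> L2_space \<omega> \<Longrightarrow> (\<lambda>s. (norm (x s))\<^sup>2) integrable_on {0..\<omega>}"
  by (auto simp: L2_space_def)

lemma norm_le_one_plus_square: "norm x \<le> 1 + (norm x)\<^sup>2"
proof -
  have "0 \<le> (norm x - 1)\<^sup>2 + 1 + (norm x)\<^sup>2" by simp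
  then have "2 * norm x \<le> 2 + 2 * (norm x)\<^sup>2" by (simp add: power2_diff)
  then show ?thesis by simp
qed

lemma L2_space_integrable:
  assumes "x \<in> L2_space \<omega>"
  shows "x integrable_on {0..\<omega>}" "(\<lambda>s. norm (x s)) integrable_on {0..\<omega>}"
proof -
  have "(\<lambda>s. 1 + (norm (x s))\<^sup>2) integrable_on {0..\<omega>}"
    by (rule integrable_add[OF integrable_const_ivl L2_space_sq_integrable[OF assms]])
  note * = strongly_measurable_integrable[OF L2_space_strongly_measurable[OF assms] this norm_le_one_plus_square]
  show "x integrable_on {0..\<omega>}" "(\<lambda>s. norm (x s)) integrable_on {0..\<omega>}" by (rule *)+
qed

lemma norm_add_squared_le: "(norm (x + y))\<^sup>2 \<le> 2 * (norm x)\<^sup>2 + 2 * (norm y)\<^sup>2"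
proof -
  have "(norm (x + y))\<^sup>2 \<le> (norm x + norm y)\<^sup>2" by (intro power_mono norm_triangle_ineq) auto
  also have "\<dots> \<le> (norm x + norm y)\<^sup>2 + (norm x - norm y)\<^sup>2" by simp
  also have "\<dots> = 2 * (norm x)\<^sup>2 + 2 * (norm y)\<^sup>2" by (simp add: power2_sum power2_diff)
  finally show ?thesis .
qed

lemma L2_space_add:
  assumes "x \<in> L2_space \<omega>" "y \<in> L2_space \<omega>"
  shows "(\<lambda>s. x s + y s) \<in> L2_space \<omega>"
proof (rule L2_space_dominated)
  show "strongly_measurable_on {0..\<omega>} (\<lambda>s. x s + y s)"
    using assms by (intro strongly_measurable_plus L2_space_strongly_measurable)
  show "(\<lambda>s. 2 * (norm (x s))\<^sup>2 + 2 * (norm (y s))\<^sup>2) integrable_on {0..\<omega>}"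
    by (intro integrable_add integrable_on_mult_right L2_space_sq_integrable assms)
qed (rule norm_add_squared_le)

lemma L2_space_mult:
  assumes x: "x \<in> L2_space \<omega>" and c: "continuous_on UNIV c" "\<And>s. cmod (c s) \<le> K"
  shows "(\<lambda>s. c s *\<^sub>C x s) \<in> L2_space \<omega>"
proof (rule L2_space_dominated)
  show "strongly_measurable_on {0..\<omega>} (\<lambda>s. c s *\<^sub>C x s)"
    by (intro strongly_measurable_scaleC strongly_measurable_continuous c L2_space_strongly_measurable x)
  show "(\<lambda>s. K\<^sup>2 * (norm (x s))\<^sup>2) integrable_on {0..\<omega>}"
    by (intro integrable_on_mult_right L2_space_sq_integrable x)
  show "(norm (c s *\<^sub>C x s))\<^sup>2 \<le> K\<^sup>2 * (norm (x s))\<^sup>2" for s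
    using c(2)[of s] by (simp add: norm_scaleC power_mult_distrib mult_right_mono power_mono)
qed

lemma L2_space_scaleC: "x \<in> L2_space \<omega> \<Longrightarrow> (\<lambda>s. c *\<^sub>C x s) \<in> L2_space \<omega>"
  by (rule L2_space_mult[where K = "cmod c"]) auto

lemma L2_space_minus:
  assumes "x \<in> L2_space \<omega>" "y \<in> L2_space \<omega>"
  shows "(\<lambda>s. x s - y s) \<in> L2_space \<omega>"
proof -
  have "(-1) *\<^sub>C y s = - y s" for s
    using scaleC_of_real[of "-1" "y s"] by simp
  then show ?thesis using L2_space_add[OF assms(1) L2_space_scaleC[OF assms(2), of "-1"]] by simp
qed

lemma L2_space_const: "(\<lambda>s. c) \<in> L2_space \<omega>"
  unfolding L2_space_def by (simp add: strongly_measurable_const integrable_const_ivl)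

lemma L2_space_sum: "(\<And>i. i \<in> F \<Longrightarrow> f i \<in> L2_space \<omega>) \<Longrightarrow> (\<lambda>s. \<Sum>i\<in>F. f i s) \<in> L2_space \<omega>"
  by (induction F rule: infinite_finite_induct) (auto simp: L2_space_const L2_space_add)

lemma L2_eq_integral:
  assumes "L2_eq \<omega> x y" "\<And>s. f s (x s) = g s" "\<And>s. f s (y s) = h s"
  shows "integral {0..\<omega>} g = integral {0..\<omega>} h"
proof -
  obtain N where N: "negligible N" "\<And>s. s \<in> {0..\<omega>} - N \<Longrightarrow> x s = y s"
    using assms(1) unfolding L2_eq_def AE_interval_iff by blast
  show ?thesis
  proof (rule integral_spike[OF N(1)])
    fix s assume "s \<in> {0..\<omega>} - N"
    then show "h s = g s" using N(2)[of s] assms(2)[of s] assms(3)[of s] by simp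
  qed
qed

lemma L2_eq_sym: "L2_eq \<omega> x y \<Longrightarrow> L2_eq \<omega> y x"
  unfolding L2_eq_def by (auto elim: eventually_mono)

lemma nn_integral_interval:
  fixes f :: "real \<Rightarrow> real"
  assumes f: "f integrable_on {a..b}" "\<And>s. f s \<ge> 0"
  shows "f \<in> borel_measurable (lebesgue_on {a..b})"
    "(\<integral>\<^sup>+s. ennreal (f s) \<partial>lebesgue_on {a..b}) = ennreal (integral {a..b} f)"
proof -
  have "f absolutely_integrable_on {a..b}" using f by (intro nonnegative_absolutely_integrable_1) auto
  then have i: "integrable (lebesgue_on {a..b}) f"
    by (simp add: set_integrable_def integrable_restrict_space)
  then show "f \<in> borel_measurable (lebesgue_on {a..b})" by (rule borel_measurable_integrable)
  show "(\<integral>\<^sup>+s. ennreal (f s) \<partial>lebesgue_on {a..b}) = ennreal (integral {a..b} f)"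
    using nn_integral_eq_integral[OF i] f(2) lebesgue_integral_eq_integral[OF i interval_lebesgue] by simp
qed

lemma nn_integral_interval_bounded:
  fixes f :: "real \<Rightarrow> real"
  assumes f: "f \<in> borel_measurable (lebesgue_on {a..b})" "\<And>s. f s \<ge> 0"
    and C: "(\<integral>\<^sup>+s. ennreal (f s) \<partial>lebesgue_on {a..b}) \<le> ennreal C" "C \<ge> 0"
  shows "f integrable_on {a..b}" "integral {a..b} f \<le> C"
proof -
  have fin: "(\<integral>\<^sup>+s. ennreal (norm (f s)) \<partial>lebesgue_on {a..b}) < \<infinity>"
    using C(1) f(2) by (simp add: le_less_trans[OF C(1)])
  then have "integrable (lebesgue_on {a..b}) f" using f(1) by (simp add: integrable_iff_bounded)
  then show i: "f integrable_on {a..b}" by (rule integrable_on_lebesgue_on[OF _ interval_lebesgue])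
  have "ennreal (integral {a..b} f) \<le> ennreal C"
    using nn_integral_interval(2)[OF i f(2)] C(1) by simp
  then show "integral {a..b} f \<le> C" using C(2) by (simp add: ennreal_le_iff)
qed

lemma sq_nonneg: "sq \<omega> x \<ge> 0"
  by (cases "(\<lambda>s. (norm (x s))\<^sup>2) integrable_on {0..\<omega>}")
     (auto intro: integral_nonneg simp: not_integrable_integral)

text \<open>Fatou's lemma: norm bounds are inherited by almost everywhere limits.\<close>

lemma L2_space_AE_limit:
  assumes X: "\<And>n. X n \<in> L2_space \<omega>" and C: "\<And>n. sq \<omega> (X n) \<le> C"
    and lim: "AE s in lebesgue_on {0..\<omega>}. (\<lambda>n. X n s) \<longlonglongrightarrow> x s"
  shows "x \<in> L2_space \<omega>" "sq \<omega> x \<le> C"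
proof -
  let ?M = "lebesgue_on {0..\<omega>}"
  have C0: "C \<ge> 0" using sq_nonneg[of \<omega> "X 0"] C[of 0] by linarith
  have xm: "strongly_measurable_on {0..\<omega>} x"
    by (rule strongly_measurable_AE_limit[OF L2_space_strongly_measurable[OF X] lim])
  have xb: "(\<lambda>s. (norm (x s))\<^sup>2) \<in> borel_measurable ?M"
    by (rule strongly_measurable_comp_real[OF xm]) (intro continuous_intros)
  note XI = nn_integral_interval[OF L2_space_sq_integrable[OF X] zero_le_power2]
  have "(\<integral>\<^sup>+s. ennreal ((norm (x s))\<^sup>2) \<partial>?M) = (\<integral>\<^sup>+s. liminf (\<lambda>n. ennreal ((norm (X n s))\<^sup>2)) \<partial>?M)"
  proof (rule nn_integral_cong_AE)
    show "AE s in ?M. ennreal ((norm (x s))\<^sup>2) = liminf (\<lambda>n. ennreal ((norm (X n s))\<^sup>2))"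
      using lim
    proof eventually_elim
      case (elim s)
      then have "(\<lambda>n. ennreal ((norm (X n s))\<^sup>2)) \<longlonglongrightarrow> ennreal ((norm (x s))\<^sup>2)"
        by (intro tendsto_ennrealI tendsto_intros)
      from lim_imp_Liminf[OF sequentially_bot this] show ?case by simp
    qed
  qed
  also have "\<dots> \<le> liminf (\<lambda>n. \<integral>\<^sup>+s. ennreal ((norm (X n s))\<^sup>2) \<partial>?M)"
    by (rule nn_integral_liminf) (use XI(1) in measurable)
  also have "\<dots> \<le> ennreal C"
  proof (rule Liminf_le)
    show "\<forall>\<^sub>F n in sequentially. (\<integral>\<^sup>+s. ennreal ((norm (X n s))\<^sup>2) \<partial>?M) \<le> ennreal C"
      by (intro always_eventually allI) (simp add: XI(2) ennreal_leI C)
  qed simp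
  finally have *: "(\<integral>\<^sup>+s. ennreal ((norm (x s))\<^sup>2) \<partial>?M) \<le> ennreal C" .
  note ** = nn_integral_interval_bounded[OF xb zero_le_power2 * C0]
  show "x \<in> L2_space \<omega>" using xm **(1) by (simp add: L2_space_def)
  show "sq \<omega> x \<le> C" by (rule **(2))
qed


section \<open>Fourier coefficients\<close>

abbreviation E :: "real \<Rightarrow> int \<Rightarrow> real \<Rightarrow> complex" where
  "E \<omega> n s \<equiv> cis (2 * pi * of_int n * s / \<omega>)"

lemma E_mult: "E \<omega> m s * E \<omega> n s = E \<omega> (m + n) s"
  by (simp add: cis_mult add_divide_distrib distrib_left distrib_right)

lemma E_has_integral:
  assumes "\<omega> > 0" "n \<noteq> 0" "t \<ge> 0"
  shows "(E \<omega> n has_integral (E \<omega> n t - 1) / (\<i> * of_real (2 * pi * of_int n / \<omega>))) {0..t}"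
proof -
  define \<alpha> where "\<alpha> = 2 * pi * of_int n / \<omega>"
  have \<alpha>: "\<alpha> \<noteq> 0" using assms by (simp add: \<alpha>_def)
  have E: "E \<omega> n s = exp (\<i> * of_real \<alpha> * of_real s)" for s
    by (simp add: cis_conv_exp \<alpha>_def mult_ac)
  have "((\<lambda>s. exp (\<i> * of_real \<alpha> * of_real s)) has_integral
      exp (\<i> * of_real \<alpha> * of_real t) / (\<i> * of_real \<alpha>) - exp (\<i> * of_real \<alpha> * of_real 0) / (\<i> * of_real \<alpha>)) {0..t}"
  proof (rule fundamental_theorem_of_calculus[OF assms(3)])
    fix s
    have "((\<lambda>z. exp (\<i> * of_real \<alpha> * z) / (\<i> * of_real \<alpha>)) has_field_derivative exp (\<i> * of_real \<alpha> * of_real s)) (at (of_real s))"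
      using \<alpha> by (auto intro!: derivative_eq_intros)
    then show "((\<lambda>s. exp (\<i> * of_real \<alpha> * of_real s) / (\<i> * of_real \<alpha>)) has_vector_derivative exp (\<i> * of_real \<alpha> * of_real s)) (at s within {0..t})"
      by (rule has_vector_derivative_real_field)
  qed
  moreover have "2 * pi * of_int n / \<omega> = \<alpha>" by (simp add: \<alpha>_def)
  ultimately show ?thesis unfolding E by (simp only: diff_divide_distrib) simp
qed

lemma E_period: "\<omega> > 0 \<Longrightarrow> E \<omega> n \<omega> = 1"
  using cis_multiple_2pi[of "of_int n"] by (simp add: mult_ac)

lemma E_integral:
  assumes "\<omega> > 0"
  shows "(E \<omega> n has_integral (if n = 0 then of_real \<omega> else 0)) {0..\<omega>}"
proof (cases "n = 0")
  case True
  then show ?thesis using has_integral_const_real[of "1::complex" 0 \<omega>] assms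
    by (simp add: cis_zero scaleR_conv_of_real)
next
  case False
  then show ?thesis using E_has_integral[OF assms False, of \<omega>] assms E_period[OF assms, of n] by simp
qed

lemma bounded_linear_scaleC_left: "bounded_linear (\<lambda>z. z *\<^sub>C (c::'h::complex_hilbert))"
proof (rule bounded_linear_intro[of _ "norm c"])
  show "(r *\<^sub>R z) *\<^sub>C c = r *\<^sub>R (z *\<^sub>C c)" for r z
    by (metis scaleC_of_real scaleC_scaleC scaleR_conv_of_real)
qed (auto simp: scaleC_add_left norm_scaleC)

lemma continuous_on_E: "continuous_on A (E \<omega> n)"
  unfolding divide_inverse by (intro continuous_intros)

lemma L2_space_E: "x \<in> L2_space \<omega> \<Longrightarrow> (\<lambda>s. E \<omega> n s *\<^sub>C x s) \<in> L2_space \<omega>"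
  by (rule L2_space_mult[where K = 1, OF _ continuous_on_E]) auto

lemma fourier_coeff_alt: "fourier_coeff \<omega> x l = (1 / \<omega>) *\<^sub>R integral {0..\<omega>} (\<lambda>s. E \<omega> (- l) s *\<^sub>C x s)"
  by (simp add: fourier_coeff_def)

lemma fourier_coeff_add:
  assumes "x \<in> L2_space \<omega>" "y \<in> L2_space \<omega>"
  shows "fourier_coeff \<omega> (\<lambda>s. x s + y s) l = fourier_coeff \<omega> x l + fourier_coeff \<omega> y l"
  unfolding fourier_coeff_alt
  by (simp only: scaleC_add_right integral_add L2_space_integrable L2_space_E assms scaleR_add_right)

lemma fourier_coeff_scaleC:
  assumes "x \<in> L2_space \<omega>"
  shows "fourier_coeff \<omega> (\<lambda>s. c *\<^sub>C x s) l = c *\<^sub>C fourier_coeff \<omega> x l"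
proof -
  have "integral {0..\<omega>} (\<lambda>s. E \<omega> (- l) s *\<^sub>C c *\<^sub>C x s) = integral {0..\<omega>} ((\<lambda>v. c *\<^sub>C v) \<circ> (\<lambda>s. E \<omega> (- l) s *\<^sub>C x s))"
    by (simp only: o_def scaleC_scaleC mult.commute)
  also have "\<dots> = c *\<^sub>C integral {0..\<omega>} (\<lambda>s. E \<omega> (- l) s *\<^sub>C x s)"
    by (rule integral_linear[OF L2_space_integrable(1)[OF L2_space_E[OF assms]] bounded_linear_scaleC])
  finally show ?thesis unfolding fourier_coeff_alt by (simp only: scaleC_scaleR)
qed

lemma scaleC_minus_one: "(-1) *\<^sub>C (x::'h::complex_hilbert) = - x"
  using scaleC_of_real[of "-1" x] by simp

lemma fourier_coeff_minus:
  assumes "x \<in> L2_space \<omega>" "y \<in> L2_space \<omega>"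
  shows "fourier_coeff \<omega> (\<lambda>s. x s - y s) l = fourier_coeff \<omega> x l - fourier_coeff \<omega> y l"
  using fourier_coeff_add[OF assms(1) L2_space_scaleC[OF assms(2), of "-1"], of l]
    fourier_coeff_scaleC[OF assms(2), of "-1" l]
  by (simp add: scaleC_minus_one)

lemma fourier_coeff_L2_eq: "L2_eq \<omega> x y \<Longrightarrow> fourier_coeff \<omega> x l = fourier_coeff \<omega> y l"
  unfolding fourier_coeff_alt
  by (subst L2_eq_integral[of \<omega> x y "\<lambda>s v. E \<omega> (- l) s *\<^sub>C v"]) auto

lemma fourier_coeff_E:
  assumes "\<omega> > 0"
  shows "fourier_coeff \<omega> (\<lambda>s. E \<omega> n s *\<^sub>C c) l = (if n = l then c else 0)"
proof -
  have "((\<lambda>z. z *\<^sub>C c) \<circ> E \<omega> (n - l) has_integral (if n - l = 0 then of_real \<omega> else 0) *\<^sub>C c) {0..\<omega>}"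
    by (rule has_integral_linear[OF E_integral[OF assms] bounded_linear_scaleC_left])
  then have "integral {0..\<omega>} (\<lambda>s. E \<omega> (n - l) s *\<^sub>C c) = (if n - l = 0 then of_real \<omega> else 0) *\<^sub>C c"
    by (simp add: o_def integral_unique)
  moreover have "E \<omega> (- l) s *\<^sub>C E \<omega> n s *\<^sub>C c = E \<omega> (n - l) s *\<^sub>C c" for s
    using E_mult[where \<omega> = \<omega> and m = "- l" and s = s and n = n] by (simp only: scaleC_scaleC) simp
  ultimately show ?thesis
    unfolding fourier_coeff_alt using assms by (simp add: scaleC_of_real del: of_int_diff)
qed

definition trig :: "real \<Rightarrow> int set \<Rightarrow> (int \<Rightarrow> 'h::complex_hilbert) \<Rightarrow> real \<Rightarrow> 'h" where
  "trig \<omega> F c s = (\<Sum>n\<in>F. E \<omega> n s *\<^sub>C c n)"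

lemma trig_L2: "trig \<omega> F c \<in> L2_space \<omega>"
  unfolding trig_def[abs_def] by (intro L2_space_sum L2_space_E L2_space_const)

lemma fourier_coeff_sum:
  assumes "finite F" "\<And>i. i \<in> F \<Longrightarrow> f i \<in> L2_space \<omega>"
  shows "fourier_coeff \<omega> (\<lambda>s. \<Sum>i\<in>F. f i s) l = (\<Sum>i\<in>F. fourier_coeff \<omega> (f i) l)"
  using assms
proof (induction F rule: finite_induct)
  case empty
  then show ?case by (simp add: fourier_coeff_def)
next
  case (insert i F)
  then have "fourier_coeff \<omega> (\<lambda>s. f i s + (\<Sum>i\<in>F. f i s)) l = fourier_coeff \<omega> (f i) l + fourier_coeff \<omega> (\<lambda>s. \<Sum>i\<in>F. f i s) l"
    by (intro fourier_coeff_add L2_space_sum) auto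
  with insert show ?case by simp
qed

lemma fourier_coeff_trig:
  assumes "\<omega> > 0" "finite F"
  shows "fourier_coeff \<omega> (trig \<omega> F c) l = (if l \<in> F then c l else 0)"
  unfolding trig_def[abs_def] using assms
  by (simp add: fourier_coeff_sum L2_space_E L2_space_const fourier_coeff_E sum.delta)

lemma inner_scaleC_right: "inner x (a *\<^sub>C y) = inner (cnj a *\<^sub>C x) (y::'h::complex_hilbert)"
proof -
  have "cinner x (a *\<^sub>C y) = cnj a * cinner x y"
    by (metis cinner_commute cinner_scaleC_left complex_cnj_mult complex_cnj_cnj)
  then show ?thesis by (simp add: inner_eq_Re_cinner cinner_scaleC_left)
qed

lemma inner_E_integral:
  assumes "\<omega> > 0" "x \<in> L2_space \<omega>"
  shows "((\<lambda>s. inner (x s) (E \<omega> n s *\<^sub>C c)) has_integral \<omega> * inner (fourier_coeff \<omega> x n) c) {0..\<omega>}"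
proof -
  have "((\<lambda>v. inner v c) \<circ> (\<lambda>s. E \<omega> (- n) s *\<^sub>C x s) has_integral inner (integral {0..\<omega>} (\<lambda>s. E \<omega> (- n) s *\<^sub>C x s)) c) {0..\<omega>}"
    by (rule has_integral_linear[OF integrable_integral[OF L2_space_integrable(1)[OF L2_space_E[OF assms(2)]]] bounded_linear_inner_left])
  moreover have "inner (E \<omega> (- n) s *\<^sub>C x s) c = inner (x s) (E \<omega> n s *\<^sub>C c)" for s
    by (simp add: inner_scaleC_right cis_cnj)
  ultimately show ?thesis unfolding fourier_coeff_alt using assms(1) by (simp add: o_def)
qed

lemma inner_trig_integral:
  assumes "\<omega> > 0" "x \<in> L2_space \<omega>" "finite F"
  shows "((\<lambda>s. inner (x s) (trig \<omega> F c s)) has_integral \<omega> * (\<Sum>n\<in>F. inner (fourier_coeff \<omega> x n) (c n))) {0..\<omega>}"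
  unfolding trig_def inner_sum_right sum_distrib_left
  by (intro has_integral_sum assms inner_E_integral)

text \<open>Orthogonality of the exponentials; Bessel's inequality is an immediate consequence.\<close>

lemma sq_minus_trig:
  assumes "\<omega> > 0" "x \<in> L2_space \<omega>" "finite F"
  shows "sq \<omega> (\<lambda>s. x s - trig \<omega> F c s) =
    sq \<omega> x - 2 * \<omega> * (\<Sum>n\<in>F. inner (fourier_coeff \<omega> x n) (c n)) + \<omega> * (\<Sum>n\<in>F. (norm (c n))\<^sup>2)"
proof -
  have t: "((\<lambda>s. inner (trig \<omega> F c s) (trig \<omega> F c s)) has_integral \<omega> * (\<Sum>n\<in>F. (norm (c n))\<^sup>2)) {0..\<omega>}"
    using inner_trig_integral[OF assms(1) trig_L2 assms(3), of F c c] assms(1,3)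
    by (simp add: fourier_coeff_trig power2_norm_eq_inner)
  have "((\<lambda>s. (norm (x s))\<^sup>2 - 2 * inner (x s) (trig \<omega> F c s) + inner (trig \<omega> F c s) (trig \<omega> F c s)) has_integral
      sq \<omega> x - 2 * (\<omega> * (\<Sum>n\<in>F. inner (fourier_coeff \<omega> x n) (c n))) + \<omega> * (\<Sum>n\<in>F. (norm (c n))\<^sup>2)) {0..\<omega>}"
    by (intro has_integral_add has_integral_diff has_integral_mult_right t integrable_integral
        inner_trig_integral L2_space_sq_integrable assms)
  moreover have "(norm (x s))\<^sup>2 - 2 * inner (x s) (trig \<omega> F c s) + inner (trig \<omega> F c s) (trig \<omega> F c s)
      = (norm (x s - trig \<omega> F c s))\<^sup>2" for s
    by (simp add: power2_norm_eq_inner inner_diff_left inner_diff_right inner_commute)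
  ultimately show ?thesis by (simp add: integral_unique mult.assoc)
qed

lemma sq_trig:
  assumes "\<omega> > 0" "finite F"
  shows "sq \<omega> (trig \<omega> F c) = \<omega> * (\<Sum>n\<in>F. (norm (c n))\<^sup>2)"
  using sq_minus_trig[OF assms(1) L2_space_const[of 0] assms(2), of c] by (simp add: fourier_coeff_def)

lemma bessel:
  assumes "\<omega> > 0" "x \<in> L2_space \<omega>" "finite F"
  shows "\<omega> * (\<Sum>n\<in>F. (norm (fourier_coeff \<omega> x n))\<^sup>2) \<le> sq \<omega> x"
proof -
  have "0 \<le> sq \<omega> (\<lambda>s. x s - trig \<omega> F (fourier_coeff \<omega> x) s)" by (rule sq_nonneg)
  also have "\<dots> = sq \<omega> x - \<omega> * (\<Sum>n\<in>F. (norm (fourier_coeff \<omega> x n))\<^sup>2)"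
    unfolding sq_minus_trig[OF assms] by (simp add: power2_norm_eq_inner)
  finally show ?thesis by simp
qed

definition fourier_seq :: "real \<Rightarrow> (real \<Rightarrow> 'h::complex_hilbert) \<Rightarrow> 'h vec2" where
  "fourier_seq \<omega> x = Ell2 (fourier_coeff \<omega> x)"

lemma entry_fourier_seq:
  assumes "\<omega> > 0" "x \<in> L2_space \<omega>"
  shows "entry (fourier_seq \<omega> x) n = fourier_coeff \<omega> x n"
  unfolding fourier_seq_def
proof (rule Ell2_bounded)
  fix F :: "int set" assume "finite F"
  from bessel[OF assms this] have "(\<Sum>n\<in>F. (norm (fourier_coeff \<omega> x n))\<^sup>2) \<le> sq \<omega> x / \<omega>"
    using assms(1) by (simp add: field_simps)
  then show "L2_set (\<lambda>n. norm (fourier_coeff \<omega> x n)) F \<le> sqrt (sq \<omega> x / \<omega>)"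
    unfolding L2_set_def by simp
qed

subsection \<open>The Riesz-Fischer theorem\<close>

text \<open>Along a sparse sequence of partial sums the consecutive differences are summable in mean,
  hence absolutely summable almost everywhere; Fatou's lemma identifies the pointwise limit as a
  limit in the mean.\<close>

lemma riesz_fischer:
  fixes c :: "'h::complex_hilbert vec2"
  assumes w: "\<omega> > 0"
  shows "\<exists>x\<in>L2_space \<omega>. (\<forall>n. fourier_coeff \<omega> x n = entry c n) \<and> sq \<omega> x \<le> \<omega> * (norm c)\<^sup>2"
proof -
  have "\<exists>M::nat. \<forall>F. finite F \<longrightarrow> F \<inter> {- int M..int M} = {} \<longrightarrow> (\<Sum>n\<in>F. (norm (entry c n))\<^sup>2) \<le> (1/4)^i" for i :: nat
  proof -
    obtain F0 where F0: "finite F0" "\<And>F. finite F \<Longrightarrow> F \<inter> F0 = {} \<Longrightarrow> (\<Sum>n\<in>F. (norm (entry c n))\<^sup>2) \<le> (1/4)^i"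
      using summable_tail[OF summable_entry[of c], of "(1/4)^i"] by auto
    have "finite (abs ` F0)" using F0(1) by simp
    then obtain M where M: "\<And>q. q \<in> abs ` F0 \<Longrightarrow> q \<le> M" using Max_ge by blast
    have "F0 \<subseteq> {- int (nat M)..int (nat M)}" using M by fastforce
    then show ?thesis using F0(2) by (intro exI[of _ "nat M"]) blast
  qed
  then obtain M :: "nat \<Rightarrow> nat" where M: "\<And>i F. finite F \<Longrightarrow> F \<inter> {- int (M i)..int (M i)} = {} \<Longrightarrow>
      (\<Sum>n\<in>F. (norm (entry c n))\<^sup>2) \<le> (1/4)^i" by metis
  \<comment> \<open>an increasing sequence above \<open>M\<close> that eventually passes every index\<close>
  define N where "N i = (\<Sum>k\<le>i. M k) + i" for i
  have MN: "M i \<le> N i" for i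
    unfolding N_def by (rule trans_le_add1, rule member_le_sum) auto
  have NS: "N i \<le> N (Suc i)" for i by (simp add: N_def)
  then have Nmono: "N i \<le> N j" if "i \<le> j" for i j using that by (rule lift_Suc_mono_le)
  define J where "J i = {- int (N i)..int (N i)}" for i
  have J: "finite (J i)" for i by (simp add: J_def)
  have Jmono: "J i \<subseteq> J j" if "i \<le> j" for i j using Nmono[OF that] by (auto simp: J_def)
  have tail: "(\<Sum>n\<in>F. (norm (entry c n))\<^sup>2) \<le> (1/4)^i" if "finite F" "F \<inter> J i = {}" for F i
    using MN[of i] that by (intro M) (auto simp: J_def)
  define S where "S i = trig \<omega> (J i) (entry c)" for i
  have SL: "S i \<in> L2_space \<omega>" for i by (simp add: S_def trig_L2)
  have Sd: "S j s - S i s = trig \<omega> (J j - J i) (entry c) s" if "i \<le> j" for i j s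
    unfolding S_def trig_def using Jmono[OF that] J by (simp add: sum_diff)
  have sqd: "sq \<omega> (\<lambda>s. S j s - S i s) \<le> \<omega> * (1/4)^i" if "i \<le> j" for i j
  proof -
    have "sq \<omega> (\<lambda>s. S j s - S i s) = \<omega> * (\<Sum>n\<in>J j - J i. (norm (entry c n))\<^sup>2)"
      unfolding Sd[OF that] using J by (intro sq_trig w) auto
    also have "\<dots> \<le> \<omega> * (1/4)^i" using w J by (intro mult_left_mono tail) auto
    finally show ?thesis .
  qed
  define d where "d i s = norm (S (Suc i) s - S i s)" for i s
  have dL: "(\<lambda>s. S (Suc i) s - S i s) \<in> L2_space \<omega>" for i by (intro L2_space_minus SL)
  have di: "d i integrable_on {0..\<omega>}" for i
    unfolding d_def[abs_def] by (rule L2_space_integrable(2)[OF dL])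
  have dint: "integral {0..\<omega>} (d i) \<le> \<omega> * (1/2)^i" for i
  proof -
    \<comment> \<open>the arithmetic-geometric mean inequality with weight \<open>2^i\<close> balances the bounds for \<open>d i\<close> and its square\<close>
    have pw: "d i s \<le> 2^i / 2 * (d i s)\<^sup>2 + (1/2)^i / 2" for s
    proof -
      have "0 \<le> (2^i * d i s - 1)\<^sup>2 * (1/2)^i" by simp
      also have "\<dots> = 2^i * (d i s)\<^sup>2 - 2 * d i s + (1/2)^i"
        by (simp add: power2_eq_square algebra_simps power_divide)
      finally show ?thesis by simp
    qed
    have "integral {0..\<omega>} (d i) \<le> integral {0..\<omega>} (\<lambda>s. 2^i / 2 * (d i s)\<^sup>2 + (1/2)^i / 2)"
      using L2_space_sq_integrable[OF dL[of i]]
      by (intro integral_le di pw integrable_add integrable_on_mult_right integrable_const_ivl) (simp add: d_def)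
    also have "\<dots> = 2^i / 2 * sq \<omega> (\<lambda>s. S (Suc i) s - S i s) + (1/2)^i / 2 * \<omega>"
      using L2_space_sq_integrable[OF dL[of i]] w
      by (subst integral_add) (auto simp: d_def intro!: integrable_on_mult_right integrable_const_ivl)
    also have "\<dots> \<le> 2^i / 2 * (\<omega> * (1/4)^i) + (1/2)^i / 2 * \<omega>"
      using sqd[of i "Suc i"] by (intro add_mono mult_left_mono) auto
    also have "\<dots> = \<omega> * (1/2)^i"
    proof -
      have "(2::real)^i * (1/4)^i = (1/2)^i" by (simp flip: power_mult_distrib)
      then show ?thesis by (simp add: mult_ac)
    qed
    finally show ?thesis .
  qed
  let ?M = "lebesgue_on {0..\<omega>}"
  have d0: "d i s \<ge> 0" for i s by (simp add: d_def)
  note dn = nn_integral_interval[OF di d0]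
  have "(\<integral>\<^sup>+s. (\<Sum>i. ennreal (d i s)) \<partial>?M) = (\<Sum>i. \<integral>\<^sup>+s. ennreal (d i s) \<partial>?M)"
    by (rule nn_integral_suminf) (use dn(1) in measurable)
  also have "\<dots> = (\<Sum>i. ennreal (integral {0..\<omega>} (d i)))" by (simp add: dn(2))
  also have "\<dots> \<le> (\<Sum>i. ennreal (\<omega> * (1/2)^i))"
    using dint by (intro suminf_le ennreal_leI) auto
  also have "\<dots> = ennreal (\<Sum>i. \<omega> * (1/2)^i)"
    using w by (intro suminf_ennreal2 summable_mult summable_geometric) auto
  also have "\<dots> < \<infinity>" by simp
  finally have fin: "(\<integral>\<^sup>+s. (\<Sum>i. ennreal (d i s)) \<partial>?M) \<noteq> \<infinity>" by simp
  have "AE s in ?M. (\<Sum>i. ennreal (d i s)) \<noteq> \<infinity>"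
    by (rule nn_integral_noteq_infinite[OF _ fin]) (use dn(1) in measurable)
  then have "AE s in ?M. convergent (\<lambda>i. S i s)"
  proof eventually_elim
    case (elim s)
    then have "summable (\<lambda>i. d i s)"
      using d0 by (intro summable_suminf_not_top) auto
    then have "summable (\<lambda>i. S (Suc i) s - S i s)"
      unfolding d_def by (rule summable_norm_cancel)
    then have "convergent (\<lambda>n. \<Sum>i<n. S (Suc i) s - S i s)" by (simp add: summable_iff_convergent)
    then have "convergent (\<lambda>n. S n s - S 0 s)" 
      using sum_lessThan_telescope[of "\<lambda>i. S i s"] by simp
    from convergent_add[OF this convergent_const[of "S 0 s"]] show ?case by simp
  qed
  then have lim: "AE s in ?M. (\<lambda>i. S i s) \<longlonglongrightarrow> lim (\<lambda>i. S i s)"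
    by eventually_elim (simp add: convergent_LIMSEQ_iff)
  define x where "x s = lim (\<lambda>i. S i s)" for s
  have xS: "(\<lambda>s. x s - S i s) \<in> L2_space \<omega>" "sq \<omega> (\<lambda>s. x s - S i s) \<le> \<omega> * (1/4)^i" for i
  proof -
    have *: "AE s in ?M. (\<lambda>j. S (i + j) s - S i s) \<longlonglongrightarrow> x s - S i s"
      using lim
    proof eventually_elim
      case (elim s)
      then have "(\<lambda>j. S (j + i) s) \<longlonglongrightarrow> x s" unfolding x_def by (rule LIMSEQ_ignore_initial_segment)
      then show ?case by (intro tendsto_diff tendsto_const) (simp add: add.commute)
    qed
    note L = L2_space_AE_limit[of "\<lambda>j s. S (i + j) s - S i s" \<omega> "\<omega> * (1/4)^i" "\<lambda>s. x s - S i s", OF L2_space_minus[OF SL SL] sqd[OF le_add1] *]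
    show "(\<lambda>s. x s - S i s) \<in> L2_space \<omega>" "sq \<omega> (\<lambda>s. x s - S i s) \<le> \<omega> * (1/4)^i" by (rule L)+
  qed
  have xL: "x \<in> L2_space \<omega>"
    using L2_space_add[OF xS(1)[of 0] SL[of 0]] by simp
  have lim4: "(\<lambda>i. (1/4)^i :: real) \<longlonglongrightarrow> 0" by (rule LIMSEQ_realpow_zero) auto
  have coef: "fourier_coeff \<omega> x n = entry c n" for n
  proof -
    have b: "(norm (fourier_coeff \<omega> x n - entry c n))\<^sup>2 \<le> (1/4)^i" if "i \<ge> nat \<bar>n\<bar>" for i
    proof -
      have "i \<le> N i" by (simp add: N_def)
      then have nJ: "n \<in> J i" using that by (auto simp: J_def)
      have "fourier_coeff \<omega> (\<lambda>s. x s - S i s) n = fourier_coeff \<omega> x n - entry c n"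
        using fourier_coeff_trig[OF w J[of i], of "entry c" n] nJ
        by (simp add: fourier_coeff_minus[OF xL SL]) (simp add: S_def)
      with bessel[OF w xS(1)[of i], of "{n}"] xS(2)[of i]
      have "\<omega> * (norm (fourier_coeff \<omega> x n - entry c n))\<^sup>2 \<le> \<omega> * (1/4)^i" by simp
      then show ?thesis using w by (simp only: mult_le_cancel_left_pos)
    qed
    have "(norm (fourier_coeff \<omega> x n - entry c n))\<^sup>2 \<le> 0"
      by (rule tendsto_lowerbound[OF lim4]) (use b in \<open>auto simp: eventually_sequentially\<close>)
    then show ?thesis by simp
  qed
  have "sq \<omega> x \<le> \<omega> * (norm c)\<^sup>2 + \<omega> * (1/4)^i" for i
  proof -
    have "sq \<omega> (\<lambda>s. x s - S i s) = sq \<omega> x - \<omega> * (\<Sum>n\<in>J i. (norm (entry c n))\<^sup>2)"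
      unfolding S_def sq_minus_trig[OF w xL J] by (simp add: coef power2_norm_eq_inner)
    moreover have "(\<Sum>n\<in>J i. (norm (entry c n))\<^sup>2) \<le> (norm c)\<^sup>2"
      unfolding norm_ell2_squared using J by (intro finite_sum_le_infsum summable_entry) auto
    then have "\<omega> * (\<Sum>n\<in>J i. (norm (entry c n))\<^sup>2) \<le> \<omega> * (norm c)\<^sup>2" using w by simp
    ultimately show ?thesis using xS(2)[of i] by linarith
  qed
  moreover have "(\<lambda>i. \<omega> * (norm c)\<^sup>2 + \<omega> * (1/4)^i) \<longlonglongrightarrow> \<omega> * (norm c)\<^sup>2 + \<omega> * 0"
    by (intro tendsto_intros lim4)
  ultimately have "sq \<omega> x \<le> \<omega> * (norm c)\<^sup>2 + \<omega> * 0"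
    by (intro tendsto_lowerbound[where F = sequentially]) auto
  with xL coef show ?thesis by (intro bexI[of _ x]) auto
qed

subsection \<open>Uniqueness of Fourier coefficients\<close>

inductive trig_poly :: "real \<Rightarrow> (real \<Rightarrow> complex) \<Rightarrow> bool" for \<omega> where
  mono: "trig_poly \<omega> (\<lambda>s. c * E \<omega> n s)"
| add: "trig_poly \<omega> p \<Longrightarrow> trig_poly \<omega> q \<Longrightarrow> trig_poly \<omega> (\<lambda>s. p s + q s)"

lemma trig_poly_mult:
  assumes "trig_poly \<omega> p" "trig_poly \<omega> q"
  shows "trig_poly \<omega> (\<lambda>s. p s * q s)"
  using assms
proof (induction rule: trig_poly.induct)
  case (mono c n)
  from mono show ?case
  proof (induction rule: trig_poly.induct)
    case (mono c' n')
    have "c * E \<omega> n s * (c' * E \<omega> n' s) = (c * c') * E \<omega> (n + n') s" for s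
    proof -
      have "c * E \<omega> n s * (c' * E \<omega> n' s) = (c * c') * (E \<omega> n s * E \<omega> n' s)" by (simp only: mult_ac)
      then show ?thesis by (simp only: E_mult)
    qed
    then show ?case by (simp only: trig_poly.mono)
  next
    case (add p q)
    then show ?case by (simp add: distrib_left trig_poly.add)
  qed
next
  case (add p p')
  then show ?case by (simp add: distrib_right trig_poly.add)
qed

lemma trig_poly_const: "trig_poly \<omega> (\<lambda>s. c)"
  using trig_poly.mono[of \<omega> c 0] by (simp add: cis_zero)

lemma trig_poly_real_polynomial:
  assumes "real_polynomial_function q"
  shows "trig_poly \<omega> (\<lambda>s. of_real (q (E \<omega> 1 s)))"
  using assms
proof (induction rule: real_polynomial_function.induct)
  case (linear f)
  interpret bounded_linear f by fact
  define a where "a = (of_real (f 1) - \<i> * of_real (f \<i>)) / 2"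
  define b where "b = (of_real (f 1) + \<i> * of_real (f \<i>)) / 2"
  have "complex_of_real (f (E \<omega> 1 s)) = a * E \<omega> 1 s + b * E \<omega> (-1) s" for s
  proof -
    have "E \<omega> 1 s = Re (E \<omega> 1 s) *\<^sub>R 1 + Im (E \<omega> 1 s) *\<^sub>R \<i>" by (simp add: complex_eq_iff)
    then have "f (E \<omega> 1 s) = Re (E \<omega> 1 s) * f 1 + Im (E \<omega> 1 s) * f \<i>"
      by (metis add scaleR real_scaleR_def)
    moreover have "E \<omega> (-1) s = cnj (E \<omega> 1 s)" by (simp add: cis_cnj)
    ultimately show ?thesis by (simp add: a_def b_def complex_eq_iff field_simps)
  qed
  then show ?case using trig_poly.add[OF trig_poly.mono[of \<omega> a 1] trig_poly.mono[of \<omega> b "-1"]] by (simp only:)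
next
  case (const c)
  then show ?case by (simp add: trig_poly_const)
next
  case (add f g)
  then show ?case by (simp add: trig_poly.add)
next
  case (mult f g)
  then show ?case by (simp add: trig_poly_mult)
qed

lemma trig_poly_orthogonal:
  assumes z: "z \<in> L2_space \<omega>" "\<And>n. fourier_coeff \<omega> z n = 0" and w: "\<omega> > 0" and "trig_poly \<omega> p"
  shows "((\<lambda>s. p s *\<^sub>C z s) has_integral 0) {0..\<omega>}"
  using assms(4)
proof (induction rule: trig_poly.induct)
  case (mono c n)
  have "integral {0..\<omega>} (\<lambda>s. E \<omega> n s *\<^sub>C z s) = 0"
    using z(2)[of "- n"] w by (simp add: fourier_coeff_alt)
  then have "((\<lambda>s. E \<omega> n s *\<^sub>C z s) has_integral 0) {0..\<omega>}"
    using integrable_integral[OF L2_space_integrable(1)[OF L2_space_E[OF z(1)]]] by metis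
  from has_integral_linear[OF this bounded_linear_scaleC[of c]] show ?case by (simp add: o_def scaleC_scaleC)
next
  case (add p q)
  from has_integral_add[OF add.IH] show ?case by (simp add: scaleC_add_left)
qed

text \<open>By the Stone-Weierstrass theorem on the circle, \<open>g\<close> is a uniform limit of real polynomials, which
  become trigonometric polynomials along the exponential.\<close>

lemma continuous_orthogonal:
  fixes z :: "real \<Rightarrow> 'h::complex_hilbert" and g :: "complex \<Rightarrow> real"
  assumes z: "z \<in> L2_space \<omega>" "\<And>n. fourier_coeff \<omega> z n = 0" and w: "\<omega> > 0" and g: "continuous_on UNIV g"
  shows "((\<lambda>s. g (E \<omega> 1 s) * inner (z s) h) has_integral 0) {0..\<omega>}"
proof -
  let ?f = "\<lambda>s. g (E \<omega> 1 s) * inner (z s) h"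
  define B where "B = norm h * integral {0..\<omega>} (\<lambda>s. norm (z s))"
  have app: "\<exists>p. (p has_integral 0) {0..\<omega>} \<and> (\<forall>s. \<bar>?f s - p s\<bar> \<le> e * (norm (z s) * norm h))" if "e > 0" for e
  proof -
    have "continuous_on (sphere 0 1) g" using g by (rule continuous_on_subset) simp
    from Stone_Weierstrass_real_polynomial_function[OF compact_sphere this that]
    obtain q where q: "real_polynomial_function q" "\<And>u. u \<in> sphere 0 1 \<Longrightarrow> \<bar>g u - q u\<bar> < e" by blast
    have "((\<lambda>s. of_real (q (E \<omega> 1 s)) *\<^sub>C z s) has_integral 0) {0..\<omega>}"
      by (intro trig_poly_orthogonal[OF z w] trig_poly_real_polynomial q)
    from has_integral_linear[OF this bounded_linear_inner_left[of h]]
    have 1: "((\<lambda>s. q (E \<omega> 1 s) * inner (z s) h) has_integral 0) {0..\<omega>}"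
      by (simp add: o_def scaleC_of_real)
    have 2: "\<bar>?f s - q (E \<omega> 1 s) * inner (z s) h\<bar> \<le> e * (norm (z s) * norm h)" for s
    proof -
      have "\<bar>?f s - q (E \<omega> 1 s) * inner (z s) h\<bar> = \<bar>g (E \<omega> 1 s) - q (E \<omega> 1 s)\<bar> * \<bar>inner (z s) h\<bar>"
        by (simp add: left_diff_distrib[symmetric] abs_mult)
      also have "\<dots> \<le> e * (norm (z s) * norm h)"
        using q(2)[of "E \<omega> 1 s"] by (intro mult_mono Cauchy_Schwarz_ineq2) auto
      finally show ?thesis .
    qed
    from 1 2 show ?thesis by blast
  qed
  have nz: "(\<lambda>s. e * (norm (z s) * norm h)) integrable_on {0..\<omega>}" for e
    by (intro integrable_on_mult_right integrable_on_mult_left L2_space_integrable(2)[OF z(1)])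
  have nzi: "integral {0..\<omega>} (\<lambda>s. e * (norm (z s) * norm h)) = e * B" for e
    by (simp add: B_def)
  have B0: "B \<ge> 0" unfolding B_def by (intro mult_nonneg_nonneg integral_nonneg L2_space_integrable(2)[OF z(1)]) auto
  have fi: "?f integrable_on {0..\<omega>}"
  proof (rule integrable_on_approximable)
    fix e :: real assume "e > 0"
    define e' where "e' = e / (B + 1)"
    have e': "e' > 0" "e' * B \<le> e" using \<open>e > 0\<close> B0 by (auto simp: e'_def field_simps)
    obtain p where p: "(p has_integral 0) {0..\<omega>}" "\<And>s. \<bar>?f s - p s\<bar> \<le> e' * (norm (z s) * norm h)" using app[OF e'(1)] by blast
    then show "\<exists>ga ha. ga integrable_on {0..\<omega>} \<and> ha integrable_on {0..\<omega>} \<and>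
        (\<forall>s\<in>{0..\<omega>}. norm (?f s - ga s) \<le> ha s) \<and> integral {0..\<omega>} ha \<le> e"
      using nz[of e'] nzi[of e'] e'(2)
      by (intro exI[of _ p] exI[of _ "\<lambda>s. e' * (norm (z s) * norm h)"]) (auto simp: has_integral_integrable)
  qed
  have bnd: "\<bar>integral {0..\<omega>} ?f\<bar> \<le> e * B" if e0: "e > 0" for e
  proof -
    obtain p where p: "(p has_integral 0) {0..\<omega>}" "\<And>s. \<bar>?f s - p s\<bar> \<le> e * (norm (z s) * norm h)" using app[OF e0] by blast
    have "((\<lambda>s. ?f s - p s) has_integral (integral {0..\<omega>} ?f - 0)) {0..\<omega>}"
      by (intro has_integral_diff integrable_integral fi p)
    then have "norm (integral {0..\<omega>} (\<lambda>s. ?f s - p s)) \<le> integral {0..\<omega>} (\<lambda>s. e * (norm (z s) * norm h))"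
      by (intro integral_norm_bound_integral nz) (use p(2) in \<open>auto simp: has_integral_integrable\<close>)
    moreover have "integral {0..\<omega>} (\<lambda>s. ?f s - p s) = integral {0..\<omega>} ?f"
      using \<open>((\<lambda>s. ?f s - p s) has_integral (integral {0..\<omega>} ?f - 0)) {0..\<omega>}\<close> by (simp add: integral_unique)
    ultimately show ?thesis by (simp only: nzi real_norm_def)
  qed
  have "\<bar>integral {0..\<omega>} ?f\<bar> \<le> 0"
  proof (rule field_le_epsilon)
    fix e :: real assume e: "e > 0"
    have "e / (B + 1) > 0" using e B0 by simp
    from bnd[OF this] have "\<bar>integral {0..\<omega>} ?f\<bar> \<le> e / (B + 1) * B" .
    also have "\<dots> \<le> e" using e B0 by (simp add: field_simps)
    finally show "\<bar>integral {0..\<omega>} ?f\<bar> \<le> 0 + e" by simp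
  qed
  then show ?thesis using integrable_integral[OF fi] by simp
qed

lemma E_inj:
  assumes "\<omega> > 0" "0 < s" "s < \<omega>" "0 \<le> s'" "s' \<le> \<omega>" "E \<omega> 1 s = E \<omega> 1 s'"
  shows "s = s'"
proof -
  have "sin (2 * pi * s / \<omega>) = sin (2 * pi * s' / \<omega>)" "cos (2 * pi * s / \<omega>) = cos (2 * pi * s' / \<omega>)"
    using assms(6) by (auto simp: complex_eq_iff)
  then obtain n where n: "2 * pi * s' / \<omega> = 2 * pi * s / \<omega> + 2 * pi * of_int n"
    using sin_cos_eq_iff[of "2 * pi * s' / \<omega>" "2 * pi * s / \<omega>"] by auto
  have "2 * pi * (s' - s - \<omega> * of_int n) = 0" using n assms(1) by (simp add: field_simps)
  then have e: "s' - s = \<omega> * of_int n" by simp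
  have "\<bar>s' - s\<bar> < \<omega>" using assms by linarith
  then have "\<bar>of_int n :: real\<bar> < 1" unfolding e using assms(1) by (simp add: abs_mult)
  then have "n = 0" by linarith
  then show ?thesis using e by simp
qed

text \<open>Continuous functions on the circle that vanish on the complement \<open>K\<close> of an open arc increase to the
  indicator of the arc, and the arc corresponds to the interval from 0 to \<open>t\<close>.\<close>

lemma inner_initial_integral:
  fixes z :: "real \<Rightarrow> 'h::complex_hilbert"
  assumes z: "z \<in> L2_space \<omega>" "\<And>n. fourier_coeff \<omega> z n = 0" and w: "\<omega> > 0" and t: "0 \<le> t" "t \<le> \<omega>"
  shows "((\<lambda>s. inner (z s) h) has_integral 0) {0..t}"
proof -
  define K where "K = insert 1 (E \<omega> 1 ` {t..\<omega>})"
  have K: "closed K" "K \<noteq> {}"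
    unfolding K_def using compact_continuous_image[OF continuous_on_E[where A = "{t..\<omega>}" and \<omega> = \<omega> and n = 1] compact_Icc]
    by (auto intro: closed_insert compact_imp_closed)
  define g where "g k u = min 1 (real k * infdist u K)" for k u
  have gc: "continuous_on UNIV (g k)" for k
    unfolding g_def[abs_def] by (intro continuous_intros)
  have g01: "0 \<le> g k u" "g k u \<le> 1" for k u by (auto simp: g_def infdist_nonneg)
  have lim: "(\<lambda>k. g k u) \<longlonglongrightarrow> (if u \<in> K then 0 else 1)" for u
  proof (cases "u \<in> K")
    case False
    then have pos: "infdist u K > 0" using K by (simp add: infdist_pos_not_in_closed)
    then obtain n where n: "1 < real n * infdist u K" using reals_Archimedean3 by blast
    have "g k u = 1" if "k \<ge> n" for k
    proof -
      have "real n * infdist u K \<le> real k * infdist u K" using that pos by (intro mult_right_mono) auto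
      then show ?thesis using n by (simp add: g_def)
    qed
    then have "\<forall>\<^sub>F k in sequentially. g k u = 1" unfolding eventually_sequentially by blast
    then show ?thesis using False by (simp add: tendsto_eventually)
  qed (simp add: g_def)
  have K_iff: "E \<omega> 1 s \<in> K \<longleftrightarrow> \<not> (0 < s \<and> s < t)" if "s \<in> {0..\<omega>}" for s
  proof
    assume "E \<omega> 1 s \<in> K"
    then consider "E \<omega> 1 s = E \<omega> 1 0" | s' where "s' \<in> {t..\<omega>}" "E \<omega> 1 s = E \<omega> 1 s'"
      by (auto simp: K_def cis_zero)
    then show "\<not> (0 < s \<and> s < t)"
    proof cases
      case 1
      then show ?thesis using E_inj[OF w, of s 0] t by auto
    next
      case (2 s')
      then show ?thesis using E_inj[OF w, of s s'] t by auto
    qed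
  next
    assume "\<not> (0 < s \<and> s < t)"
    then have "s = 0 \<or> s \<in> {t..\<omega>}" using that by auto
    then show "E \<omega> 1 s \<in> K" by (auto simp: K_def cis_zero)
  qed
  have ii: "(\<lambda>s. norm (z s) * norm h) integrable_on {0..\<omega>}"
    by (intro integrable_on_mult_left L2_space_integrable(2)[OF z(1)])
  have "((\<lambda>s. (if E \<omega> 1 s \<in> K then 0 else 1) * inner (z s) h) has_integral 0) {0..\<omega>}"
  proof (rule has_integral_dominated_convergence[where y = "\<lambda>_. 0"])
    show "((\<lambda>s. g k (E \<omega> 1 s) * inner (z s) h) has_integral 0) {0..\<omega>}" for k
      by (rule continuous_orthogonal[OF z w gc])
    show "(\<lambda>s. norm (z s) * norm h) integrable_on {0..\<omega>}" by (rule ii)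
    show "\<forall>s\<in>{0..\<omega>}. norm (g k (E \<omega> 1 s) * inner (z s) h) \<le> norm (z s) * norm h" for k
    proof
      fix s
      have "\<bar>g k (E \<omega> 1 s)\<bar> * \<bar>inner (z s) h\<bar> \<le> 1 * (norm (z s) * norm h)"
        using g01[of k "E \<omega> 1 s"] by (intro mult_mono Cauchy_Schwarz_ineq2) auto
      then show "norm (g k (E \<omega> 1 s) * inner (z s) h) \<le> norm (z s) * norm h" by (simp add: abs_mult)
    qed
    show "\<forall>s\<in>{0..\<omega>}. (\<lambda>k. g k (E \<omega> 1 s) * inner (z s) h) \<longlonglongrightarrow> (if E \<omega> 1 s \<in> K then 0 else 1) * inner (z s) h"
      by (intro ballI tendsto_mult lim tendsto_const)
  qed simp
  then have "((\<lambda>s. if s \<in> {0..t} then inner (z s) h else 0) has_integral 0) {0..\<omega>}"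
  proof (rule has_integral_spike_finite[of "{0, t}", rotated -1])
    fix s assume "s \<in> {0..\<omega>} - {0, t}"
    then show "(if s \<in> {0..t} then inner (z s) h else 0) = (if E \<omega> 1 s \<in> K then 0 else 1) * inner (z s) h"
      using K_iff[of s] by auto
  qed simp
  moreover have sub: "{0..t} \<subseteq> {0..\<omega>}" using t by auto
  ultimately show ?thesis by (simp only: has_integral_restrict[OF sub])
qed

text \<open>Henstock's lemma bounds the Riemann sums of \<open>\<bar>f\<bar>\<close> by the distances between the terms of a Riemann
  sum of \<open>f\<close> and the integrals over the pieces, which vanish.\<close>

lemma zero_integrals_imp_AE_zero:
  fixes f :: "real \<Rightarrow> real"
  assumes f: "f integrable_on {a..b}" and z: "\<And>u v. {u..v} \<subseteq> {a..b} \<Longrightarrow> integral {u..v} f = 0"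
  shows "AE s in lebesgue_on {a..b}. f s = 0"
proof -
  have "((\<lambda>s. \<bar>f s\<bar>) has_integral 0) (cbox a b)"
    unfolding has_integral
  proof (intro allI impI)
    fix e :: real assume "e > 0"
    from f have "f integrable_on cbox a b" by (simp add: cbox_interval)
    from Henstock_lemma[OF this \<open>e > 0\<close>] obtain \<gamma> where \<gamma>: "gauge \<gamma>"
      "\<And>p. p tagged_partial_division_of cbox a b \<Longrightarrow> \<gamma> fine p \<Longrightarrow>
        (\<Sum>(x,k)\<in>p. norm (measure lborel k *\<^sub>R f x - integral k f)) < e" by blast
    show "\<exists>\<gamma>. gauge \<gamma> \<and> (\<forall>\<D>. \<D> tagged_division_of cbox a b \<and> \<gamma> fine \<D> \<longrightarrow>
        norm ((\<Sum>(x, k)\<in>\<D>. measure lborel k *\<^sub>R \<bar>f x\<bar>) - 0) < e)"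
    proof (intro exI[of _ \<gamma>] conjI allI impI \<gamma>(1))
      fix p assume p: "p tagged_division_of cbox a b \<and> \<gamma> fine p"
      have "(\<Sum>(x, k)\<in>p. measure lborel k *\<^sub>R \<bar>f x\<bar>) = (\<Sum>(x,k)\<in>p. norm (measure lborel k *\<^sub>R f x - integral k f))"
      proof (rule sum.cong[OF refl], clarify)
        fix x k assume xk: "(x, k) \<in> p"
        obtain u v where k: "k = cbox u v" using tagged_division_ofD(4)[of p "cbox a b" x k] p xk by blast
        have "k \<subseteq> cbox a b" using tagged_division_ofD(3)[of p "cbox a b" x k] p xk by blast
        then have "integral k f = 0" using z[of u v] unfolding k by (simp add: cbox_interval)
        then show "measure lborel k *\<^sub>R \<bar>f x\<bar> = norm (measure lborel k *\<^sub>R f x - integral k f)"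
          by (simp add: abs_mult)
      qed
      also have "\<dots> < e" using p by (intro \<gamma>(2)) (auto simp: tagged_division_of_def)
      finally have "(\<Sum>(x, k)\<in>p. measure lborel k *\<^sub>R \<bar>f x\<bar>) < e" .
      moreover have "0 \<le> (\<Sum>(x, k)\<in>p. measure lborel k *\<^sub>R \<bar>f x\<bar>)" by (intro sum_nonneg) auto
      ultimately show "norm ((\<Sum>(x, k)\<in>p. measure lborel k *\<^sub>R \<bar>f x\<bar>) - 0) < e" by simp
    qed
  qed
  then have h: "((\<lambda>s. \<bar>f s\<bar>) has_integral 0) {a..b}" by (simp add: cbox_interval)
  note n = nn_integral_interval[OF has_integral_integrable[OF h] abs_ge_zero]
  have "(\<integral>\<^sup>+s. ennreal \<bar>f s\<bar> \<partial>lebesgue_on {a..b}) = 0" using n(2) h by (simp add: integral_unique)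
  then have "AE s in lebesgue_on {a..b}. ennreal \<bar>f s\<bar> = 0"
    by (subst (asm) nn_integral_0_iff_AE) (use n(1) in measurable)
  then show ?thesis by (auto elim: eventually_mono simp: ennreal_eq_0_iff)
qed

text \<open>The scalar product with each fixed vector vanishes almost everywhere. As the values essentially lie in
  the closure of a countable set, one null set serves for all vectors of this set, and by continuity a
  value in its closure is orthogonal to itself.\<close>

lemma fourier_uniqueness:
  fixes z :: "real \<Rightarrow> 'h::complex_hilbert"
  assumes w: "\<omega> > 0" and z: "z \<in> L2_space \<omega>" "\<And>n. fourier_coeff \<omega> z n = 0"
  shows "L2_eq \<omega> z (\<lambda>s. 0)"
proof -
  have i0: "((\<lambda>s. inner (z s) h) has_integral 0) {u..v}" if "{u..v} \<subseteq> {0..\<omega>}" for h u v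
  proof (cases "u \<le> v")
    case True
    with that have uv: "0 \<le> u" "v \<le> \<omega>" by auto
    have a: "((\<lambda>s. inner (z s) h) has_integral 0) {0..v}" and b: "((\<lambda>s. inner (z s) h) has_integral 0) {0..u}"
      using True uv by (auto intro!: inner_initial_integral[OF z w])
    have "(\<lambda>s. inner (z s) h) integrable_on {u..v}"
      by (rule integrable_on_subinterval[OF has_integral_integrable[OF a]]) (use uv in auto)
    moreover have "integral {0..u} (\<lambda>s. inner (z s) h) + integral {u..v} (\<lambda>s. inner (z s) h) = integral {0..v} (\<lambda>s. inner (z s) h)"
      by (rule Henstock_Kurzweil_Integration.integral_combine) (use True uv a in \<open>auto simp: has_integral_integrable\<close>)
    ultimately show ?thesis using a b by (metis add_0 has_integral_iff)
  qed simp
  have ae: "AE s in lebesgue_on {0..\<omega>}. inner (z s) h = 0" for h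
    using i0[of 0 \<omega> h] by (intro zero_integrals_imp_AE_zero) (auto simp: has_integral_integrable intro!: integral_unique i0)
  obtain C where C: "countable C" "AE s in lebesgue_on {0..\<omega>}. z s \<in> closure C"
    using strongly_measurable_separable[OF L2_space_strongly_measurable[OF z(1)]] .
  have "AE s in lebesgue_on {0..\<omega>}. \<forall>h\<in>C. inner (z s) h = 0"
    using C(1) ae by (subst AE_ball_countable) auto
  then show ?thesis
    unfolding L2_eq_def using C(2)
  proof eventually_elim
    case (elim s)
    have "closed {h. inner (z s) h = 0}" by (intro closed_Collect_eq continuous_intros)
    moreover have "C \<subseteq> {h. inner (z s) h = 0}" using elim(1) by blast
    ultimately have "closure C \<subseteq> {h. inner (z s) h = 0}" by (rule closure_minimal[rotated])
    then show ?case using elim(2) by auto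
  qed
qed

subsection \<open>Parseval's identity\<close>

lemma L2_eq_trans: "L2_eq \<omega> x y \<Longrightarrow> L2_eq \<omega> y z \<Longrightarrow> L2_eq \<omega> x z"
  unfolding L2_eq_def by (rule AE_mp) (auto elim: eventually_mono)

lemma L2_eq_iff_fourier:
  assumes w: "\<omega> > 0" and "x \<in> L2_space \<omega>" "y \<in> L2_space \<omega>"
  shows "L2_eq \<omega> x y \<longleftrightarrow> fourier_seq \<omega> x = fourier_seq \<omega> y"
proof
  assume "L2_eq \<omega> x y"
  then have "fourier_coeff \<omega> x = fourier_coeff \<omega> y" by (intro ext fourier_coeff_L2_eq)
  then show "fourier_seq \<omega> x = fourier_seq \<omega> y" by (simp add: fourier_seq_def)
next
  assume "fourier_seq \<omega> x = fourier_seq \<omega> y"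
  then have "fourier_coeff \<omega> x n = fourier_coeff \<omega> y n" for n
    using entry_fourier_seq[OF w assms(2), of n] entry_fourier_seq[OF w assms(3), of n] by simp
  then have "L2_eq \<omega> (\<lambda>s. x s - y s) (\<lambda>s. 0)"
    using assms by (intro fourier_uniqueness w L2_space_minus) (auto simp: fourier_coeff_minus)
  then show "L2_eq \<omega> x y" unfolding L2_eq_def by simp
qed

text \<open>The Riesz-Fischer theorem gives a function with the same coefficients that satisfies the upper bound;
  by uniqueness it is the given one.\<close>

lemma parseval:
  assumes w: "\<omega> > 0" and x: "x \<in> L2_space \<omega>"
  shows "sq \<omega> x = \<omega> * (norm (fourier_seq \<omega> x))\<^sup>2"
proof (rule antisym)
  obtain y where y: "y \<in> L2_space \<omega>" "\<And>n. fourier_coeff \<omega> y n = entry (fourier_seq \<omega> x) n"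
    "sq \<omega> y \<le> \<omega> * (norm (fourier_seq \<omega> x))\<^sup>2" using riesz_fischer[OF w, of "fourier_seq \<omega> x"] by blast
  have "fourier_seq \<omega> y = fourier_seq \<omega> x" by (rule ell2_eqI) (simp add: entry_fourier_seq[OF w y(1)] y(2))
  then have "L2_eq \<omega> y x" using L2_eq_iff_fourier[OF w y(1) x] by simp
  then have "sq \<omega> y = sq \<omega> x" by (rule L2_eq_integral[where f = "\<lambda>s v. (norm v)\<^sup>2"]) auto
  with y(3) show "sq \<omega> x \<le> \<omega> * (norm (fourier_seq \<omega> x))\<^sup>2" by simp
  have "(\<Sum>\<^sub>\<infinity>n. (norm (entry (fourier_seq \<omega> x) n))\<^sup>2) \<le> sq \<omega> x / \<omega>"
  proof (rule infsum_le_finite_sums[OF summable_entry])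
    fix F :: "int set" assume "finite F"
    from bessel[OF w x this] show "(\<Sum>n\<in>F. (norm (entry (fourier_seq \<omega> x) n))\<^sup>2) \<le> sq \<omega> x / \<omega>"
      using w by (simp add: entry_fourier_seq[OF w x] field_simps)
  qed
  then show "\<omega> * (norm (fourier_seq \<omega> x))\<^sup>2 \<le> sq \<omega> x"
    using w by (simp add: norm_ell2_squared field_simps)
qed

lemma L2_norm_fourier_seq:
  assumes w: "\<omega> > 0" and x: "x \<in> L2_space \<omega>"
  shows "L2_norm \<omega> x = norm (fourier_seq \<omega> x)"
  unfolding L2_norm_def parseval[OF assms] using w by simp

text \<open>A right inverse of the Fourier transform, determined up to equality almost everywhere.\<close>

definition synth :: "real \<Rightarrow> 'h::complex_hilbert vec2 \<Rightarrow> real \<Rightarrow> 'h" where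
  "synth \<omega> c = (SOME x. x \<in> L2_space \<omega> \<and> fourier_seq \<omega> x = c)"

lemma synth:
  assumes w: "\<omega> > 0"
  shows "synth \<omega> c \<in> L2_space \<omega>" "fourier_seq \<omega> (synth \<omega> c) = c"
proof -
  obtain y where y: "y \<in> L2_space \<omega>" "\<And>n. fourier_coeff \<omega> y n = entry c n"
    using riesz_fischer[OF w, of c] by blast
  have "fourier_seq \<omega> y = c" by (rule ell2_eqI) (simp add: entry_fourier_seq[OF w y(1)] y(2))
  with y(1) have "synth \<omega> c \<in> L2_space \<omega> \<and> fourier_seq \<omega> (synth \<omega> c) = c"
    unfolding synth_def by (intro someI[of "\<lambda>x. x \<in> L2_space \<omega> \<and> fourier_seq \<omega> x = c" y]) simp
  then show "synth \<omega> c \<in> L2_space \<omega>" "fourier_seq \<omega> (synth \<omega> c) = c" by auto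
qed


section \<open>The domain of the derivative\<close>

text \<open>The Cauchy-Schwarz inequality with the constant function 1, from the integral of the squared deviation of
  the norm from its mean \<open>m / \<omega>\<close>.\<close>

lemma integral_norm_squared_le:
  assumes w: "\<omega> > 0" and u: "u \<in> L2_space \<omega>"
  shows "(integral {0..\<omega>} (\<lambda>s. norm (u s)))\<^sup>2 \<le> \<omega> * sq \<omega> u"
proof -
  define m where "m = integral {0..\<omega>} (\<lambda>s. norm (u s))"
  have "((\<lambda>s. (norm (u s))\<^sup>2 - 2 * (m / \<omega>) * norm (u s) + (m / \<omega>)\<^sup>2) has_integral
      sq \<omega> u - 2 * (m / \<omega>) * m + (\<omega> - 0) *\<^sub>R (m / \<omega>)\<^sup>2) {0..\<omega>}"
    unfolding m_def using w
    by (intro has_integral_add has_integral_diff has_integral_mult_right integrable_integral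
        L2_space_sq_integrable L2_space_integrable u has_integral_const_real[where a=0 and b=\<omega>, simplified, THEN has_integral_eq_rhs]) auto
  then have "0 \<le> sq \<omega> u - 2 * (m / \<omega>) * m + (\<omega> - 0) *\<^sub>R (m / \<omega>)\<^sup>2"
  proof (rule has_integral_nonneg)
    fix s
    have "(norm (u s))\<^sup>2 - 2 * (m / \<omega>) * norm (u s) + (m / \<omega>)\<^sup>2 = (norm (u s) - m / \<omega>)\<^sup>2"
      by (simp add: power2_diff)
    then show "0 \<le> (norm (u s))\<^sup>2 - 2 * (m / \<omega>) * norm (u s) + (m / \<omega>)\<^sup>2" by simp
  qed
  then have "m\<^sup>2 / \<omega> \<le> sq \<omega> u" using w by (simp add: power2_eq_square field_simps)
  then show ?thesis using w unfolding m_def[symmetric] by (simp add: field_simps)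
qed

lemma sq_minus_partial_sum_tendsto:
  assumes w: "\<omega> > 0" and z: "z \<in> L2_space \<omega>"
  shows "((\<lambda>F. sq \<omega> (\<lambda>s. z s - trig \<omega> F (fourier_coeff \<omega> z) s)) \<longlongrightarrow> 0) (finite_subsets_at_top UNIV)"
proof -
  have e: "sq \<omega> (\<lambda>s. z s - trig \<omega> F (fourier_coeff \<omega> z) s) = \<omega> * ((norm (fourier_seq \<omega> z))\<^sup>2 - (\<Sum>n\<in>F. (norm (entry (fourier_seq \<omega> z) n))\<^sup>2))"
    if "finite F" for F
    using sq_minus_trig[OF w z that, of "fourier_coeff \<omega> z"] parseval[OF w z]
    by (simp add: entry_fourier_seq[OF w z] power2_norm_eq_inner right_diff_distrib)
  have "((\<lambda>F. \<omega> * ((norm (fourier_seq \<omega> z))\<^sup>2 - (\<Sum>n\<in>F. (norm (entry (fourier_seq \<omega> z) n))\<^sup>2))) \<longlongrightarrow> \<omega> * ((norm (fourier_seq \<omega> z))\<^sup>2 - (norm (fourier_seq \<omega> z))\<^sup>2)) (finite_subsets_at_top UNIV)"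
    unfolding norm_ell2_squared by (intro tendsto_intros infsum_tendsto summable_entry)
  then have "((\<lambda>F. \<omega> * ((norm (fourier_seq \<omega> z))\<^sup>2 - (\<Sum>n\<in>F. (norm (entry (fourier_seq \<omega> z) n))\<^sup>2))) \<longlongrightarrow> 0) (finite_subsets_at_top UNIV)"
    by simp
  then show ?thesis
    by (rule tendsto_cong[THEN iffD1, rotated]) (auto intro!: eventually_finite_subsets_at_top_weakI simp: e)
qed

text \<open>Integration from 0 to \<open>t\<close> is continuous in the mean, so Fourier series may be integrated term by term.
  At \<open>n = 0\<close> the factor is 0 by division by 0, in agreement with the vanishing coefficient.\<close>

lemma has_sum_initial_integral:
  fixes z :: "real \<Rightarrow> 'h::complex_hilbert"
  assumes w: "\<omega> > 0" and z: "z \<in> L2_space \<omega>" and z0: "fourier_coeff \<omega> z 0 = 0" and t: "0 \<le> t" "t \<le> \<omega>"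
  shows "((\<lambda>n. ((E \<omega> n t - 1) / (\<i> * of_real (2 * pi * of_int n / \<omega>))) *\<^sub>C fourier_coeff \<omega> z n) has_sum integral {0..t} z) UNIV"
    (is "(?g has_sum _) UNIV")
proof -
  have sub: "{0..t} \<subseteq> {0..\<omega>}" using t by auto
  have tr: "(trig \<omega> F (fourier_coeff \<omega> z) has_integral (\<Sum>n\<in>F. ?g n)) {0..t}" if "finite F" for F
    unfolding trig_def[abs_def]
  proof (intro has_integral_sum that)
    fix n
    show "((\<lambda>s. E \<omega> n s *\<^sub>C fourier_coeff \<omega> z n) has_integral ?g n) {0..t}"
    proof (cases "n = 0")
      case False
      from has_integral_linear[OF E_has_integral[OF w False t(1)] bounded_linear_scaleC_left[of "fourier_coeff \<omega> z n"]]
      show ?thesis by (simp only: o_def)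
    qed (simp add: z0)
  qed
  have bd: "norm ((\<Sum>n\<in>F. ?g n) - integral {0..t} z) \<le> sqrt (\<omega> * sq \<omega> (\<lambda>s. z s - trig \<omega> F (fourier_coeff \<omega> z) s))"
    if F: "finite F" for F
  proof -
    let ?u = "\<lambda>s. z s - trig \<omega> F (fourier_coeff \<omega> z) s"
    have uL: "?u \<in> L2_space \<omega>" by (intro L2_space_minus z trig_L2)
    note ui = L2_space_integrable[OF uL]
    have zi: "z integrable_on {0..t}" by (rule integrable_on_subinterval[OF L2_space_integrable(1)[OF z] sub])
    have "integral {0..t} ?u = integral {0..t} z - (\<Sum>n\<in>F. ?g n)"
      using has_integral_diff[OF integrable_integral[OF zi] tr[OF F]] by (rule integral_unique)
    then have "norm ((\<Sum>n\<in>F. ?g n) - integral {0..t} z) = norm (integral {0..t} ?u)"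
      by (simp only: norm_minus_commute)
    also have "\<dots> \<le> integral {0..t} (\<lambda>s. norm (?u s))"
      by (rule integral_norm_bound_integral[OF integrable_on_subinterval[OF ui(1) sub] integrable_on_subinterval[OF ui(2) sub]]) simp
    also have "\<dots> \<le> integral {0..\<omega>} (\<lambda>s. norm (?u s))"
      by (rule integral_subset_le[OF sub integrable_on_subinterval[OF ui(2) sub] ui(2)]) simp
    also have "\<dots> \<le> sqrt (\<omega> * sq \<omega> ?u)"
      by (rule real_le_rsqrt[OF integral_norm_squared_le[OF w uL]])
    finally show ?thesis .
  qed
  have "((\<lambda>F. sqrt (\<omega> * sq \<omega> (\<lambda>s. z s - trig \<omega> F (fourier_coeff \<omega> z) s))) \<longlongrightarrow> sqrt (\<omega> * 0)) (finite_subsets_at_top UNIV)"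
    by (intro tendsto_intros sq_minus_partial_sum_tendsto w z)
  then have l: "((\<lambda>F. sqrt (\<omega> * sq \<omega> (\<lambda>s. z s - trig \<omega> F (fourier_coeff \<omega> z) s))) \<longlongrightarrow> 0) (finite_subsets_at_top UNIV)"
    by simp
  have "((\<lambda>F. (\<Sum>n\<in>F. ?g n) - integral {0..t} z) \<longlongrightarrow> 0) (finite_subsets_at_top UNIV)"
    by (rule Lim_null_comparison[OF _ l], rule eventually_finite_subsets_at_top_weakI, rule bd)
  then show ?thesis unfolding has_sum_def by (simp only: LIM_zero_iff)
qed

lemma norm_E_scaleC: "norm (E \<omega> n s *\<^sub>C x) = norm (x :: 'h::complex_hilbert)"
  by (simp add: norm_scaleC)

lemma summable_E:
  fixes e :: "int \<Rightarrow> 'h::complex_hilbert"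
  assumes "(\<lambda>n. norm (e n)) summable_on UNIV"
  shows "(\<lambda>n. E \<omega> n s *\<^sub>C e n) summable_on UNIV"
  by (rule abs_summable_summable) (simp only: norm_E_scaleC assms)

lemma infsum_minus_partial_le:
  fixes e :: "int \<Rightarrow> 'h::complex_hilbert"
  assumes s: "(\<lambda>n. norm (e n)) summable_on UNIV" and F: "finite F"
    and d: "\<And>G. finite G \<Longrightarrow> G \<inter> F = {} \<Longrightarrow> (\<Sum>n\<in>G. norm (e n)) \<le> \<epsilon>"
  shows "norm ((\<Sum>\<^sub>\<infinity>n. E \<omega> n t *\<^sub>C e n) - trig \<omega> F e t) \<le> \<epsilon>"
proof -
  let ?f = "\<lambda>n. E \<omega> n t *\<^sub>C e n"
  have sF: "?f summable_on UNIV - F" by (rule summable_on_subset_banach[OF summable_E[OF s]]) simp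
  have nF: "(\<lambda>n. norm (e n)) summable_on UNIV - F" by (rule summable_on_subset_banach[OF s]) simp
  have "infsum ?f (F \<union> (UNIV - F)) = infsum ?f F + infsum ?f (UNIV - F)"
    by (rule infsum_Un_disjoint) (use F sF in auto)
  then have "infsum ?f UNIV - trig \<omega> F e t = infsum ?f (UNIV - F)"
    using F by (simp add: trig_def)
  also have "norm \<dots> \<le> (\<Sum>\<^sub>\<infinity>n\<in>UNIV - F. norm (?f n))"
    by (rule norm_infsum_bound) (simp only: norm_E_scaleC nF)
  also have "\<dots> \<le> \<epsilon>"
    unfolding norm_E_scaleC by (rule infsum_le_finite_sums[OF nF]) (auto intro!: d)
  finally show ?thesis .
qed

lemma abs_tail_sequence:
  fixes e :: "int \<Rightarrow> 'h::real_normed_vector"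
  assumes s: "(\<lambda>n. norm (e n)) summable_on UNIV" and "\<epsilon> > 0"
  shows "\<exists>N::nat. \<forall>M\<ge>N. \<forall>G. finite G \<longrightarrow> G \<inter> {- int M..int M} = {} \<longrightarrow> (\<Sum>n\<in>G. norm (e n)) \<le> \<epsilon>"
proof -
  obtain F0 where F0: "finite F0" "\<And>F. finite F \<Longrightarrow> F \<inter> F0 = {} \<Longrightarrow> (\<Sum>n\<in>F. norm (e n)) \<le> \<epsilon>"
    using summable_tail[OF s _ \<open>\<epsilon> > 0\<close>] by auto
  have "finite (abs ` F0)" using F0(1) by simp
  then obtain M where M: "\<And>q. q \<in> abs ` F0 \<Longrightarrow> q \<le> M" using Max_ge by blast
  have "F0 \<subseteq> {- int m..int m}" if "m \<ge> nat M" for m using M that by fastforce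
  then show ?thesis using F0(2) by (intro exI[of _ "nat M"]) blast
qed

lemma abs_convergent_series:
  fixes e :: "int \<Rightarrow> 'h::complex_hilbert"
  assumes w: "\<omega> > 0" and s: "(\<lambda>n. norm (e n)) summable_on UNIV"
  shows "(\<lambda>t. \<Sum>\<^sub>\<infinity>n. E \<omega> n t *\<^sub>C e n) \<in> L2_space \<omega>"
    "continuous_on {0..\<omega>} (\<lambda>t. \<Sum>\<^sub>\<infinity>n. E \<omega> n t *\<^sub>C e n)"
proof -
  let ?Y = "\<lambda>t. \<Sum>\<^sub>\<infinity>n. E \<omega> n t *\<^sub>C e n"
  let ?T = "\<lambda>N::nat. trig \<omega> {- int N..int N} e"
  have close: "\<exists>N. \<forall>M\<ge>N. \<forall>t. norm (?Y t - ?T M t) \<le> \<epsilon>" if eps: "\<epsilon> > 0" for \<epsilon>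
  proof -
    obtain N :: nat where N: "\<forall>M\<ge>N. \<forall>G. finite G \<longrightarrow> G \<inter> {- int M..int M} = {} \<longrightarrow> (\<Sum>n\<in>G. norm (e n)) \<le> \<epsilon>"
      using abs_tail_sequence[OF s eps] by blast
    have "norm (?Y t - ?T M t) \<le> \<epsilon>" if "M \<ge> N" for M t
      by (rule infsum_minus_partial_le[OF s]) (use N that in auto)
    then show ?thesis by blast
  qed
  have lim: "uniform_limit UNIV ?T ?Y sequentially"
    unfolding uniform_limit_iff eventually_sequentially dist_norm
  proof (intro allI impI)
    fix \<epsilon> :: real assume "\<epsilon> > 0"
    then obtain N where N: "\<forall>M\<ge>N. \<forall>t. norm (?Y t - ?T M t) \<le> \<epsilon>/2" using close[of "\<epsilon>/2"] by auto
    have "norm (?T n t - ?Y t) < \<epsilon>" if "n \<ge> N" for n t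
    proof -
      have "norm (?T n t - ?Y t) \<le> \<epsilon>/2" using N that by (subst norm_minus_commute) blast
      then show ?thesis using \<open>\<epsilon> > 0\<close> by linarith
    qed
    then show "\<exists>N. \<forall>n\<ge>N. \<forall>t\<in>UNIV. norm (?T n t - ?Y t) < \<epsilon>" by blast
  qed
  have cT: "continuous_on A (?T N)" for N A
    unfolding trig_def
    by (intro continuous_on_sum bounded_linear.continuous_on[OF bounded_linear_scaleC_left] continuous_on_E)
  show "continuous_on {0..\<omega>} ?Y"
    by (rule uniform_limit_theorem[OF always_eventually uniform_limit_on_subset[OF lim]]) (auto intro: cT)
  have sqT: "sq \<omega> (?T N) \<le> \<omega> * (\<Sum>\<^sub>\<infinity>n. norm (e n))\<^sup>2" for N
  proof -
    have "(norm (?T N t))\<^sup>2 \<le> (\<Sum>\<^sub>\<infinity>n. norm (e n))\<^sup>2" for t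
    proof (rule power_mono)
      have "norm (?T N t) \<le> (\<Sum>n\<in>{- int N..int N}. norm (e n))"
        unfolding trig_def by (rule order_trans[OF norm_sum]) (simp only: norm_E_scaleC order_refl)
      also have "\<dots> \<le> (\<Sum>\<^sub>\<infinity>n. norm (e n))" by (rule finite_sum_le_infsum[OF s]) auto
      finally show "norm (?T N t) \<le> (\<Sum>\<^sub>\<infinity>n. norm (e n))" .
    qed simp
    then have "sq \<omega> (?T N) \<le> integral {0..\<omega>} (\<lambda>t. (\<Sum>\<^sub>\<infinity>n. norm (e n))\<^sup>2)"
      by (intro integral_le L2_space_sq_integrable trig_L2 integrable_const_ivl) auto
    then show ?thesis using w by simp
  qed
  show "?Y \<in> L2_space \<omega>"
    by (rule L2_space_AE_limit(1)[of ?T, OF trig_L2 sqT], intro AE_I2 tendsto_uniform_limitI[OF lim]) simp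
qed

lemma sq_le_sup:
  assumes "\<omega> > 0" "x \<in> L2_space \<omega>" "\<And>s. s \<in> {0..\<omega>} \<Longrightarrow> norm (x s) \<le> K"
  shows "sq \<omega> x \<le> \<omega> * K\<^sup>2"
proof -
  have "sq \<omega> x \<le> integral {0..\<omega>} (\<lambda>s. K\<^sup>2)"
    using assms(3) by (intro integral_le L2_space_sq_integrable assms(2) integrable_const_ivl power_mono) auto
  then show ?thesis using assms(1) by simp
qed

lemma norm_fourier_coeff_le:
  assumes "\<omega> > 0" "x \<in> L2_space \<omega>"
  shows "\<omega> * (norm (fourier_coeff \<omega> x n))\<^sup>2 \<le> sq \<omega> x"
  using bessel[OF assms, of "{n}"] by simp

lemma fourier_coeff_abs_convergent:
  fixes e :: "int \<Rightarrow> 'h::complex_hilbert"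
  assumes w: "\<omega> > 0" and s: "(\<lambda>n. norm (e n)) summable_on UNIV"
    and x: "x \<in> L2_space \<omega>" "\<And>t. t \<in> {0..\<omega>} \<Longrightarrow> x t = (\<Sum>\<^sub>\<infinity>n. E \<omega> n t *\<^sub>C e n)"
  shows "fourier_coeff \<omega> x n = e n"
proof -
  have "norm (fourier_coeff \<omega> x n - e n) \<le> 0 + \<epsilon>" if eps: "\<epsilon> > 0" for \<epsilon>
  proof -
    obtain N :: nat where N: "\<forall>M\<ge>N. \<forall>G. finite G \<longrightarrow> G \<inter> {- int M..int M} = {} \<longrightarrow> (\<Sum>n\<in>G. norm (e n)) \<le> \<epsilon>"
      using abs_tail_sequence[OF s eps] by blast
    define F where "F = {- int (max N (nat \<bar>n\<bar>))..int (max N (nat \<bar>n\<bar>))}"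
    have F: "finite F" "n \<in> F" by (auto simp: F_def)
    let ?u = "\<lambda>t. x t - trig \<omega> F e t"
    have uL: "?u \<in> L2_space \<omega>" by (intro L2_space_minus x trig_L2)
    have "norm (?u t) \<le> \<epsilon>" if "t \<in> {0..\<omega>}" for t
      unfolding x(2)[OF that] 
    proof (rule infsum_minus_partial_le[OF s F(1)])
      fix G :: "int set" assume "finite G" "G \<inter> F = {}"
      then show "(\<Sum>n\<in>G. norm (e n)) \<le> \<epsilon>"
        using N[rule_format, of "max N (nat \<bar>n\<bar>)" G] unfolding F_def by simp
    qed
    from sq_le_sup[OF w uL this] norm_fourier_coeff_le[OF w uL, of n]
    have "\<omega> * (norm (fourier_coeff \<omega> ?u n))\<^sup>2 \<le> \<omega> * \<epsilon>\<^sup>2" by linarith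
    then have "(norm (fourier_coeff \<omega> ?u n))\<^sup>2 \<le> \<epsilon>\<^sup>2" using w by (simp only: mult_le_cancel_left_pos)
    then have "norm (fourier_coeff \<omega> ?u n) \<le> \<epsilon>" by (rule power2_le_imp_le) (use eps in simp)
    moreover have "fourier_coeff \<omega> ?u n = fourier_coeff \<omega> x n - e n"
      unfolding fourier_coeff_minus[OF x(1) trig_L2] fourier_coeff_trig[OF w F(1)] using F(2) by simp
    ultimately show ?thesis by simp
  qed
  then have "norm (fourier_coeff \<omega> x n - e n) \<le> 0" by (rule field_le_epsilon)
  then show ?thesis by simp
qed

text \<open>The eigenvalues of the derivative with periodic boundary condition are the integer multiples of this
  number.\<close>

definition ik :: "real \<Rightarrow> complex" where
  "ik \<omega> = \<i> * of_real (2 * pi / \<omega>)"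

lemma ik_nonzero: "\<omega> > 0 \<Longrightarrow> ik \<omega> \<noteq> 0"
  by (simp add: ik_def)

lemma ik_mult: "\<i> * of_real (2 * pi * of_int n / \<omega>) = of_int n * ik \<omega>"
  by (simp add: ik_def)

text \<open>Integrating the derivative term by term represents \<open>y\<close> by an absolutely convergent trigonometric
  series, from which the coefficients of \<open>y\<close> can be read off.\<close>

lemma derivative_fourier_coeff:
  fixes y :: "real \<Rightarrow> 'h::complex_hilbert"
  assumes w: "\<omega> > 0" and y: "y \<in> W21 \<omega>" "y 0 = y \<omega>" and z: "is_L2_derivative \<omega> y z"
  shows "fourier_coeff \<omega> z n = (of_int n * ik \<omega>) *\<^sub>C fourier_coeff \<omega> y n"
proof -
  have zL: "z \<in> L2_space \<omega>" and yz: "\<And>t. t \<in> {0..\<omega>} \<Longrightarrow> y t = y 0 + integral {0..t} z"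
    and yL: "y \<in> L2_space \<omega>"
    using y(1) z unfolding is_L2_derivative_def W21_def by blast+
  have "integral {0..\<omega>} z = 0" using yz[of \<omega>] y(2) w by simp
  then have z0: "fourier_coeff \<omega> z 0 = 0" by (simp add: fourier_coeff_alt cis_zero)
  define c where "c n = (1 / (of_int n * ik \<omega>)) *\<^sub>C fourier_coeff \<omega> z n" for n
  have sc: "(\<lambda>n. norm (c n)) summable_on UNIV"
  proof -
    have "norm (c n) = norm (entry inv_index n) * norm (entry (fourier_seq \<omega> z) n) * (1 / cmod (ik \<omega>))" for n
      by (simp add: c_def norm_scaleC entry_inv_index entry_fourier_seq[OF w zL] norm_mult norm_divide)
    then show ?thesis
      using summable_on_cmult_left[OF summable_on_product[OF summable_entry[of inv_index] summable_entry[of "fourier_seq \<omega> z"]], of "1 / cmod (ik \<omega>)"]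
      by simp
  qed
  define b where "b = y 0 - infsum c UNIV"
  define e where "e n = (if n = 0 then b else c n)" for n
  have e_alt: "e n = c n + (if n \<in> {0} then b else 0)" for n
    by (auto simp: e_def c_def)
  have sb: "((\<lambda>n. (if n \<in> {0::int} then b else 0)) has_sum b) UNIV"
    by (rule has_sum_finite_neutralI[of "{0}"]) auto
  have se: "(\<lambda>n. norm (e n)) summable_on UNIV"
  proof -
    have "(\<lambda>n. norm (if n \<in> {0::int} then b else 0)) summable_on UNIV"
      by (rule finite_nonzero_values_imp_summable_on, rule finite_subset[of _ "{0}"]) auto
    from summable_on_add[OF sc this] show ?thesis
      by (rule summable_on_comparison_test) (auto simp: e_alt intro: norm_triangle_ineq)
  qed
  have "y t = (\<Sum>\<^sub>\<infinity>n. E \<omega> n t *\<^sub>C e n)" if t: "t \<in> {0..\<omega>}" for t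
  proof -
    have "((\<lambda>n. E \<omega> n t *\<^sub>C c n - c n) has_sum integral {0..t} z) UNIV"
    proof (rule has_sum_cong[THEN iffD1, OF _ has_sum_initial_integral[OF w zL z0, of t]])
      fix n
      show "((E \<omega> n t - 1) / (\<i> * of_real (2 * pi * of_int n / \<omega>))) *\<^sub>C fourier_coeff \<omega> z n = E \<omega> n t *\<^sub>C c n - c n"
        unfolding ik_mult c_def scaleC_scaleC scaleC_minus_left[symmetric] by (simp only: left_diff_distrib diff_divide_distrib mult_1_right mult_1_left times_divide_eq_right)
    qed (use t in auto)
    from has_sum_add[OF this has_sum_infsum[OF abs_summable_summable[OF sc]]]
    have "((\<lambda>n. E \<omega> n t *\<^sub>C c n) has_sum (integral {0..t} z + infsum c UNIV)) UNIV" by simp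
    from has_sum_add[OF this sb]
    have "((\<lambda>n. E \<omega> n t *\<^sub>C e n) has_sum (integral {0..t} z + infsum c UNIV + b)) UNIV"
      by (rule has_sum_cong[THEN iffD1, rotated]) (auto simp: e_def c_def cis_zero)
    then have "(\<Sum>\<^sub>\<infinity>n. E \<omega> n t *\<^sub>C e n) = integral {0..t} z + infsum c UNIV + b" by (rule infsumI)
    then show ?thesis using yz[OF t] by (simp add: b_def)
  qed
  from fourier_coeff_abs_convergent[OF w se yL this] have "fourier_coeff \<omega> y n = e n" .
  then show ?thesis
    using z0 ik_nonzero[OF w] by (cases "n = 0") (simp_all add: e_def c_def scaleC_scaleC)
qed

lemma continuous_L2_eq_imp_eq:
  fixes y y' :: "real \<Rightarrow> 'h::complex_hilbert"
  assumes w: "\<omega> > 0" and "continuous_on {0..\<omega>} y" "continuous_on {0..\<omega>} y'" and e: "L2_eq \<omega> y y'"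
    and t: "t \<in> {0..\<omega>}"
  shows "y t = y' t"
proof -
  obtain N where N: "negligible N" "\<And>s. s \<in> {0..\<omega>} - N \<Longrightarrow> y s = y' s"
    using e unfolding L2_eq_def AE_interval_iff by blast
  have "integral {0..\<omega>} (\<lambda>s. (norm (y s - y' s))\<^sup>2) = integral {0..\<omega>} (\<lambda>s. 0)"
    by (rule integral_spike[OF N(1)]) (use N(2) in auto)
  moreover have "continuous_on {0..\<omega>} (\<lambda>s. (norm (y s - y' s))\<^sup>2)"
    using assms by (intro continuous_intros)
  ultimately have "(norm (y t - y' t))\<^sup>2 = 0"
    using integral_eq_0_iff[of 0 \<omega> "\<lambda>s. (norm (y s - y' s))\<^sup>2"] w t by simp
  then show ?thesis by simp
qed

lemma has_sum_minus:
  fixes f g :: "'a \<Rightarrow> 'b::real_normed_vector"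
  assumes "(f has_sum a) A" "(g has_sum b) A"
  shows "((\<lambda>x. f x - g x) has_sum (a - b)) A"
  using has_sum_add[OF assms(1) has_sum_bounded_linear[OF bounded_linear_minus[OF bounded_linear_ident] assms(2)]] by simp

text \<open>A Fourier series that stays square-summable after multiplication by the index is absolutely
  convergent, and it is the integral of the series differentiated term by term.\<close>

lemma dom_L0_of_fourier:
  fixes x :: "real \<Rightarrow> 'h::complex_hilbert"
  assumes w: "\<omega> > 0" and x: "x \<in> L2_space \<omega>" and N: "times_index (fourier_seq \<omega> x) u"
  shows "x \<in> dom_L0 \<omega>"
    "L2_eq \<omega> x (\<lambda>t. \<Sum>\<^sub>\<infinity>n. E \<omega> n t *\<^sub>C fourier_coeff \<omega> x n)"
proof -
  define y where "y = (\<lambda>t. \<Sum>\<^sub>\<infinity>n. E \<omega> n t *\<^sub>C fourier_coeff \<omega> x n)"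
  have s: "(\<lambda>n. norm (fourier_coeff \<omega> x n)) summable_on UNIV"
    using dom_index_abs_summable[OF N] by (simp add: entry_fourier_seq[OF w x])
  note ss = abs_summable_summable[OF s]
  have yL: "y \<in> L2_space \<omega>" and yc: "continuous_on {0..\<omega>} y"
    unfolding y_def by (rule abs_convergent_series[OF w s])+
  have fy: "fourier_coeff \<omega> y n = fourier_coeff \<omega> x n" for n
    by (rule fourier_coeff_abs_convergent[OF w s yL]) (simp add: y_def)
  define z where "z = synth \<omega> (cmul (\<lambda>_. ik \<omega>) u)"
  have zL: "z \<in> L2_space \<omega>" unfolding z_def by (rule synth[OF w])
  have fz: "fourier_coeff \<omega> z n = (of_int n * ik \<omega>) *\<^sub>C fourier_coeff \<omega> x n" for n
  proof -
    have "fourier_coeff \<omega> z n = entry (cmul (\<lambda>_. ik \<omega>) u) n"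
      using entry_fourier_seq[OF w zL, of n] by (simp add: z_def synth[OF w])
    also have "\<dots> = ik \<omega> *\<^sub>C (real_of_int n *\<^sub>R fourier_coeff \<omega> x n)"
      using N by (simp add: entry_cmul_const times_index_def entry_fourier_seq[OF w x])
    also have "\<dots> = (of_int n * ik \<omega>) *\<^sub>C fourier_coeff \<omega> x n"
      by (metis mult.commute of_real_of_int_eq scaleC_of_real scaleC_scaleC)
    finally show ?thesis .
  qed
  have d: "y t = y 0 + integral {0..t} z" if t: "t \<in> {0..\<omega>}" for t
  proof -
    have a: "((\<lambda>n. E \<omega> n t *\<^sub>C fourier_coeff \<omega> x n - fourier_coeff \<omega> x n) has_sum (y t - infsum (fourier_coeff \<omega> x) UNIV)) UNIV"
      unfolding y_def
      by (intro has_sum_minus has_sum_infsum summable_E s ss)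
    have b: "y 0 = infsum (fourier_coeff \<omega> x) UNIV" by (simp add: y_def cis_zero)
    have c: "((\<lambda>n. E \<omega> n t *\<^sub>C fourier_coeff \<omega> x n - fourier_coeff \<omega> x n) has_sum integral {0..t} z) UNIV"
    proof (rule has_sum_cong[THEN iffD1, OF _ has_sum_initial_integral[OF w zL _, of t]])
      fix n
      show "((E \<omega> n t - 1) / (\<i> * of_real (2 * pi * of_int n / \<omega>))) *\<^sub>C fourier_coeff \<omega> z n =
          E \<omega> n t *\<^sub>C fourier_coeff \<omega> x n - fourier_coeff \<omega> x n"
      proof (cases "n = 0")
        case False
        then have "of_int n * ik \<omega> \<noteq> 0" using ik_nonzero[OF w] by simp
        then have "(E \<omega> n t - 1) / (of_int n * ik \<omega>) * (of_int n * ik \<omega>) = E \<omega> n t - 1" by simp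
        then show ?thesis unfolding ik_mult fz scaleC_scaleC by (simp only: scaleC_minus_left scaleC_one)
      qed (simp add: cis_zero)
    qed (use t in \<open>auto simp: fz\<close>)
    have "y t - infsum (fourier_coeff \<omega> x) UNIV = integral {0..t} z" by (rule has_sum_unique[OF a c])
    then show ?thesis unfolding b by (simp only: diff_eq_eq add.commute)
  qed
  have "is_L2_derivative \<omega> y z" unfolding is_L2_derivative_def using zL d by blast
  then have W: "y \<in> W21 \<omega>" unfolding W21_def using yL yc by blast
  have "y 0 = y \<omega>" unfolding y_def E_period[OF w] by (simp add: cis_zero)
  moreover have xy: "L2_eq \<omega> x y"
    unfolding L2_eq_iff_fourier[OF w x yL] fourier_seq_def using fy by presburger
  ultimately show "x \<in> dom_L0 \<omega>" unfolding dom_L0_def using x W by blast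
  show "L2_eq \<omega> x (\<lambda>t. \<Sum>\<^sub>\<infinity>n. E \<omega> n t *\<^sub>C fourier_coeff \<omega> x n)" using xy unfolding y_def .
qed

lemma L0_fourier:
  fixes x :: "real \<Rightarrow> 'h::complex_hilbert"
  assumes w: "\<omega> > 0" and x: "x \<in> dom_L0 \<omega>"
  shows "L0 \<omega> x \<in> L2_space \<omega>" "fourier_coeff \<omega> (L0 \<omega> x) n = (of_int n * ik \<omega>) *\<^sub>C fourier_coeff \<omega> x n"
proof -
  obtain y where y: "y \<in> W21 \<omega>" "y 0 = y \<omega>" "L2_eq \<omega> x y" using x unfolding dom_L0_def by blast
  have "\<exists>z. \<exists>y\<in>W21 \<omega>. L2_eq \<omega> x y \<and> is_L2_derivative \<omega> y z" using y(1,3) unfolding W21_def by blast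
  then have "\<exists>y\<in>W21 \<omega>. L2_eq \<omega> x y \<and> is_L2_derivative \<omega> y (L0 \<omega> x)"
    unfolding L0_def by (rule someI_ex)
  then obtain y' where y': "y' \<in> W21 \<omega>" "L2_eq \<omega> x y'" "is_L2_derivative \<omega> y' (L0 \<omega> x)" by blast
  have "L2_eq \<omega> y y'" using L2_eq_trans[OF L2_eq_sym[OF y(3)] y'(2)] .
  then have "y t = y' t" if "t \<in> {0..\<omega>}" for t
    using continuous_L2_eq_imp_eq[OF w _ _ _ that] y(1) y'(1) unfolding W21_def by blast
  from this[of 0] this[of \<omega>] have per: "y' 0 = y' \<omega>" using y(2) w by simp
  show "L0 \<omega> x \<in> L2_space \<omega>" using y'(3) by (simp add: is_L2_derivative_def)
  show "fourier_coeff \<omega> (L0 \<omega> x) n = (of_int n * ik \<omega>) *\<^sub>C fourier_coeff \<omega> x n"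
    unfolding derivative_fourier_coeff[OF w y'(1) per y'(3)] fourier_coeff_L2_eq[OF y'(2)] ..
qed

lemma dom_L0_times_index:
  fixes x :: "real \<Rightarrow> 'h::complex_hilbert"
  assumes w: "\<omega> > 0" and x: "x \<in> dom_L0 \<omega>"
  shows "x \<in> L2_space \<omega>" "times_index (fourier_seq \<omega> x) (cmul (\<lambda>_. 1 / ik \<omega>) (fourier_seq \<omega> (L0 \<omega> x)))"
proof -
  show xL: "x \<in> L2_space \<omega>" using x by (simp add: dom_L0_def)
  show "times_index (fourier_seq \<omega> x) (cmul (\<lambda>_. 1 / ik \<omega>) (fourier_seq \<omega> (L0 \<omega> x)))"
    unfolding times_index_def
  proof
    fix n
    have "(1 / ik \<omega>) *\<^sub>C ((of_int n * ik \<omega>) *\<^sub>C fourier_coeff \<omega> x n) = complex_of_real (of_int n) *\<^sub>C fourier_coeff \<omega> x n"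
      using ik_nonzero[OF w] by (simp add: scaleC_scaleC)
    then show "entry (cmul (\<lambda>_. 1 / ik \<omega>) (fourier_seq \<omega> (L0 \<omega> x))) n = real_of_int n *\<^sub>R entry (fourier_seq \<omega> x) n"
      by (simp add: entry_cmul_const entry_fourier_seq[OF w] xL L0_fourier[OF w x] scaleC_of_real del: of_real_of_int_eq)
  qed
qed


section \<open>The perturbation\<close>

lemma fourier_seq_add:
  assumes w: "\<omega> > 0" and "x \<in> L2_space \<omega>" "y \<in> L2_space \<omega>"
  shows "fourier_seq \<omega> (\<lambda>s. x s + y s) = fourier_seq \<omega> x + fourier_seq \<omega> y"
  by (rule ell2_eqI) (simp add: entry_simps entry_fourier_seq[OF w] L2_space_add assms fourier_coeff_add)

lemma fourier_seq_minus:
  assumes w: "\<omega> > 0" and "x \<in> L2_space \<omega>" "y \<in> L2_space \<omega>"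
  shows "fourier_seq \<omega> (\<lambda>s. x s - y s) = fourier_seq \<omega> x - fourier_seq \<omega> y"
  by (rule ell2_eqI) (simp add: entry_simps entry_fourier_seq[OF w] L2_space_minus assms fourier_coeff_minus)

lemma fourier_seq_scaleC:
  assumes w: "\<omega> > 0" and "x \<in> L2_space \<omega>"
  shows "fourier_seq \<omega> (\<lambda>s. c *\<^sub>C x s) = cmul (\<lambda>_. c) (fourier_seq \<omega> x)"
  by (rule ell2_eqI) (simp add: entry_cmul_const entry_fourier_seq[OF w] L2_space_scaleC assms fourier_coeff_scaleC)

lemma norm_fourier_seq_sum_le:
  assumes w: "\<omega> > 0" and "finite F" "\<And>i. i \<in> F \<Longrightarrow> f i \<in> L2_space \<omega>" "\<And>i. i \<in> F \<Longrightarrow> norm (fourier_seq \<omega> (f i)) \<le> B i"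
  shows "norm (fourier_seq \<omega> (\<lambda>s. \<Sum>i\<in>F. f i s)) \<le> sum B F"
  using assms(2-)
proof (induction F rule: finite_induct)
  case empty
  have "sq \<omega> (\<lambda>s. 0) = 0" by simp
  then show ?case using parseval[OF w L2_space_const[of 0]] w by simp
next
  case (insert i F)
  have "norm (fourier_seq \<omega> (\<lambda>s. f i s + (\<Sum>i\<in>F. f i s))) \<le> norm (fourier_seq \<omega> (f i)) + norm (fourier_seq \<omega> (\<lambda>s. \<Sum>i\<in>F. f i s))"
    using insert.prems by (subst fourier_seq_add[OF w]) (auto intro: L2_space_sum norm_triangle_ineq)
  also have "\<dots> \<le> B i + sum B F" using insert by (intro add_mono) auto
  finally show ?case using insert.hyps by simp
qed

lemma E_reflect: "\<omega> > 0 \<Longrightarrow> E \<omega> n (\<omega> - s) = E \<omega> (- n) s"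
proof -
  assume w: "\<omega> > 0"
  have "2 * pi * of_int n * (\<omega> - s) / \<omega> = 2 * pi * of_int n + 2 * pi * of_int (- n) * s / \<omega>"
    using w by (simp add: field_simps)
  then have "E \<omega> n (\<omega> - s) = cis (2 * pi * of_int n) * E \<omega> (- n) s" by (simp only: cis_mult)
  also have "cis (2 * pi * of_int n) = 1" by (rule cis_multiple_2pi) simp
  finally show ?thesis by simp
qed

definition scaleC_blinfun :: "complex \<Rightarrow> 'h::complex_hilbert \<Rightarrow>\<^sub>L 'h" where
  "scaleC_blinfun c = Blinfun (\<lambda>x. c *\<^sub>C x)"

lemma scaleC_blinfun_apply: "blinfun_apply (scaleC_blinfun c) x = c *\<^sub>C x"
  unfolding scaleC_blinfun_def by (simp add: bounded_linear_Blinfun_apply bounded_linear_scaleC)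

lemma clinear_scaleC_blinfun: "clinear (scaleC_blinfun c)"
  by (simp add: clinear_def scaleC_blinfun_apply scaleC_scaleC mult.commute)

lemma norm_scaleC_blinfun_compose_le: "norm (scaleC_blinfun c o\<^sub>L A) \<le> cmod c * norm A"
proof (rule norm_blinfun_bound)
  show "norm (blinfun_apply (scaleC_blinfun c o\<^sub>L A) x) \<le> cmod c * norm A * norm x" for x
    by (simp add: scaleC_blinfun_apply norm_scaleC mult.assoc mult_left_mono norm_blinfun)
qed simp

locale potential =
  fixes \<omega> :: real and \<V> :: "real \<Rightarrow> ('h::complex_hilbert \<Rightarrow>\<^sub>L 'h)"
  assumes w: "\<omega> > 0"
    and lin: "\<And>s c x. s \<in> {0..\<omega>} \<Longrightarrow> blinfun_apply (\<V> s) (c *\<^sub>C x) = c *\<^sub>C blinfun_apply (\<V> s) x"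
    and L2: "\<And>x. (\<lambda>s. blinfun_apply (\<V> s) x) \<in> L2_space \<omega>"
    and sumV: "(\<lambda>n. (norm (V_hat \<omega> \<V> n))\<^sup>2) summable_on (UNIV :: int set)"
begin

text \<open>The sublevel sets are closed by Fatou's lemma and cover the space, so one of them has
  interior points by Baire's theorem.\<close>

lemma potential_bounded:
  "\<exists>K\<ge>0. \<forall>h. sq \<omega> (\<lambda>s. blinfun_apply (\<V> s) h) \<le> K * (norm h)\<^sup>2"
proof -
  define A where "A N = {h. sq \<omega> (\<lambda>s. blinfun_apply (\<V> s) h) \<le> real N}" for N
  have cl: "closed (A N)" for N
    unfolding closed_sequential_limits
  proof (intro allI impI)
    fix H h assume H: "(\<forall>n. H n \<in> A N) \<and> H \<longlonglongrightarrow> h"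
    have "sq \<omega> (\<lambda>s. blinfun_apply (\<V> s) h) \<le> real N"
    proof (rule L2_space_AE_limit(2)[of "\<lambda>n s. blinfun_apply (\<V> s) (H n)", OF L2])
      show "sq \<omega> (\<lambda>s. blinfun_apply (\<V> s) (H n)) \<le> real N" for n using H by (auto simp: A_def)
      show "AE s in lebesgue_on {0..\<omega>}. (\<lambda>n. blinfun_apply (\<V> s) (H n)) \<longlonglongrightarrow> blinfun_apply (\<V> s) h"
        using H by (intro AE_I2 tendsto_intros) auto
    qed
    then show "h \<in> A N" by (simp add: A_def)
  qed
  have cov: "(\<Union>N. A N) = UNIV"
  proof -
    have "\<exists>N. h \<in> A N" for h using real_arch_simple by (auto simp: A_def)
    then show ?thesis by blast
  qed
  have mc: "Met_TC.mcomplete TYPE('h)"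
    unfolding Met_TC.mcomplete_def by (simp add: Cauchy_convergent_iff convergent_def)
  have "\<exists>N. interior (A N) \<noteq> {}"
  proof (rule ccontr)
    assume "\<not> ?thesis"
    then have "euclidean interior_of (\<Union>(range A)) = {}"
      using Met_TC.metric_Baire_category_alt[OF mc, of "range A"] cl by auto
    then show False using cov by simp
  qed
  then obtain N c r where r: "r > 0" "ball c r \<subseteq> A N"
    by (metis all_not_in_conv interior_subset open_contains_ball open_interior subset_trans)
  have small: "sq \<omega> (\<lambda>s. blinfun_apply (\<V> s) h) \<le> 4 * real N" if "norm h < r" for h
  proof -
    have "c + h \<in> A N" "c \<in> A N" using r that by (auto simp: subset_iff dist_norm)
    then have b: "sq \<omega> (\<lambda>s. blinfun_apply (\<V> s) (c + h)) \<le> real N" "sq \<omega> (\<lambda>s. blinfun_apply (\<V> s) c) \<le> real N"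
      by (auto simp: A_def)
    have "sq \<omega> (\<lambda>s. blinfun_apply (\<V> s) h) \<le> integral {0..\<omega>} (\<lambda>s. 2 * (norm (blinfun_apply (\<V> s) (c + h)))\<^sup>2 + 2 * (norm (blinfun_apply (\<V> s) c))\<^sup>2)"
    proof (rule integral_le[OF L2_space_sq_integrable[OF L2]])
      show "(\<lambda>s. 2 * (norm (blinfun_apply (\<V> s) (c + h)))\<^sup>2 + 2 * (norm (blinfun_apply (\<V> s) c))\<^sup>2) integrable_on {0..\<omega>}"
        by (intro integrable_add integrable_on_mult_right L2_space_sq_integrable L2)
      show "(norm (blinfun_apply (\<V> s) h))\<^sup>2 \<le> 2 * (norm (blinfun_apply (\<V> s) (c + h)))\<^sup>2 + 2 * (norm (blinfun_apply (\<V> s) c))\<^sup>2" for s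
        using norm_add_squared_le[of "blinfun_apply (\<V> s) (c + h)" "- blinfun_apply (\<V> s) c"]
        by (simp add: blinfun.add_right)
    qed
    also have "\<dots> = 2 * sq \<omega> (\<lambda>s. blinfun_apply (\<V> s) (c + h)) + 2 * sq \<omega> (\<lambda>s. blinfun_apply (\<V> s) c)"
      by (subst integral_add) (intro integrable_on_mult_right L2_space_sq_integrable L2 | simp)+
    finally show ?thesis using b by linarith
  qed
  have "sq \<omega> (\<lambda>s. blinfun_apply (\<V> s) h) \<le> 16 * real N / r\<^sup>2 * (norm h)\<^sup>2" for h
  proof (cases "h = 0")
    case False
    define a where "a = r / (2 * norm h)"
    have a: "a > 0" using r False by (simp add: a_def)
    have "norm (a *\<^sub>R h) < r" using r False by (simp add: a_def)
    from small[OF this] have "a\<^sup>2 * sq \<omega> (\<lambda>s. blinfun_apply (\<V> s) h) \<le> 4 * real N"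
      by (simp add: blinfun.scaleR_right power_mult_distrib)
    then have "sq \<omega> (\<lambda>s. blinfun_apply (\<V> s) h) \<le> 4 * real N / a\<^sup>2"
      using a by (simp add: pos_le_divide_eq mult.commute)
    also have "\<dots> = 16 * real N / r\<^sup>2 * (norm h)\<^sup>2" by (simp add: a_def power_divide power_mult_distrib)
    finally show ?thesis .
  qed simp
  then show ?thesis by (intro exI[of _ "16 * real N / r\<^sup>2"]) auto
qed

lemma V_hat_apply: "blinfun_apply (V_hat \<omega> \<V> n) h = fourier_coeff \<omega> (\<lambda>s. blinfun_apply (\<V> s) h) n"
proof -
  obtain K where K: "K \<ge> 0" "\<And>h. sq \<omega> (\<lambda>s. blinfun_apply (\<V> s) h) \<le> K * (norm h)\<^sup>2"
    using potential_bounded by blast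
  have "bounded_linear (\<lambda>x. fourier_coeff \<omega> (\<lambda>s. blinfun_apply (\<V> s) x) n)"
  proof (rule bounded_linear_intro[of _ "sqrt (K / \<omega>)"])
    fix x y :: 'h and a :: real
    show "fourier_coeff \<omega> (\<lambda>s. blinfun_apply (\<V> s) (x + y)) n =
        fourier_coeff \<omega> (\<lambda>s. blinfun_apply (\<V> s) x) n + fourier_coeff \<omega> (\<lambda>s. blinfun_apply (\<V> s) y) n"
      unfolding blinfun.add_right by (rule fourier_coeff_add[OF L2 L2])
    show "fourier_coeff \<omega> (\<lambda>s. blinfun_apply (\<V> s) (a *\<^sub>R x)) n = a *\<^sub>R fourier_coeff \<omega> (\<lambda>s. blinfun_apply (\<V> s) x) n"
      using fourier_coeff_scaleC[OF L2, of "of_real a" x n] by (simp only: blinfun.scaleR_right scaleC_of_real)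
    have "\<omega> * (norm (fourier_coeff \<omega> (\<lambda>s. blinfun_apply (\<V> s) x) n))\<^sup>2 \<le> K * (norm x)\<^sup>2"
      by (rule order_trans[OF norm_fourier_coeff_le[OF w L2] K(2)])
    then have "(norm (fourier_coeff \<omega> (\<lambda>s. blinfun_apply (\<V> s) x) n))\<^sup>2 \<le> K / \<omega> * (norm x)\<^sup>2"
      using w by (simp add: field_simps)
    then have "norm (fourier_coeff \<omega> (\<lambda>s. blinfun_apply (\<V> s) x) n) \<le> sqrt (K / \<omega> * (norm x)\<^sup>2)"
      by (rule real_le_rsqrt)
    then show "norm (fourier_coeff \<omega> (\<lambda>s. blinfun_apply (\<V> s) x) n) \<le> norm x * sqrt (K / \<omega>)"
      by (simp only: real_sqrt_mult real_sqrt_abs abs_norm_cancel mult.commute)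
  qed
  then show ?thesis unfolding V_hat_def by (simp add: bounded_linear_Blinfun_apply)
qed

lemma clinear_V_hat: "clinear (V_hat \<omega> \<V> n)"
  unfolding clinear_def
proof (intro allI)
  fix c x
  have "L2_eq \<omega> (\<lambda>s. blinfun_apply (\<V> s) (c *\<^sub>C x)) (\<lambda>s. c *\<^sub>C blinfun_apply (\<V> s) x)"
    unfolding L2_eq_def by (rule AE_I2) (simp add: lin)
  from fourier_coeff_L2_eq[OF this]
  show "blinfun_apply (V_hat \<omega> \<V> n) (c *\<^sub>C x) = c *\<^sub>C blinfun_apply (V_hat \<omega> \<V> n) x"
    unfolding V_hat_apply by (simp only: fourier_coeff_scaleC[OF L2])
qed

definition symbol :: "'h row" where "symbol = Ell2 (V_hat \<omega> \<V>)"

lemma entry_symbol: "entry symbol n = V_hat \<omega> \<V> n"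
  unfolding symbol_def by (rule entry_Ell2[OF sumV])

lemma norm_fourier_seq_potential_le: "norm (fourier_seq \<omega> (\<lambda>s. blinfun_apply (\<V> s) h)) \<le> norm symbol * norm h"
proof (rule norm_ell2_le)
  fix F :: "int set" assume F: "finite F"
  have "L2_set (\<lambda>n. norm (entry (fourier_seq \<omega> (\<lambda>s. blinfun_apply (\<V> s) h)) n)) F \<le> L2_set (\<lambda>n. norm h * norm (entry symbol n)) F"
  proof (intro L2_set_mono)
    fix n
    show "norm (entry (fourier_seq \<omega> (\<lambda>s. blinfun_apply (\<V> s) h)) n) \<le> norm h * norm (entry symbol n)"
      using norm_blinfun[of "V_hat \<omega> \<V> n" h] by (simp add: entry_fourier_seq[OF w L2] entry_symbol V_hat_apply mult.commute)
  qed simp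
  also have "\<dots> = norm h * L2_set (\<lambda>n. norm (entry symbol n)) F" by (simp add: L2_set_right_distrib)
  also have "\<dots> \<le> norm h * norm symbol" by (intro mult_left_mono L2_set_entry_le_norm F) simp
  finally show "L2_set (\<lambda>n. norm (entry (fourier_seq \<omega> (\<lambda>s. blinfun_apply (\<V> s) h)) n)) F \<le> norm symbol * norm h"
    by (simp add: mult.commute)
qed

text \<open>Reflection turns the exponential with index \<open>n\<close> into that with index \<open>-n\<close>, so the \<open>n\<close>-th term of
  \<open>x\<close> contributes the shifted coefficients \<open>V_hat (j + n)\<close>: the perturbation is a Hankel operator. For
  \<open>x\<close> in the domain the coefficients are absolutely summable; hence the terms \<open>q n\<close> are absolutely summable
  in the mean as well as pointwise almost everywhere, and both sums agree by Fatou's lemma.\<close>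

lemma V_op_fourier:
  assumes x: "x \<in> dom_L0 \<omega>"
  shows "V_op \<omega> \<V> x \<in> L2_space \<omega>" "fourier_coeff \<omega> (V_op \<omega> \<V> x) j = hankel symbol (fourier_seq \<omega> x) j"
proof -
  note xL = dom_L0_times_index(1)[OF w x] and xN = dom_L0_times_index(2)[OF w x]
  define e where "e = fourier_coeff \<omega> x"
  have s: "(\<lambda>n. norm (e n)) summable_on UNIV"
    using dom_index_abs_summable[OF xN] by (simp add: entry_fourier_seq[OF w xL] e_def)
  let ?u = "V_op \<omega> \<V> x"
  define q where "q n s = E \<omega> (- n) s *\<^sub>C blinfun_apply (\<V> s) (e n)" for n s
  have qL: "q n \<in> L2_space \<omega>" for n unfolding q_def by (rule L2_space_E[OF L2])
  have qc: "fourier_coeff \<omega> (q n) l = blinfun_apply (entry symbol (l + n)) (e n)" for n l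
  proof -
    have "E \<omega> (- l) s *\<^sub>C q n s = E \<omega> (- (l + n)) s *\<^sub>C blinfun_apply (\<V> s) (e n)" for s
      unfolding q_def scaleC_scaleC E_mult by simp
    then show ?thesis unfolding entry_symbol V_hat_apply fourier_coeff_alt by (simp only:)
  qed
  have qn: "norm (fourier_seq \<omega> (q n)) \<le> norm symbol * norm (e n)" for n
  proof -
    have "sq \<omega> (q n) = sq \<omega> (\<lambda>s. blinfun_apply (\<V> s) (e n))" unfolding q_def norm_E_scaleC ..
    then have "\<omega> * (norm (fourier_seq \<omega> (q n)))\<^sup>2 = \<omega> * (norm (fourier_seq \<omega> (\<lambda>s. blinfun_apply (\<V> s) (e n))))\<^sup>2"
      unfolding parseval[OF w qL] parseval[OF w L2] .
    then have "norm (fourier_seq \<omega> (q n)) = norm (fourier_seq \<omega> (\<lambda>s. blinfun_apply (\<V> s) (e n)))"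
      using w by simp
    then show ?thesis using norm_fourier_seq_potential_le[of "e n"] by simp
  qed
  define I where "I M = {- int M..int M}" for M :: nat
  define g where "g M s = (\<Sum>n\<in>I M. q n s)" for M s
  have gL: "g M \<in> L2_space \<omega>" for M unfolding g_def[abs_def] by (intro L2_space_sum qL)
  have lim: "AE s in lebesgue_on {0..\<omega>}. (\<lambda>M. g M s) \<longlonglongrightarrow> ?u s"
  proof -
    have "L2_eq \<omega> x (\<lambda>t. \<Sum>\<^sub>\<infinity>n. E \<omega> n t *\<^sub>C e n)"
      unfolding e_def by (rule dom_L0_of_fourier(2)[OF w xL xN])
    then obtain N where N: "negligible N" "\<And>t. t \<in> {0..\<omega>} - N \<Longrightarrow> x t = (\<Sum>\<^sub>\<infinity>n. E \<omega> n t *\<^sub>C e n)"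
      unfolding L2_eq_def AE_interval_iff by blast
    define N' where "N' = (\<lambda>s. \<omega> - s) ` N"
    have N': "negligible N'"
      unfolding N'_def
      by (rule negligible_differentiable_image_negligible[OF _ N(1)])
         (auto intro!: differentiable_on_diff differentiable_on_const differentiable_on_ident)
    have "(\<lambda>M. g M s) \<longlonglongrightarrow> ?u s" if s': "s \<in> {0..\<omega>} - N'" for s
    proof -
      have "\<omega> - s \<in> {0..\<omega>}" using s' by auto
      moreover have "\<omega> - s \<notin> N"
      proof
        assume "\<omega> - s \<in> N"
        then have "s \<in> N'" unfolding N'_def by (intro image_eqI[of _ _ "\<omega> - s"]) auto
        then show False using s' by blast
      qed
      ultimately have "?u s = blinfun_apply (\<V> s) (\<Sum>\<^sub>\<infinity>n. E \<omega> n (\<omega> - s) *\<^sub>C e n)"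
        unfolding V_op_def using N(2)[of "\<omega> - s"] by simp
      also have "\<dots> = (\<Sum>\<^sub>\<infinity>n. blinfun_apply (\<V> s) (E \<omega> n (\<omega> - s) *\<^sub>C e n))"
        by (rule infsum_linear[OF blinfun.bounded_linear_right summable_E[OF s], symmetric])
      also have "\<dots> = (\<Sum>\<^sub>\<infinity>n. E \<omega> n (\<omega> - s) *\<^sub>C blinfun_apply (\<V> s) (e n))"
        using s' lin by (intro infsum_cong) auto
      finally have us: "?u s = (\<Sum>\<^sub>\<infinity>n. E \<omega> n (\<omega> - s) *\<^sub>C blinfun_apply (\<V> s) (e n))" .
      have se: "(\<lambda>n. norm (blinfun_apply (\<V> s) (e n))) summable_on UNIV"
        by (rule summable_on_comparison_test[OF summable_on_cmult_right[OF s, of "norm (\<V> s)"]]) (auto simp: norm_blinfun)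
      have gt: "g M s = trig \<omega> (I M) (\<lambda>n. blinfun_apply (\<V> s) (e n)) (\<omega> - s)" for M
        unfolding g_def trig_def q_def E_reflect[OF w] ..
      show ?thesis
      proof (rule LIMSEQ_I)
        fix r :: real assume r: "r > 0"
        then have r2: "r/2 > 0" by simp
        obtain N :: nat where N: "\<forall>M\<ge>N. \<forall>G. finite G \<longrightarrow> G \<inter> {- int M..int M} = {} \<longrightarrow> (\<Sum>n\<in>G. norm (blinfun_apply (\<V> s) (e n))) \<le> r/2"
          using abs_tail_sequence[OF se r2] by blast
        have "norm (g M s - ?u s) < r" if "M \<ge> N" for M
        proof -
          have "norm (?u s - g M s) \<le> r/2"
            unfolding us gt I_def by (rule infsum_minus_partial_le[OF se]) (use N that in auto)
          then show ?thesis using r by (simp add: norm_minus_commute)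
        qed
        then show "\<exists>no. \<forall>M\<ge>no. norm (g M s - ?u s) < r" by blast
      qed
    qed
    then show ?thesis unfolding AE_interval_iff using N' by blast
  qed
  have tail: "\<exists>M. (\<lambda>s. ?u s - g M s) \<in> L2_space \<omega> \<and> sq \<omega> (\<lambda>s. ?u s - g M s) \<le> \<omega> * (norm symbol * \<epsilon>)\<^sup>2 \<and>
      norm (hankel symbol (fourier_seq \<omega> x) j - fourier_coeff \<omega> (g M) j) \<le> norm symbol * \<epsilon>" if eps: "\<epsilon> > 0" for \<epsilon> j
  proof -
    obtain M :: nat where M: "\<forall>M'\<ge>M. \<forall>G. finite G \<longrightarrow> G \<inter> {- int M'..int M'} = {} \<longrightarrow> (\<Sum>n\<in>G. norm (e n)) \<le> \<epsilon>"
      using abs_tail_sequence[OF s eps] by blast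
    have tl: "(\<Sum>n\<in>G. norm symbol * norm (e n)) \<le> norm symbol * \<epsilon>" if "finite G" "G \<inter> I M = {}" for G
      using M that unfolding I_def sum_distrib_left[symmetric] by (intro mult_left_mono) auto
    have d: "sq \<omega> (\<lambda>s. g (M + k) s - g M s) \<le> \<omega> * (norm symbol * \<epsilon>)\<^sup>2" for k
    proof -
      have sub: "I M \<subseteq> I (M + k)" by (auto simp: I_def)
      have fin: "finite (I (M + k))" by (simp add: I_def)
      have eq: "(\<lambda>s. g (M + k) s - g M s) = (\<lambda>s. \<Sum>n\<in>I (M + k) - I M. q n s)"
        unfolding g_def using fin sub by (simp add: sum_diff)
      have "norm (fourier_seq \<omega> (\<lambda>s. \<Sum>n\<in>I (M + k) - I M. q n s)) \<le> (\<Sum>n\<in>I (M + k) - I M. norm symbol * norm (e n))"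
        by (rule norm_fourier_seq_sum_le[OF w _ qL qn]) (use fin in auto)
      also have "\<dots> \<le> norm symbol * \<epsilon>" using fin by (intro tl) auto
      finally have "(norm (fourier_seq \<omega> (\<lambda>s. g (M + k) s - g M s)))\<^sup>2 \<le> (norm symbol * \<epsilon>)\<^sup>2"
        unfolding eq by (rule power_mono) simp
      then show ?thesis unfolding parseval[OF w L2_space_minus[OF gL gL]] using w by simp
    qed
    have l: "AE s in lebesgue_on {0..\<omega>}. (\<lambda>k. g (M + k) s - g M s) \<longlonglongrightarrow> ?u s - g M s"
      using lim
    proof eventually_elim
      case (elim s)
      then have "(\<lambda>k. g (k + M) s) \<longlonglongrightarrow> ?u s" by (rule LIMSEQ_ignore_initial_segment)
      then have "(\<lambda>k. g (M + k) s) \<longlonglongrightarrow> ?u s" by (simp only: add.commute)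
      then show ?case by (intro tendsto_diff tendsto_const)
    qed
    note L = L2_space_AE_limit[of "\<lambda>k s. g (M + k) s - g M s", OF L2_space_minus[OF gL gL] d l]
    \<comment> \<open>at the point 0 all exponentials are 1, so the estimate for trigonometric series covers this series\<close>
    have "norm ((\<Sum>\<^sub>\<infinity>n. E 1 n 0 *\<^sub>C blinfun_apply (entry symbol (j + n)) (e n)) - trig 1 (I M) (\<lambda>n. blinfun_apply (entry symbol (j + n)) (e n)) 0) \<le> norm symbol * \<epsilon>"
    proof (rule infsum_minus_partial_le)
      have le: "norm (blinfun_apply (entry symbol (j + n)) (e n)) \<le> norm symbol * norm (e n)" for n
        by (rule order_trans[OF norm_blinfun]) (intro mult_right_mono norm_entry_le norm_ge_zero)
      show "(\<lambda>n. norm (blinfun_apply (entry symbol (j + n)) (e n))) summable_on UNIV"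
        by (rule summable_on_comparison_test[OF summable_on_cmult_right[OF s, of "norm symbol"]]) (auto simp: le)
      show "finite (I M)" by (simp add: I_def)
      show "(\<Sum>n\<in>G. norm (blinfun_apply (entry symbol (j + n)) (e n))) \<le> norm symbol * \<epsilon>" if "finite G" "G \<inter> I M = {}" for G
        by (rule order_trans[OF sum_mono[OF le] tl[OF that]])
    qed
    moreover have "fourier_coeff \<omega> (g M) j = (\<Sum>n\<in>I M. blinfun_apply (entry symbol (j + n)) (e n))"
      unfolding g_def[abs_def] by (subst fourier_coeff_sum) (auto simp: qL qc I_def)
    moreover have "hankel symbol (fourier_seq \<omega> x) j = (\<Sum>\<^sub>\<infinity>n. blinfun_apply (entry symbol (j + n)) (e n))"
      by (simp add: hankel_def pairing_def entry_shift_row entry_fourier_seq[OF w xL] e_def)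
    ultimately have "norm (hankel symbol (fourier_seq \<omega> x) j - fourier_coeff \<omega> (g M) j) \<le> norm symbol * \<epsilon>"
      by (simp add: trig_def cis_zero)
    then show ?thesis using L by blast
  qed
  obtain M where "(\<lambda>s. ?u s - g M s) \<in> L2_space \<omega>" using tail[of 1] by auto
  from L2_space_add[OF this gL[of M]] show uL: "?u \<in> L2_space \<omega>" by simp
  have "norm (fourier_coeff \<omega> ?u j - hankel symbol (fourier_seq \<omega> x) j) \<le> 0 + \<delta>" if del: "\<delta> > 0" for \<delta>
  proof -
    define \<epsilon> where "\<epsilon> = \<delta> / (2 * (norm symbol + 1))"
    have np: "norm symbol + 1 > 0" by (simp add: add_nonneg_pos)
    have eps: "\<epsilon> > 0" using del np by (simp add: \<epsilon>_def)
    have ve: "norm symbol * \<epsilon> \<le> \<delta> / 2"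
    proof -
      have "norm symbol * \<epsilon> \<le> (norm symbol + 1) * \<epsilon>" using eps by (intro mult_right_mono) auto
      also have "\<dots> = \<delta> / 2"
      proof -
        have g: "a * (\<delta> / (2 * a)) = \<delta> / 2" if "a > 0" for a :: real using that by simp
        show ?thesis unfolding \<epsilon>_def by (rule g[OF np])
      qed
      finally show ?thesis .
    qed
    obtain M where M: "(\<lambda>s. ?u s - g M s) \<in> L2_space \<omega>" "sq \<omega> (\<lambda>s. ?u s - g M s) \<le> \<omega> * (norm symbol * \<epsilon>)\<^sup>2"
      "norm (hankel symbol (fourier_seq \<omega> x) j - fourier_coeff \<omega> (g M) j) \<le> norm symbol * \<epsilon>" using tail[OF eps, of j] by blast
    have "\<omega> * (norm (fourier_coeff \<omega> (\<lambda>s. ?u s - g M s) j))\<^sup>2 \<le> \<omega> * (norm symbol * \<epsilon>)\<^sup>2"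
      by (rule order_trans[OF norm_fourier_coeff_le[OF w M(1)] M(2)])
    then have "(norm (fourier_coeff \<omega> (\<lambda>s. ?u s - g M s) j))\<^sup>2 \<le> (norm symbol * \<epsilon>)\<^sup>2"
      using w by (simp only: mult_le_cancel_left_pos)
    then have "norm (fourier_coeff \<omega> (\<lambda>s. ?u s - g M s) j) \<le> norm symbol * \<epsilon>"
      by (rule power2_le_imp_le) (use eps in simp)
    then have n1: "norm (fourier_coeff \<omega> ?u j - fourier_coeff \<omega> (g M) j) \<le> norm symbol * \<epsilon>"
      unfolding fourier_coeff_minus[OF uL gL] .
    have "norm ((fourier_coeff \<omega> ?u j - fourier_coeff \<omega> (g M) j) - (hankel symbol (fourier_seq \<omega> x) j - fourier_coeff \<omega> (g M) j)) \<le> norm symbol * \<epsilon> + norm symbol * \<epsilon>"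
      by (rule order_trans[OF norm_triangle_ineq4 add_mono[OF n1 M(3)]])
    moreover have "(fourier_coeff \<omega> ?u j - fourier_coeff \<omega> (g M) j) - (hankel symbol (fourier_seq \<omega> x) j - fourier_coeff \<omega> (g M) j)
        = fourier_coeff \<omega> ?u j - hankel symbol (fourier_seq \<omega> x) j" by simp
    ultimately have "norm (fourier_coeff \<omega> ?u j - hankel symbol (fourier_seq \<omega> x) j) \<le> norm symbol * \<epsilon> + norm symbol * \<epsilon>" by (simp only:)
    then show ?thesis using ve by linarith
  qed
  then have "norm (fourier_coeff \<omega> ?u j - hankel symbol (fourier_seq \<omega> x) j) \<le> 0" by (rule field_le_epsilon)
  then show "fourier_coeff \<omega> ?u j = hankel symbol (fourier_seq \<omega> x) j" by simp
qed

text \<open>Dividing by \<open>2 \<pi> i / \<omega>\<close> turns the derivative into multiplication by the index.\<close>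

definition v :: "'h row" where "v = Ell2 (\<lambda>n. scaleC_blinfun (1 / ik \<omega>) o\<^sub>L V_hat \<omega> \<V> n)"

lemma entry_v: "entry v n = scaleC_blinfun (1 / ik \<omega>) o\<^sub>L V_hat \<omega> \<V> n"
  unfolding v_def
proof (rule entry_Ell2)
  show "(\<lambda>n. (norm (scaleC_blinfun (1 / ik \<omega>) o\<^sub>L V_hat \<omega> \<V> n))\<^sup>2) summable_on UNIV"
    by (rule summable_on_comparison_test[OF summable_on_cmult_right[OF sumV, of "(cmod (1 / ik \<omega>))\<^sup>2"]])
       (auto simp: power_mult_distrib[symmetric] intro!: power_mono norm_scaleC_blinfun_compose_le)
qed

lemma mclinear_v: "mclinear v"
  unfolding mclinear_def entry_v
  by (intro allI clinear_compose clinear_V_hat clinear_scaleC_blinfun)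

lemma hankel_v: "hankel v x j = (1 / ik \<omega>) *\<^sub>C hankel symbol x j"
proof -
  have "hankel v x j = (\<Sum>\<^sub>\<infinity>n. (1 / ik \<omega>) *\<^sub>C blinfun_apply (entry (shift_row symbol j) n) (entry x n))"
    unfolding hankel_def pairing_def by (simp add: entry_shift_row entry_v entry_symbol scaleC_blinfun_apply)
  also have "\<dots> = (1 / ik \<omega>) *\<^sub>C hankel symbol x j"
    unfolding hankel_def pairing_def by (rule infsum_linear[OF bounded_linear_scaleC app.summable])
  finally show ?thesis .
qed

lemma products_summable:
  assumes hyp: "(\<lambda>(j, l). (norm (\<Sum>\<^sub>\<infinity>n\<in>UNIV - {l}.
          (1 / real_of_int (l - n)) *\<^sub>R (V_hat \<omega> \<V> (j + n) o\<^sub>L V_hat \<omega> \<V> (l + n))))\<^sup>2)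
        summable_on (UNIV :: (int \<times> int) set)"
  shows "(\<lambda>(j, l). (norm (\<Sum>\<^sub>\<infinity>n\<in>UNIV - {l}.
          (1 / real_of_int (l - n)) *\<^sub>R (entry v (j + n) o\<^sub>L entry v (l + n))))\<^sup>2)
        summable_on (UNIV :: (int \<times> int) set)"
proof -
  let ?t = "\<lambda>j l n. (1 / real_of_int (l - n)) *\<^sub>R (V_hat \<omega> \<V> (j + n) o\<^sub>L V_hat \<omega> \<V> (l + n))"
  define c where "c = (1 / ik \<omega>) * (1 / ik \<omega>)"
  have e: "(1 / real_of_int (l - n)) *\<^sub>R (entry v (j + n) o\<^sub>L entry v (l + n)) = scaleC_blinfun c o\<^sub>L ?t j l n" for j l n
  proof -
    have "entry v (j + n) o\<^sub>L entry v (l + n) = scaleC_blinfun c o\<^sub>L (V_hat \<omega> \<V> (j + n) o\<^sub>L V_hat \<omega> \<V> (l + n))"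
      using clinear_V_hat[of "j + n"]
      by (intro blinfun_eqI) (simp only: entry_v blinfun_apply_blinfun_compose scaleC_blinfun_apply clinear_def scaleC_scaleC c_def)
    then show ?thesis by (simp only: comp.scaleR_right)
  qed
  have s: "?t j l summable_on UNIV - {l}" for j l
  proof (rule abs_summable_summable, rule summable_on_comparison_test)
    show "(\<lambda>n. norm (entry (shift_row symbol j) n) * norm (entry (shift_row symbol l) n)) summable_on UNIV - {l}"
      by (rule summable_on_subset_banach[OF summable_on_product[OF summable_entry summable_entry]]) simp
    fix n assume n: "n \<in> UNIV - {l}"
    then have "1 \<le> \<bar>l - n\<bar>" by auto
    then have "1 \<le> \<bar>real_of_int (l - n)\<bar>" by linarith
    then have "\<bar>1 / real_of_int (l - n)\<bar> \<le> 1" by simp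
    then have "norm (?t j l n) \<le> norm (V_hat \<omega> \<V> (j + n) o\<^sub>L V_hat \<omega> \<V> (l + n))"
      unfolding norm_scaleR by (rule mult_left_le_one_le[OF norm_ge_zero abs_ge_zero])
    also have "\<dots> \<le> norm (entry (shift_row symbol j) n) * norm (entry (shift_row symbol l) n)"
      unfolding entry_shift_row entry_symbol by (rule norm_blinfun_compose)
    finally show "norm (?t j l n) \<le> norm (entry (shift_row symbol j) n) * norm (entry (shift_row symbol l) n)" .
  qed simp
  have i: "(\<Sum>\<^sub>\<infinity>n\<in>UNIV - {l}. (1 / real_of_int (l - n)) *\<^sub>R (entry v (j + n) o\<^sub>L entry v (l + n))) = scaleC_blinfun c o\<^sub>L infsum (?t j l) (UNIV - {l})" for j l
    unfolding e by (rule infsum_linear[OF comp.bounded_linear_right s])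
  show ?thesis
    unfolding i
  proof (rule summable_on_comparison_test[OF summable_on_cmult_right[OF hyp, of "(cmod c)\<^sup>2"]])
    fix p :: "int \<times> int"
    show "(case p of (j, l) \<Rightarrow> (norm (scaleC_blinfun c o\<^sub>L infsum (?t j l) (UNIV - {l})))\<^sup>2)
        \<le> (cmod c)\<^sup>2 * (case p of (j, l) \<Rightarrow> (norm (infsum (?t j l) (UNIV - {l})))\<^sup>2)"
      unfolding case_prod_unfold power_mult_distrib[symmetric] by (intro power_mono norm_scaleC_blinfun_compose_le norm_ge_zero)
  qed (simp add: case_prod_unfold)
qed

lemma L_op_fourier:
  assumes x: "x \<in> dom_L0 \<omega>" and z: "times_index (fourier_seq \<omega> x) z"
  shows "L_op \<omega> \<V> x \<in> L2_space \<omega>"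
    "entry (fourier_seq \<omega> (L_op \<omega> \<V> x)) j = ik \<omega> *\<^sub>C (entry z j - hankel v (fourier_seq \<omega> x) j)"
proof -
  note xL = dom_L0_times_index(1)[OF w x]
  have L: "(\<lambda>s. L0 \<omega> x s - V_op \<omega> \<V> x s) \<in> L2_space \<omega>"
    by (rule L2_space_minus[OF L0_fourier(1)[OF w x] V_op_fourier(1)[OF x]])
  then show "L_op \<omega> \<V> x \<in> L2_space \<omega>" by (simp add: L_op_def)
  have "entry (fourier_seq \<omega> (L_op \<omega> \<V> x)) j = (of_int j * ik \<omega>) *\<^sub>C fourier_coeff \<omega> x j - hankel symbol (fourier_seq \<omega> x) j"
    unfolding L_op_def entry_fourier_seq[OF w L] fourier_coeff_minus[OF L0_fourier(1)[OF w x] V_op_fourier(1)[OF x]]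
      L0_fourier(2)[OF w x] V_op_fourier(2)[OF x] ..
  also have "(of_int j * ik \<omega>) *\<^sub>C fourier_coeff \<omega> x j = ik \<omega> *\<^sub>C entry z j"
  proof -
    have "entry z j = complex_of_real (of_int j) *\<^sub>C fourier_coeff \<omega> x j"
      using z by (simp add: times_index_def entry_fourier_seq[OF w xL] scaleC_of_real del: of_real_of_int_eq)
    then show ?thesis by (simp add: scaleC_scaleC mult.commute)
  qed
  also have "hankel symbol (fourier_seq \<omega> x) j = ik \<omega> *\<^sub>C hankel v (fourier_seq \<omega> x) j"
    unfolding hankel_v using ik_nonzero[OF w] by (simp add: scaleC_scaleC)
  finally show "entry (fourier_seq \<omega> (L_op \<omega> \<V> x)) j = ik \<omega> *\<^sub>C (entry z j - hankel v (fourier_seq \<omega> x) j)"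
    by (simp only: scaleC_minus_right)
qed

end


section \<open>Operators described by Fourier coefficients\<close>

lemma norm_cinner_le: "cmod (cinner x y) \<le> norm x * norm (y::'h::complex_hilbert)"
proof (cases "cinner x y = 0")
  case False
  define a where "a = cnj (cinner x y) / cmod (cinner x y)"
  have a: "cmod a = 1" using False by (simp add: a_def norm_divide)
  have "cinner (a *\<^sub>C x) y = cmod (cinner x y)"
    using False by (simp add: cinner_scaleC_left a_def complex_norm_square[symmetric] power2_eq_square mult.commute)
  then have "cmod (cinner x y) = inner (a *\<^sub>C x) y" by (simp add: inner_eq_Re_cinner)
  also have "\<dots> \<le> norm (a *\<^sub>C x) * norm y" by (rule norm_cauchy_schwarz)
  finally show ?thesis by (simp add: norm_scaleC a)
qed simp

lemma cinner_scaleC_right: "cinner x (a *\<^sub>C y) = cnj a * cinner x (y::'h::complex_hilbert)"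
  by (metis cinner_commute cinner_scaleC_left complex_cnj_mult complex_cnj_cnj)

lemma cinner_add_right: "cinner x (y + z) = cinner x y + cinner x (z::'h::complex_hilbert)"
  by (metis cinner_add_left cinner_commute complex_cnj_add)

lemma bounded_linear_cinner_right: "bounded_linear (cinner (x::'h::complex_hilbert))"
proof (rule bounded_linear_intro[of _ "norm x"])
  show "cinner x (r *\<^sub>R y) = r *\<^sub>R cinner x y" for r y
    unfolding scaleC_of_real[of r y, symmetric] cinner_scaleC_right by (simp add: scaleR_conv_of_real)
  show "norm (cinner x y) \<le> norm y * norm x" for y using norm_cinner_le[of x y] by (simp add: mult.commute)
qed (rule cinner_add_right)

lemma bounded_linear_cinner_left: "bounded_linear (\<lambda>x. cinner x (y::'h::complex_hilbert))"
proof (rule bounded_linear_intro[of _ "norm y"])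
  show "cinner (r *\<^sub>R x) y = r *\<^sub>R cinner x y" for r x
    unfolding scaleC_of_real[of r x, symmetric] cinner_scaleC_left by (simp add: scaleR_conv_of_real)
  show "norm (cinner x y) \<le> norm x * norm y" for x by (rule norm_cinner_le)
qed (rule cinner_add_left)

definition coord_proj :: "int set \<Rightarrow> 'h::complex_hilbert vec2 \<Rightarrow> 'h vec2" where
  "coord_proj S a = cmul (\<lambda>n. if n \<in> S then 1 else 0) a"

lemma entry_coord_proj: "entry (coord_proj S a) n = (if n \<in> S then entry a n else 0)"
  unfolding coord_proj_def by (subst cmul_bounded(1)[where K = 1]) auto

lemma norm_coord_proj_squared: "finite S \<Longrightarrow> (norm (coord_proj S a))\<^sup>2 = (\<Sum>n\<in>S. (norm (entry a n))\<^sup>2)"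
  unfolding norm_ell2_squared
  by (subst infsum_cong_neutral[where T = S and g = "\<lambda>n. (norm (entry a n))\<^sup>2"]) (auto simp: entry_coord_proj)

lemma cmul_const_linear:
  "cmul (\<lambda>_. c) (x + y) = cmul (\<lambda>_. c) x + cmul (\<lambda>_. c) y"
  "cmul (\<lambda>_. c) (x - y) = cmul (\<lambda>_. c) x - cmul (\<lambda>_. c) y"
  "cmul (\<lambda>_. c) (cmul (\<lambda>_. d) x) = cmul (\<lambda>_. c * d) x"
  "cmul (\<lambda>_. 1) x = x"
  by (auto intro!: ell2_eqI simp: entry_simps entry_cmul_const scaleC_add_right scaleC_minus_right scaleC_scaleC)

lemma norm_cmul_const_le: "norm (cmul (\<lambda>_. c) x) \<le> cmod c * norm x"
  by (rule cmul_bounded(2)) simp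

lemma bounded_linear_cmul_const: "bounded_linear (cmul (\<lambda>_. c))"
  by (rule bounded_linear_cmul[of _ "cmod c"]) simp

definition clinear_map :: "('h::complex_hilbert vec2 \<Rightarrow> 'h vec2) \<Rightarrow> bool" where
  "clinear_map T \<longleftrightarrow> (\<forall>x y. T (x + y) = T x + T y) \<and> (\<forall>c x. T (cmul (\<lambda>_. c) x) = cmul (\<lambda>_. c) (T x))"

lemma clinear_map_mv:
  assumes "mclinear M"
  shows "clinear_map (mv M)"
  using assms by (simp add: clinear_map_def mv.add_right mv_cmul)

definition lift_op :: "real \<Rightarrow> ('h::complex_hilbert vec2 \<Rightarrow> 'h vec2) \<Rightarrow> 'h operator" where
  "lift_op \<omega> T x = synth \<omega> (T (fourier_seq \<omega> x))"

definition block_set :: "nat \<Rightarrow> int option \<Rightarrow> int set" where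
  "block_set k i = (case i of None \<Rightarrow> {l. \<bar>l\<bar> \<le> int k} | Some l \<Rightarrow> {l})"

definition block_of :: "nat \<Rightarrow> int \<Rightarrow> int option" where
  "block_of k n = (if \<bar>n\<bar> \<le> int k then None else Some n)"

lemma finite_block_set: "finite (block_set k i)"
proof -
  have "{l::int. \<bar>l\<bar> \<le> int k} = {- int k..int k}" by auto
  then show ?thesis by (cases i) (auto simp: block_set_def)
qed

lemma block_of: "block_of k n \<in> block_index k" "i \<in> block_index k \<Longrightarrow> n \<in> block_set k i \<longleftrightarrow> block_of k n = i"
  by (auto simp: block_of_def block_index_def block_set_def split: option.splits)

lemma same_block_iff: "same_block k j l \<longleftrightarrow> block_of k j = block_of k l"
  by (auto simp: same_block_def block_of_def)

context
  fixes \<omega> :: real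
  assumes w: "\<omega> > 0"
begin

lemma lift_op: "lift_op \<omega> T x \<in> L2_space \<omega>" "fourier_seq \<omega> (lift_op \<omega> T x) = T (fourier_seq \<omega> x)"
  unfolding lift_op_def by (rule synth[OF w])+

lemma L2_eqI:
  "x \<in> L2_space \<omega> \<Longrightarrow> y \<in> L2_space \<omega> \<Longrightarrow> fourier_seq \<omega> x = fourier_seq \<omega> y \<Longrightarrow> L2_eq \<omega> x y"
  by (simp add: L2_eq_iff_fourier[OF w])

lemma fourier_seq_zero: "fourier_seq \<omega> (\<lambda>s. 0 :: 'h::complex_hilbert) = 0"
  by (rule ell2_eqI) (simp add: entry_fourier_seq[OF w] L2_space_const entry_zero fourier_coeff_def)

lemma L2_subspace_fourier:
  fixes P :: "'h::complex_hilbert vec2 \<Rightarrow> bool"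
  assumes G: "G = {x \<in> L2_space \<omega>. P (fourier_seq \<omega> x)}"
    and "P 0" "\<And>a b. P a \<Longrightarrow> P b \<Longrightarrow> P (a + b)" "\<And>c a. P a \<Longrightarrow> P (cmul (\<lambda>_. c) a)"
  shows "L2_subspace \<omega> G"
  unfolding L2_subspace_def G using assms(2-)
  by (auto simp: L2_space_const fourier_seq_zero L2_space_add L2_space_scaleC fourier_seq_add[OF w] fourier_seq_scaleC[OF w] L2_eq_iff_fourier[OF w])

lemma L2_subspace_L2: "L2_subspace \<omega> (L2_space \<omega> :: (real \<Rightarrow> 'h::complex_hilbert) set)"
  by (rule L2_subspace_fourier[of _ "\<lambda>_. True"]) auto

lemma linear_operator_fourier:
  fixes A :: "'h::complex_hilbert operator"
  assumes D: "L2_subspace \<omega> D" and R: "L2_subspace \<omega> R" and A: "\<And>x. x \<in> D \<Longrightarrow> A x \<in> R"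
    and T: "\<And>x. x \<in> D \<Longrightarrow> fourier_seq \<omega> (A x) = T (fourier_seq \<omega> x)"
    and add: "\<And>x y. x \<in> D \<Longrightarrow> y \<in> D \<Longrightarrow> T (fourier_seq \<omega> x + fourier_seq \<omega> y) = T (fourier_seq \<omega> x) + T (fourier_seq \<omega> y)"
    and mult: "\<And>c x. x \<in> D \<Longrightarrow> T (cmul (\<lambda>_. c) (fourier_seq \<omega> x)) = cmul (\<lambda>_. c) (T (fourier_seq \<omega> x))"
  shows "linear_operator \<omega> D R A"
proof -
  have DL: "D \<subseteq> L2_space \<omega>" and RL: "R \<subseteq> L2_space \<omega>"
    and Da: "\<And>x y. x \<in> D \<Longrightarrow> y \<in> D \<Longrightarrow> (\<lambda>s. x s + y s) \<in> D"
    and Dc: "\<And>c x. x \<in> D \<Longrightarrow> (\<lambda>s. c *\<^sub>C x s) \<in> D"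
    using D R unfolding L2_subspace_def by blast+
  have xL: "x \<in> L2_space \<omega>" and AL: "A x \<in> L2_space \<omega>" if "x \<in> D" for x using that DL RL A by blast+
  show ?thesis
    unfolding linear_operator_def
  proof (intro conjI ballI allI impI D R A)
    fix x y assume x: "x \<in> D" and y: "y \<in> D"
    show "L2_eq \<omega> (A x) (A y)" if "L2_eq \<omega> x y"
      using that x y by (intro L2_eqI AL) (auto simp: T L2_eq_iff_fourier[OF w xL xL])
    show "L2_eq \<omega> (A (\<lambda>s. x s + y s)) (\<lambda>s. A x s + A y s)"
      using x y by (intro L2_eqI AL L2_space_add Da) (auto simp: T Da fourier_seq_add[OF w] xL AL add)
  next
    fix c x assume x: "x \<in> D"
    show "L2_eq \<omega> (A (\<lambda>s. c *\<^sub>C x s)) (\<lambda>s. c *\<^sub>C A x s)"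
      using x by (intro L2_eqI AL L2_space_scaleC Dc) (auto simp: T Dc fourier_seq_scaleC[OF w] xL AL mult)
  qed
qed

lemma bounded_operator_lift:
  fixes T :: "'h::complex_hilbert vec2 \<Rightarrow> 'h vec2"
  assumes T: "clinear_map T" and C: "\<And>a. norm (T a) \<le> C * norm a"
  shows "bounded_operator_on \<omega> (L2_space \<omega>) (lift_op \<omega> T)"
  unfolding bounded_operator_on_def
proof
  show "linear_operator \<omega> (L2_space \<omega>) (L2_space \<omega>) (lift_op \<omega> T)"
    by (rule linear_operator_fourier[OF L2_subspace_L2 L2_subspace_L2, where T = T])
       (use T in \<open>auto simp: lift_op clinear_map_def\<close>)
  show "\<exists>C. \<forall>x\<in>L2_space \<omega>. L2_norm \<omega> (lift_op \<omega> T x) \<le> C * L2_norm \<omega> x"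
    using C by (intro exI[of _ C]) (simp add: L2_norm_fourier_seq[OF w] lift_op)
qed

lemma closed_operator_fourier:
  fixes A :: "'h::complex_hilbert operator"
  assumes lin: "linear_operator \<omega> D (L2_space \<omega>) A"
    and cl: "\<And>X x y. (\<And>n::nat. X n \<in> D) \<Longrightarrow> x \<in> L2_space \<omega> \<Longrightarrow> y \<in> L2_space \<omega> \<Longrightarrow>
      (\<lambda>n. fourier_seq \<omega> (X n)) \<longlonglongrightarrow> fourier_seq \<omega> x \<Longrightarrow> (\<lambda>n. fourier_seq \<omega> (A (X n))) \<longlonglongrightarrow> fourier_seq \<omega> y \<Longrightarrow> x \<in> D \<and> fourier_seq \<omega> (A x) = fourier_seq \<omega> y"
  shows "closed_operator \<omega> D A"
  unfolding closed_operator_def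
proof (intro conjI allI impI lin)
  fix X x y
  assume a: "(\<forall>n::nat. X n \<in> D) \<and> x \<in> L2_space \<omega> \<and> y \<in> L2_space \<omega> \<and>
      (\<lambda>n. L2_norm \<omega> (\<lambda>s. X n s - x s)) \<longlonglongrightarrow> 0 \<and> (\<lambda>n. L2_norm \<omega> (\<lambda>s. A (X n) s - y s)) \<longlonglongrightarrow> 0"
  have DL: "D \<subseteq> L2_space \<omega>" using lin by (simp add: linear_operator_def L2_subspace_def)
  have AL: "A x \<in> L2_space \<omega>" if "x \<in> D" for x using lin that unfolding linear_operator_def by blast
  have XL: "X n \<in> L2_space \<omega>" "A (X n) \<in> L2_space \<omega>" for n using a DL AL by blast+
  have xL: "x \<in> L2_space \<omega>" and yL: "y \<in> L2_space \<omega>" using a by blast+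
  have "(\<lambda>n. norm (fourier_seq \<omega> (X n) - fourier_seq \<omega> x)) \<longlonglongrightarrow> 0" "(\<lambda>n. norm (fourier_seq \<omega> (A (X n)) - fourier_seq \<omega> y)) \<longlonglongrightarrow> 0"
    using a by (simp_all add: L2_norm_fourier_seq[OF w] L2_space_minus XL xL yL fourier_seq_minus[OF w])
  then have "(\<lambda>n. fourier_seq \<omega> (X n)) \<longlonglongrightarrow> fourier_seq \<omega> x" "(\<lambda>n. fourier_seq \<omega> (A (X n))) \<longlonglongrightarrow> fourier_seq \<omega> y"
    by (simp_all add: tendsto_norm_zero_iff LIM_zero_iff)
  with cl[of X x y] a have c: "x \<in> D" "fourier_seq \<omega> (A x) = fourier_seq \<omega> y" by blast+
  show "x \<in> D" by (rule c)
  show "L2_eq \<omega> (A x) y" by (rule L2_eqI[OF AL[OF c(1)] yL c(2)])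
qed

lemma L2_has_sum_fourier:
  assumes x: "x \<in> L2_space \<omega>" and f: "\<And>i. i \<in> I \<Longrightarrow> f i \<in> L2_space \<omega>"
    and s: "((\<lambda>i. fourier_seq \<omega> (f i)) has_sum fourier_seq \<omega> x) I"
  shows "L2_has_sum \<omega> f I x"
proof -
  have e: "L2_norm \<omega> (\<lambda>s. (\<Sum>i\<in>F. f i s) - x s) = norm ((\<Sum>i\<in>F. fourier_seq \<omega> (f i)) - fourier_seq \<omega> x)"
    if F: "finite F" "F \<subseteq> I" for F
  proof -
    have fs: "fourier_seq \<omega> (\<lambda>s. \<Sum>i\<in>F. f i s) = (\<Sum>i\<in>F. fourier_seq \<omega> (f i))"
      using F
    proof (induction F rule: finite_induct)
      case empty
      show ?case using fourier_seq_zero by simp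
    next
      case (insert i F)
      have "fourier_seq \<omega> (\<lambda>s. f i s + (\<Sum>i\<in>F. f i s)) = fourier_seq \<omega> (f i) + fourier_seq \<omega> (\<lambda>s. \<Sum>i\<in>F. f i s)"
        using insert.prems f by (intro fourier_seq_add[OF w] L2_space_sum) auto
      with insert show ?case by simp
    qed
    have "(\<lambda>s. \<Sum>i\<in>F. f i s) \<in> L2_space \<omega>" using F f by (intro L2_space_sum) auto
    then show ?thesis using x by (simp add: L2_norm_fourier_seq[OF w] L2_space_minus fourier_seq_minus[OF w] fs)
  qed
  have "((\<lambda>F. (\<Sum>i\<in>F. fourier_seq \<omega> (f i)) - fourier_seq \<omega> x) \<longlongrightarrow> 0) (finite_subsets_at_top I)"
    using s unfolding has_sum_def by (rule LIM_zero)
  then have "((\<lambda>F. norm ((\<Sum>i\<in>F. fourier_seq \<omega> (f i)) - fourier_seq \<omega> x)) \<longlongrightarrow> 0) (finite_subsets_at_top I)"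
    by (rule tendsto_norm_zero)
  then show ?thesis
    unfolding L2_has_sum_def
    by (rule tendsto_cong[THEN iffD2, rotated]) (rule eventually_finite_subsets_at_top_weakI, rule e)
qed

text \<open>Between the projections onto two exponentials the operator acts as a single matrix entry.\<close>

lemma S2_lift:
  fixes T :: "'h::complex_hilbert vec2 \<Rightarrow> 'h vec2" and M :: "'h mat"
  assumes T: "clinear_map T" and C: "\<And>a. norm (T a) \<le> C * norm a"
    and M: "\<And>j l a. norm (entry (T (coord_proj {l} a)) j) \<le> c * norm (entry M (j, l)) * norm (entry a l)" and c: "c \<ge> 0"
  shows "lift_op \<omega> T \<in> S2 \<omega>"
proof -
  have P: "P_single \<omega> l x \<in> L2_space \<omega>" "fourier_seq \<omega> (P_single \<omega> l x) = coord_proj {l} (fourier_seq \<omega> x)"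
    if "x \<in> L2_space \<omega>" for l and x :: "real \<Rightarrow> 'h"
  proof -
    have p: "P_single \<omega> l x = trig \<omega> {l} (fourier_coeff \<omega> x)"
      by (simp add: P_single_def trig_def fun_eq_iff)
    then show "P_single \<omega> l x \<in> L2_space \<omega>" by (simp add: trig_L2)
    show "fourier_seq \<omega> (P_single \<omega> l x) = coord_proj {l} (fourier_seq \<omega> x)"
      unfolding p by (rule ell2_eqI) (simp add: entry_fourier_seq[OF w trig_L2] entry_coord_proj fourier_coeff_trig[OF w] entry_fourier_seq[OF w that])
  qed
  have on: "0 \<le> operator_norm \<omega> (P_single \<omega> j \<circ> lift_op \<omega> T \<circ> P_single \<omega> l)"
    "operator_norm \<omega> (P_single \<omega> j \<circ> lift_op \<omega> T \<circ> P_single \<omega> l) \<le> c * norm (entry M (j, l))" for j l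
  proof -
    let ?B = "{x \<in> L2_space \<omega>. L2_norm \<omega> (x :: real \<Rightarrow> 'h) \<le> 1}"
    let ?X = "P_single \<omega> j \<circ> lift_op \<omega> T \<circ> P_single \<omega> l"
    have b: "L2_norm \<omega> (?X x) \<le> c * norm (entry M (j, l))" if "x \<in> ?B" for x
    proof -
      have x: "x \<in> L2_space \<omega>" "norm (fourier_seq \<omega> x) \<le> 1" using that by (auto simp: L2_norm_fourier_seq[OF w])
      have "L2_norm \<omega> (?X x) = norm (coord_proj {j} (T (coord_proj {l} (fourier_seq \<omega> x))))"
        by (simp add: L2_norm_fourier_seq[OF w] P lift_op x)
      also have "\<dots> = norm (entry (T (coord_proj {l} (fourier_seq \<omega> x))) j)"
        using norm_coord_proj_squared[of "{j}" "T (coord_proj {l} (fourier_seq \<omega> x))"] by simp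
      also have "\<dots> \<le> c * norm (entry M (j, l)) * norm (entry (fourier_seq \<omega> x) l)" by (rule M)
      also have "\<dots> \<le> c * norm (entry M (j, l)) * 1"
        using x(2) norm_entry_le[of "fourier_seq \<omega> x" l] c by (intro mult_left_mono) auto
      finally show ?thesis by simp
    qed
    have z: "(\<lambda>s. 0) \<in> ?B" by (simp add: L2_space_const L2_norm_fourier_seq[OF w] fourier_seq_zero)
    have bd: "bdd_above ((\<lambda>x. L2_norm \<omega> (?X x)) ` ?B)" using b by (auto intro!: bdd_aboveI2)
    show "operator_norm \<omega> ?X \<le> c * norm (entry M (j, l))"
      unfolding operator_norm_def using z b by (intro cSUP_least) auto
    have "0 \<le> L2_norm \<omega> (?X (\<lambda>s. 0))"
      using w by (simp add: L2_norm_def sq_nonneg)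
    also have "\<dots> \<le> operator_norm \<omega> ?X" unfolding operator_norm_def by (rule cSUP_upper[OF z bd])
    finally show "0 \<le> operator_norm \<omega> ?X" .
  qed
  have "(\<lambda>(j, l). (operator_norm \<omega> (P_single \<omega> j \<circ> lift_op \<omega> T \<circ> P_single \<omega> l))\<^sup>2) summable_on (UNIV :: (int \<times> int) set)"
  proof (rule summable_on_comparison_test[OF summable_on_cmult_right[OF summable_entry[of M], of "c\<^sup>2"]])
    fix p :: "int \<times> int"
    show "(case p of (j, l) \<Rightarrow> (operator_norm \<omega> (P_single \<omega> j \<circ> lift_op \<omega> T \<circ> P_single \<omega> l))\<^sup>2) \<le> c\<^sup>2 * (norm (entry M p))\<^sup>2"
      unfolding power_mult_distrib[symmetric] by (cases p) (use on in \<open>auto intro!: power_mono\<close>)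
  qed (simp add: case_prod_unfold)
  with bounded_operator_lift[OF T C] show ?thesis by (simp add: S2_def)
qed

subsection \<open>The block projections\<close>

lemma block_proj_trig: "block_proj \<omega> k i x = trig \<omega> (block_set k i) (fourier_coeff \<omega> x)"
  by (cases i) (auto simp: block_proj_def block_set_def P_upto_def P_single_def trig_def fun_eq_iff)

lemma block_proj_fourier:
  fixes x :: "real \<Rightarrow> 'h::complex_hilbert"
  assumes "x \<in> L2_space \<omega>"
  shows "block_proj \<omega> k i x \<in> L2_space \<omega>" "fourier_seq \<omega> (block_proj \<omega> k i x) = coord_proj (block_set k i) (fourier_seq \<omega> x)"
proof -
  show "block_proj \<omega> k i x \<in> L2_space \<omega>" by (simp add: block_proj_trig trig_L2)
  show "fourier_seq \<omega> (block_proj \<omega> k i x) = coord_proj (block_set k i) (fourier_seq \<omega> x)"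
    by (rule ell2_eqI) (simp add: block_proj_trig entry_fourier_seq[OF w trig_L2] entry_coord_proj fourier_coeff_trig[OF w finite_block_set] entry_fourier_seq[OF w assms])
qed

lemma block_Im:
  "operator_Im \<omega> (block_proj \<omega> k i) = {x \<in> L2_space \<omega>. \<forall>n. n \<notin> block_set k i \<longrightarrow> entry (fourier_seq \<omega> x) n = (0 :: 'h::complex_hilbert)}"
proof (intro set_eqI iffI)
  fix y :: "real \<Rightarrow> 'h" assume "y \<in> operator_Im \<omega> (block_proj \<omega> k i)"
  then obtain x where x: "y \<in> L2_space \<omega>" "x \<in> L2_space \<omega>" "L2_eq \<omega> y (block_proj \<omega> k i x)"
    unfolding operator_Im_def L2_image_def by blast
  then have "fourier_seq \<omega> y = coord_proj (block_set k i) (fourier_seq \<omega> x)"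
    by (simp add: L2_eq_iff_fourier[OF w] block_proj_fourier)
  then show "y \<in> {x \<in> L2_space \<omega>. \<forall>n. n \<notin> block_set k i \<longrightarrow> entry (fourier_seq \<omega> x) n = 0}"
    using x(1) by (simp add: entry_coord_proj)
next
  fix y :: "real \<Rightarrow> 'h" assume y: "y \<in> {x \<in> L2_space \<omega>. \<forall>n. n \<notin> block_set k i \<longrightarrow> entry (fourier_seq \<omega> x) n = 0}"
  then have yL: "y \<in> L2_space \<omega>" by blast
  have "fourier_seq \<omega> y = coord_proj (block_set k i) (fourier_seq \<omega> y)" by (rule ell2_eqI) (use y in \<open>auto simp: entry_coord_proj\<close>)
  then have "L2_eq \<omega> y (block_proj \<omega> k i y)"
    by (intro L2_eqI yL block_proj_fourier(1)) (simp add: block_proj_fourier[OF yL])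
  then show "y \<in> operator_Im \<omega> (block_proj \<omega> k i)"
    unfolding operator_Im_def L2_image_def using yL by blast
qed

lemma block_Im_subspace: "L2_subspace \<omega> (operator_Im \<omega> (block_proj \<omega> k i) :: (real \<Rightarrow> 'h::complex_hilbert) set)"
  by (rule L2_subspace_fourier[OF block_Im]) (auto simp: entry_simps entry_cmul_const)

lemma block_proj_in_Im: "x \<in> L2_space \<omega> \<Longrightarrow> block_proj \<omega> k i x \<in> operator_Im \<omega> (block_proj \<omega> k i)"
  by (simp add: block_Im block_proj_fourier entry_coord_proj)

text \<open>Only the finitely many coefficients of the trigonometric polynomial enter the scalar product, so the
  self-adjointness and orthogonality of the block projections follow from these two formulas.\<close>

lemma L2_inner_trig_left:
  fixes y :: "real \<Rightarrow> 'h::complex_hilbert"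
  assumes y: "y \<in> L2_space \<omega>" and F: "finite F"
  shows "L2_inner \<omega> (trig \<omega> F c) y = (\<Sum>n\<in>F. cinner (c n) (fourier_coeff \<omega> y n))"
proof -
  have i: "((\<lambda>s. cinner (E \<omega> n s *\<^sub>C c n) (y s)) has_integral of_real \<omega> * cinner (c n) (fourier_coeff \<omega> y n)) {0..\<omega>}" for n
  proof -
    have "((\<lambda>v. cinner (c n) v) \<circ> (\<lambda>s. E \<omega> (- n) s *\<^sub>C y s) has_integral cinner (c n) (integral {0..\<omega>} (\<lambda>s. E \<omega> (- n) s *\<^sub>C y s))) {0..\<omega>}"
      by (rule has_integral_linear[OF integrable_integral[OF L2_space_integrable(1)[OF L2_space_E[OF y]]] bounded_linear_cinner_right])
    moreover have "cinner (c n) (E \<omega> (- n) s *\<^sub>C y s) = cinner (E \<omega> n s *\<^sub>C c n) (y s)" for s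
      by (simp add: cinner_scaleC_right cinner_scaleC_left cis_cnj)
    moreover have "integral {0..\<omega>} (\<lambda>s. E \<omega> (- n) s *\<^sub>C y s) = \<omega> *\<^sub>R fourier_coeff \<omega> y n"
      using w by (simp add: fourier_coeff_alt)
    ultimately show ?thesis
      by (simp add: o_def linear_simps(5)[OF bounded_linear_cinner_right] scaleR_conv_of_real)
  qed
  have "cinner (trig \<omega> F c s) (y s) = (\<Sum>n\<in>F. cinner (E \<omega> n s *\<^sub>C c n) (y s))" for s
    unfolding trig_def by (rule Real_Vector_Spaces.linear_sum[OF bounded_linear.linear[OF bounded_linear_cinner_left]])
  then have "((\<lambda>s. cinner (trig \<omega> F c s) (y s)) has_integral (\<Sum>n\<in>F. of_real \<omega> * cinner (c n) (fourier_coeff \<omega> y n))) {0..\<omega>}"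
    using has_integral_sum[OF F i] by simp
  then show ?thesis unfolding L2_inner_def using w by (simp add: integral_unique sum_distrib_left[symmetric])
qed

lemma L2_inner_trig_right:
  fixes x :: "real \<Rightarrow> 'h::complex_hilbert"
  assumes x: "x \<in> L2_space \<omega>" and F: "finite F"
  shows "L2_inner \<omega> x (trig \<omega> F c) = (\<Sum>n\<in>F. cinner (fourier_coeff \<omega> x n) (c n))"
proof -
  have i: "((\<lambda>s. cinner (x s) (E \<omega> n s *\<^sub>C c n)) has_integral of_real \<omega> * cinner (fourier_coeff \<omega> x n) (c n)) {0..\<omega>}" for n
  proof -
    have "((\<lambda>v. cinner v (c n)) \<circ> (\<lambda>s. E \<omega> (- n) s *\<^sub>C x s) has_integral cinner (integral {0..\<omega>} (\<lambda>s. E \<omega> (- n) s *\<^sub>C x s)) (c n)) {0..\<omega>}"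
      by (rule has_integral_linear[OF integrable_integral[OF L2_space_integrable(1)[OF L2_space_E[OF x]]] bounded_linear_cinner_left])
    moreover have "cinner (E \<omega> (- n) s *\<^sub>C x s) (c n) = cinner (x s) (E \<omega> n s *\<^sub>C c n)" for s
      by (simp add: cinner_scaleC_right cinner_scaleC_left cis_cnj)
    moreover have "integral {0..\<omega>} (\<lambda>s. E \<omega> (- n) s *\<^sub>C x s) = \<omega> *\<^sub>R fourier_coeff \<omega> x n"
      using w by (simp add: fourier_coeff_alt)
    ultimately show ?thesis
      by (simp add: o_def linear_simps(5)[OF bounded_linear_cinner_left] scaleR_conv_of_real)
  qed
  have "cinner (x s) (trig \<omega> F c s) = (\<Sum>n\<in>F. cinner (x s) (E \<omega> n s *\<^sub>C c n))" for s
    unfolding trig_def by (rule Real_Vector_Spaces.linear_sum[OF bounded_linear.linear[OF bounded_linear_cinner_right]])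
  then have "((\<lambda>s. cinner (x s) (trig \<omega> F c s)) has_integral (\<Sum>n\<in>F. of_real \<omega> * cinner (fourier_coeff \<omega> x n) (c n))) {0..\<omega>}"
    using has_integral_sum[OF F i] by simp
  then show ?thesis unfolding L2_inner_def using w by (simp add: integral_unique sum_distrib_left[symmetric])
qed

text \<open>Once the finitely many indices that carry all but a small part of the norm are covered by the chosen
  blocks, any further blocks change the sum by little.\<close>

lemma has_sum_blocks:
  fixes b :: "'h::complex_hilbert vec2"
  shows "((\<lambda>i. coord_proj (block_set k i) b) has_sum b) (block_index k)"
  unfolding has_sum_def tendsto_iff eventually_finite_subsets_at_top
proof (intro allI impI)
  fix e :: real assume e: "e > 0"
  obtain N0 where N0: "finite N0" "\<And>F. finite F \<Longrightarrow> F \<inter> N0 = {} \<Longrightarrow> (\<Sum>n\<in>F. (norm (entry b n))\<^sup>2) \<le> (e/2)\<^sup>2"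
    using summable_tail[OF summable_entry[of b], of "(e/2)\<^sup>2"] e by auto
  have "dist (\<Sum>i\<in>F. coord_proj (block_set k i) b) b < e" if F: "finite F" "block_of k ` N0 \<subseteq> F" "F \<subseteq> block_index k" for F
  proof -
    have ent: "entry ((\<Sum>i\<in>F. coord_proj (block_set k i) b) - b) n = (if block_of k n \<in> F then 0 else - entry b n)" for n
    proof -
      have "entry (\<Sum>i\<in>F. coord_proj (block_set k i) b) n = (\<Sum>i\<in>F. entry (coord_proj (block_set k i) b) n)"
        by (rule Real_Vector_Spaces.linear_sum[OF bounded_linear.linear[OF bounded_linear_entry]])
      also have "\<dots> = (\<Sum>i\<in>F. if block_of k n = i then entry b n else 0)"
        using F(3) block_of(2)[of _ k n] by (intro sum.cong) (auto simp: entry_coord_proj)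
      also have "\<dots> = (if block_of k n \<in> F then entry b n else 0)" using F(1) by simp
      finally show ?thesis by (simp add: entry_minus)
    qed
    have "norm ((\<Sum>i\<in>F. coord_proj (block_set k i) b) - b) \<le> e/2"
    proof (rule norm_ell2_le)
      fix G :: "int set" assume G: "finite G"
      have "(L2_set (\<lambda>n. norm (entry ((\<Sum>i\<in>F. coord_proj (block_set k i) b) - b) n)) G)\<^sup>2 = (\<Sum>n\<in>{n\<in>G. block_of k n \<notin> F}. (norm (entry b n))\<^sup>2)"
        unfolding L2_set_squared ent using G by (intro sum.mono_neutral_cong_right) auto
      also have "\<dots> \<le> (e/2)\<^sup>2" using G F(2) by (intro N0) auto
      finally show "L2_set (\<lambda>n. norm (entry ((\<Sum>i\<in>F. coord_proj (block_set k i) b) - b) n)) G \<le> e/2"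
        by (rule power2_le_imp_le) (use e in simp)
    qed
    then show ?thesis using e by (simp add: dist_norm)
  qed
  then show "\<exists>X. finite X \<and> X \<subseteq> block_index k \<and> (\<forall>Y. finite Y \<and> X \<subseteq> Y \<and> Y \<subseteq> block_index k \<longrightarrow> dist (\<Sum>i\<in>Y. coord_proj (block_set k i) b) b < e)"
    using N0(1) block_of(1) by (intro exI[of _ "block_of k ` N0"]) (auto simp: image_subset_iff)
qed

lemma summable_on_blocks: "(\<lambda>i. (norm (coord_proj (block_set k i) (b :: 'h::complex_hilbert vec2)))\<^sup>2) summable_on (block_index k)"
proof (rule nonneg_bdd_above_summable_on)
  show "bdd_above (sum (\<lambda>i. (norm (coord_proj (block_set k i) b))\<^sup>2) ` {F. F \<subseteq> block_index k \<and> finite F})"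
  proof (rule bdd_aboveI2)
    fix F assume "F \<in> {F. F \<subseteq> block_index k \<and> finite F}"
    then have F: "F \<subseteq> block_index k" "finite F" by auto
    have "(\<Sum>i\<in>F. (norm (coord_proj (block_set k i) b))\<^sup>2) = (\<Sum>i\<in>F. \<Sum>n\<in>block_set k i. (norm (entry b n))\<^sup>2)"
      by (simp add: norm_coord_proj_squared finite_block_set)
    also have "\<dots> = (\<Sum>n\<in>(\<Union>i\<in>F. block_set k i). (norm (entry b n))\<^sup>2)"
      using F block_of(2)[of _ k] by (intro sum.UNION_disjoint[symmetric] ballI impI finite_block_set) (auto, metis subsetD)
    also have "\<dots> \<le> (norm b)\<^sup>2"
      unfolding norm_ell2_squared using F finite_block_set by (intro finite_sum_le_infsum summable_entry) auto
    finally show "(\<Sum>i\<in>F. (norm (coord_proj (block_set k i) b))\<^sup>2) \<le> (norm b)\<^sup>2" .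
  qed
qed auto

lemma orthogonal_decomposition_blocks:
  "orthogonal_decomposition \<omega> (block_index k) (block_proj \<omega> k :: int option \<Rightarrow> 'h::complex_hilbert operator)"
  unfolding orthogonal_decomposition_def
proof (intro conjI ballI impI)
  fix i assume i: "i \<in> block_index k"
  let ?Q = "block_proj \<omega> k i :: 'h operator"
  show "orthogonal_projection \<omega> ?Q"
    unfolding orthogonal_projection_def
  proof (intro conjI ballI)
    show "bounded_operator_on \<omega> (L2_space \<omega>) ?Q"
      unfolding bounded_operator_on_def
    proof
      show "linear_operator \<omega> (L2_space \<omega>) (L2_space \<omega>) ?Q"
        by (rule linear_operator_fourier[OF L2_subspace_L2 L2_subspace_L2, where T = "coord_proj (block_set k i)"])
           (auto simp: block_proj_fourier intro!: ell2_eqI simp: entry_coord_proj entry_simps entry_cmul_const)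
      have "norm (coord_proj (block_set k i) a) \<le> 1 * norm a" for a :: "'h vec2"
        by (auto intro!: norm_ell2_mono simp: entry_coord_proj)
      then show "\<exists>C. \<forall>x\<in>L2_space \<omega>. L2_norm \<omega> (?Q x) \<le> C * L2_norm \<omega> x"
        by (intro exI[of _ 1]) (simp add: L2_norm_fourier_seq[OF w] block_proj_fourier)
    qed
    fix x :: "real \<Rightarrow> 'h" assume x: "x \<in> L2_space \<omega>"
    show "L2_eq \<omega> (?Q (?Q x)) (?Q x)"
      by (intro L2_eqI block_proj_fourier(1) x ell2_eqI) (simp add: block_proj_fourier x entry_coord_proj)
    fix y :: "real \<Rightarrow> 'h" assume y: "y \<in> L2_space \<omega>"
    show "L2_inner \<omega> (?Q x) y = L2_inner \<omega> x (?Q y)"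
      unfolding block_proj_trig L2_inner_trig_left[OF y finite_block_set] L2_inner_trig_right[OF x finite_block_set] ..
  qed
next
  fix i j and x y :: "real \<Rightarrow> 'h"
  assume ij: "i \<in> block_index k" "j \<in> block_index k" "i \<noteq> j"
    and x: "x \<in> operator_Im \<omega> (block_proj \<omega> k i)" and y: "y \<in> operator_Im \<omega> (block_proj \<omega> k j)"
  have xL: "x \<in> L2_space \<omega>" and yL: "y \<in> L2_space \<omega>" using x y by (auto simp: block_Im)
  have "L2_eq \<omega> x (block_proj \<omega> k i x)"
    by (intro L2_eqI xL block_proj_fourier(1) ell2_eqI) (use x in \<open>auto simp: block_proj_fourier xL entry_coord_proj block_Im\<close>)
  then have "L2_inner \<omega> x y = L2_inner \<omega> (block_proj \<omega> k i x) y"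
    unfolding L2_inner_def by (subst L2_eq_integral[where f = "\<lambda>s v. cinner v (y s)"]) auto
  also have "\<dots> = 0"
    unfolding block_proj_trig L2_inner_trig_left[OF yL finite_block_set]
  proof (rule sum.neutral, rule ballI)
    fix n assume "n \<in> block_set k i"
    then have "n \<notin> block_set k j" using block_of(2)[of i k n] block_of(2)[of j k n] ij by auto
    then have "fourier_coeff \<omega> y n = 0" using y entry_fourier_seq[OF w yL, of n] by (simp add: block_Im)
    then show "cinner (fourier_coeff \<omega> x n) (fourier_coeff \<omega> y n) = 0"
      by (simp add: linear_simps(3)[OF bounded_linear_cinner_right])
  qed
  finally show "L2_inner \<omega> x y = 0" .
next
  fix x :: "real \<Rightarrow> 'h" assume x: "x \<in> L2_space \<omega>"
  show "L2_has_sum \<omega> (\<lambda>i. block_proj \<omega> k i x) (block_index k) x"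
    by (rule L2_has_sum_fourier[OF x]) (simp_all add: block_proj_fourier x has_sum_blocks)
qed

text \<open>A criterion for direct sums in terms of Fourier coefficients: the operator acts blockwise on
  coefficients, and its domain consists of those functions whose formal image \<open>T\<close> is
  square-summable.\<close>

lemma orthogonal_direct_sum_blocks:
  fixes A :: "'h::complex_hilbert operator" and B :: "int option \<Rightarrow> 'h operator" and T :: "'h vec2 \<Rightarrow> int \<Rightarrow> 'h"
  assumes cl: "closed_operator \<omega> D A"
    and D: "D = {x \<in> L2_space \<omega>. (\<lambda>n. (norm (T (fourier_seq \<omega> x) n))\<^sup>2) summable_on UNIV}"
    and A: "\<And>x n. x \<in> D \<Longrightarrow> entry (fourier_seq \<omega> (A x)) n = T (fourier_seq \<omega> x) n"
    and BL: "\<And>i x. i \<in> block_index k \<Longrightarrow> x \<in> operator_Im \<omega> (block_proj \<omega> k i) \<Longrightarrow> B i x \<in> L2_space \<omega>"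
    and B: "\<And>i x n. i \<in> block_index k \<Longrightarrow> x \<in> operator_Im \<omega> (block_proj \<omega> k i) \<Longrightarrow> entry (fourier_seq \<omega> (B i x)) n = T (fourier_seq \<omega> x) n"
    and Bb: "\<And>i. i \<in> block_index k \<Longrightarrow> \<exists>C. \<forall>x\<in>operator_Im \<omega> (block_proj \<omega> k i). norm (fourier_seq \<omega> (B i x)) \<le> C * norm (fourier_seq \<omega> x)"
    and Tadd: "\<And>a b n. T (a + b) n = T a n + T b n"
    and Tmult: "\<And>c a n. T (cmul (\<lambda>_. c) a) n = c *\<^sub>C T a n"
    and Tpr: "\<And>i a n. i \<in> block_index k \<Longrightarrow> T (coord_proj (block_set k i) a) n = (if n \<in> block_set k i then T a n else 0)"
  shows "orthogonal_direct_sum \<omega> (block_index k) (block_proj \<omega> k) D A B"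
proof -
  let ?Im = "\<lambda>i. operator_Im \<omega> (block_proj \<omega> k i) :: (real \<Rightarrow> 'h) set"
  have AL: "A x \<in> L2_space \<omega>" if "x \<in> D" for x
    using cl that unfolding closed_operator_def linear_operator_def by blast
  have ImT: "T (fourier_seq \<omega> x) n = 0" if "i \<in> block_index k" "x \<in> ?Im i" "n \<notin> block_set k i" for i x n
  proof -
    have "fourier_seq \<omega> x = coord_proj (block_set k i) (fourier_seq \<omega> x)" by (rule ell2_eqI) (use that(2) in \<open>auto simp: entry_coord_proj block_Im\<close>)
    then show ?thesis using Tpr[OF that(1), of "fourier_seq \<omega> x" n] that(3) by simp
  qed
  have ImL: "x \<in> L2_space \<omega>" if "x \<in> ?Im i" for x i using that by (simp add: block_Im)
  have ImD: "x \<in> D" if "i \<in> block_index k" "x \<in> ?Im i" for x i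
  proof -
    have "(\<lambda>n. (norm (T (fourier_seq \<omega> x) n))\<^sup>2) summable_on UNIV"
      by (rule finite_nonzero_values_imp_summable_on, rule finite_subset[OF _ finite_block_set[of k i]])
         (use ImT[OF that] in auto)
    then show ?thesis using ImL[OF that(2)] by (simp add: D)
  qed
  have Bpr: "fourier_seq \<omega> (B i (block_proj \<omega> k i x)) = coord_proj (block_set k i) b"
    if "i \<in> block_index k" "x \<in> L2_space \<omega>" "\<And>n. n \<in> block_set k i \<Longrightarrow> entry b n = T (fourier_seq \<omega> x) n" for i x b
    by (rule ell2_eqI) (simp add: B[OF that(1) block_proj_in_Im[OF that(2)]] block_proj_fourier that Tpr entry_coord_proj)
  have BIm: "B i x \<in> ?Im i" if "i \<in> block_index k" "x \<in> ?Im i" for i x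
    unfolding block_Im using BL[OF that] ImT[OF that] by (simp add: B[OF that])
  have nB: "L2_norm \<omega> (B i (block_proj \<omega> k i x)) = norm (fourier_seq \<omega> (B i (block_proj \<omega> k i x)))"
    if "i \<in> block_index k" "x \<in> L2_space \<omega>" for i x
    by (rule L2_norm_fourier_seq[OF w BL[OF that(1) block_proj_in_Im[OF that(2)]]])
  show ?thesis
    unfolding orthogonal_direct_sum_def
  proof (intro conjI ballI)
    show "orthogonal_decomposition \<omega> (block_index k) (block_proj \<omega> k :: int option \<Rightarrow> 'h operator)"
      by (rule orthogonal_decomposition_blocks)
    show "closed_operator \<omega> D A" by (rule cl)
    show "D = {x \<in> L2_space \<omega>. (\<lambda>i. (L2_norm \<omega> (B i (block_proj \<omega> k i x)))\<^sup>2) summable_on block_index k}"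
    proof (intro set_eqI iffI)
      fix x assume "x \<in> D"
      then have x: "x \<in> L2_space \<omega>" "(\<lambda>n. (norm (T (fourier_seq \<omega> x) n))\<^sup>2) summable_on UNIV" by (auto simp: D)
      have "(\<lambda>i. (norm (coord_proj (block_set k i) (Ell2 (T (fourier_seq \<omega> x)))))\<^sup>2) summable_on block_index k" by (rule summable_on_blocks)
      then have "(\<lambda>i. (L2_norm \<omega> (B i (block_proj \<omega> k i x)))\<^sup>2) summable_on block_index k"
        by (rule summable_on_cong[THEN iffD1, rotated]) (simp add: nB x(1) Bpr[OF _ x(1), of _ "Ell2 (T (fourier_seq \<omega> x))"] entry_Ell2[OF x(2)])
      with x(1) show "x \<in> {x \<in> L2_space \<omega>. (\<lambda>i. (L2_norm \<omega> (B i (block_proj \<omega> k i x)))\<^sup>2) summable_on block_index k}" by simp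
    next
      fix x assume "x \<in> {x \<in> L2_space \<omega>. (\<lambda>i. (L2_norm \<omega> (B i (block_proj \<omega> k i x)))\<^sup>2) summable_on block_index k}"
      then have x: "x \<in> L2_space \<omega>" and s: "(\<lambda>i. (L2_norm \<omega> (B i (block_proj \<omega> k i x)))\<^sup>2) summable_on block_index k" by auto
      have pw: "(norm (T (fourier_seq \<omega> x) n))\<^sup>2 = (norm (entry (fourier_seq \<omega> (B i (block_proj \<omega> k i x))) n))\<^sup>2" if "i \<in> block_index k" "n \<in> block_set k i" for i n
        using that by (simp add: B[OF that(1) block_proj_in_Im[OF x]] block_proj_fourier x Tpr)
      have "(\<lambda>n. (norm (T (fourier_seq \<omega> x) n))\<^sup>2) summable_on UNIV"
      proof (rule nonneg_bdd_above_summable_on)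
        show "bdd_above (sum (\<lambda>n. (norm (T (fourier_seq \<omega> x) n))\<^sup>2) ` {F. F \<subseteq> UNIV \<and> finite F})"
        proof (rule bdd_aboveI2)
          fix G :: "int set" assume "G \<in> {F. F \<subseteq> UNIV \<and> finite F}"
          then have G: "finite G" by simp
          have "(\<Sum>n\<in>G. (norm (T (fourier_seq \<omega> x) n))\<^sup>2) = (\<Sum>i\<in>block_of k ` G. \<Sum>n\<in>{n\<in>G. block_of k n = i}. (norm (T (fourier_seq \<omega> x) n))\<^sup>2)"
            by (rule sum.image_gen[OF G])
          also have "\<dots> \<le> (\<Sum>i\<in>block_of k ` G. (L2_norm \<omega> (B i (block_proj \<omega> k i x)))\<^sup>2)"
          proof (rule sum_mono)
            fix i assume "i \<in> block_of k ` G"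
            then have i: "i \<in> block_index k" using block_of(1) by auto
            have "(\<Sum>n\<in>{n\<in>G. block_of k n = i}. (norm (T (fourier_seq \<omega> x) n))\<^sup>2)
                = (\<Sum>n\<in>{n\<in>G. block_of k n = i}. (norm (entry (fourier_seq \<omega> (B i (block_proj \<omega> k i x))) n))\<^sup>2)"
              using block_of(2)[OF i] by (intro sum.cong pw i) auto
            also have "\<dots> \<le> (norm (fourier_seq \<omega> (B i (block_proj \<omega> k i x))))\<^sup>2"
              unfolding norm_ell2_squared using G by (intro finite_sum_le_infsum summable_entry) auto
            finally show "(\<Sum>n\<in>{n\<in>G. block_of k n = i}. (norm (T (fourier_seq \<omega> x) n))\<^sup>2) \<le> (L2_norm \<omega> (B i (block_proj \<omega> k i x)))\<^sup>2"
              by (simp only: nB[OF i x])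
          qed
          also have "\<dots> \<le> (\<Sum>\<^sub>\<infinity>i\<in>block_index k. (L2_norm \<omega> (B i (block_proj \<omega> k i x)))\<^sup>2)"
            using G block_of(1) by (intro finite_sum_le_infsum s) auto
          finally show "(\<Sum>n\<in>G. (norm (T (fourier_seq \<omega> x) n))\<^sup>2) \<le> (\<Sum>\<^sub>\<infinity>i\<in>block_index k. (L2_norm \<omega> (B i (block_proj \<omega> k i x)))\<^sup>2)" .
        qed
      qed simp
      with x show "x \<in> D" by (simp add: D)
    qed
  next
    fix i assume i: "i \<in> block_index k"
    show "bounded_operator_on \<omega> (?Im i) (B i)"
      unfolding bounded_operator_on_def
    proof
      have e: "fourier_seq \<omega> (B i x) = Ell2 (T (fourier_seq \<omega> x))" if "x \<in> ?Im i" for x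
      proof -
        have "(\<lambda>n. (norm (T (fourier_seq \<omega> x) n))\<^sup>2) summable_on UNIV" using ImD[OF i that] by (simp add: D)
        then show ?thesis by (intro ell2_eqI) (simp add: entry_Ell2 B[OF i that])
      qed
      have sT: "(\<lambda>n. (norm (T (fourier_seq \<omega> x) n))\<^sup>2) summable_on UNIV" if "x \<in> ?Im i" for x
        using ImD[OF i that] by (simp add: D)
      show "linear_operator \<omega> (?Im i) (?Im i) (B i)"
      proof (rule linear_operator_fourier[where T = "\<lambda>a. Ell2 (T a)", OF block_Im_subspace block_Im_subspace BIm[OF i] e])
        fix x y assume x: "x \<in> ?Im i" and y: "y \<in> ?Im i"
        show "Ell2 (T (fourier_seq \<omega> x + fourier_seq \<omega> y)) = Ell2 (T (fourier_seq \<omega> x)) + Ell2 (T (fourier_seq \<omega> y))"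
          using square_summable_add[OF sT[OF x] sT[OF y]]
          by (intro ell2_eqI) (simp add: entry_simps entry_Ell2 sT[OF x] sT[OF y] Tadd)
      next
        fix c x assume x: "x \<in> ?Im i"
        have "(\<lambda>n. (norm (T (cmul (\<lambda>_. c) (fourier_seq \<omega> x)) n))\<^sup>2) summable_on UNIV"
          using summable_on_cmult_right[OF sT[OF x], of "(cmod c)\<^sup>2"] by (simp add: Tmult norm_scaleC power_mult_distrib)
        then show "Ell2 (T (cmul (\<lambda>_. c) (fourier_seq \<omega> x))) = cmul (\<lambda>_. c) (Ell2 (T (fourier_seq \<omega> x)))"
          by (intro ell2_eqI) (simp add: entry_cmul_const entry_Ell2 sT[OF x] Tmult)
      qed
      obtain C where "\<forall>x\<in>?Im i. norm (fourier_seq \<omega> (B i x)) \<le> C * norm (fourier_seq \<omega> x)" using Bb[OF i] by blast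
      then show "\<exists>C. \<forall>x\<in>?Im i. L2_norm \<omega> (B i x) \<le> C * L2_norm \<omega> x"
        by (intro exI[of _ C]) (simp add: L2_norm_fourier_seq[OF w] BL[OF i] ImL)
    qed
    show "?Im i \<subseteq> D" using ImD[OF i] by blast
    show "invariant_subspace \<omega> A (?Im i)"
      unfolding invariant_subspace_def
    proof (intro conjI ballI block_Im_subspace)
      fix x assume x: "x \<in> ?Im i"
      show "A x \<in> ?Im i"
        unfolding block_Im using AL[OF ImD[OF i x]] ImT[OF i x] by (simp add: A[OF ImD[OF i x]])
    qed
    fix x assume x: "x \<in> ?Im i"
    show "L2_eq \<omega> (A x) (B i x)"
      by (intro L2_eqI AL ImD[OF i x] BL[OF i x] ell2_eqI) (simp add: A[OF ImD[OF i x]] B[OF i x])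
  next
    fix x assume x: "x \<in> D"
    then have xL: "x \<in> L2_space \<omega>" by (simp add: D)
    show "L2_has_sum \<omega> (\<lambda>i. B i (block_proj \<omega> k i x)) (block_index k) (A x)"
    proof (rule L2_has_sum_fourier[OF AL[OF x]])
      show "B i (block_proj \<omega> k i x) \<in> L2_space \<omega>" if "i \<in> block_index k" for i
        by (rule BL[OF that block_proj_in_Im[OF xL]])
      show "((\<lambda>i. fourier_seq \<omega> (B i (block_proj \<omega> k i x))) has_sum fourier_seq \<omega> (A x)) (block_index k)"
        by (rule has_sum_cong[THEN iffD2, OF _ has_sum_blocks]) (rule Bpr[OF _ xL], simp_all add: A[OF x])
    qed
  qed
qed

end


section \<open>Transfer of the similarity to the function space\<close>

lemma cmul_of_real: "cmul (\<lambda>_. complex_of_real r) x = r *\<^sub>R x"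
  by (rule ell2_eqI) (simp only: entry_cmul_const scaleC_of_real entry_scaleR)

lemma clinear_map_bounded:
  assumes T: "clinear_map T" and C: "\<And>a. norm (T a) \<le> C * norm a"
  shows "bounded_linear T"
proof (rule bounded_linear_intro[of _ C])
  show "T (x + y) = T x + T y" for x y using T by (simp add: clinear_map_def)
  show "T (r *\<^sub>R x) = r *\<^sub>R T x" for r x
    using T unfolding clinear_map_def cmul_of_real[symmetric] by blast
  show "norm (T x) \<le> norm x * C" for x using C[of x] by (simp add: mult.commute)
qed

lemma times_index_unique: "times_index a z \<Longrightarrow> times_index a z' \<Longrightarrow> z = z'"
  by (rule ell2_eqI) (simp add: times_index_def)

lemma times_index_add: "times_index a z \<Longrightarrow> times_index b y \<Longrightarrow> times_index (a + b) (z + y)"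
  by (simp add: times_index_def entry_simps scaleR_add_right)

lemma times_index_cmul: "times_index a z \<Longrightarrow> times_index (cmul (\<lambda>_. c) a) (cmul (\<lambda>_. c) z)"
  by (simp add: times_index_def entry_cmul_const scaleC_scaleR)

lemma times_index_zero: "times_index 0 0"
  by (simp add: times_index_def entry_zero)

lemma times_index_closed:
  assumes N: "\<And>n::nat. times_index (X n) (Z n)" and X: "X \<longlonglongrightarrow> a" and Z: "Z \<longlonglongrightarrow> z"
  shows "times_index a z"
  unfolding times_index_def
proof
  fix j
  have "(\<lambda>n. entry (Z n) j) \<longlonglongrightarrow> entry z j" by (rule bounded_linear.tendsto[OF bounded_linear_entry Z])
  moreover have "(\<lambda>n. real_of_int j *\<^sub>R entry (X n) j) \<longlonglongrightarrow> real_of_int j *\<^sub>R entry a j"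
    by (intro tendsto_intros bounded_linear.tendsto[OF bounded_linear_entry X])
  moreover have "entry (Z n) j = real_of_int j *\<^sub>R entry (X n) j" for n using N[of n] by (simp add: times_index_def)
  ultimately show "entry z j = real_of_int j *\<^sub>R entry a j" by (simp add: LIMSEQ_unique)
qed

lemma times_index_finite_support:
  assumes "finite S" "\<And>n. n \<notin> S \<Longrightarrow> entry a n = 0"
  shows "\<exists>z. times_index a z"
proof -
  have "(\<lambda>n. (norm (real_of_int n *\<^sub>R entry a n))\<^sup>2) summable_on UNIV"
    by (rule finite_nonzero_values_imp_summable_on, rule finite_subset[OF _ assms(1)]) (use assms(2) in auto)
  then have "times_index a (Ell2 (\<lambda>n. real_of_int n *\<^sub>R entry a n))" by (simp add: times_index_def entry_Ell2)
  then show ?thesis by blast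
qed

lemma entry_mv_coord_proj_single: "entry (mv M (coord_proj {l} a)) j = blinfun_apply (entry M (j, l)) (entry a l)"
proof -
  have "entry (mv M (coord_proj {l} a)) j = (\<Sum>\<^sub>\<infinity>n\<in>{l}. blinfun_apply (entry M (j, n)) (entry a n))"
    unfolding entry_mv pairing_def by (rule infsum_cong_neutral) (auto simp: entry_coord_proj entry_mrow)
  then show ?thesis by simp
qed

lemma entry_mv_coord_proj_block:
  assumes bd: "\<And>j l. \<not> same_block k j l \<Longrightarrow> entry M (j, l) = 0" and i: "i \<in> block_index k"
  shows "entry (mv M (coord_proj (block_set k i) a)) j = (if j \<in> block_set k i then entry (mv M a) j else 0)"
proof -
  have "blinfun_apply (entry M (j, n)) (entry (coord_proj (block_set k i) a) n)
      = (if j \<in> block_set k i then blinfun_apply (entry M (j, n)) (entry a n) else 0)" for n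
    using bd[of j n] block_of(2)[OF i] by (cases "same_block k j n") (auto simp: entry_coord_proj same_block_iff)
  then show ?thesis unfolding entry_mv pairing_def by (simp add: entry_mrow)
qed

lemma clinear_map_cmul_mv: "mclinear M \<Longrightarrow> clinear_map (\<lambda>a. cmul (\<lambda>_. c) (mv M a))"
  by (simp add: clinear_map_def mv.add_right mv_cmul cmul_const_linear mult.commute)

lemma norm_cmul_mv_le: "norm (cmul (\<lambda>_. c) (mv M a)) \<le> cmod c * norm M * norm a"
proof -
  have "norm (cmul (\<lambda>_. c) (mv M a)) \<le> cmod c * norm (mv M a)" by (rule norm_cmul_const_le)
  also have "\<dots> \<le> cmod c * (norm M * norm a)" by (intro mult_left_mono norm_mv_le) simp
  finally show ?thesis by (simp add: mult.assoc)
qed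

context
  fixes \<omega> :: real
  assumes w: "\<omega> > 0"
begin

lemma S2_mv:
  fixes M :: "'h::complex_hilbert mat"
  assumes "mclinear M"
  shows "lift_op \<omega> (\<lambda>a. cmul (\<lambda>_. c) (mv M a)) \<in> S2 \<omega>"
proof (rule S2_lift[OF w clinear_map_cmul_mv[OF assms] norm_cmul_mv_le])
  fix j l and a :: "'h vec2"
  show "norm (entry (cmul (\<lambda>_. c) (mv M (coord_proj {l} a))) j) \<le> cmod c * norm (entry M (j, l)) * norm (entry a l)"
    by (simp add: entry_cmul_const norm_scaleC entry_mv_coord_proj_single mult.assoc mult_left_mono norm_blinfun)
qed simp

lemma dom_L0_iff: "x \<in> dom_L0 \<omega> \<longleftrightarrow> x \<in> L2_space \<omega> \<and> (\<exists>z. times_index (fourier_seq \<omega> x) z)"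
  using dom_L0_times_index[OF w] dom_L0_of_fourier(1)[OF w] by blast

lemma fourier_seq_L0:
  assumes x: "x \<in> dom_L0 \<omega>" and z: "times_index (fourier_seq \<omega> x) z"
  shows "fourier_seq \<omega> (L0 \<omega> x) = cmul (\<lambda>_. ik \<omega>) z"
proof -
  have "z = cmul (\<lambda>_. 1 / ik \<omega>) (fourier_seq \<omega> (L0 \<omega> x))" by (rule times_index_unique[OF z dom_L0_times_index(2)[OF w x]])
  then show ?thesis using ik_nonzero[OF w] by (simp add: cmul_const_linear)
qed

lemma dom_L0_subspace: "L2_subspace \<omega> (dom_L0 \<omega> :: (real \<Rightarrow> 'h::complex_hilbert) set)"
proof (rule L2_subspace_fourier[OF w, where P = "\<lambda>a. \<exists>z. times_index a z"])
  show "dom_L0 \<omega> = {x \<in> L2_space \<omega>. \<exists>z. times_index (fourier_seq \<omega> x) z}" using dom_L0_iff by blast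
qed (use times_index_add times_index_cmul times_index_zero in blast)+

text \<open>Solving the formula for \<open>A\<close> for the image under multiplication by the index expresses it continuously
  through \<open>x\<close> and \<open>A x\<close>, and multiplication by the index is closed. With \<open>T\<close> the identity this covers
  the diagonalised operator itself.\<close>

lemma closed_operator_similar:
  fixes A :: "'h::complex_hilbert operator" and T Ti S :: "'h vec2 \<Rightarrow> 'h vec2"
  assumes T: "clinear_map T" "\<And>a. norm (T a) \<le> C * norm a"
    and Ti: "clinear_map Ti" "\<And>a. norm (Ti a) \<le> K * norm a"
    and S: "clinear_map S" "\<And>a. norm (S a) \<le> B * norm a"
    and inv: "\<And>a. Ti (T a) = a"  "\<And>a. T (Ti a) = a"
    and dom: "\<And>x. x \<in> L2_space \<omega> \<Longrightarrow> x \<in> dom_L0 \<omega> \<longleftrightarrow> (\<exists>z. times_index (Ti (fourier_seq \<omega> x)) z)"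
    and AL: "\<And>x. x \<in> dom_L0 \<omega> \<Longrightarrow> A x \<in> L2_space \<omega>"
    and A: "\<And>x z. x \<in> dom_L0 \<omega> \<Longrightarrow> times_index (Ti (fourier_seq \<omega> x)) z \<Longrightarrow> fourier_seq \<omega> (A x) = cmul (\<lambda>_. c) (T (z - S (Ti (fourier_seq \<omega> x))))"
    and c: "c \<noteq> 0"
  shows "closed_operator \<omega> (dom_L0 \<omega>) A"
proof (rule closed_operator_fourier[OF w])
  note bT = clinear_map_bounded[OF T] and bTi = clinear_map_bounded[OF Ti] and bS = clinear_map_bounded[OF S]
  have addT: "T (x + y) = T x + T y" and cmT: "T (cmul (\<lambda>_. d) x) = cmul (\<lambda>_. d) (T x)"
    and addTi: "Ti (x + y) = Ti x + Ti y" and cmTi: "Ti (cmul (\<lambda>_. d) x) = cmul (\<lambda>_. d) (Ti x)"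
    and addS: "S (x + y) = S x + S y" and cmS: "S (cmul (\<lambda>_. d) x) = cmul (\<lambda>_. d) (S x)" for x y d
    using T(1) Ti(1) S(1) by (auto simp: clinear_map_def)
  define G where "G a = cmul (\<lambda>_. c) (T ((SOME z. times_index (Ti a) z) - S (Ti a)))" for a
  have G: "G a = cmul (\<lambda>_. c) (T (z - S (Ti a)))" if "times_index (Ti a) z" for a z
  proof -
    have "(SOME z. times_index (Ti a) z) = z" using times_index_unique[OF someI[of "times_index (Ti a)", OF that] that] .
    then show ?thesis by (simp add: G_def)
  qed
  have domL: "x \<in> L2_space \<omega>" if "x \<in> dom_L0 \<omega>" for x :: "real \<Rightarrow> 'h" using that by (simp add: dom_L0_iff)
  have domN: "\<exists>z. times_index (Ti (fourier_seq \<omega> x)) z" if "x \<in> dom_L0 \<omega>" for x :: "real \<Rightarrow> 'h"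
    using dom[OF domL[OF that]] that by blast
  show "linear_operator \<omega> (dom_L0 \<omega>) (L2_space \<omega>) A"
  proof (rule linear_operator_fourier[OF w dom_L0_subspace L2_subspace_L2[OF w] AL, where T = G])
    show "fourier_seq \<omega> (A x) = G (fourier_seq \<omega> x)" if "x \<in> dom_L0 \<omega>" for x
      using domN[OF that] A[OF that] G by auto
    fix x :: "real \<Rightarrow> 'h" assume x: "x \<in> dom_L0 \<omega>"
    obtain z where z: "times_index (Ti (fourier_seq \<omega> x)) z" using domN[OF x] by blast
    show "G (cmul (\<lambda>_. d) (fourier_seq \<omega> x)) = cmul (\<lambda>_. d) (G (fourier_seq \<omega> x))" for d
    proof -
      have "times_index (Ti (cmul (\<lambda>_. d) (fourier_seq \<omega> x))) (cmul (\<lambda>_. d) z)" unfolding cmTi by (rule times_index_cmul[OF z])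
      from G[OF this] show ?thesis
        by (simp add: G[OF z] cmTi cmS cmul_const_linear(2)[symmetric] cmT cmul_const_linear(3) mult.commute)
    qed
    fix y :: "real \<Rightarrow> 'h" assume y: "y \<in> dom_L0 \<omega>"
    obtain u where u: "times_index (Ti (fourier_seq \<omega> y)) u" using domN[OF y] by blast
    have "times_index (Ti (fourier_seq \<omega> x + fourier_seq \<omega> y)) (z + u)" unfolding addTi by (rule times_index_add[OF z u])
    from G[OF this] show "G (fourier_seq \<omega> x + fourier_seq \<omega> y) = G (fourier_seq \<omega> x) + G (fourier_seq \<omega> y)"
      by (simp add: G[OF z] G[OF u] addTi addS cmul_const_linear(1)[symmetric] addT[symmetric] algebra_simps)
  qed
  fix X :: "nat \<Rightarrow> real \<Rightarrow> 'h" and x y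
  assume X: "\<And>n. X n \<in> dom_L0 \<omega>" and x: "x \<in> L2_space \<omega>" and y: "y \<in> L2_space \<omega>"
    and Xx: "(\<lambda>n. fourier_seq \<omega> (X n)) \<longlonglongrightarrow> fourier_seq \<omega> x" and Ay: "(\<lambda>n. fourier_seq \<omega> (A (X n))) \<longlonglongrightarrow> fourier_seq \<omega> y"
  define Z where "Z n = Ti (cmul (\<lambda>_. 1 / c) (fourier_seq \<omega> (A (X n)))) + S (Ti (fourier_seq \<omega> (X n)))" for n
  define z where "z = Ti (cmul (\<lambda>_. 1 / c) (fourier_seq \<omega> y)) + S (Ti (fourier_seq \<omega> x))"
  have "times_index (Ti (fourier_seq \<omega> (X n))) (Z n)" for n
  proof -
    obtain u where u: "times_index (Ti (fourier_seq \<omega> (X n))) u" using domN[OF X] by blast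
    have "Z n = u" unfolding Z_def A[OF X u] using c by (simp add: cmul_const_linear(3,4) inv)
    with u show ?thesis by simp
  qed
  moreover have "(\<lambda>n. Ti (fourier_seq \<omega> (X n))) \<longlonglongrightarrow> Ti (fourier_seq \<omega> x)" by (rule bounded_linear.tendsto[OF bTi Xx])
  moreover have "Z \<longlonglongrightarrow> z"
    unfolding Z_def z_def
    by (intro tendsto_add bounded_linear.tendsto[OF bTi] bounded_linear.tendsto[OF bS]
        bounded_linear.tendsto[OF bounded_linear_cmul_const] Xx Ay)
  ultimately have N: "times_index (Ti (fourier_seq \<omega> x)) z" by (rule times_index_closed)
  then have xd: "x \<in> dom_L0 \<omega>" using dom[OF x] by blast
  have "fourier_seq \<omega> (A x) = fourier_seq \<omega> y" unfolding A[OF xd N] z_def using c by (simp add: inv cmul_const_linear(3,4))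
  with xd show "x \<in> dom_L0 \<omega> \<and> fourier_seq \<omega> (A x) = fourier_seq \<omega> y" by blast
qed

text \<open>A block-diagonal matrix commutes with the projections onto the blocks.\<close>

lemma direct_sum_bounded:
  fixes M :: "'h::complex_hilbert mat" and c :: complex
  assumes M: "mclinear M" and bd: "\<And>j l. \<not> same_block k j l \<Longrightarrow> entry M (j, l) = 0"
  defines "S \<equiv> lift_op \<omega> (\<lambda>a. cmul (\<lambda>_. c) (mv M a))"
  shows "orthogonal_direct_sum \<omega> (block_index k) (block_proj \<omega> k) (L2_space \<omega>) S
    (\<lambda>i. restrict S (operator_Im \<omega> (block_proj \<omega> k i)))"
proof -
  let ?R = "\<lambda>a. cmul (\<lambda>_. c) (mv M a)"
  note R = clinear_map_cmul_mv[OF M, of c]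
  have addR: "?R (a + b) = ?R a + ?R b" and cmR: "?R (cmul (\<lambda>_. d) a) = cmul (\<lambda>_. d) (?R a)" for a b d
    using R by (auto simp: clinear_map_def)
  note SL = lift_op[OF w, of ?R, folded S_def]
  have bS: "bounded_operator_on \<omega> (L2_space \<omega>) S"
    unfolding S_def by (rule bounded_operator_lift[OF w R norm_cmul_mv_le])
  have cl: "closed_operator \<omega> (L2_space \<omega>) S"
  proof (rule closed_operator_fourier[OF w])
    show "linear_operator \<omega> (L2_space \<omega>) (L2_space \<omega>) S" using bS by (simp add: bounded_operator_on_def)
    fix X :: "nat \<Rightarrow> real \<Rightarrow> 'h" and x y
    assume x: "x \<in> L2_space \<omega>" and Xx: "(\<lambda>n. fourier_seq \<omega> (X n)) \<longlonglongrightarrow> fourier_seq \<omega> x" and Ay: "(\<lambda>n. fourier_seq \<omega> (S (X n))) \<longlonglongrightarrow> fourier_seq \<omega> y"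
    have "(\<lambda>n. fourier_seq \<omega> (S (X n))) \<longlonglongrightarrow> fourier_seq \<omega> (S x)"
      unfolding SL by (rule bounded_linear.tendsto[OF clinear_map_bounded[OF R norm_cmul_mv_le] Xx])
    then show "x \<in> L2_space \<omega> \<and> fourier_seq \<omega> (S x) = fourier_seq \<omega> y" using x Ay LIMSEQ_unique by blast
  qed
  show ?thesis
  proof (rule orthogonal_direct_sum_blocks[OF w cl, where T = "\<lambda>a. entry (?R a)"])
    show "L2_space \<omega> = {x \<in> L2_space \<omega>. (\<lambda>n. (norm (entry (?R (fourier_seq \<omega> x)) n))\<^sup>2) summable_on UNIV}"
      by (simp add: summable_entry)
    show "entry (fourier_seq \<omega> (S x)) n = entry (?R (fourier_seq \<omega> x)) n" for x n by (simp add: SL)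
    fix i assume i: "i \<in> block_index k"
    let ?Im = "operator_Im \<omega> (block_proj \<omega> k i) :: (real \<Rightarrow> 'h) set"
    show "restrict S ?Im x \<in> L2_space \<omega>" "entry (fourier_seq \<omega> (restrict S ?Im x)) n = entry (?R (fourier_seq \<omega> x)) n" if "x \<in> ?Im" for x n
      using that by (simp_all add: SL)
    show "\<exists>C. \<forall>x\<in>?Im. norm (fourier_seq \<omega> (restrict S ?Im x)) \<le> C * norm (fourier_seq \<omega> x)"
      by (intro exI[of _ "cmod c * norm M"]) (simp add: SL norm_cmul_mv_le)
    show "entry (?R (coord_proj (block_set k i) a)) n = (if n \<in> block_set k i then entry (?R a) n else 0)" for a n
      by (simp add: entry_cmul_const entry_mv_coord_proj_block[OF bd i])
  next
    show "entry (?R (a + b)) n = entry (?R a) n + entry (?R b) n" for a b n unfolding addR by (rule entry_plus)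
    show "entry (?R (cmul (\<lambda>_. d) a)) n = d *\<^sub>C entry (?R a) n" for d a n unfolding cmR by (rule entry_cmul_const)
  qed
qed

text \<open>Only finitely many frequencies occur in a block, so the derivative is bounded there and the block lies
  in its domain.\<close>

lemma direct_sum_L0_minus:
  fixes M :: "'h::complex_hilbert mat"
  assumes M: "mclinear M" and bd: "\<And>j l. \<not> same_block k j l \<Longrightarrow> entry M (j, l) = 0"
    and AL: "\<And>x. x \<in> dom_L0 \<omega> \<Longrightarrow> A x \<in> L2_space \<omega>"
    and A: "\<And>x z. x \<in> dom_L0 \<omega> \<Longrightarrow> times_index (fourier_seq \<omega> x) z \<Longrightarrow> fourier_seq \<omega> (A x) = cmul (\<lambda>_. ik \<omega>) (z - mv M (fourier_seq \<omega> x))"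
  defines "S \<equiv> lift_op \<omega> (\<lambda>a. cmul (\<lambda>_. ik \<omega>) (mv M a))"
  shows "orthogonal_direct_sum \<omega> (block_index k) (block_proj \<omega> k) (dom_L0 \<omega>) A
    (\<lambda>i x s. L0 \<omega> x s - restrict S (operator_Im \<omega> (block_proj \<omega> k i)) x s)"
proof -
  let ?R = "\<lambda>a. cmul (\<lambda>_. ik \<omega>) (mv M a)"
  have i0: "ik \<omega> \<noteq> 0" by (rule ik_nonzero[OF w])
  define T where "T a n = ik \<omega> *\<^sub>C (real_of_int n *\<^sub>R entry a n - entry (mv M a) n)" for a n
  note SL = lift_op[OF w, of ?R, folded S_def]
  have T: "entry (cmul (\<lambda>_. ik \<omega>) (z - mv M a)) n = T a n" if "times_index a z" for a z n
    using that by (simp add: T_def times_index_def entry_cmul_const entry_minus)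
  have cl: "closed_operator \<omega> (dom_L0 \<omega>) A"
  proof (rule closed_operator_similar[where T = "\<lambda>a. a" and Ti = "\<lambda>a. a" and S = "mv M" and C = 1 and K = 1 and B = "norm M" and c = "ik \<omega>"])
    show "clinear_map (mv M)" by (rule clinear_map_mv[OF M])
  qed (auto simp: clinear_map_def norm_mv_le dom_L0_iff AL A i0)
  show ?thesis
  proof (rule orthogonal_direct_sum_blocks[OF w cl, where T = T])
    show "dom_L0 \<omega> = {x \<in> L2_space \<omega>. (\<lambda>n. (norm (T (fourier_seq \<omega> x) n))\<^sup>2) summable_on UNIV}"
    proof (intro set_eqI iffI)
      fix x :: "real \<Rightarrow> 'h" assume "x \<in> dom_L0 \<omega>"
      then obtain z where x: "x \<in> L2_space \<omega>" and z: "times_index (fourier_seq \<omega> x) z" by (auto simp: dom_L0_iff)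
      show "x \<in> {x \<in> L2_space \<omega>. (\<lambda>n. (norm (T (fourier_seq \<omega> x) n))\<^sup>2) summable_on UNIV}"
        using summable_entry[of "cmul (\<lambda>_. ik \<omega>) (z - mv M (fourier_seq \<omega> x))"] x by (simp add: T[OF z])
    next
      fix x assume "x \<in> {x \<in> L2_space \<omega>. (\<lambda>n. (norm (T (fourier_seq \<omega> x) n))\<^sup>2) summable_on UNIV}"
      then have x: "x \<in> L2_space \<omega>" and s: "(\<lambda>n. (norm (T (fourier_seq \<omega> x) n))\<^sup>2) summable_on UNIV" by auto
      have "times_index (fourier_seq \<omega> x) (cmul (\<lambda>_. 1 / ik \<omega>) (Ell2 (T (fourier_seq \<omega> x))) + mv M (fourier_seq \<omega> x))"
        using i0 by (simp add: times_index_def entry_simps entry_cmul_const entry_Ell2[OF s] T_def scaleC_scaleC)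
      then show "x \<in> dom_L0 \<omega>" using x dom_L0_iff by blast
    qed
    show "entry (fourier_seq \<omega> (A x)) n = T (fourier_seq \<omega> x) n" if "x \<in> dom_L0 \<omega>" for x n
      using that A[OF that] T by (auto simp: dom_L0_iff)
    fix i assume i: "i \<in> block_index k"
    let ?Im = "operator_Im \<omega> (block_proj \<omega> k i) :: (real \<Rightarrow> 'h) set"
    have Imd: "x \<in> dom_L0 \<omega>" if "x \<in> ?Im" for x
      using that times_index_finite_support[OF finite_block_set[of k i], of "fourier_seq \<omega> x"] by (auto simp: block_Im[OF w] dom_L0_iff)
    have rL: "restrict S ?Im x \<in> L2_space \<omega>" if "x \<in> ?Im" for x using that by (simp add: SL)
    have fB: "fourier_seq \<omega> (\<lambda>s. L0 \<omega> x s - restrict S ?Im x s) = fourier_seq \<omega> (L0 \<omega> x) - ?R (fourier_seq \<omega> x)" if "x \<in> ?Im" for x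
      using fourier_seq_minus[OF w L0_fourier(1)[OF w Imd[OF that]] rL[OF that]] that by (simp add: SL)
    show "(\<lambda>s. L0 \<omega> x s - restrict S ?Im x s) \<in> L2_space \<omega>" if "x \<in> ?Im" for x
      by (rule L2_space_minus[OF L0_fourier(1)[OF w Imd[OF that]] rL[OF that]])
    show "entry (fourier_seq \<omega> (\<lambda>s. L0 \<omega> x s - restrict S ?Im x s)) n = T (fourier_seq \<omega> x) n" if x: "x \<in> ?Im" for x n
    proof -
      obtain z where z: "times_index (fourier_seq \<omega> x) z" using Imd[OF x] by (auto simp: dom_L0_iff)
      show ?thesis unfolding fB[OF x] fourier_seq_L0[OF Imd[OF x] z] cmul_const_linear(2)[symmetric] by (rule T[OF z])
    qed
    show "\<exists>C. \<forall>x\<in>?Im. norm (fourier_seq \<omega> (\<lambda>s. L0 \<omega> x s - restrict S ?Im x s)) \<le> C * norm (fourier_seq \<omega> x)"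
    proof (intro exI ballI)
      fix x assume x: "x \<in> ?Im"
      define m where "m n = (if n \<in> block_set k i then of_int n * ik \<omega> else 0)" for n
      define C where "C = (\<Sum>n\<in>block_set k i. cmod (m n))"
      have m: "cmod (m n) \<le> C" for n
        unfolding C_def using member_le_sum[of n "block_set k i" "\<lambda>n. cmod (m n)"] finite_block_set[of k i]
        by (cases "n \<in> block_set k i") (auto simp: m_def intro!: sum_nonneg)
      have e: "fourier_seq \<omega> (L0 \<omega> x) = cmul m (fourier_seq \<omega> x)"
      proof (rule ell2_eqI)
        fix n
        show "entry (fourier_seq \<omega> (L0 \<omega> x)) n = entry (cmul m (fourier_seq \<omega> x)) n"
          using x unfolding cmul_bounded(1)[OF m] entry_fourier_seq[OF w L0_fourier(1)[OF w Imd[OF x]]] L0_fourier(2)[OF w Imd[OF x]]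
          by (cases "n \<in> block_set k i") (auto simp: m_def block_Im[OF w] entry_fourier_seq[OF w])
      qed
      have "norm (fourier_seq \<omega> (L0 \<omega> x)) \<le> C * norm (fourier_seq \<omega> x)" unfolding e by (rule cmul_bounded(2)[OF m])
      then have "norm (fourier_seq \<omega> (L0 \<omega> x) - ?R (fourier_seq \<omega> x)) \<le> C * norm (fourier_seq \<omega> x) + cmod (ik \<omega>) * norm M * norm (fourier_seq \<omega> x)"
        using norm_triangle_ineq4[of "fourier_seq \<omega> (L0 \<omega> x)" "?R (fourier_seq \<omega> x)"] norm_cmul_mv_le[of "ik \<omega>" M "fourier_seq \<omega> x"] by linarith
      then show "norm (fourier_seq \<omega> (\<lambda>s. L0 \<omega> x s - restrict S ?Im x s)) \<le>
          ((\<Sum>n\<in>block_set k i. cmod (if n \<in> block_set k i then of_int n * ik \<omega> else 0)) + cmod (ik \<omega>) * norm M) * norm (fourier_seq \<omega> x)"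
        unfolding fB[OF x] C_def m_def by (simp only: distrib_right)
    qed
    show "T (coord_proj (block_set k i) a) n = (if n \<in> block_set k i then T a n else 0)" for a n
      by (simp add: T_def entry_coord_proj entry_mv_coord_proj_block[OF bd i])
  next
    show "T (a + b) n = T a n + T b n" for a b n
      by (simp add: T_def entry_simps mv.add_right scaleC_add_right[symmetric] scaleR_add_right add_diff_add)
    show "T (cmul (\<lambda>_. d) a) n = d *\<^sub>C T a n" for d a n
      by (simp add: T_def mv_cmul[OF M] entry_cmul_const scaleC_scaleR[symmetric] scaleC_minus_right[symmetric] scaleC_scaleC mult.commute)
  qed
qed

end

theorem theorem2p6:
  fixes \<omega> :: real and \<V> :: "real \<Rightarrow> ('h::complex_hilbert \<Rightarrow>\<^sub>L 'h)"
  assumes "\<omega> > 0"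
    and \<V>_complex_linear: "\<And>s c x. s \<in> {0..\<omega>} \<Longrightarrow>
      blinfun_apply (\<V> s) (c *\<^sub>C x) = c *\<^sub>C blinfun_apply (\<V> s) x"
    and \<V>_strongly_measurable:
      "\<And>x. strongly_measurable_on {0..\<omega>} (\<lambda>s. blinfun_apply (\<V> s) x)"
    and \<V>_L2: "\<And>x. (\<lambda>s. blinfun_apply (\<V> s) x) \<in> L2_space \<omega>"
    and \<V>_hat_summable: "(\<lambda>n. (norm (V_hat \<omega> \<V> n))\<^sup>2) summable_on (UNIV :: int set)"
    and \<V>_hat_products_summable:
      "(\<lambda>(j, l). (norm (\<Sum>\<^sub>\<infinity>n\<in>UNIV - {l}.
          (1 / real_of_int (l - n)) *\<^sub>R (V_hat \<omega> \<V> (j + n) o\<^sub>L V_hat \<omega> \<V> (l + n))))\<^sup>2)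
        summable_on (UNIV :: (int \<times> int) set)"
  shows "\<exists>(k :: nat) V0 U Ui W.
    V0 \<in> S2 \<omega> \<and> W \<in> S2 \<omega> \<and>
    inverse_operators \<omega> U Ui \<and>
    (\<forall>x\<in>L2_space \<omega>. L2_eq \<omega> (U x) (\<lambda>s. x s + W x s)) \<and>
    L2_image \<omega> U (dom_L0 \<omega>) = dom_L0 \<omega> \<and>
    (\<forall>x\<in>dom_L0 \<omega>. L2_eq \<omega> (L_op \<omega> \<V> (U x)) (U (\<lambda>s. L0 \<omega> x s - V0 x s))) \<and>
    invariant_subspace \<omega> V0 (operator_Im \<omega> (P_upto \<omega> k)) \<and>
    (\<forall>l. \<bar>l\<bar> > int k \<longrightarrow> invariant_subspace \<omega> V0 (operator_Im \<omega> (P_single \<omega> l))) \<and>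
    (let I = block_index k; Q = block_proj \<omega> k;
         V0_part = (\<lambda>i. restrict V0 (operator_Im \<omega> (Q i)))
     in orthogonal_direct_sum \<omega> I Q (L2_space \<omega>) V0 V0_part \<and>
        U_orthogonal_direct_sum \<omega> U Ui I Q (dom_L0 \<omega>) (L_op \<omega> \<V>)
          (\<lambda>i x s. L0 \<omega> x s - V0_part i x s))"
proof -
  interpret potential \<omega> \<V>
    by (rule potential.intro[OF assms(1,2,4,5)])
  obtain k M N0 K where M: "mclinear M" and N0: "mclinear N0" and bij: "bij (\<lambda>a. a + mv M a)"
    and bd: "\<And>j l. \<not> same_block k j l \<Longrightarrow> entry N0 (j, l) = 0"
    and K: "\<And>a. norm a \<le> K * norm (a + mv M a)"
    and tr: "\<And>a z. times_index a z \<Longrightarrow> \<exists>z'. times_index (a + mv M a) z' \<and>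
      (\<forall>j. entry z' j - hankel v (a + mv M a) j = entry (z - mv N0 a + mv M (z - mv N0 a)) j)"
    and onto: "\<And>b z'. times_index b z' \<Longrightarrow> \<exists>a z. times_index a z \<and> b = a + mv M a"
  proof (rule sequence_similarity[OF mclinear_v products_summable[OF \<V>_hat_products_summable]], goal_cases)
    case (1 k M N0 K)
    show ?case by (rule that[of M N0 k K]) (fact 1)+
  qed
  define T where "T a = a + mv M a" for a
  define Ti where "Ti = inv T"
  have bijT: "bij T" using bij by (simp add: T_def[abs_def])
  have TTi: "T (Ti a) = a" and TiT: "Ti (T a) = a" for a
    using bijT by (simp_all add: Ti_def bij_is_surj surj_f_inv_f bij_is_inj)
  have clT: "clinear_map T" using clinear_map_mv[OF M]
    by (simp add: clinear_map_def T_def cmul_const_linear(1) algebra_simps)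
  have T_add: "T (a + b) = T a + T b" and T_cmul: "T (cmul (\<lambda>_. c) a) = cmul (\<lambda>_. c) (T a)" for a b c
    using clT by (auto simp: clinear_map_def)
  have clTi: "clinear_map Ti"
    unfolding clinear_map_def
  proof (intro conjI allI)
    show "Ti (a + b) = Ti a + Ti b" for a b by (metis T_add TTi TiT)
    show "Ti (cmul (\<lambda>_. c) a) = cmul (\<lambda>_. c) (Ti a)" for a c by (metis T_cmul TTi TiT)
  qed
  have nT: "norm (T a) \<le> (1 + norm M) * norm a" for a
    using norm_triangle_ineq[of a "mv M a"] norm_mv_le[of M a] unfolding T_def by (simp add: distrib_right)
  have nTi: "norm (Ti a) \<le> K * norm a" for a using K[of "Ti a"] TTi[of a] by (simp add: T_def)
  let ?U = "lift_op \<omega> T" and ?Ui = "lift_op \<omega> Ti" and ?W = "lift_op \<omega> (\<lambda>a. cmul (\<lambda>_. 1) (mv M a))"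
    and ?V0 = "lift_op \<omega> (\<lambda>a. cmul (\<lambda>_. ik \<omega>) (mv N0 a))"
  note lift = lift_op[OF w]
  have NT: "\<exists>z'. times_index (T a) z'" if "times_index a z" for a z using tr[OF that] unfolding T_def by blast
  have NTi: "\<exists>z. times_index (Ti b) z" if "times_index b z'" for b z' using onto[OF that] TiT unfolding T_def by metis
  have U_dom: "?U x \<in> dom_L0 \<omega> \<longleftrightarrow> x \<in> dom_L0 \<omega>" if "x \<in> L2_space \<omega>" for x
    using that NT[of "fourier_seq \<omega> x"] NTi[of "T (fourier_seq \<omega> x)"] by (auto simp: dom_L0_iff[OF w] lift TiT)
  have L: "L_op \<omega> \<V> y \<in> L2_space \<omega> \<and> fourier_seq \<omega> (L_op \<omega> \<V> y) = cmul (\<lambda>_. ik \<omega>) (T (z - mv N0 (Ti (fourier_seq \<omega> y))))"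
    if y: "y \<in> dom_L0 \<omega>" and z: "times_index (Ti (fourier_seq \<omega> y)) z" for y z
  proof -
    obtain z' where z': "times_index (fourier_seq \<omega> y) z'"
      "\<And>j. entry z' j - hankel v (fourier_seq \<omega> y) j = entry (T (z - mv N0 (Ti (fourier_seq \<omega> y)))) j"
      using tr[OF z] unfolding T_def[symmetric] TTi by blast
    show ?thesis
      using L_op_fourier[OF y z'(1)] by (auto intro!: ell2_eqI simp: z'(2) entry_cmul_const)
  qed
  have LL: "L_op \<omega> \<V> y \<in> L2_space \<omega>" if "y \<in> dom_L0 \<omega>" for y
    using that L[OF that] NTi by (auto simp: dom_L0_iff[OF w])
  have LU: "fourier_seq \<omega> (L_op \<omega> \<V> (?U x)) = T (cmul (\<lambda>_. ik \<omega>) (z - mv N0 (fourier_seq \<omega> x)))"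
    if x: "x \<in> dom_L0 \<omega>" and z: "times_index (fourier_seq \<omega> x) z" for x z
  proof -
    have "?U x \<in> dom_L0 \<omega>" using x U_dom[of x] by (simp add: dom_L0_iff[OF w])
    from L[OF this, of z] z show ?thesis by (simp add: lift TiT T_cmul)
  qed
  have inv: "inverse_operators \<omega> ?U ?Ui"
    unfolding inverse_operators_def
    by (intro conjI ballI bounded_operator_lift[OF w clT nT] bounded_operator_lift[OF w clTi nTi] L2_eqI[OF w])
      (simp_all add: lift TTi TiT)
  have dsV: "orthogonal_direct_sum \<omega> (block_index k) (block_proj \<omega> k) (L2_space \<omega>) ?V0
      (\<lambda>i. restrict ?V0 (operator_Im \<omega> (block_proj \<omega> k i)))"
    by (rule direct_sum_bounded[OF w N0 bd])
  have domU: "{x \<in> L2_space \<omega>. ?U x \<in> dom_L0 \<omega>} = dom_L0 \<omega>"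
    using U_dom dom_L0_iff[OF w, where 'a = 'h] by blast
  have dsL: "orthogonal_direct_sum \<omega> (block_index k) (block_proj \<omega> k) (dom_L0 \<omega>) (\<lambda>x. ?Ui (L_op \<omega> \<V> (?U x)))
      (\<lambda>i x s. L0 \<omega> x s - restrict ?V0 (operator_Im \<omega> (block_proj \<omega> k i)) x s)"
    by (rule direct_sum_L0_minus[OF w N0 bd]) (simp_all add: lift LU TiT)
  have clL: "closed_operator \<omega> (dom_L0 \<omega>) (L_op \<omega> \<V>)"
  proof (rule closed_operator_similar[OF w clT nT clTi nTi clinear_map_mv[OF N0] norm_mv_le TiT TTi _ LL _ ik_nonzero[OF w]])
    show "x \<in> dom_L0 \<omega> \<longleftrightarrow> (\<exists>z. times_index (Ti (fourier_seq \<omega> x)) z)" if "x \<in> L2_space \<omega>" for x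
      using that NT[of "Ti (fourier_seq \<omega> x)"] NTi[of "fourier_seq \<omega> x"] by (auto simp: dom_L0_iff[OF w] TTi)
    show "fourier_seq \<omega> (L_op \<omega> \<V> x) = cmul (\<lambda>_. ik \<omega>) (T (z - mv N0 (Ti (fourier_seq \<omega> x))))"
      if "x \<in> dom_L0 \<omega>" "times_index (Ti (fourier_seq \<omega> x)) z" for x z
      using L[OF that] by blast
  qed
  have invar: "invariant_subspace \<omega> ?V0 (operator_Im \<omega> (block_proj \<omega> k i))" if "i \<in> block_index k" for i
    using dsV that unfolding orthogonal_direct_sum_def by blast
  show ?thesis
    unfolding Let_def
  proof (rule exI[of _ k], rule exI[of _ ?V0], rule exI[of _ ?U], rule exI[of _ ?Ui], rule exI[of _ ?W], intro conjI ballI allI impI)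
    show "?V0 \<in> S2 \<omega>" by (rule S2_mv[OF w N0])
    show "?W \<in> S2 \<omega>" by (rule S2_mv[OF w M])
    show "inverse_operators \<omega> ?U ?Ui" by (rule inv)
    show "L2_eq \<omega> (?U x) (\<lambda>s. x s + ?W x s)" if "x \<in> L2_space \<omega>" for x
      by (rule L2_eqI[OF w]) (simp_all add: lift that L2_space_add fourier_seq_add[OF w] T_def cmul_const_linear(4))
    show "L2_image \<omega> ?U (dom_L0 \<omega>) = dom_L0 \<omega>"
    proof (intro set_eqI iffI)
      fix y :: "real \<Rightarrow> 'h" assume "y \<in> L2_image \<omega> ?U (dom_L0 \<omega>)"
      then obtain x where y: "y \<in> L2_space \<omega>" and x: "x \<in> dom_L0 \<omega>" and e: "L2_eq \<omega> y (?U x)"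
        unfolding L2_image_def by blast
      have "fourier_seq \<omega> y = T (fourier_seq \<omega> x)" using e y by (simp add: L2_eq_iff_fourier[OF w] lift)
      then show "y \<in> dom_L0 \<omega>" using x y NT by (auto simp: dom_L0_iff[OF w])
    next
      fix y :: "real \<Rightarrow> 'h" assume y: "y \<in> dom_L0 \<omega>"
      then have yL: "y \<in> L2_space \<omega>" and N: "\<exists>z. times_index (Ti (fourier_seq \<omega> y)) z"
        using NTi by (auto simp: dom_L0_iff[OF w])
      have "?Ui y \<in> dom_L0 \<omega>" using N by (simp add: dom_L0_iff[OF w] lift)
      moreover have "L2_eq \<omega> y (?U (?Ui y))" by (rule L2_eqI[OF w yL]) (simp_all add: lift TTi)
      ultimately show "y \<in> L2_image \<omega> ?U (dom_L0 \<omega>)" unfolding L2_image_def using yL by blast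
    qed
    show "L2_eq \<omega> (L_op \<omega> \<V> (?U x)) (?U (\<lambda>s. L0 \<omega> x s - ?V0 x s))" if x: "x \<in> dom_L0 \<omega>" for x
    proof -
      have xL: "x \<in> L2_space \<omega>" using x by (simp add: dom_L0_iff[OF w])
      obtain z where z: "times_index (fourier_seq \<omega> x) z" using x by (auto simp: dom_L0_iff[OF w])
      show ?thesis
      proof (rule L2_eqI[OF w])
        show "L_op \<omega> \<V> (?U x) \<in> L2_space \<omega>" using x U_dom[OF xL] LL by blast
        show "fourier_seq \<omega> (L_op \<omega> \<V> (?U x)) = fourier_seq \<omega> (?U (\<lambda>s. L0 \<omega> x s - ?V0 x s))"
          by (simp add: LU[OF x z] lift fourier_seq_minus[OF w L0_fourier(1)[OF w x]] fourier_seq_L0[OF w x z] cmul_const_linear(2))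
      qed (rule lift)
    qed
    show "invariant_subspace \<omega> ?V0 (operator_Im \<omega> (P_upto \<omega> k))"
      using invar[of None] by (simp add: block_index_def block_proj_def)
    show "invariant_subspace \<omega> ?V0 (operator_Im \<omega> (P_single \<omega> l))" if "\<bar>l\<bar> > int k" for l
      using invar[of "Some l"] that by (simp add: block_index_def block_proj_def)
    show "orthogonal_direct_sum \<omega> (block_index k) (block_proj \<omega> k) (L2_space \<omega>) ?V0
        (\<lambda>i. restrict ?V0 (operator_Im \<omega> (block_proj \<omega> k i)))" by (rule dsV)
    show "U_orthogonal_direct_sum \<omega> ?U ?Ui (block_index k) (block_proj \<omega> k) (dom_L0 \<omega>) (L_op \<omega> \<V>)
        (\<lambda>i x s. L0 \<omega> x s - restrict ?V0 (operator_Im \<omega> (block_proj \<omega> k i)) x s)"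
      unfolding U_orthogonal_direct_sum_def domU using inv clL dsL by blast
  qed
qed

end
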